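(* Let $R$ be a commutative noetherian ring. (1) For each $M\in\mathrm{D}_{-}(R)$, one has $\mathrm{supp}_R M\subseteq\bigcup_{i\in\mathbb{Z}}\mathrm{supp}_R \mathrm{H}_i(M)$. (2) For each $M\in\mathrm{D}_{+}(R)$, one has $\mathrm{cosupp}_R M\subseteq\bigcup_{i\in\mathbb{Z}}\mathrm{cosupp}_R \mathrm{H}_i(M)$.
   Context: $R$ is a commutative noetherian ring, not necessarily local; $\simeq$ denotes isomorphism in the derived category $\mathrm{D}(R)$; modules are complexes concentrated in degree $0$. $E(-)$ denotes injective envelopes, and $k(\mathfrak p)=R_\mathfrak p/\mathfrak pR_\mathfrak p$. Put $D_R(-)=\mathrm{Hom}_R(-,\bigoplus_{\mathfrak{m}\in\mathrm{Max}R}E(R/\mathfrak{m}))$ and, for an $R$-complex $M$ and $\mathfrak{p}\in\mathrm{Spec}R$, ${}^{\mathfrak{p}}M=\mathrm{Hom}_{R_\mathfrak{p}}(D_R(M)_\mathfrak{p},E_{R_\mathfrak{p}}(k(\mathfrak{p})))$. The small support is $\mathrm{supp}_R M=\{\mathfrak{p}\in\mathrm{Spec}R\mid k(\mathfrak{p})\otimes^{\mathrm{L}}_R M\not\simeq 0\}$ and the small cosupport is $\mathrm{cosupp}_R M=\{\mathfrak{p}\in\mathrm{Spec}R\mid \mathrm{RHom}_R(R/\mathfrak{p},{}^{\mathfrak{p}}M)\not\simeq 0\}$. $\mathrm{D}_{-}(R)$ (resp. $\mathrm{D}_{+}(R)$) is the full subcategory of $\mathrm{D}(R)$ of complexes $M$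 with $\mathrm{H}_n(M)=0$ for all $n\gg 0$ (resp. for all $n\ll 0$). *)

theory Defs
  imports "HOL-Algebra.Module" "HOL-Algebra.Ring_Divisibility"
begin

section \<open>Modules\<close>

text \<open>Only the additive structure and the scalar multiplication of a module record are
  meaningful; the fields \<open>mult\<close> and \<open>one\<close>, inherited from the ring record, are left unspecified.\<close>

definition linear_map ::
  "('a, 'r) ring_scheme \<Rightarrow> ('a, 'm) module \<Rightarrow> ('a, 'n) module \<Rightarrow> ('m \<Rightarrow> 'n) \<Rightarrow> bool" where
  "linear_map R M N f \<longleftrightarrow>
     f \<in> carrier M \<rightarrow> carrier N \<and>
     (\<forall>x\<in>carrier M. \<forall>y\<in>carrier M. f (x \<oplus>\<^bsub>M\<^esub> y) = f x \<oplus>\<^bsub>N\<^esub> f y) \<and>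
     (\<forall>a\<in>carrier R. \<forall>x\<in>carrier M. f (a \<odot>\<^bsub>M\<^esub> x) = a \<odot>\<^bsub>N\<^esub> f x)"

definition zero_module :: "('a, unit) module" where
  "zero_module = \<lparr>carrier = {()}, mult = \<lambda>_ _. (), one = (), zero = (), add = \<lambda>_ _. (),
     smult = \<lambda>_ _. ()\<rparr>"

definition self_module :: "('a, 'r) ring_scheme \<Rightarrow> ('a, 'a) module" where
  "self_module R = \<lparr>carrier = carrier R, mult = mult R, one = one R, zero = zero R,
     add = add R, smult = mult R\<rparr>"

definition restrict_scalars :: "('a \<Rightarrow> 'b) \<Rightarrow> ('b, 'm) module \<Rightarrow> ('a, 'm) module" where
  "restrict_scalars h M = \<lparr>carrier = carrier M, mult = mult M, one = one M, zero = zero M,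
     add = add M, smult = \<lambda>a x. h a \<odot>\<^bsub>M\<^esub> x\<rparr>"

definition quotient_module :: "('a, 'm) module \<Rightarrow> 'm set \<Rightarrow> ('a, 'm set) module" where
  "quotient_module M H = \<lparr>carrier = a_rcosets\<^bsub>M\<^esub> H, mult = undefined, one = undefined, zero = H,
     add = set_add M, smult = \<lambda>a X. \<Union>x\<in>X. H +>\<^bsub>M\<^esub> (a \<odot>\<^bsub>M\<^esub> x)\<rparr>"

definition direct_product :: "'i set \<Rightarrow> ('i \<Rightarrow> ('a, 'm) module) \<Rightarrow> ('a, 'i \<Rightarrow> 'm) module" where
  "direct_product I M = \<lparr>carrier = (\<Pi>\<^sub>E i\<in>I. carrier (M i)), mult = undefined, one = undefined,
     zero = (\<lambda>i\<in>I. \<zero>\<^bsub>M i\<^esub>), add = \<lambda>f g. \<lambda>i\<in>I. f i \<oplus>\<^bsub>M i\<^esub> g i, smult = \<lambda>a f. \<lambda>i\<in>I. a \<odot>\<^bsub>M i\<^esub> f i\<rparr>"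

definition direct_sum :: "'i set \<Rightarrow> ('i \<Rightarrow> ('a, 'm) module) \<Rightarrow> ('a, 'i \<Rightarrow> 'm) module" where
  "direct_sum I M = (direct_product I M)
     \<lparr>carrier := {f \<in> \<Pi>\<^sub>E i\<in>I. carrier (M i). finite {i \<in> I. f i \<noteq> \<zero>\<^bsub>M i\<^esub>}}\<rparr>"

definition free_module :: "('a, 'r) ring_scheme \<Rightarrow> 's set \<Rightarrow> ('a, 's \<Rightarrow> 'a) module" where
  "free_module R S = direct_sum S (\<lambda>_. self_module R)"

definition free_gen :: "('a, 'r) ring_scheme \<Rightarrow> 's set \<Rightarrow> 's \<Rightarrow> 's \<Rightarrow> 'a" where
  "free_gen R S s = (\<lambda>t\<in>S. if t = s then \<one>\<^bsub>R\<^esub> else \<zero>\<^bsub>R\<^esub>)"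

text \<open>Elements of Hom modules are extensional functions, so that equality of elements is equality
  on the domain.\<close>

definition Hom_module ::
  "('a, 'r) ring_scheme \<Rightarrow> ('a, 'm) module \<Rightarrow> ('a, 'n) module \<Rightarrow> ('a, 'm \<Rightarrow> 'n) module" where
  "Hom_module R M N = \<lparr>carrier = {f \<in> extensional (carrier M). linear_map R M N f},
     mult = undefined, one = undefined, zero = (\<lambda>x\<in>carrier M. \<zero>\<^bsub>N\<^esub>),
     add = \<lambda>f g. \<lambda>x\<in>carrier M. f x \<oplus>\<^bsub>N\<^esub> g x, smult = \<lambda>a f. \<lambda>x\<in>carrier M. a \<odot>\<^bsub>N\<^esub> f x\<rparr>"


subsection \<open>Tensor products\<close>

definition submodule_span :: "('a, 'r) ring_scheme \<Rightarrow> ('a, 'm) module \<Rightarrow> 'm set \<Rightarrow> 'm set" where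
  "submodule_span R M X = \<Inter>{H. submodule H R M \<and> X \<subseteq> H}"

definition tensor_relations ::
  "('a, 'r) ring_scheme \<Rightarrow> ('a, 'm) module \<Rightarrow> ('a, 'n) module \<Rightarrow> ('m \<times> 'n \<Rightarrow> 'a) set" where
  "tensor_relations R M N =
     (let F = free_module R (carrier M \<times> carrier N);
          e = (\<lambda>x y. free_gen R (carrier M \<times> carrier N) (x, y))
      in {e (x \<oplus>\<^bsub>M\<^esub> x') y \<ominus>\<^bsub>F\<^esub> (e x y \<oplus>\<^bsub>F\<^esub> e x' y) | x x' y.
            x \<in> carrier M \<and> x' \<in> carrier M \<and> y \<in> carrier N} \<union>
         {e x (y \<oplus>\<^bsub>N\<^esub> y') \<ominus>\<^bsub>F\<^esub> (e x y \<oplus>\<^bsub>F\<^esub> e x y') | x y y'.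
            x \<in> carrier M \<and> y \<in> carrier N \<and> y' \<in> carrier N} \<union>
         {e (a \<odot>\<^bsub>M\<^esub> x) y \<ominus>\<^bsub>F\<^esub> a \<odot>\<^bsub>F\<^esub> e x y | a x y.
            a \<in> carrier R \<and> x \<in> carrier M \<and> y \<in> carrier N} \<union>
         {e x (a \<odot>\<^bsub>N\<^esub> y) \<ominus>\<^bsub>F\<^esub> a \<odot>\<^bsub>F\<^esub> e x y | a x y.
            a \<in> carrier R \<and> x \<in> carrier M \<and> y \<in> carrier N})"

definition tensor_module ::
  "('a, 'r) ring_scheme \<Rightarrow> ('a, 'm) module \<Rightarrow> ('a, 'n) module \<Rightarrow> ('a, ('m \<times> 'n \<Rightarrow> 'a) set) module" where
  "tensor_module R M N =
     (let F = free_module R (carrier M \<times> carrier N)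
      in quotient_module F (submodule_span R F (tensor_relations R M N)))"

definition pure_tensor ::
  "('a, 'r) ring_scheme \<Rightarrow> ('a, 'm) module \<Rightarrow> ('a, 'n) module \<Rightarrow> 'm \<Rightarrow> 'n \<Rightarrow> ('m \<times> 'n \<Rightarrow> 'a) set" where
  "pure_tensor R M N x y =
     (let F = free_module R (carrier M \<times> carrier N)
      in submodule_span R F (tensor_relations R M N) +>\<^bsub>F\<^esub>
           free_gen R (carrier M \<times> carrier N) (x, y))"

definition tensor_map ::
  "('a, 'r) ring_scheme \<Rightarrow> ('a, 'm) module \<Rightarrow> ('a, 'n) module \<Rightarrow> ('a, 'm') module \<Rightarrow> ('a, 'n') module
    \<Rightarrow> ('m \<Rightarrow> 'm') \<Rightarrow> ('n \<Rightarrow> 'n') \<Rightarrow> ('m \<times> 'n \<Rightarrow> 'a) set \<Rightarrow> ('m' \<times> 'n' \<Rightarrow> 'a) set" where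
  "tensor_map R M N M' N' f g =
     (THE h. h \<in> carrier (Hom_module R (tensor_module R M N) (tensor_module R M' N')) \<and>
        (\<forall>x\<in>carrier M. \<forall>y\<in>carrier N.
           h (pure_tensor R M N x y) = pure_tensor R M' N' (f x) (g y)))"


subsection \<open>Injective envelopes\<close>

text \<open>HOL cannot quantify over the types of the modules against which injectivity is tested. The
  type \<open>'a + 'e\<close> contains copies of \<open>R\<close> and of its ideals, so by Baer's criterion testing on
  modules over this type is equivalent to testing on all modules.\<close>

definition injective_module :: "('a, 'r) ring_scheme \<Rightarrow> ('a, 'e) module \<Rightarrow> bool" where
  "injective_module R E \<longleftrightarrow> module R E \<and>
     (\<forall>(B :: ('a, 'a + 'e) module) A f.
        module R B \<and> submodule A R B \<and> linear_map R (B\<lparr>carrier := A\<rparr>) E f \<longrightarrow>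
        (\<exists>g. linear_map R B E g \<and> (\<forall>x\<in>A. g x = f x)))"

definition is_injective_envelope ::
  "('a, 'r) ring_scheme \<Rightarrow> ('a, 'n) module \<Rightarrow> ('a, 'e) module \<Rightarrow> ('n \<Rightarrow> 'e) \<Rightarrow> bool" where
  "is_injective_envelope R N E \<iota> \<longleftrightarrow>
     injective_module R E \<and> linear_map R N E \<iota> \<and> inj_on \<iota> (carrier N) \<and>
     (\<forall>H. submodule H R E \<and> H \<noteq> {\<zero>\<^bsub>E\<^esub>} \<longrightarrow> H \<inter> \<iota> ` carrier N \<noteq> {\<zero>\<^bsub>E\<^esub>})"

text \<open>Envelopes are unique up to isomorphism. The module \<open>N\<close> embeds into a product, indexed by
  its elements, of copies of the injective module of additive maps from \<open>R\<close> to \<open>\<rat>/\<int>\<close>; hence it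
  has an envelope whose elements are of type \<open>'n \<Rightarrow> 'a \<Rightarrow> rat\<close>.\<close>

definition injective_envelope ::
  "('a, 'r) ring_scheme \<Rightarrow> ('a, 'n) module \<Rightarrow> ('a, 'n \<Rightarrow> 'a \<Rightarrow> rat) module" where
  "injective_envelope R N = (SOME E. \<exists>\<iota>. is_injective_envelope R N E \<iota>)"


section \<open>Complexes and the derived category\<close>

text \<open>Homological grading: \<open>diff X n\<close> maps \<open>obj X n\<close> to \<open>obj X (n - 1)\<close>.\<close>

record ('a, 'm) cplx =
  obj :: "int \<Rightarrow> ('a, 'm) module"
  diff :: "int \<Rightarrow> 'm \<Rightarrow> 'm"

definition chain_complex :: "('a, 'r) ring_scheme \<Rightarrow> ('a, 'm) cplx \<Rightarrow> bool" where
  "chain_complex R X \<longleftrightarrow>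
     (\<forall>n. module R (obj X n)) \<and>
     (\<forall>n. linear_map R (obj X n) (obj X (n - 1)) (diff X n)) \<and>
     (\<forall>n. \<forall>x\<in>carrier (obj X n). diff X (n - 1) (diff X n x) = \<zero>\<^bsub>obj X (n - 2)\<^esub>)"

definition cycles :: "('a, 'm) cplx \<Rightarrow> int \<Rightarrow> 'm set" where
  "cycles X n = {x \<in> carrier (obj X n). diff X n x = \<zero>\<^bsub>obj X (n - 1)\<^esub>}"

definition boundaries :: "('a, 'm) cplx \<Rightarrow> int \<Rightarrow> 'm set" where
  "boundaries X n = diff X (n + 1) ` carrier (obj X (n + 1))"

definition homology :: "('a, 'm) cplx \<Rightarrow> int \<Rightarrow> ('a, 'm set) module" where
  "homology X n = quotient_module ((obj X n)\<lparr>carrier := cycles X n\<rparr>) (boundaries X n)"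

definition chain_map ::
  "('a, 'r) ring_scheme \<Rightarrow> ('a, 'x) cplx \<Rightarrow> ('a, 'y) cplx \<Rightarrow> (int \<Rightarrow> 'x \<Rightarrow> 'y) \<Rightarrow> bool" where
  "chain_map R X Y f \<longleftrightarrow>
     (\<forall>n. linear_map R (obj X n) (obj Y n) (f n)) \<and>
     (\<forall>n. \<forall>x\<in>carrier (obj X n). f (n - 1) (diff X n x) = diff Y n (f n x))"

definition homology_map ::
  "('a, 'x) cplx \<Rightarrow> ('a, 'y) cplx \<Rightarrow> (int \<Rightarrow> 'x \<Rightarrow> 'y) \<Rightarrow> int \<Rightarrow> 'x set \<Rightarrow> 'y set" where
  "homology_map X Y f n = (\<lambda>C\<in>carrier (homology X n). \<Union>c\<in>C. boundaries Y n +>\<^bsub>obj Y n\<^esub> f n c)"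

definition quasi_iso ::
  "('a, 'r) ring_scheme \<Rightarrow> ('a, 'x) cplx \<Rightarrow> ('a, 'y) cplx \<Rightarrow> (int \<Rightarrow> 'x \<Rightarrow> 'y) \<Rightarrow> bool" where
  "quasi_iso R X Y f \<longleftrightarrow> chain_map R X Y f \<and>
     (\<forall>n. bij_betw (homology_map X Y f n) (carrier (homology X n)) (carrier (homology Y n)))"

text \<open>Isomorphism in the derived category: a roof \<open>X \<leftarrow> Z \<rightarrow> Y\<close> of quasi-isomorphisms. The type of
  \<open>Z\<close> imposes no restriction, since it has room for a semifree resolution of \<open>X\<close>, and \<open>Z\<close> can
  always be taken to be one.\<close>

definition derived_iso :: "('a, 'r) ring_scheme \<Rightarrow> ('a, 'x) cplx \<Rightarrow> ('a, 'y) cplx \<Rightarrow> bool" where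
  "derived_iso R X Y \<longleftrightarrow>
     (\<exists>(Z :: ('a, ('a + 'x) list) cplx) f g.
        chain_complex R Z \<and> quasi_iso R Z X f \<and> quasi_iso R Z Y g)"

definition concentrated :: "('a, 'm) module \<Rightarrow> ('a, 'm) cplx" where
  "concentrated N = \<lparr>obj = \<lambda>n. if n = 0 then N else N\<lparr>carrier := {\<zero>\<^bsub>N\<^esub>}\<rparr>, diff = \<lambda>_ _. \<zero>\<^bsub>N\<^esub>\<rparr>"

definition zero_complex :: "('a, unit) cplx" where
  "zero_complex = concentrated zero_module"

definition D_minus :: "('a, 'r) ring_scheme \<Rightarrow> ('a, 'm) cplx set" where
  "D_minus R = {M. chain_complex R M \<and>
     (\<exists>b. \<forall>n>b. carrier (homology M n) = {\<zero>\<^bsub>homology M n\<^esub>})}"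

definition D_plus :: "('a, 'r) ring_scheme \<Rightarrow> ('a, 'm) cplx set" where
  "D_plus R = {M. chain_complex R M \<and>
     (\<exists>b. \<forall>n<b. carrier (homology M n) = {\<zero>\<^bsub>homology M n\<^esub>})}"


subsection \<open>Hom and tensor complexes\<close>

text \<open>The component of degree \<open>n\<close> is the product over \<open>i\<close> of \<open>Hom (X\<^sub>i, Y\<^sub>i\<^sub>+\<^sub>n)\<close>, and
  \<open>d \<phi> = d\<^sub>Y \<circ> \<phi> - (-1)\<^sup>n \<phi> \<circ> d\<^sub>X\<close>.\<close>

definition Hom_complex ::
  "('a, 'r) ring_scheme \<Rightarrow> ('a, 'x) cplx \<Rightarrow> ('a, 'y) cplx \<Rightarrow> ('a, int \<Rightarrow> 'x \<Rightarrow> 'y) cplx" where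
  "Hom_complex R X Y =
     \<lparr>obj = \<lambda>n. direct_product UNIV (\<lambda>i. Hom_module R (obj X i) (obj Y (i + n))),
      diff = \<lambda>n \<phi> i. \<lambda>x\<in>carrier (obj X i).
        if even n
        then diff Y (i + n) (\<phi> i x) \<ominus>\<^bsub>obj Y (i + n - 1)\<^esub> \<phi> (i - 1) (diff X i x)
        else diff Y (i + n) (\<phi> i x) \<oplus>\<^bsub>obj Y (i + n - 1)\<^esub> \<phi> (i - 1) (diff X i x)\<rparr>"

text \<open>The component of degree \<open>n\<close> is the direct sum over \<open>i\<close> of \<open>X\<^sub>i \<otimes> Y\<^sub>n\<^sub>-\<^sub>i\<close>, and
  \<open>d (x \<otimes> y) = d x \<otimes> y + (-1)\<^sup>i x \<otimes> d y\<close> for \<open>x\<close> of degree \<open>i\<close>.\<close>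

definition tensor_complex ::
  "('a, 'r) ring_scheme \<Rightarrow> ('a, 'x) cplx \<Rightarrow> ('a, 'y) cplx \<Rightarrow> ('a, int \<Rightarrow> ('x \<times> 'y \<Rightarrow> 'a) set) cplx" where
  "tensor_complex R X Y =
     \<lparr>obj = \<lambda>n. direct_sum UNIV (\<lambda>i. tensor_module R (obj X i) (obj Y (n - i))),
      diff = \<lambda>n \<phi> i.
        let T = tensor_module R (obj X i) (obj Y (n - 1 - i));
            u = tensor_map R (obj X (i + 1)) (obj Y (n - 1 - i)) (obj X i) (obj Y (n - 1 - i))
                  (diff X (i + 1)) id (\<phi> (i + 1));
            v = tensor_map R (obj X i) (obj Y (n - i)) (obj X i) (obj Y (n - 1 - i))
                  id (diff Y (n - i)) (\<phi> i)
        in if even i then u \<oplus>\<^bsub>T\<^esub> v else u \<ominus>\<^bsub>T\<^esub> v\<rparr>"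


subsection \<open>Derived functors of modules\<close>

definition is_free_resolution ::
  "('a, 'r) ring_scheme \<Rightarrow> ('a, 'n) module \<Rightarrow> ('a, 's \<Rightarrow> 'a) cplx \<Rightarrow> bool" where
  "is_free_resolution R N F \<longleftrightarrow> chain_complex R F \<and>
     (\<forall>n. \<exists>S. obj F n = free_module R S) \<and> (\<forall>n<0. obj F n = free_module R {}) \<and>
     (\<exists>\<epsilon>. quasi_iso R F (concentrated N) \<epsilon>)"

text \<open>Free resolutions are unique up to homotopy equivalence. The basis type \<open>('a + 'n) list\<close> is infinite and contains copies of \<open>R\<close> and \<open>N\<close>, hence has
  room for generators of \<open>N\<close> and of all successive syzygies.\<close>

definition free_resolution ::
  "('a, 'r) ring_scheme \<Rightarrow> ('a, 'n) module \<Rightarrow> ('a, ('a + 'n) list \<Rightarrow> 'a) cplx" where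
  "free_resolution R N = (SOME F. is_free_resolution R N F)"

definition derived_tensor ::
  "('a, 'r) ring_scheme \<Rightarrow> ('a, 'n) module \<Rightarrow> ('a, 'm) cplx
    \<Rightarrow> ('a, int \<Rightarrow> ((('a + 'n) list \<Rightarrow> 'a) \<times> 'm \<Rightarrow> 'a) set) cplx" where
  "derived_tensor R N M = tensor_complex R (free_resolution R N) M"

definition RHom ::
  "('a, 'r) ring_scheme \<Rightarrow> ('a, 'n) module \<Rightarrow> ('a, 'm) cplx
    \<Rightarrow> ('a, int \<Rightarrow> (('a + 'n) list \<Rightarrow> 'a) \<Rightarrow> 'm) cplx" where
  "RHom R N M = Hom_complex R (free_resolution R N) M"


section \<open>Localization at a prime ideal\<close>

text \<open>A fraction is represented by the set of all pairs (numerator, denominator) equivalent to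
  a given one.\<close>

definition frac ::
  "('a, 'r) ring_scheme \<Rightarrow> 'a set \<Rightarrow> ('a, 'm) module \<Rightarrow> 'm \<Rightarrow> 'a \<Rightarrow> ('m \<times> 'a) set" where
  "frac R p M x s = {(y, t). y \<in> carrier M \<and> t \<in> carrier R - p \<and>
     (\<exists>u\<in>carrier R - p. u \<odot>\<^bsub>M\<^esub> (t \<odot>\<^bsub>M\<^esub> x) = u \<odot>\<^bsub>M\<^esub> (s \<odot>\<^bsub>M\<^esub> y))}"

definition localization_module ::
  "('a, 'r) ring_scheme \<Rightarrow> 'a set \<Rightarrow> ('a, 'm) module \<Rightarrow> (('a \<times> 'a) set, ('m \<times> 'a) set) module" where
  "localization_module R p M =
     \<lparr>carrier = {frac R p M x s | x s. x \<in> carrier M \<and> s \<in> carrier R - p},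
      mult = undefined, one = undefined,
      zero = frac R p M \<zero>\<^bsub>M\<^esub> \<one>\<^bsub>R\<^esub>,
      add = \<lambda>X Y. \<Union>(x, s)\<in>X. \<Union>(y, t)\<in>Y. frac R p M (t \<odot>\<^bsub>M\<^esub> x \<oplus>\<^bsub>M\<^esub> s \<odot>\<^bsub>M\<^esub> y) (s \<otimes>\<^bsub>R\<^esub> t),
      smult = \<lambda>A X. \<Union>(a, s)\<in>A. \<Union>(x, t)\<in>X. frac R p M (a \<odot>\<^bsub>M\<^esub> x) (s \<otimes>\<^bsub>R\<^esub> t)\<rparr>"

definition localization_ring :: "('a, 'r) ring_scheme \<Rightarrow> 'a set \<Rightarrow> (('a \<times> 'a) set) ring" where
  "localization_ring R p =
     (let L = localization_module R p (self_module R)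
      in \<lparr>carrier = carrier L, mult = smult L, one = frac R p (self_module R) \<one>\<^bsub>R\<^esub> \<one>\<^bsub>R\<^esub>,
          zero = zero L, add = add L\<rparr>)"

definition localization_hom :: "('a, 'r) ring_scheme \<Rightarrow> 'a set \<Rightarrow> 'a \<Rightarrow> ('a \<times> 'a) set" where
  "localization_hom R p a = frac R p (self_module R) a \<one>\<^bsub>R\<^esub>"

definition localization_complex ::
  "('a, 'r) ring_scheme \<Rightarrow> 'a set \<Rightarrow> ('a, 'm) cplx \<Rightarrow> (('a \<times> 'a) set, ('m \<times> 'a) set) cplx" where
  "localization_complex R p X =
     \<lparr>obj = \<lambda>n. localization_module R p (obj X n),
      diff = \<lambda>n A. \<Union>(x, s)\<in>A. frac R p (obj X (n - 1)) (diff X n x) s\<rparr>"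

definition restrict_scalars_complex :: "('a \<Rightarrow> 'b) \<Rightarrow> ('b, 'm) cplx \<Rightarrow> ('a, 'm) cplx" where
  "restrict_scalars_complex h X =
     \<lparr>obj = \<lambda>n. restrict_scalars h (obj X n), diff = diff X\<rparr>"

text \<open>\<open>k(p)\<close> as a module over the local ring at \<open>p\<close>.\<close>

definition residue_field ::
  "('a, 'r) ring_scheme \<Rightarrow> 'a set \<Rightarrow> (('a \<times> 'a) set, ('a \<times> 'a) set set) module" where
  "residue_field R p =
     (let L = localization_ring R p
      in quotient_module (self_module L) (Idl\<^bsub>L\<^esub> (localization_hom R p ` p)))"


section \<open>Small support and small cosupport\<close>

definition Spec :: "('a, 'r) ring_scheme \<Rightarrow> 'a set set" where
  "Spec R = {p. primeideal p R}"

definition Max_Spec :: "('a, 'r) ring_scheme \<Rightarrow> 'a set set" where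
  "Max_Spec R = {m. maximalideal m R}"

definition small_supp :: "('a, 'r) ring_scheme \<Rightarrow> ('a, 'm) cplx \<Rightarrow> 'a set set" where
  "small_supp R M = {p \<in> Spec R.
     \<not> derived_iso R
         (derived_tensor R (restrict_scalars (localization_hom R p) (residue_field R p)) M)
         zero_complex}"

definition global_dual ::
  "('a, 'r) ring_scheme \<Rightarrow> ('a, 'm) cplx
    \<Rightarrow> ('a, int \<Rightarrow> 'm \<Rightarrow> 'a set \<Rightarrow> 'a set \<Rightarrow> 'a \<Rightarrow> rat) cplx" where
  "global_dual R M = Hom_complex R M
     (concentrated (direct_sum (Max_Spec R)
        (\<lambda>m. injective_envelope R (quotient_module (self_module R) m))))"

text \<open>\<open>colocal_dual R p M\<close> is the complex of modules over the local ring at \<open>p\<close> that is written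
  as \<open>M\<close> with left superscript \<open>p\<close>.\<close>

definition colocal_dual ::
  "('a, 'r) ring_scheme \<Rightarrow> 'a set \<Rightarrow> ('a, 'm) cplx
    \<Rightarrow> (('a \<times> 'a) set, int \<Rightarrow> ((int \<Rightarrow> 'm \<Rightarrow> 'a set \<Rightarrow> 'a set \<Rightarrow> 'a \<Rightarrow> rat) \<times> 'a) set
          \<Rightarrow> ('a \<times> 'a) set set \<Rightarrow> ('a \<times> 'a) set \<Rightarrow> rat) cplx" where
  "colocal_dual R p M = Hom_complex (localization_ring R p)
     (localization_complex R p (global_dual R M))
     (concentrated (injective_envelope (localization_ring R p) (residue_field R p)))"

definition small_cosupp :: "('a, 'r) ring_scheme \<Rightarrow> ('a, 'm) cplx \<Rightarrow> 'a set set" where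
  "small_cosupp R M = {p \<in> Spec R.
     \<not> derived_iso R
         (RHom R (quotient_module (self_module R) p)
            (restrict_scalars_complex (localization_hom R p) (colocal_dual R p M)))
         zero_complex}"

end

theory Submission
  imports Defs "HOL-Algebra.IntRing"
begin

text \<open>
  A complex is isomorphic to zero in the derived category exactly if it is exact
  (\<open>derived_iso_zero_iff\<close>). So each half of the statement says: if tensoring with a free resolution
  \<open>F\<close> of \<open>k(p)\<close> makes every homology module of \<open>M\<close> acyclic, then \<open>F \<otimes> M\<close> is exact; and if mapping a
  free resolution \<open>F\<close> of \<open>R/p\<close> into the colocal dual of every homology module of \<open>M\<close> gives an acyclic
  complex, then so does mapping it into the colocal dual of \<open>M\<close>.

  Both follow from one principle on double complexes. Since the modules \<open>F\<^sub>i\<close> are free, the functors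
  \<open>F\<^sub>i \<otimes> -\<close> and \<open>Hom(F\<^sub>i, -)\<close> commute with homology. Hence a component of a cycle of the total complex
  can be corrected by a boundary to become zero, at the price of changing the neighbouring component
  (\<open>tensor_exact_correction\<close>, \<open>hom_exact_correction\<close>). A cycle of \<open>F \<otimes> M\<close> has finitely many nonzero
  components, and these are removed from the top downwards; the process stops because \<open>F\<close> vanishes in
  negative degrees (\<open>tensor_free_complex_exact\<close>). A cycle of \<open>Hom(F, N)\<close> may have infinitely many
  components, all of index at least zero; they are removed from the bottom upwards, and the
  corrections converge because each component changes only twice (\<open>Hom_free_complex_exact\<close>).

  For the cosupport it remains to see that the homology of the colocal dual of \<open>M\<close> is the colocal dual
  of the homology of \<open>M\<close> (\<open>colocal_dual_is_homology\<close>). The colocal dual is a composite of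
  homomorphisms into an injective module, localization, and once more homomorphisms into an injective
  module, and each of these functors is exact. The first of the two injective modules is a direct sum
  of injective envelopes; it is injective because \<open>R\<close> is noetherian (\<open>baer_direct_sum\<close>).

  Injective envelopes and free resolutions are introduced by choice within fixed types, so their
  existence within these types has to be proved. Envelopes are found as maximal essential extensions
  in a power of \<open>Hom\<^sub>\<int>(R, \<rat>/\<int>)\<close> (\<open>injective_envelope_exists\<close>). For resolutions, a finitely supported
  function on words is encoded by a single word, so that each kernel can serve as a basis of the
  next free module (\<open>free_resolution_exists\<close>).
\<close>


section \<open>Linear maps and constructions of modules\<close>

lemma linear_mapI:
  assumes "\<And>x. x \<in> carrier M \<Longrightarrow> f x \<in> carrier N"
    and "\<And>x y. x \<in> carrier M \<Longrightarrow> y \<in> carrier M \<Longrightarrow> f (x \<oplus>\<^bsub>M\<^esub> y) = f x \<oplus>\<^bsub>N\<^esub> f y"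
    and "\<And>a x. a \<in> carrier R \<Longrightarrow> x \<in> carrier M \<Longrightarrow> f (a \<odot>\<^bsub>M\<^esub> x) = a \<odot>\<^bsub>N\<^esub> f x"
  shows "linear_map R M N f"
  using assms unfolding linear_map_def by auto

lemma linear_map_closed: "linear_map R M N f \<Longrightarrow> x \<in> carrier M \<Longrightarrow> f x \<in> carrier N"
  and linear_map_add: "linear_map R M N f \<Longrightarrow> x \<in> carrier M \<Longrightarrow> y \<in> carrier M
    \<Longrightarrow> f (x \<oplus>\<^bsub>M\<^esub> y) = f x \<oplus>\<^bsub>N\<^esub> f y"
  and linear_map_smult: "linear_map R M N f \<Longrightarrow> a \<in> carrier R \<Longrightarrow> x \<in> carrier M
    \<Longrightarrow> f (a \<odot>\<^bsub>M\<^esub> x) = a \<odot>\<^bsub>N\<^esub> f x"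
  unfolding linear_map_def by auto

lemma linear_map_compose:
  "linear_map R M N f \<Longrightarrow> linear_map R N P g \<Longrightarrow> linear_map R M P (\<lambda>x. g (f x))"
  unfolding linear_map_def by (auto simp: Pi_iff)

lemma linear_map_cong:
  assumes "linear_map R M N f" "module R M" "\<And>x. x \<in> carrier M \<Longrightarrow> g x = f x"
  shows "linear_map R M N g"
proof -
  interpret module R M by fact
  show ?thesis using assms(1,3) unfolding linear_map_def by (auto simp: Pi_iff)
qed

text \<open>Interpreting this locale turns the computation rules for a linear map into simplification
  rules.\<close>

locale lin = M: module R M + N: module R N
  for R (structure) and M :: "('a, 'm) module" and N :: "('a, 'n) module" +
  fixes f
  assumes lin: "linear_map R M N f"
begin

lemma closed [simp]: "x \<in> carrier M \<Longrightarrow> f x \<in> carrier N"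
  using lin by (rule linear_map_closed)

lemma add [simp]: "x \<in> carrier M \<Longrightarrow> y \<in> carrier M \<Longrightarrow> f (x \<oplus>\<^bsub>M\<^esub> y) = f x \<oplus>\<^bsub>N\<^esub> f y"
  using lin by (rule linear_map_add)

lemma smult [simp]: "a \<in> carrier R \<Longrightarrow> x \<in> carrier M \<Longrightarrow> f (a \<odot>\<^bsub>M\<^esub> x) = a \<odot>\<^bsub>N\<^esub> f x"
  using lin by (rule linear_map_smult)

lemma zero [simp]: "f \<zero>\<^bsub>M\<^esub> = \<zero>\<^bsub>N\<^esub>"
  using add[of "\<zero>\<^bsub>M\<^esub>" "\<zero>\<^bsub>M\<^esub>"] by simp

lemma neg [simp]: "x \<in> carrier M \<Longrightarrow> f (\<ominus>\<^bsub>M\<^esub> x) = \<ominus>\<^bsub>N\<^esub> f x"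
  by (metis M.add.inv_closed M.add.l_inv N.minus_equality add closed zero)

lemma minus [simp]:
  "x \<in> carrier M \<Longrightarrow> y \<in> carrier M \<Longrightarrow> f (x \<ominus>\<^bsub>M\<^esub> y) = f x \<ominus>\<^bsub>N\<^esub> f y"
  by (simp add: a_minus_def)

lemma finsum: "finite A \<Longrightarrow> g \<in> A \<rightarrow> carrier M
    \<Longrightarrow> f (finsum M g A) = finsum N (\<lambda>a. f (g a)) A"
proof (induction A rule: finite_induct)
  case (insert a A)
  then have "g \<in> A \<rightarrow> carrier M" "g a \<in> carrier M" by auto
  with insert show ?case by (simp add: Pi_iff)
qed simp

lemma kernel_submodule: "submodule {x \<in> carrier M. f x = \<zero>\<^bsub>N\<^esub>} R M"
  by (rule M.submoduleI) auto

lemma image_submodule: "submodule (f ` carrier M) R N"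
proof (rule N.submoduleI)
  show "f ` carrier M \<subseteq> carrier N" by auto
  show "\<zero>\<^bsub>N\<^esub> \<in> f ` carrier M" using zero by (metis M.zero_closed imageI)
  show "\<ominus>\<^bsub>N\<^esub> a \<in> f ` carrier M" if "a \<in> f ` carrier M" for a
    using that neg by (metis (no_types, lifting) M.add.inv_closed imageE imageI)
  show "a \<oplus>\<^bsub>N\<^esub> b \<in> f ` carrier M" if "a \<in> f ` carrier M" "b \<in> f ` carrier M" for a b
    using that add by (metis (no_types, lifting) M.a_closed imageE imageI)
  show "a \<odot>\<^bsub>N\<^esub> b \<in> f ` carrier M" if "a \<in> carrier R" "b \<in> f ` carrier M" for a b
    using that smult by (metis (no_types, lifting) M.smult_closed imageE imageI)
qed

lemma preimage_submodule:
  assumes "submodule H R N"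
  shows "submodule {x \<in> carrier M. f x \<in> H} R M"
proof -
  note E = N.submoduleE[OF assms]
  have z: "\<zero>\<^bsub>N\<^esub> \<in> H" using E(2,5,3,1) by (metis N.add.l_inv ex_in_conv subsetD)
  show ?thesis by (rule M.submoduleI) (use E z in auto)
qed

end

lemma linI: "module R M \<Longrightarrow> module R N \<Longrightarrow> linear_map R M N f \<Longrightarrow> lin R M N f"
  by (simp add: lin_def lin_axioms_def)

lemma (in module) submodule_zero: "submodule H R M \<Longrightarrow> \<zero>\<^bsub>M\<^esub> \<in> H"
  using subgroup.one_closed[OF submodule.axioms(1)] by fastforce

lemma (in module) zero_submodule: "submodule {\<zero>\<^bsub>M\<^esub>} R M"
  by (rule submoduleI) auto

text \<open>Quotients of a module, and copies of it over another type, are images of it. The module laws are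
  equations, so they pass to the image.\<close>

lemma module_surj_image:
  fixes M :: "('a, 'm) module" and Q :: "('a, 'q) module"
  assumes "module R M" and img: "p ` carrier M = carrier Q"
    and add: "\<And>x y. x \<in> carrier M \<Longrightarrow> y \<in> carrier M \<Longrightarrow> p (x \<oplus>\<^bsub>M\<^esub> y) = p x \<oplus>\<^bsub>Q\<^esub> p y"
    and smult: "\<And>a x. a \<in> carrier R \<Longrightarrow> x \<in> carrier M \<Longrightarrow> p (a \<odot>\<^bsub>M\<^esub> x) = a \<odot>\<^bsub>Q\<^esub> p x"
    and zero: "p \<zero>\<^bsub>M\<^esub> = \<zero>\<^bsub>Q\<^esub>"
  shows "module R Q"
proof -
  interpret M: module R M by fact
  have ex: "\<exists>u \<in> carrier M. x = p u" if "x \<in> carrier Q" for x using that img by auto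
  have cl: "p x \<in> carrier Q" if "x \<in> carrier M" for x using that img by auto
  show ?thesis
  proof (rule moduleI)
    show "cring R" by unfold_locales
    show "abelian_group Q"
    proof (rule abelian_groupI)
      fix x y assume "x \<in> carrier Q" "y \<in> carrier Q"
      then obtain u v where u: "u \<in> carrier M" "x = p u" and v: "v \<in> carrier M" "y = p v"
        using ex by meson
      show "x \<oplus>\<^bsub>Q\<^esub> y \<in> carrier Q" using u v add[symmetric] cl by simp
      show "x \<oplus>\<^bsub>Q\<^esub> y = y \<oplus>\<^bsub>Q\<^esub> x" using u v add[symmetric] by (simp add: M.a_comm)
      fix z assume "z \<in> carrier Q"
      then obtain w where w: "w \<in> carrier M" "z = p w" using ex by meson
      show "x \<oplus>\<^bsub>Q\<^esub> y \<oplus>\<^bsub>Q\<^esub> z = x \<oplus>\<^bsub>Q\<^esub> (y \<oplus>\<^bsub>Q\<^esub> z)"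
        using u v w add[symmetric] by (simp add: M.a_assoc)
    next
      show "\<zero>\<^bsub>Q\<^esub> \<in> carrier Q" using cl[OF M.zero_closed] zero by simp
      fix x assume "x \<in> carrier Q"
      then obtain u where u: "u \<in> carrier M" "x = p u" using ex by meson
      show "\<zero>\<^bsub>Q\<^esub> \<oplus>\<^bsub>Q\<^esub> x = x" using u add[of "\<zero>\<^bsub>M\<^esub>" u] zero by simp
      show "\<exists>y\<in>carrier Q. y \<oplus>\<^bsub>Q\<^esub> x = \<zero>\<^bsub>Q\<^esub>"
        using u add[of "\<ominus>\<^bsub>M\<^esub> u" u] zero cl by (metis M.a_inv_closed M.l_neg)
    qed
    fix a b x y assume a: "a \<in> carrier R" and b: "b \<in> carrier R" and "x \<in> carrier Q" "y \<in> carrier Q"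
    then obtain u v where u: "u \<in> carrier M" "x = p u" and v: "v \<in> carrier M" "y = p v"
        using ex by meson
    show "a \<odot>\<^bsub>Q\<^esub> x \<in> carrier Q" using a u smult[symmetric] cl by simp
    show "(a \<oplus>\<^bsub>R\<^esub> b) \<odot>\<^bsub>Q\<^esub> x = a \<odot>\<^bsub>Q\<^esub> x \<oplus>\<^bsub>Q\<^esub> b \<odot>\<^bsub>Q\<^esub> x"
      using a b u smult[symmetric] add[symmetric] by (simp add: M.smult_l_distr)
    show "a \<odot>\<^bsub>Q\<^esub> (x \<oplus>\<^bsub>Q\<^esub> y) = a \<odot>\<^bsub>Q\<^esub> x \<oplus>\<^bsub>Q\<^esub> a \<odot>\<^bsub>Q\<^esub> y"
      using a u v smult[symmetric] add[symmetric] by (simp add: M.smult_r_distr)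
    show "(a \<otimes>\<^bsub>R\<^esub> b) \<odot>\<^bsub>Q\<^esub> x = a \<odot>\<^bsub>Q\<^esub> (b \<odot>\<^bsub>Q\<^esub> x)"
      using a b u smult[symmetric] by (simp add: M.smult_assoc1)
  next
    interpret R: cring R by unfold_locales
    fix x assume "x \<in> carrier Q"
    then obtain u where u: "u \<in> carrier M" "x = p u" using ex by meson
    show "\<one>\<^bsub>R\<^esub> \<odot>\<^bsub>Q\<^esub> x = x" using u smult[symmetric] by simp
  qed
qed

lemma zero_module_module: "cring R \<Longrightarrow> module R zero_module"
  by (rule moduleI) (auto simp: zero_module_def intro!: abelian_groupI)

lemma abelian_group_cong:
  assumes "abelian_group G" "carrier H = carrier G" "add H = add G" "zero H = zero G"
  shows "abelian_group H"
proof -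
  interpret abelian_group G by fact
  show ?thesis
  proof (rule abelian_groupI)
    show "\<exists>y\<in>carrier H. y \<oplus>\<^bsub>H\<^esub> x = \<zero>\<^bsub>H\<^esub>" if "x \<in> carrier H" for x
      using that l_neg a_inv_closed by (metis assms(2-4))
  qed (simp_all add: assms a_ac)
qed

lemma module_cong_group:
  assumes "cring R" "abelian_group G"
    and "carrier M = carrier G" "add M = add G" "zero M = zero G"
    and "\<And>a x. a \<in> carrier R \<Longrightarrow> x \<in> carrier G \<Longrightarrow> a \<odot>\<^bsub>M\<^esub> x \<in> carrier G"
    and "\<And>a b x. a \<in> carrier R \<Longrightarrow> b \<in> carrier R \<Longrightarrow> x \<in> carrier G \<Longrightarrow>
      (a \<oplus>\<^bsub>R\<^esub> b) \<odot>\<^bsub>M\<^esub> x = (a \<odot>\<^bsub>M\<^esub> x) \<oplus>\<^bsub>G\<^esub> (b \<odot>\<^bsub>M\<^esub> x)"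
    and "\<And>a x y. a \<in> carrier R \<Longrightarrow> x \<in> carrier G \<Longrightarrow> y \<in> carrier G \<Longrightarrow>
      a \<odot>\<^bsub>M\<^esub> (x \<oplus>\<^bsub>G\<^esub> y) = (a \<odot>\<^bsub>M\<^esub> x) \<oplus>\<^bsub>G\<^esub> (a \<odot>\<^bsub>M\<^esub> y)"
    and "\<And>a b x. a \<in> carrier R \<Longrightarrow> b \<in> carrier R \<Longrightarrow> x \<in> carrier G \<Longrightarrow>
      (a \<otimes>\<^bsub>R\<^esub> b) \<odot>\<^bsub>M\<^esub> x = a \<odot>\<^bsub>M\<^esub> (b \<odot>\<^bsub>M\<^esub> x)"
    and "\<And>x. x \<in> carrier G \<Longrightarrow> \<one>\<^bsub>R\<^esub> \<odot>\<^bsub>M\<^esub> x = x"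
  shows "module R M"
  by (rule moduleI) (simp_all add: assms abelian_group_cong[OF assms(2-5)])

lemma self_module_module:
  assumes "cring R" shows "module R (self_module R)"
proof -
  interpret cring R by fact
  show ?thesis
    by (rule module_cong_group[OF is_cring is_abelian_group])
      (simp_all add: self_module_def l_distr r_distr m_assoc)
qed

lemma self_module_simps [simp]:
  "carrier (self_module R) = carrier R" "add (self_module R) = add R"
  "zero (self_module R) = zero R" "smult (self_module R) = mult R"
  by (simp_all add: self_module_def)

lemma restrict_scalars_simps [simp]:
  "carrier (restrict_scalars h M) = carrier M" "add (restrict_scalars h M) = add M"
  "zero (restrict_scalars h M) = zero M" "smult (restrict_scalars h M) a x = h a \<odot>\<^bsub>M\<^esub> x"
  by (simp_all add: restrict_scalars_def)

lemma restrict_scalars_module: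
  assumes "cring R" "module S M" "h \<in> ring_hom R S"
  shows "module R (restrict_scalars h M)"
proof -
  interpret R: cring R by fact
  interpret M: module S M by fact
  note H = ring_hom_closed[OF assms(3)] ring_hom_mult[OF assms(3)] ring_hom_add[OF assms(3)]
    ring_hom_one[OF assms(3)]
  show ?thesis
    by (rule moduleI)
      (auto simp: H M.smult_l_distr M.smult_r_distr M.smult_assoc1
        intro!: assms abelian_group_cong[OF M.M.abelian_group_axioms])
qed

lemma restrict_scalars_linear:
  "linear_map S M N f \<Longrightarrow> h \<in> ring_hom R S \<Longrightarrow>
    linear_map R (restrict_scalars h M) (restrict_scalars h N) f"
  unfolding linear_map_def by (auto simp: ring_hom_closed)

subsection \<open>Quotients\<close>

locale submod = M: module R M for R (structure) and M :: "('a, 'm) module" +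
  fixes H
  assumes H: "submodule H R M"
begin

lemma submodule_abelian_subgroup: "abelian_subgroup H M"
  by (intro abelian_subgroupI3 additive_subgroupI submodule.axioms(1)[OF H] M.abelian_group_axioms)

lemma quotient_carrier: "carrier (quotient_module M H) = (\<lambda>x. H +>\<^bsub>M\<^esub> x) ` carrier M"
  by (auto simp: quotient_module_def A_RCOSETS_def')

lemma coset_eq_iff:
  assumes "x \<in> carrier M" "y \<in> carrier M"
  shows "H +>\<^bsub>M\<^esub> x = H +>\<^bsub>M\<^esub> y \<longleftrightarrow> x \<ominus>\<^bsub>M\<^esub> y \<in> H"
proof -
  interpret H: abelian_subgroup H M by (rule submodule_abelian_subgroup)
  show ?thesis
    by (metis H.a_rcos_module H.a_rcos_self H.a_subset H.a_subgroup M.a_repr_independence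
        M.minus_eq assms)
qed

lemma coset_memberD:
  assumes "c \<in> H +>\<^bsub>M\<^esub> x" "x \<in> carrier M"
  shows "c \<in> carrier M" "H +>\<^bsub>M\<^esub> c = H +>\<^bsub>M\<^esub> x" "c \<ominus>\<^bsub>M\<^esub> x \<in> H"
proof -
  interpret H: abelian_subgroup H M by (rule submodule_abelian_subgroup)
  show 1: "c \<in> carrier M" using assms H.a_subset M.a_r_coset_subset_G by blast
  show 2: "H +>\<^bsub>M\<^esub> c = H +>\<^bsub>M\<^esub> x"
    using H.a_subgroup M.a_repr_independence assms by metis
  show "c \<ominus>\<^bsub>M\<^esub> x \<in> H" using 1 2 assms coset_eq_iff by blast
qed

lemma coset_self: "x \<in> carrier M \<Longrightarrow> x \<in> H +>\<^bsub>M\<^esub> x"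
  using abelian_subgroup.a_rcos_self[OF submodule_abelian_subgroup] .

lemma coset_add:
  "x \<in> carrier M \<Longrightarrow> y \<in> carrier M \<Longrightarrow>
    (H +>\<^bsub>M\<^esub> x) \<oplus>\<^bsub>quotient_module M H\<^esub> (H +>\<^bsub>M\<^esub> y) = H +>\<^bsub>M\<^esub> (x \<oplus>\<^bsub>M\<^esub> y)"
  using abelian_subgroup.a_rcos_sum[OF submodule_abelian_subgroup] by (simp add: quotient_module_def)

lemma coset_smult:
  assumes "a \<in> carrier R" "x \<in> carrier M"
  shows "a \<odot>\<^bsub>quotient_module M H\<^esub> (H +>\<^bsub>M\<^esub> x) = H +>\<^bsub>M\<^esub> (a \<odot>\<^bsub>M\<^esub> x)"
proof -
  have "H +>\<^bsub>M\<^esub> (a \<odot>\<^bsub>M\<^esub> c) = H +>\<^bsub>M\<^esub> (a \<odot>\<^bsub>M\<^esub> x)" if "c \<in> H +>\<^bsub>M\<^esub> x" for c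
  proof -
    have c: "c \<in> carrier M" "c \<ominus>\<^bsub>M\<^esub> x \<in> H" using coset_memberD[OF that assms(2)] by auto
    then have "a \<odot>\<^bsub>M\<^esub> c \<ominus>\<^bsub>M\<^esub> a \<odot>\<^bsub>M\<^esub> x \<in> H"
      using M.submoduleE(4)[OF H assms(1), of "c \<ominus>\<^bsub>M\<^esub> x"] assms
      by (simp add: M.minus_eq M.smult_r_distr M.smult_r_minus)
    then show ?thesis using c assms coset_eq_iff by simp
  qed
  then have "(\<Union>c \<in> H +>\<^bsub>M\<^esub> x. H +>\<^bsub>M\<^esub> (a \<odot>\<^bsub>M\<^esub> c)) = H +>\<^bsub>M\<^esub> (a \<odot>\<^bsub>M\<^esub> x)"
    by (intro UN_constant_eq[OF coset_self[OF assms(2)]] ballI)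
  then show ?thesis by (simp add: quotient_module_def)
qed

lemma coset_zero: "H +>\<^bsub>M\<^esub> \<zero>\<^bsub>M\<^esub> = \<zero>\<^bsub>quotient_module M H\<^esub>"
  using M.submoduleE(1)[OF H] by (simp add: quotient_module_def)

lemma coset_eq_zero_iff:
  assumes "x \<in> carrier M"
  shows "H +>\<^bsub>M\<^esub> x = \<zero>\<^bsub>quotient_module M H\<^esub> \<longleftrightarrow> x \<in> H"
proof -
  have "\<ominus>\<^bsub>M\<^esub> \<zero>\<^bsub>M\<^esub> = \<zero>\<^bsub>M\<^esub>" by (rule M.minus_equality) auto
  then have "x \<ominus>\<^bsub>M\<^esub> \<zero>\<^bsub>M\<^esub> = x" using M.r_zero[OF assms] unfolding a_minus_def by metis
  then show ?thesis
    using coset_eq_iff[OF assms M.zero_closed] by (simp add: coset_zero)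
qed

lemma quotient_module_module: "module R (quotient_module M H)"
  by (rule module_surj_image[OF M.module_axioms quotient_carrier[symmetric] coset_add[symmetric]
        coset_smult[symmetric] coset_zero])

lemma coset_linear: "linear_map R M (quotient_module M H) (\<lambda>x. H +>\<^bsub>M\<^esub> x)"
  by (rule linear_mapI) (auto simp: quotient_carrier coset_add coset_smult)

end

subsection \<open>Products, direct sums and Hom\<close>

lemma direct_product_simps:
  "carrier (direct_product I M) = (\<Pi>\<^sub>E i\<in>I. carrier (M i))"
  "zero (direct_product I M) = (\<lambda>i\<in>I. \<zero>\<^bsub>M i\<^esub>)"
  "add (direct_product I M) f g = (\<lambda>i\<in>I. f i \<oplus>\<^bsub>M i\<^esub> g i)"
  "smult (direct_product I M) a f = (\<lambda>i\<in>I. a \<odot>\<^bsub>M i\<^esub> f i)"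
  by (simp_all add: direct_product_def)

lemma direct_sum_simps:
  "carrier (direct_sum I M) = {f \<in> \<Pi>\<^sub>E i\<in>I. carrier (M i). finite {i \<in> I. f i \<noteq> \<zero>\<^bsub>M i\<^esub>}}"
  "zero (direct_sum I M) = (\<lambda>i\<in>I. \<zero>\<^bsub>M i\<^esub>)"
  "add (direct_sum I M) f g = (\<lambda>i\<in>I. f i \<oplus>\<^bsub>M i\<^esub> g i)"
  "smult (direct_sum I M) a f = (\<lambda>i\<in>I. a \<odot>\<^bsub>M i\<^esub> f i)"
  by (simp_all add: direct_product_def direct_sum_def)

lemma direct_sumI:
  "f \<in> carrier (direct_product I M) \<Longrightarrow> finite A \<Longrightarrow> {i \<in> I. f i \<noteq> \<zero>\<^bsub>M i\<^esub>} \<subseteq> A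
    \<Longrightarrow> f \<in> carrier (direct_sum I M)"
  by (auto simp: direct_product_simps direct_sum_simps intro: finite_subset)

lemma direct_product_module:
  assumes "cring R" "\<And>i. i \<in> I \<Longrightarrow> module R (M i)"
  shows "module R (direct_product I M)"
proof -
  have G: "abelian_group (M i)" if "i \<in> I" for i using assms(2)[OF that] by (simp add: module_def)
  note E = abelian_groupE[OF G]
  note D = module.smult_closed[OF assms(2)] module.smult_l_distr[OF assms(2)]
    module.smult_r_distr[OF assms(2)] module.smult_assoc1[OF assms(2)] module.smult_one[OF assms(2)]
  show ?thesis
  proof (rule moduleI)
    show "abelian_group (direct_product I M)"
    proof (rule abelian_groupI)
      fix x assume x: "x \<in> carrier (direct_product I M)"
      show "\<exists>y\<in>carrier (direct_product I M). y \<oplus>\<^bsub>direct_product I M\<^esub> x = \<zero>\<^bsub>direct_product I M\<^esub>"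
        using x abelian_group.a_inv_closed[OF G] abelian_group.l_neg[OF G]
        by (intro bexI[where x = "\<lambda>i\<in>I. \<ominus>\<^bsub>M i\<^esub> x i"])
          (auto simp: direct_product_simps fun_eq_iff PiE_iff)
    next
      fix x y assume "x \<in> carrier (direct_product I M)" "y \<in> carrier (direct_product I M)"
      then show "x \<oplus>\<^bsub>direct_product I M\<^esub> y = y \<oplus>\<^bsub>direct_product I M\<^esub> x"
        by (auto simp: direct_product_simps PiE_iff intro!: restrict_ext E(4))
    qed (auto simp: direct_product_simps E(1-3,5) PiE_iff fun_eq_iff extensional_def)
  qed (use assms(1) in \<open>auto simp: direct_product_simps D PiE_iff fun_eq_iff extensional_def\<close>)
qed

lemma direct_sum_submodule:
  assumes "cring R" "\<And>i. i \<in> I \<Longrightarrow> module R (M i)"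
  shows "submodule (carrier (direct_sum I M)) R (direct_product I M)"
proof -
  interpret P: module R "direct_product I M" using assms by (rule direct_product_module)
  interpret cring R by fact
  have G: "abelian_group (M i)" if "i \<in> I" for i using assms(2)[OF that] by (simp add: module_def)
  have sm: "a \<odot>\<^bsub>direct_product I M\<^esub> f \<in> carrier (direct_sum I M)"
    if a: "a \<in> carrier R" and f: "f \<in> carrier (direct_sum I M)" for a f
  proof -
    have "{i \<in> I. (a \<odot>\<^bsub>direct_product I M\<^esub> f) i \<noteq> \<zero>\<^bsub>M i\<^esub>} \<subseteq> {i \<in> I. f i \<noteq> \<zero>\<^bsub>M i\<^esub>}"
      using module.smult_r_null[OF assms(2) a] by (auto simp: direct_product_simps)
    moreover have "a \<odot>\<^bsub>direct_product I M\<^esub> f \<in> carrier (direct_product I M)"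
      using a f by (intro P.smult_closed) (auto simp: direct_product_simps direct_sum_simps)
    ultimately show ?thesis
      using f by (intro direct_sumI) (auto simp: direct_sum_simps)
  qed
  show ?thesis
  proof (rule P.submoduleI)
    show "carrier (direct_sum I M) \<subseteq> carrier (direct_product I M)"
      by (auto simp: direct_sum_simps direct_product_simps)
    show "\<zero>\<^bsub>direct_product I M\<^esub> \<in> carrier (direct_sum I M)"
      using abelian_groupE(2)[OF G]
      by (auto simp: direct_sum_simps direct_product_simps)
  next
    fix f assume f: "f \<in> carrier (direct_sum I M)"
    then have "f \<in> carrier (direct_product I M)" by (auto simp: direct_sum_simps direct_product_simps)
    then have "\<ominus>\<^bsub>direct_product I M\<^esub> f = (\<ominus>\<^bsub>R\<^esub> \<one>\<^bsub>R\<^esub>) \<odot>\<^bsub>direct_product I M\<^esub> f"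
      using P.smult_l_minus[of "\<one>\<^bsub>R\<^esub>" f] by simp
    with sm[OF _ f] show "\<ominus>\<^bsub>direct_product I M\<^esub> f \<in> carrier (direct_sum I M)" by simp
  next
    fix f g assume f: "f \<in> carrier (direct_sum I M)" and g: "g \<in> carrier (direct_sum I M)"
    have "{i \<in> I. (f \<oplus>\<^bsub>direct_product I M\<^esub> g) i \<noteq> \<zero>\<^bsub>M i\<^esub>}
        \<subseteq> {i \<in> I. f i \<noteq> \<zero>\<^bsub>M i\<^esub>} \<union> {i \<in> I. g i \<noteq> \<zero>\<^bsub>M i\<^esub>}"
      using abelian_groupE(5)[OF G] abelian_groupE(2)[OF G] by (auto simp: direct_product_simps)
    moreover have "f \<oplus>\<^bsub>direct_product I M\<^esub> g \<in> carrier (direct_product I M)"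
      using f g by (intro P.a_closed) (auto simp: direct_product_simps direct_sum_simps)
    ultimately show "f \<oplus>\<^bsub>direct_product I M\<^esub> g \<in> carrier (direct_sum I M)"
      using f g by (intro direct_sumI[where A = "{i \<in> I. f i \<noteq> \<zero>\<^bsub>M i\<^esub>} \<union> {i \<in> I. g i \<noteq> \<zero>\<^bsub>M i\<^esub>}"])
        (auto simp: direct_sum_simps)
  qed (rule sm)
qed

lemma direct_sum_module:
  assumes "cring R" "\<And>i. i \<in> I \<Longrightarrow> module R (M i)"
  shows "module R (direct_sum I M)"
  using submodule.submodule_is_module[OF direct_sum_submodule[OF assms]
      direct_product_module[OF assms]]
  by (simp add: direct_sum_def)

lemma Hom_module_simps:
  "carrier (Hom_module R M N) = {f \<in> extensional (carrier M). linear_map R M N f}"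
  "zero (Hom_module R M N) = (\<lambda>x\<in>carrier M. \<zero>\<^bsub>N\<^esub>)"
  "add (Hom_module R M N) f g = (\<lambda>x\<in>carrier M. f x \<oplus>\<^bsub>N\<^esub> g x)"
  "smult (Hom_module R M N) a f = (\<lambda>x\<in>carrier M. a \<odot>\<^bsub>N\<^esub> f x)"
  by (simp_all add: Hom_module_def)

lemma Hom_module_submodule:
  assumes "module R M" "module R N"
  shows "submodule (carrier (Hom_module R M N)) R (direct_product (carrier M) (\<lambda>_. N))"
proof -
  interpret M: module R M by fact
  interpret N: module R N by fact
  interpret P: module R "direct_product (carrier M) (\<lambda>_. N)"
    by (rule direct_product_module) (auto intro: N.module_axioms M.R.cring_axioms)
  have sm: "a \<odot>\<^bsub>direct_product (carrier M) (\<lambda>_. N)\<^esub> f \<in> carrier (Hom_module R M N)"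
    if a: "a \<in> carrier R" and f: "f \<in> carrier (Hom_module R M N)" for a f
  proof -
    interpret f: lin R M N f using assms f by (intro linI) (auto simp: Hom_module_simps)
    show ?thesis using a
      by (auto simp: Hom_module_simps direct_product_simps N.smult_r_distr
          N.smult_assoc1[symmetric] M.R.m_comm intro!: linear_mapI)
  qed
  have sub: "carrier (Hom_module R M N) \<subseteq> carrier (direct_product (carrier M) (\<lambda>_. N))"
    by (auto simp: Hom_module_simps direct_product_simps linear_map_def PiE_def)
  show ?thesis
  proof (rule P.submoduleI[OF sub])
    show "\<zero>\<^bsub>direct_product (carrier M) (\<lambda>_. N)\<^esub> \<in> carrier (Hom_module R M N)"
      by (auto simp: Hom_module_simps direct_product_simps intro!: linear_mapI)
  next
    fix f assume f: "f \<in> carrier (Hom_module R M N)"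
    then have "\<ominus>\<^bsub>direct_product (carrier M) (\<lambda>_. N)\<^esub> f
        = (\<ominus>\<^bsub>R\<^esub> \<one>\<^bsub>R\<^esub>) \<odot>\<^bsub>direct_product (carrier M) (\<lambda>_. N)\<^esub> f"
      using P.smult_l_minus[of "\<one>\<^bsub>R\<^esub>" f] sub by auto
    with sm[OF _ f] show "\<ominus>\<^bsub>direct_product (carrier M) (\<lambda>_. N)\<^esub> f \<in> carrier (Hom_module R M N)"
      by simp
  next
    fix f g assume f: "f \<in> carrier (Hom_module R M N)" and g: "g \<in> carrier (Hom_module R M N)"
    interpret f: lin R M N f using assms f by (intro linI) (auto simp: Hom_module_simps)
    interpret g: lin R M N g using assms g by (intro linI) (auto simp: Hom_module_simps)
    show "f \<oplus>\<^bsub>direct_product (carrier M) (\<lambda>_. N)\<^esub> g \<in> carrier (Hom_module R M N)"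
      by (auto simp: Hom_module_simps direct_product_simps N.smult_r_distr N.a_ac
          intro!: linear_mapI)
  qed (rule sm)
qed

lemma module_cong:
  fixes M :: "('a, 'm) module" and N :: "('a, 'm) module"
  assumes "module R M" "carrier N = carrier M" "add N = add M" "zero N = zero M" "smult N = smult M"
  shows "module R N"
  by (rule module_surj_image[OF assms(1), where p = "\<lambda>x. x"]) (auto simp: assms)

lemma Hom_module_module:
  assumes "module R M" "module R N"
  shows "module R (Hom_module R M N)"
proof -
  have "cring R" using assms(1) by (simp add: module_def)
  then have P: "module R (direct_product (carrier M) (\<lambda>_. N))"
    using assms(2) by (rule direct_product_module)
  show ?thesis
    by (rule module_cong[OF submodule.submodule_is_module[OF Hom_module_submodule[OF assms] P]])
      (auto simp: Hom_module_simps direct_product_simps fun_eq_iff)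
qed


section \<open>Injective modules\<close>

text \<open>Baer's condition involves no module other than \<open>E\<close> itself, hence no auxiliary type: it is the
  form of injectivity that can be used for maps between modules over arbitrary types.\<close>

definition baer :: "('a, 'r) ring_scheme \<Rightarrow> ('a, 'e) module \<Rightarrow> bool" where
  "baer R E \<longleftrightarrow> module R E \<and>
     (\<forall>I f. submodule I R (self_module R) \<and> linear_map R ((self_module R)\<lparr>carrier := I\<rparr>) E f \<longrightarrow>
        (\<exists>e\<in>carrier E. \<forall>a\<in>I. f a = a \<odot>\<^bsub>E\<^esub> e))"

lemma (in abelian_group) minus_eq_zero_iff:
  assumes "x \<in> carrier G" "y \<in> carrier G"
  shows "x \<ominus> y = \<zero> \<longleftrightarrow> x = y"
  using assms by (metis a_minus_def add.inv_closed minus_equality minus_minus r_neg)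

text \<open>A partial linear map is represented by its graph, so that extension is inclusion and Zorn's lemma
  applies. The last condition makes the relation single-valued.\<close>

definition linear_graph ::
  "('a, 'r) ring_scheme \<Rightarrow> ('a, 'b) module \<Rightarrow> ('a, 'e) module \<Rightarrow> ('b \<times> 'e) set \<Rightarrow> bool" where
  "linear_graph R B E G \<longleftrightarrow> G \<subseteq> carrier B \<times> carrier E \<and> (\<zero>\<^bsub>B\<^esub>, \<zero>\<^bsub>E\<^esub>) \<in> G \<and>
     (\<forall>x e y e'. (x, e) \<in> G \<longrightarrow> (y, e') \<in> G \<longrightarrow> (x \<oplus>\<^bsub>B\<^esub> y, e \<oplus>\<^bsub>E\<^esub> e') \<in> G) \<and>
     (\<forall>a\<in>carrier R. \<forall>x e. (x, e) \<in> G \<longrightarrow> (a \<odot>\<^bsub>B\<^esub> x, a \<odot>\<^bsub>E\<^esub> e) \<in> G) \<and>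
     (\<forall>e. (\<zero>\<^bsub>B\<^esub>, e) \<in> G \<longrightarrow> e = \<zero>\<^bsub>E\<^esub>)"

lemma linear_graph_fun:
  assumes G: "linear_graph R B E G" and B: "module R B" and E: "module R E"
    and "(x, e) \<in> G" "(x, e') \<in> G"
  shows "e = e'"
proof -
  interpret B: module R B by fact
  interpret E: module R E by fact
  have x: "x \<in> carrier B" "e \<in> carrier E" "e' \<in> carrier E"
    using assms unfolding linear_graph_def by auto
  have "((\<ominus>\<^bsub>R\<^esub> \<one>\<^bsub>R\<^esub>) \<odot>\<^bsub>B\<^esub> x, (\<ominus>\<^bsub>R\<^esub> \<one>\<^bsub>R\<^esub>) \<odot>\<^bsub>E\<^esub> e') \<in> G"
    using assms unfolding linear_graph_def by simp
  then have "(x \<oplus>\<^bsub>B\<^esub> (\<ominus>\<^bsub>R\<^esub> \<one>\<^bsub>R\<^esub>) \<odot>\<^bsub>B\<^esub> x, e \<oplus>\<^bsub>E\<^esub> (\<ominus>\<^bsub>R\<^esub> \<one>\<^bsub>R\<^esub>) \<odot>\<^bsub>E\<^esub> e') \<in> G"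
    using assms unfolding linear_graph_def by blast
  then have "(\<zero>\<^bsub>B\<^esub>, e \<ominus>\<^bsub>E\<^esub> e') \<in> G"
    using x by (simp add: B.smult_l_minus E.smult_l_minus B.M.r_neg E.M.minus_eq)
  then have "e \<ominus>\<^bsub>E\<^esub> e' = \<zero>\<^bsub>E\<^esub>" using G unfolding linear_graph_def by blast
  then show ?thesis using x E.M.minus_eq_zero_iff by blast
qed

lemma linear_graph_domain:
  assumes G: "linear_graph R B E G" and B: "module R B"
  shows "submodule (Domain G) R B"
proof -
  interpret B: module R B by fact
  note D = G[unfolded linear_graph_def]
  have neg: "\<ominus>\<^bsub>B\<^esub> x \<in> Domain G" if "x \<in> Domain G" for x
  proof -
    from that obtain e where "(x, e) \<in> G" by blast
    then have x: "x \<in> carrier B" "((\<ominus>\<^bsub>R\<^esub> \<one>\<^bsub>R\<^esub>) \<odot>\<^bsub>B\<^esub> x, (\<ominus>\<^bsub>R\<^esub> \<one>\<^bsub>R\<^esub>) \<odot>\<^bsub>E\<^esub> e) \<in> G" using D by auto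
    then show ?thesis by (auto simp: B.smult_l_minus)
  qed
  show ?thesis
  proof (rule B.submoduleI)
    show "a \<oplus>\<^bsub>B\<^esub> b \<in> Domain G" if "a \<in> Domain G" "b \<in> Domain G" for a b
      using that D by (meson Domain.simps)
    show "a \<odot>\<^bsub>B\<^esub> b \<in> Domain G" if "a \<in> carrier R" "b \<in> Domain G" for a b
      using that D by (meson Domain.simps)
  qed (use D neg in auto)
qed

lemma linear_graph_chain:
  assumes "C \<noteq> {}" and C: "\<And>G. G \<in> C \<Longrightarrow> linear_graph R B E G"
    and ch: "\<And>G H. G \<in> C \<Longrightarrow> H \<in> C \<Longrightarrow> G \<subseteq> H \<or> H \<subseteq> G"
  shows "linear_graph R B E (\<Union>C)"
proof -
  have two: "\<exists>K\<in>C. p \<in> K \<and> q \<in> K" if pq: "p \<in> \<Union>C" "q \<in> \<Union>C" for p q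
  proof -
    from pq obtain X Y where X: "X \<in> C" "p \<in> X" and Y: "Y \<in> C" "q \<in> Y" by blast
    then show ?thesis using ch[OF X(1) Y(1)] by blast
  qed
  note D = C[unfolded linear_graph_def]
  show ?thesis unfolding linear_graph_def
  proof (intro conjI allI impI ballI)
    show "\<Union>C \<subseteq> carrier B \<times> carrier E" using D by blast
    show "(\<zero>\<^bsub>B\<^esub>, \<zero>\<^bsub>E\<^esub>) \<in> \<Union>C" using D assms(1) by blast
    fix x e y e' assume "(x, e) \<in> \<Union>C" "(y, e') \<in> \<Union>C"
    from two[OF this] obtain K where K: "K \<in> C" "(x, e) \<in> K" "(y, e') \<in> K" by blast
    then have "(x \<oplus>\<^bsub>B\<^esub> y, e \<oplus>\<^bsub>E\<^esub> e') \<in> K" using D[OF K(1)] by blast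
    with K(1) show "(x \<oplus>\<^bsub>B\<^esub> y, e \<oplus>\<^bsub>E\<^esub> e') \<in> \<Union>C" by blast
  next
    fix a x e assume "a \<in> carrier R" "(x, e) \<in> \<Union>C"
    then obtain K where K: "K \<in> C" "(x, e) \<in> K" by blast
    then have "(a \<odot>\<^bsub>B\<^esub> x, a \<odot>\<^bsub>E\<^esub> e) \<in> K" using D[OF K(1)] \<open>a \<in> carrier R\<close> by blast
    with K(1) show "(a \<odot>\<^bsub>B\<^esub> x, a \<odot>\<^bsub>E\<^esub> e) \<in> \<Union>C" by blast
  next
    fix e assume "(\<zero>\<^bsub>B\<^esub>, e) \<in> \<Union>C"
    then obtain K where K: "K \<in> C" "(\<zero>\<^bsub>B\<^esub>, e) \<in> K" by blast
    then show "e = \<zero>\<^bsub>E\<^esub>" using D[OF K(1)] by blast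
  qed
qed

text \<open>The inductive step of Baer's criterion: a partial linear map with values in \<open>E\<close> extends to
  one more element \<open>b\<close>, because Baer's condition supplies a value for \<open>b\<close> that is compatible with
  all multiples of \<open>b\<close> on which the map is defined already.\<close>

lemma linear_graph_extend:
  fixes B :: "('a, 'b) module" and E :: "('a, 'e) module"
  assumes G: "linear_graph R B E G" and B: "module R B" and E: "baer R E" and b: "b \<in> carrier B"
  obtains G' where "linear_graph R B E G'" "G \<subseteq> G'" "b \<in> Domain G'"
proof -
  interpret B: module R B by fact
  interpret E: module R E using E by (simp add: baer_def)
  note D = G[unfolded linear_graph_def]
  note fn = linear_graph_fun[OF G B E.module_axioms]
  interpret m: lin R "self_module R" B "\<lambda>r. r \<odot>\<^bsub>B\<^esub> b"
    using b by (intro linI self_module_module linear_mapI B)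
      (auto simp: B.smult_l_distr B.smult_assoc1 B.R.cring_axioms)
  define I where "I = {r \<in> carrier R. r \<odot>\<^bsub>B\<^esub> b \<in> Domain G}"
  have I: "submodule I R (self_module R)"
    using m.preimage_submodule[OF linear_graph_domain[OF G B]] by (simp add: I_def)
  define f where "f r = (THE e. (r \<odot>\<^bsub>B\<^esub> b, e) \<in> G)" for r
  have fI: "(r \<odot>\<^bsub>B\<^esub> b, f r) \<in> G" if r: "r \<in> I" for r
    unfolding f_def
  proof (rule theI')
    show "\<exists>!e. (r \<odot>\<^bsub>B\<^esub> b, e) \<in> G" using r fn unfolding I_def by blast
  qed
  have "linear_map R ((self_module R)\<lparr>carrier := I\<rparr>) E f"
  proof (rule linear_mapI)
    fix x y assume "x \<in> carrier ((self_module R)\<lparr>carrier := I\<rparr>)" "y \<in> carrier ((self_module R)\<lparr>carrier := I\<rparr>)"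
    then have x: "x \<in> I" "y \<in> I" by auto
    show "f x \<in> carrier E" using fI[OF x(1)] D by auto
    have "x \<oplus>\<^bsub>R\<^esub> y \<in> I" using m.M.submoduleE(5)[OF I x] by simp
    moreover have "((x \<oplus>\<^bsub>R\<^esub> y) \<odot>\<^bsub>B\<^esub> b, f x \<oplus>\<^bsub>E\<^esub> f y) \<in> G"
      using fI[OF x(1)] fI[OF x(2)] D x b by (auto simp: I_def B.smult_l_distr)
    ultimately show "f (x \<oplus>\<^bsub>(self_module R)\<lparr>carrier := I\<rparr>\<^esub> y) = f x \<oplus>\<^bsub>E\<^esub> f y"
      using fn fI by simp blast
  next
    fix a x assume a: "a \<in> carrier R" and "x \<in> carrier ((self_module R)\<lparr>carrier := I\<rparr>)"
    then have x: "x \<in> I" by auto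
    have "a \<otimes>\<^bsub>R\<^esub> x \<in> I" using m.M.submoduleE(4)[OF I a x] by simp
    moreover have "((a \<otimes>\<^bsub>R\<^esub> x) \<odot>\<^bsub>B\<^esub> b, a \<odot>\<^bsub>E\<^esub> f x) \<in> G"
      using fI[OF x] D x b a by (auto simp: I_def B.smult_assoc1)
    ultimately show "f (a \<odot>\<^bsub>(self_module R)\<lparr>carrier := I\<rparr>\<^esub> x) = a \<odot>\<^bsub>E\<^esub> f x"
      using fn fI by simp blast
  qed
  with I E obtain e where e: "e \<in> carrier E" "\<And>r. r \<in> I \<Longrightarrow> f r = r \<odot>\<^bsub>E\<^esub> e"
    unfolding baer_def by blast
  define G' where "G' = {(x \<oplus>\<^bsub>B\<^esub> r \<odot>\<^bsub>B\<^esub> b, y \<oplus>\<^bsub>E\<^esub> r \<odot>\<^bsub>E\<^esub> e) | x y r. (x, y) \<in> G \<and> r \<in> carrier R}"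
  have GI: "(x \<oplus>\<^bsub>B\<^esub> r \<odot>\<^bsub>B\<^esub> b, y \<oplus>\<^bsub>E\<^esub> r \<odot>\<^bsub>E\<^esub> e) \<in> G'" if "(x, y) \<in> G" "r \<in> carrier R" for x y r
    using that unfolding G'_def by blast
  have car: "x \<in> carrier B" "y \<in> carrier E" if "(x, y) \<in> G" for x y using that D by auto
  show ?thesis
  proof (rule that)
    show "G \<subseteq> G'"
    proof clarify
      fix x y assume "(x, y) \<in> G"
      then show "(x, y) \<in> G'" using GI[of x y "\<zero>\<^bsub>R\<^esub>"] car b e(1) by simp
    qed
    then have z: "(\<zero>\<^bsub>B\<^esub>, \<zero>\<^bsub>E\<^esub>) \<in> G'" using D by blast
    have "(\<zero>\<^bsub>B\<^esub> \<oplus>\<^bsub>B\<^esub> \<one>\<^bsub>R\<^esub> \<odot>\<^bsub>B\<^esub> b, \<zero>\<^bsub>E\<^esub> \<oplus>\<^bsub>E\<^esub> \<one>\<^bsub>R\<^esub> \<odot>\<^bsub>E\<^esub> e) \<in> G'" using D by (intro GI) auto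
    then show "b \<in> Domain G'" using b by auto
    show "linear_graph R B E G'" unfolding linear_graph_def
    proof (intro conjI allI impI ballI)
      show "G' \<subseteq> carrier B \<times> carrier E" using car b e(1) unfolding G'_def by auto
      show "(\<zero>\<^bsub>B\<^esub>, \<zero>\<^bsub>E\<^esub>) \<in> G'" by (rule z)
    next
      fix x u y v assume "(x, u) \<in> G'" "(y, v) \<in> G'"
      then obtain x1 u1 r y1 v1 s where *: "x = x1 \<oplus>\<^bsub>B\<^esub> r \<odot>\<^bsub>B\<^esub> b" "u = u1 \<oplus>\<^bsub>E\<^esub> r \<odot>\<^bsub>E\<^esub> e"
        "y = y1 \<oplus>\<^bsub>B\<^esub> s \<odot>\<^bsub>B\<^esub> b" "v = v1 \<oplus>\<^bsub>E\<^esub> s \<odot>\<^bsub>E\<^esub> e" "(x1, u1) \<in> G" "(y1, v1) \<in> G"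
        "r \<in> carrier R" "s \<in> carrier R"
        unfolding G'_def by blast
      have "(x1 \<oplus>\<^bsub>B\<^esub> y1, u1 \<oplus>\<^bsub>E\<^esub> v1) \<in> G" using * D by blast
      from GI[OF this, of "r \<oplus>\<^bsub>R\<^esub> s"] show "(x \<oplus>\<^bsub>B\<^esub> y, u \<oplus>\<^bsub>E\<^esub> v) \<in> G'"
        using * car b e(1) by (simp add: B.smult_l_distr E.smult_l_distr B.M.a_ac E.M.a_ac)
    next
      fix a x u assume a: "a \<in> carrier R" and "(x, u) \<in> G'"
      then obtain x1 u1 r where *: "x = x1 \<oplus>\<^bsub>B\<^esub> r \<odot>\<^bsub>B\<^esub> b" "u = u1 \<oplus>\<^bsub>E\<^esub> r \<odot>\<^bsub>E\<^esub> e" "(x1, u1) \<in> G" 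
        "r \<in> carrier R"
        unfolding G'_def by blast
      have "(a \<odot>\<^bsub>B\<^esub> x1, a \<odot>\<^bsub>E\<^esub> u1) \<in> G" using * D a by blast
      from GI[OF this, of "a \<otimes>\<^bsub>R\<^esub> r"] show "(a \<odot>\<^bsub>B\<^esub> x, a \<odot>\<^bsub>E\<^esub> u) \<in> G'"
        using * car b e(1) a by (simp add: B.smult_r_distr E.smult_r_distr B.smult_assoc1 E.smult_assoc1)
    next
      fix u assume "(\<zero>\<^bsub>B\<^esub>, u) \<in> G'"
      then obtain x1 u1 r where *: "\<zero>\<^bsub>B\<^esub> = x1 \<oplus>\<^bsub>B\<^esub> r \<odot>\<^bsub>B\<^esub> b" "u = u1 \<oplus>\<^bsub>E\<^esub> r \<odot>\<^bsub>E\<^esub> e" "(x1, u1) \<in> G" 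
        "r \<in> carrier R"
        unfolding G'_def by blast
      have "r \<odot>\<^bsub>B\<^esub> b = \<ominus>\<^bsub>B\<^esub> x1"
        using * car b by (metis B.M.a_comm B.M.minus_equality B.smult_closed)
      moreover have "\<ominus>\<^bsub>B\<^esub> x1 \<in> Domain G"
        using B.submoduleE(3)[OF linear_graph_domain[OF G B]] *(3) by blast
      ultimately have r: "r \<in> I" using *(4) by (simp add: I_def)
      have "(r \<odot>\<^bsub>B\<^esub> b, r \<odot>\<^bsub>E\<^esub> e) \<in> G" using fI[OF r] e(2)[OF r] by simp
      then have "(\<zero>\<^bsub>B\<^esub>, u) \<in> G" using *(1-3) D by metis
      then show "u = \<zero>\<^bsub>E\<^esub>" using D by blast
    qed
  qed
qed

text \<open>Baer's criterion: a maximal extension of the given map exists by Zorn's lemma, and it is defined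
  everywhere because it could be extended to one more element otherwise.\<close>

theorem baer_extension:
  fixes B :: "('a, 'b) module" and E :: "('a, 'e) module"
  assumes E: "baer R E" and B: "module R B" and A: "submodule A R B"
    and f: "linear_map R (B\<lparr>carrier := A\<rparr>) E f"
  obtains g where "linear_map R B E g" "\<And>x. x \<in> A \<Longrightarrow> g x = f x"
proof -
  interpret B: module R B by fact
  have mE: "module R E" using E by (simp add: baer_def)
  interpret E: module R E by fact
  interpret f: lin R "B\<lparr>carrier := A\<rparr>" E f
    by (intro linI submodule.submodule_is_module[OF A] B mE f)
  let ?g = "(\<lambda>x. (x, f x)) ` A"
  let ?S = "{G. linear_graph R B E G \<and> ?g \<subseteq> G}"
  have "linear_graph R B E ?g" unfolding linear_graph_def
  proof (intro conjI allI impI ballI)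
    show "?g \<subseteq> carrier B \<times> carrier E" using B.submoduleE(1)[OF A] f.closed by auto
    show "(\<zero>\<^bsub>B\<^esub>, \<zero>\<^bsub>E\<^esub>) \<in> ?g" using B.submodule_zero[OF A] f.zero by force
    show "(x \<oplus>\<^bsub>B\<^esub> y, e \<oplus>\<^bsub>E\<^esub> e') \<in> ?g" if "(x, e) \<in> ?g" "(y, e') \<in> ?g" for x y e e'
      using that f.add B.submoduleE(5)[OF A] by force
    show "(a \<odot>\<^bsub>B\<^esub> x, a \<odot>\<^bsub>E\<^esub> e) \<in> ?g" if "a \<in> carrier R" "(x, e) \<in> ?g" for a x e
      using that f.smult B.submoduleE(4)[OF A] by force
    show "e = \<zero>\<^bsub>E\<^esub>" if "(\<zero>\<^bsub>B\<^esub>, e) \<in> ?g" for e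
      using that f.zero by auto
  qed
  then have ne: "?S \<noteq> {}" by blast
  have "\<exists>G\<in>?S. \<forall>X\<in>?S. G \<subseteq> X \<longrightarrow> X = G"
  proof (rule subset_Zorn_nonempty[OF ne])
    fix C assume C: "C \<noteq> {}" "subset.chain ?S C"
    then have "linear_graph R B E (\<Union>C)"
      by (intro linear_graph_chain) (auto simp: subset_chain_def)
    moreover have "?g \<subseteq> \<Union>C"
    proof -
      obtain X where X: "X \<in> C" using C(1) by (meson ex_in_conv)
      have "C \<subseteq> ?S" using C(2) by (simp only: subset_chain_def)
      from subsetD[OF this X] have "?g \<subseteq> X" by simp
      then show ?thesis using Union_upper[OF X] by (rule subset_trans)
    qed
    ultimately show "\<Union>C \<in> ?S" by simp
  qed
  then obtain G where GS: "G \<in> ?S" "\<forall>X\<in>?S. G \<subseteq> X \<longrightarrow> X = G" ..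
  then have G: "linear_graph R B E G" "?g \<subseteq> G" by simp_all
  have max: "X = G" if X: "linear_graph R B E X" "G \<subseteq> X" for X
  proof -
    have "?g \<subseteq> X" using G(2) X(2) by (rule subset_trans)
    with X GS(2) show ?thesis by simp
  qed
  have dom: "\<exists>e. (x, e) \<in> G" if x: "x \<in> carrier B" for x
  proof -
    obtain G' where "linear_graph R B E G'" "G \<subseteq> G'" "x \<in> Domain G'"
      using linear_graph_extend[OF G(1) B E x] .
    with max[of G'] show ?thesis by blast
  qed
  note fn = linear_graph_fun[OF G(1) B mE]
  note D = G(1)[unfolded linear_graph_def]
  define g where "g x = (THE e. (x, e) \<in> G)" for x
  have gx: "(x, g x) \<in> G" if x: "x \<in> carrier B" for x
    unfolding g_def
  proof (rule theI')
    show "\<exists>!e. (x, e) \<in> G" using dom[OF x] fn by blast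
  qed
  show ?thesis
  proof (rule that)
    show "linear_map R B E g"
    proof (rule linear_mapI)
      fix x y assume x: "x \<in> carrier B" and y: "y \<in> carrier B"
      show "g x \<in> carrier E" using gx[OF x] D by blast
      have "(x \<oplus>\<^bsub>B\<^esub> y, g x \<oplus>\<^bsub>E\<^esub> g y) \<in> G" using gx[OF x] gx[OF y] D by blast
      then show "g (x \<oplus>\<^bsub>B\<^esub> y) = g x \<oplus>\<^bsub>E\<^esub> g y" by (rule fn[OF gx[OF B.M.a_closed[OF x y]]])
    next
      fix a x assume a: "a \<in> carrier R" and x: "x \<in> carrier B"
      have "(a \<odot>\<^bsub>B\<^esub> x, a \<odot>\<^bsub>E\<^esub> g x) \<in> G" using gx[OF x] a D by blast
      then show "g (a \<odot>\<^bsub>B\<^esub> x) = a \<odot>\<^bsub>E\<^esub> g x" by (rule fn[OF gx[OF B.smult_closed[OF a x]]])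
    qed
    show "g x = f x" if x: "x \<in> A" for x
    proof -
      have "(x, f x) \<in> G" using G(2) x by (rule subsetD[OF _ imageI])
      moreover have "x \<in> carrier B" using B.submoduleE(1)[OF A] x by (rule subsetD)
      ultimately show ?thesis using fn[OF gx] by metis
    qed
  qed
qed

text \<open>The test type in the definition of injectivity has room for a copy of \<open>R\<close>, so injectivity
  includes Baer's condition.\<close>

theorem injective_module_iff_baer:
  fixes R :: "('a, 'r) ring_scheme" and E :: "('a, 'e) module"
  assumes R: "cring R"
  shows "injective_module R E \<longleftrightarrow> baer R E"
proof
  assume "baer R E"
  then show "injective_module R E"
    unfolding injective_module_def by (metis baer_def baer_extension)
next
  assume E: "injective_module R E"
  interpret R: cring R by fact
  interpret E: module R E using E by (simp add: injective_module_def)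
  interpret S: module R "self_module R" by (rule self_module_module[OF R])
  define B :: "('a, 'a + 'e) module" where "B = \<lparr>carrier = Inl ` carrier R, mult = undefined,
    one = undefined, zero = Inl \<zero>\<^bsub>R\<^esub>, add = \<lambda>x y. Inl (projl x \<oplus>\<^bsub>R\<^esub> projl y),
    smult = \<lambda>a x. Inl (a \<otimes>\<^bsub>R\<^esub> projl x)\<rparr>"
  have B: "module R B"
    by (rule module_surj_image[OF S.module_axioms, where p = Inl]) (auto simp: B_def)
  interpret B: module R B by (rule B)
  show "baer R E" unfolding baer_def
  proof (intro conjI allI impI, rule E.module_axioms, elim conjE)
    fix I f assume I: "submodule I R (self_module R)"
      and f: "linear_map R ((self_module R)\<lparr>carrier := I\<rparr>) E f"
    note IE = S.submoduleE[OF I] S.submodule_zero[OF I]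
    have "submodule (Inl ` I) R B"
    proof (rule B.submoduleI)
      fix x :: "'a + 'e" assume "x \<in> Inl ` I"
      then obtain i where i: "i \<in> I" "x = Inl i" by auto
      have "\<ominus>\<^bsub>B\<^esub> x = Inl (\<ominus>\<^bsub>R\<^esub> i)"
        using i IE(1) by (intro B.M.minus_equality) (auto simp: B_def R.l_neg)
      moreover have "\<ominus>\<^bsub>R\<^esub> i \<in> I" using IE(4)[of "\<ominus>\<^bsub>R\<^esub> \<one>\<^bsub>R\<^esub>" i] i IE(1) by (auto simp: R.l_minus)
      ultimately show "\<ominus>\<^bsub>B\<^esub> x \<in> Inl ` I" by simp
    qed (use IE in \<open>auto simp: B_def\<close>)
    moreover have "linear_map R (B\<lparr>carrier := Inl ` I\<rparr>) E (\<lambda>x. f (projl x))"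
      using f by (auto simp: linear_map_def B_def)
    ultimately obtain g where g: "linear_map R B E g" "\<And>x. x \<in> Inl ` I \<Longrightarrow> g x = f (projl x)"
      using conjunct2[OF E[unfolded injective_module_def], THEN spec, of B, THEN spec, of "Inl ` I",
          THEN spec, of "\<lambda>x. f (projl x)"] B by blast
    have 1: "Inl \<one>\<^bsub>R\<^esub> \<in> carrier B" by (simp add: B_def)
    show "\<exists>e\<in>carrier E. \<forall>a\<in>I. f a = a \<odot>\<^bsub>E\<^esub> e"
    proof (intro bexI ballI)
      show "g (Inl \<one>\<^bsub>R\<^esub>) \<in> carrier E" by (rule linear_map_closed[OF g(1) 1])
      fix a assume a: "a \<in> I"
      then have aR: "a \<in> carrier R" using IE(1) by auto
      have "a \<odot>\<^bsub>E\<^esub> g (Inl \<one>\<^bsub>R\<^esub>) = g (a \<odot>\<^bsub>B\<^esub> Inl \<one>\<^bsub>R\<^esub>)"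
        using linear_map_smult[OF g(1) aR 1] by simp
      also have "a \<odot>\<^bsub>B\<^esub> Inl \<one>\<^bsub>R\<^esub> = Inl a" using aR by (simp add: B_def)
      finally show "f a = a \<odot>\<^bsub>E\<^esub> g (Inl \<one>\<^bsub>R\<^esub>)" using g(2)[of "Inl a"] a by simp
    qed
  qed
qed

subsection \<open>Products and direct sums of injectives\<close>

lemma baer_direct_product:
  assumes R: "cring R" and E: "\<And>i. i \<in> S \<Longrightarrow> baer R (E i)"
  shows "baer R (direct_product S E)"
  unfolding baer_def
proof (intro conjI allI impI)
  show "module R (direct_product S E)"
    using E by (intro direct_product_module R) (auto simp: baer_def)
  fix I f assume *: "submodule I R (self_module R) \<and>
    linear_map R ((self_module R)\<lparr>carrier := I\<rparr>) (direct_product S E) f"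
  have "\<exists>e\<in>carrier (E i). \<forall>a\<in>I. f a i = a \<odot>\<^bsub>E i\<^esub> e" if i: "i \<in> S" for i
  proof -
    have "linear_map R ((self_module R)\<lparr>carrier := I\<rparr>) (E i) (\<lambda>a. f a i)"
      using * i by (auto simp: linear_map_def direct_product_simps)
    then show ?thesis using * E[OF i] unfolding baer_def by blast
  qed
  then obtain e where e: "\<And>i. i \<in> S \<Longrightarrow> e i \<in> carrier (E i)"
    "\<And>i a. i \<in> S \<Longrightarrow> a \<in> I \<Longrightarrow> f a i = a \<odot>\<^bsub>E i\<^esub> e i" by metis
  show "\<exists>e\<in>carrier (direct_product S E). \<forall>a\<in>I. f a = a \<odot>\<^bsub>direct_product S E\<^esub> e"
  proof (intro bexI ballI)
    show "(\<lambda>i\<in>S. e i) \<in> carrier (direct_product S E)" using e by (auto simp: direct_product_simps)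
    fix a assume a: "a \<in> I"
    then have "f a \<in> (\<Pi>\<^sub>E i\<in>S. carrier (E i))"
      using * by (auto simp: linear_map_def direct_product_simps)
    then show "f a = a \<odot>\<^bsub>direct_product S E\<^esub> (\<lambda>i\<in>S. e i)"
      using e a by (auto simp: direct_product_simps fun_eq_iff PiE_iff extensional_def)
  qed
qed

lemma submodule_self_iff_ideal:
  assumes "cring R"
  shows "submodule I R (self_module R) \<longleftrightarrow> ideal I R"
proof
  interpret R: cring R by fact
  interpret S: module R "self_module R" by (rule self_module_module[OF assms])
  assume I: "submodule I R (self_module R)"
  note IE = S.submoduleE[OF I]
  have neg: "\<ominus>\<^bsub>R\<^esub> a \<in> I" if "a \<in> I" for a
    using IE(4)[of "\<ominus>\<^bsub>R\<^esub> \<one>\<^bsub>R\<^esub>" a] that IE(1) by (auto simp: R.l_minus subset_iff)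
  have "subgroup I (add_monoid R)"
    using IE(1,2,5) neg by (intro R.add.subgroupI) auto
  then show "ideal I R"
  proof (rule idealI[OF R.ring_axioms])
    fix a x assume a: "a \<in> I" and x: "x \<in> carrier R"
    show "x \<otimes>\<^bsub>R\<^esub> a \<in> I" using IE(4)[OF x a] by simp
    then show "a \<otimes>\<^bsub>R\<^esub> x \<in> I" using IE(1) a x by (simp add: R.m_comm subset_iff)
  qed
next
  interpret R: cring R by fact
  interpret S: module R "self_module R" by (rule self_module_module[OF assms])
  assume "ideal I R"
  then interpret ideal I R .
  show "submodule I R (self_module R)"
    using a_subset I_l_closed
      a_inv_closed[unfolded a_inv_def m_inv_def]
    by (intro S.submoduleI) (auto simp: a_inv_def m_inv_def)
qed

text \<open>Over a noetherian ring a map from an ideal to a direct sum meets only finitely many summands,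
  since the ideal is finitely generated; so Baer's condition holds summand by summand.\<close>

theorem baer_direct_sum:
  fixes E :: "'i \<Rightarrow> ('a, 'e) module"
  assumes R: "cring R" and N: "noetherian_ring R" and E: "\<And>i. i \<in> S \<Longrightarrow> baer R (E i)"
  shows "baer R (direct_sum S E)"
  unfolding baer_def
proof (intro conjI allI impI)
  interpret R: cring R by fact
  have mE: "module R (E i)" if "i \<in> S" for i using E[OF that] by (auto simp: baer_def)
  show DS: "module R (direct_sum S E)"
    using mE by (intro direct_sum_module R) 
  fix I f assume *: "submodule I R (self_module R) \<and>
    linear_map R ((self_module R)\<lparr>carrier := I\<rparr>) (direct_sum S E) f"
  have I: "ideal I R" using * submodule_self_iff_ideal[OF R] by blast
  then obtain A where A: "A \<subseteq> carrier R" "finite A" "I = Idl\<^bsub>R\<^esub> A"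
    using noetherian_ring.finetely_gen[OF N] by blast
  interpret I: ideal I R by (rule I)
  interpret f: lin R "(self_module R)\<lparr>carrier := I\<rparr>" "direct_sum S E" f
    using * by (intro linI submodule.submodule_is_module[of I] self_module_module R DS) auto
  have fc: "f a \<in> carrier (direct_sum S E)" if "a \<in> I" for a
    using f.closed[of a] that by simp
  define T where "T = (\<Union>a\<in>A. {i \<in> S. f a i \<noteq> \<zero>\<^bsub>E i\<^esub>})"
  have AI: "A \<subseteq> I" using A R.genideal_self by blast
  have T: "finite T" "T \<subseteq> S" using A(2) fc AI by (auto simp: T_def direct_sum_simps)
  let ?K = "{a \<in> I. \<forall>i\<in>S - T. f a i = \<zero>\<^bsub>E i\<^esub>}"
  have "ideal ?K R"
  proof -
    have z: "\<zero>\<^bsub>E i\<^esub> \<oplus>\<^bsub>E i\<^esub> \<zero>\<^bsub>E i\<^esub> = \<zero>\<^bsub>E i\<^esub>" if "i \<in> S" for i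
      using mE[OF that] by (simp add: module_def abelian_groupE)
    have sm: "x \<otimes>\<^bsub>R\<^esub> a \<in> ?K" if "a \<in> ?K" "x \<in> carrier R" for a x
    proof -
      have "f (x \<otimes>\<^bsub>R\<^esub> a) = x \<odot>\<^bsub>direct_sum S E\<^esub> f a" using f.smult[of x a] that by simp
      then show ?thesis
        using that module.smult_r_null[OF mE] I.I_l_closed by (auto simp: direct_sum_simps)
    qed
    have ad: "a \<oplus>\<^bsub>R\<^esub> b \<in> ?K" if "a \<in> ?K" "b \<in> ?K" for a b
    proof -
      have "f (a \<oplus>\<^bsub>R\<^esub> b) = f a \<oplus>\<^bsub>direct_sum S E\<^esub> f b" using f.add[of a b] that by simp
      then show ?thesis using that z by (auto simp: direct_sum_simps)
    qed
    have ne: "\<zero>\<^bsub>R\<^esub> \<in> ?K" using f.zero by (auto simp: direct_sum_simps)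
    have neg: "\<ominus>\<^bsub>R\<^esub> a \<in> ?K" if "a \<in> ?K" for a
    proof -
      have "a \<in> carrier R" using that I.a_subset by auto
      then have "\<ominus>\<^bsub>R\<^esub> a = (\<ominus>\<^bsub>R\<^esub> \<one>\<^bsub>R\<^esub>) \<otimes>\<^bsub>R\<^esub> a" by (simp add: R.l_minus)
      with sm[OF that, of "\<ominus>\<^bsub>R\<^esub> \<one>\<^bsub>R\<^esub>"] show ?thesis by simp
    qed
    show ?thesis
    proof (rule idealI[OF R.ring_axioms])
      show "subgroup ?K (add_monoid R)"
      proof (rule R.add.subgroupI)
        show "?K \<subseteq> carrier R" using I.a_subset by auto
        show "?K \<noteq> {}" using ne by blast
      qed (use ad neg in blast)+
      show "a \<otimes>\<^bsub>R\<^esub> x \<in> ?K" if "a \<in> ?K" "x \<in> carrier R" for a x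
        using sm[OF that] that I.a_subset by (auto simp: R.m_comm)
    qed (rule sm)
  qed
  moreover have "A \<subseteq> ?K" using AI by (auto simp: T_def)
  ultimately have IK: "I \<subseteq> ?K" unfolding A(3) by (rule R.genideal_minimal)
  have "\<exists>e\<in>carrier (E i). \<forall>a\<in>I. f a i = a \<odot>\<^bsub>E i\<^esub> e" if i: "i \<in> S" for i
  proof -
    have "linear_map R ((self_module R)\<lparr>carrier := I\<rparr>) (E i) (\<lambda>a. f a i)"
      using * i by (auto simp: linear_map_def direct_sum_simps)
    then show ?thesis using * E[OF i] unfolding baer_def by blast
  qed
  then obtain e where e: "\<And>i. i \<in> S \<Longrightarrow> e i \<in> carrier (E i)"
    "\<And>i a. i \<in> S \<Longrightarrow> a \<in> I \<Longrightarrow> f a i = a \<odot>\<^bsub>E i\<^esub> e i" by metis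
  have z: "\<zero>\<^bsub>E i\<^esub> \<in> carrier (E i)" if "i \<in> S" for i
      using mE[OF that] by (simp add: module_def abelian_groupE)
  let ?e = "\<lambda>i\<in>S. if i \<in> T then e i else \<zero>\<^bsub>E i\<^esub>"
  show "\<exists>e\<in>carrier (direct_sum S E). \<forall>a\<in>I. f a = a \<odot>\<^bsub>direct_sum S E\<^esub> e"
  proof (intro bexI ballI)
    show "?e \<in> carrier (direct_sum S E)"
      using e z by (intro direct_sumI[OF _ T(1)]) (auto simp: direct_product_simps)
    fix a assume a: "a \<in> I"
    then have fa: "f a \<in> (\<Pi>\<^sub>E i\<in>S. carrier (E i))" using fc by (auto simp: direct_sum_simps)
    show "f a = a \<odot>\<^bsub>direct_sum S E\<^esub> ?e"
    proof (rule extensionalityI[where A = S])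
      show "f a \<in> extensional S" using fa by (auto simp: PiE_iff)
      show "a \<odot>\<^bsub>direct_sum S E\<^esub> ?e \<in> extensional S" by (auto simp: direct_sum_simps)
      show "f a i = (a \<odot>\<^bsub>direct_sum S E\<^esub> ?e) i" if "i \<in> S" for i
        using e that a IK I.a_subset module.smult_r_null[OF mE[OF that]]
        by (auto simp: direct_sum_simps)
    qed
  qed
qed


section \<open>Existence of injective envelopes\<close>

subsection \<open>The group of rationals modulo one\<close>

text \<open>The group \<open>\<rat>/\<int>\<close>, with the representatives in the interval \<open>[0, 1)\<close> as its elements.\<close>

definition rat_mod_one :: "(int, rat) module" where
  "rat_mod_one = \<lparr>carrier = {0..<1}, mult = undefined, one = undefined, zero = 0,
     add = \<lambda>x y. Archimedean_Field.frac (x + y),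
     smult = \<lambda>k x. Archimedean_Field.frac (of_int k * x)\<rparr>"

lemma frac_eqI: "x - y \<in> \<int> \<Longrightarrow> Archimedean_Field.frac x = Archimedean_Field.frac (y :: rat)"
proof -
  assume "x - y \<in> \<int>"
  then have "(x - y) + (y - Archimedean_Field.frac y) \<in> \<int>"
    by (intro Ints_add) (auto simp: Archimedean_Field.frac_def)
  then show ?thesis by (subst frac_unique_iff) (auto simp: frac_lt_1)
qed

lemma frac_diff_Ints: "Archimedean_Field.frac x - (x :: rat) \<in> \<int>"
  by (simp add: Archimedean_Field.frac_def)

lemma rat_mod_one_module: "module \<Z> rat_mod_one"
proof -
  define Q :: "(int, rat) module" where "Q = \<lparr>carrier = UNIV, mult = undefined, one = undefined,
     zero = 0, add = (+), smult = \<lambda>k x. of_int k * x\<rparr>"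
  have "module \<Z> Q"
    by (rule moduleI[OF int_is_cring], rule abelian_groupI)
      (auto simp: Q_def algebra_simps intro: exI[where x = "- x" for x])
  then show ?thesis
  proof (rule module_surj_image[where p = Archimedean_Field.frac])
    show "Archimedean_Field.frac ` carrier Q = carrier rat_mod_one"
    proof
      show "carrier rat_mod_one \<subseteq> Archimedean_Field.frac ` carrier Q"
      proof
        fix x assume "x \<in> carrier rat_mod_one"
        then have "x = Archimedean_Field.frac x" by (simp add: rat_mod_one_def frac_eq)
        then show "x \<in> Archimedean_Field.frac ` carrier Q" by (simp add: Q_def)
      qed
    qed (auto simp: rat_mod_one_def frac_lt_1)
    show "Archimedean_Field.frac (x \<oplus>\<^bsub>Q\<^esub> y) =
      Archimedean_Field.frac x \<oplus>\<^bsub>rat_mod_one\<^esub> Archimedean_Field.frac y" for x y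
    proof -
      have "x + y - (Archimedean_Field.frac x + Archimedean_Field.frac y) =
        - ((Archimedean_Field.frac x - x) + (Archimedean_Field.frac y - y))" by simp
      also have "\<dots> \<in> \<int>" by (intro Ints_minus Ints_add frac_diff_Ints)
      finally show ?thesis by (auto simp: Q_def rat_mod_one_def intro!: frac_eqI)
    qed
    show "Archimedean_Field.frac (k \<odot>\<^bsub>Q\<^esub> x) = k \<odot>\<^bsub>rat_mod_one\<^esub> Archimedean_Field.frac x" for k x
    proof -
      have "of_int k * x - of_int k * Archimedean_Field.frac x =
        - (of_int k * (Archimedean_Field.frac x - x))" by (simp add: algebra_simps)
      also have "\<dots> \<in> \<int>" by (intro Ints_minus Ints_mult frac_diff_Ints) auto
      finally show ?thesis by (auto simp: Q_def rat_mod_one_def intro!: frac_eqI)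
    qed
  qed (auto simp: Q_def rat_mod_one_def)
qed

lemma int_submodule_principal:
  assumes "submodule I \<Z> (self_module \<Z>)"
  obtains d :: int where "d \<ge> 0" "I = {k. d dvd k}"
proof -
  interpret S: module \<Z> "self_module \<Z>" by (rule self_module_module[OF int_is_cring])
  note IE = S.submoduleE(4,5)[OF assms] S.submodule_zero[OF assms]
  have sm: "a * x \<in> I" if "x \<in> I" for a x using IE(1)[of a x] that by simp
  have ad: "x + y \<in> I" if "x \<in> I" "y \<in> I" for x y using IE(2)[of x y] that by simp
  have z: "0 \<in> I" using IE(3) by simp
  show ?thesis
  proof (cases "I = {0}")
    case True
    then show ?thesis using that[of 0] by auto
  next
    case False
    then obtain x where x: "x \<in> I" "x \<noteq> 0" using z by blast
    then have "\<bar>x\<bar> \<in> I" using sm[of x "-1"] by (auto simp: abs_if)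
    then have ex: "\<exists>n::nat. n > 0 \<and> int n \<in> I" using x(2) by (intro exI[where x = "nat \<bar>x\<bar>"]) auto
    define n where "n = (LEAST n::nat. n > 0 \<and> int n \<in> I)"
    have n: "n > 0" "int n \<in> I" using LeastI_ex[OF ex] by (auto simp: n_def)
    have least: "m \<ge> n" if "m > 0" "int m \<in> I" for m using that by (auto simp: n_def intro: Least_le)
    have "int n dvd k" if "k \<in> I" for k
    proof -
      have "k mod int n = k + (- (k div int n)) * int n" by (simp add: minus_div_mult_eq_mod)
      then have kI: "k mod int n \<in> I" using ad[OF that sm[OF n(2)]] by metis
      have "0 \<le> k mod int n" "k mod int n < int n" using n(1) by auto
      have "k mod int n = 0"
      proof (rule ccontr)
        assume "k mod int n \<noteq> 0"
        then have "n \<le> nat (k mod int n)"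
          using least[of "nat (k mod int n)"] kI \<open>0 \<le> k mod int n\<close> by simp
        then show False using \<open>0 \<le> k mod int n\<close> \<open>k mod int n < int n\<close> by linarith
      qed
      then show ?thesis by auto
    qed
    moreover have "k \<in> I" if "int n dvd k" for k
      using that sm[OF n(2)] by (metis dvd_def mult.commute)
    ultimately show ?thesis using that[of "int n"] by auto
  qed
qed

text \<open>A map from the ideal generated by \<open>d\<close> is determined by its value at \<open>d\<close>, and that value can be divided
  by \<open>d\<close>.\<close>

lemma baer_rat_mod_one: "baer \<Z> rat_mod_one"
  unfolding baer_def
proof (intro conjI allI impI, rule rat_mod_one_module, elim conjE)
  fix I f assume I: "submodule I \<Z> (self_module \<Z>)"
    and f: "linear_map \<Z> ((self_module \<Z>)\<lparr>carrier := I\<rparr>) rat_mod_one f"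
  interpret f: lin \<Z> "(self_module \<Z>)\<lparr>carrier := I\<rparr>" rat_mod_one f
    by (intro linI submodule.submodule_is_module[OF I] self_module_module int_is_cring
      rat_mod_one_module f)
  obtain d :: int where d: "d \<ge> 0" "I = {k. d dvd k}" using int_submodule_principal[OF I] .
  show "\<exists>e\<in>carrier rat_mod_one. \<forall>a\<in>I. f a = a \<odot>\<^bsub>rat_mod_one\<^esub> e"
  proof (cases "d = 0")
    case True
    then show ?thesis using d f.zero by (intro bexI[where x = 0]) (auto simp: rat_mod_one_def)
  next
    case False
    have q: "f d \<in> carrier rat_mod_one" using f.closed[of d] d by simp
    have "f d / of_int d \<in> carrier rat_mod_one"
      using q False d(1) by (auto simp: rat_mod_one_def divide_simps)
    moreover have "f a = a \<odot>\<^bsub>rat_mod_one\<^esub> (f d / of_int d)" if "a \<in> I" for a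
    proof -
      obtain k where k: "a = k * d" using \<open>a \<in> I\<close> d by (auto simp: dvd_def mult.commute)
      have "f (k * d) = k \<odot>\<^bsub>rat_mod_one\<^esub> f d" using f.smult[of k d] d by simp
      then show ?thesis using k False by (simp add: rat_mod_one_def)
    qed
    ultimately show ?thesis by blast
  qed
qed

lemma additive_int_linear:
  fixes M :: "(int, 'm) module" and N :: "(int, 'n) module"
  assumes M: "module \<Z> M" and N: "module \<Z> N"
    and cl: "\<And>x. x \<in> carrier M \<Longrightarrow> h x \<in> carrier N"
    and ad: "\<And>x y. x \<in> carrier M \<Longrightarrow> y \<in> carrier M \<Longrightarrow> h (x \<oplus>\<^bsub>M\<^esub> y) = h x \<oplus>\<^bsub>N\<^esub> h y"
  shows "linear_map \<Z> M N h"
proof (rule linear_mapI[OF cl ad])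
  interpret M: module \<Z> M by fact
  interpret N: module \<Z> N by fact
  fix a :: int and x assume x: "x \<in> carrier M"
  have z: "h \<zero>\<^bsub>M\<^esub> = \<zero>\<^bsub>N\<^esub>" using ad[of "\<zero>\<^bsub>M\<^esub>" "\<zero>\<^bsub>M\<^esub>"] cl[of "\<zero>\<^bsub>M\<^esub>"] by simp
  have 1: "(1 :: int) \<odot>\<^bsub>M\<^esub> x = x" "(1 :: int) \<odot>\<^bsub>N\<^esub> h x = h x" 
    using M.smult_one[OF x] N.smult_one[OF cl[OF x]] by simp_all
  have M1: "(i + 1) \<odot>\<^bsub>M\<^esub> x = i \<odot>\<^bsub>M\<^esub> x \<oplus>\<^bsub>M\<^esub> x" for i :: int
    using M.smult_l_distr[of i 1 x] x 1 by simp
  have N1: "(i + 1) \<odot>\<^bsub>N\<^esub> h x = i \<odot>\<^bsub>N\<^esub> h x \<oplus>\<^bsub>N\<^esub> h x" for i :: int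
    using N.smult_l_distr[of i 1 "h x"] cl x 1 by simp
  have c: "i \<odot>\<^bsub>M\<^esub> x \<in> carrier M" "i \<odot>\<^bsub>N\<^esub> h x \<in> carrier N" for i :: int
    using x cl by auto
  show "h (a \<odot>\<^bsub>M\<^esub> x) = a \<odot>\<^bsub>N\<^esub> h x"
  proof (induction a rule: int_induct[where k = 0])
    case base
    show ?case using M.smult_l_null[OF x] N.smult_l_null[OF cl[OF x]] z by simp
  next
    case (step1 i)
    then show ?case using x c by (simp add: M1 N1 ad)
  next
    case (step2 i)
    have "h ((i - 1) \<odot>\<^bsub>M\<^esub> x) \<oplus>\<^bsub>N\<^esub> h x = h (i \<odot>\<^bsub>M\<^esub> x)" using M1[of "i - 1"] x c ad by simp
    also have "\<dots> = (i - 1) \<odot>\<^bsub>N\<^esub> h x \<oplus>\<^bsub>N\<^esub> h x" using N1[of "i - 1"] step2 by simp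
    finally show ?case using c cl x by (simp add: N.M.add.r_cancel)
  qed
qed

subsection \<open>Modules of additive maps into the rationals modulo one\<close>

definition int_embed :: "('a, 'r) ring_scheme \<Rightarrow> int \<Rightarrow> 'a" where
  "int_embed R k = add_pow R k \<one>\<^bsub>R\<^esub>"

lemma int_embed_hom:
  assumes "cring R" shows "int_embed R \<in> ring_hom \<Z> R"
proof -
  interpret cring R by fact
  show ?thesis
  proof (rule ring_hom_memI)
    fix k l :: int
    show "int_embed R k \<in> carrier R" by (simp add: int_embed_def)
    show "int_embed R (k \<oplus>\<^bsub>\<Z>\<^esub> l) = int_embed R k \<oplus>\<^bsub>R\<^esub> int_embed R l"
      by (simp add: int_embed_def add.int_pow_mult)
    have "int_embed R k \<otimes>\<^bsub>R\<^esub> int_embed R l = add_pow R k (int_embed R l)"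
      by (simp add: int_embed_def add_pow_ldistr_int)
    also have "\<dots> = add_pow R (l * k) \<one>\<^bsub>R\<^esub>" by (simp add: int_embed_def add.int_pow_pow)
    finally show "int_embed R (k \<otimes>\<^bsub>\<Z>\<^esub> l) = int_embed R k \<otimes>\<^bsub>R\<^esub> int_embed R l"
      by (simp add: int_embed_def mult.commute)
    show "int_embed R \<one>\<^bsub>\<Z>\<^esub> = \<one>\<^bsub>R\<^esub>" by (simp add: int_embed_def)
  qed
qed

abbreviation as_int_module :: "('a, 'r) ring_scheme \<Rightarrow> ('a, 'm) module \<Rightarrow> (int, 'm) module" where
  "as_int_module R M \<equiv> restrict_scalars (int_embed R) M"

lemma as_int_module_module: "module R M \<Longrightarrow> module \<Z> (as_int_module R M)"
  by (rule restrict_scalars_module[OF int_is_cring _ int_embed_hom]) (auto simp: module_def)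

text \<open>The module \<open>Hom\<^sub>\<int>(R, \<rat>/\<int>)\<close>, on which \<open>R\<close> acts through the argument of a map.\<close>

definition cofree_module :: "('a, 'r) ring_scheme \<Rightarrow> ('a, 'a \<Rightarrow> rat) module" where
  "cofree_module R = (let H = Hom_module \<Z> (as_int_module R (self_module R)) rat_mod_one
     in \<lparr>carrier = carrier H, mult = undefined, one = undefined, zero = zero H, add = add H,
         smult = \<lambda>a h. \<lambda>r\<in>carrier R. h (r \<otimes>\<^bsub>R\<^esub> a)\<rparr>)"

lemma cofree_module_carrier:
  assumes R: "cring R"
  shows "h \<in> carrier (cofree_module R) \<longleftrightarrow> h \<in> extensional (carrier R) \<and>
    (\<forall>x\<in>carrier R. h x \<in> carrier rat_mod_one) \<and>
    (\<forall>x\<in>carrier R. \<forall>y\<in>carrier R. h (x \<oplus>\<^bsub>R\<^esub> y) = h x \<oplus>\<^bsub>rat_mod_one\<^esub> h y)" (is "_ \<longleftrightarrow> ?r")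
proof
  assume "h \<in> carrier (cofree_module R)"
  then show ?r by (auto simp: cofree_module_def Hom_module_simps linear_map_def)
next
  assume ?r
  moreover have "module \<Z> (as_int_module R (self_module R))"
    by (intro as_int_module_module self_module_module R)
  ultimately have "linear_map \<Z> (as_int_module R (self_module R)) rat_mod_one h"
    by (intro additive_int_linear rat_mod_one_module) auto
  then show "h \<in> carrier (cofree_module R)"
    using \<open>?r\<close> by (simp add: cofree_module_def Hom_module_simps)
qed

lemma cofree_module_simps:
  "zero (cofree_module R) = (\<lambda>r\<in>carrier R. \<zero>\<^bsub>rat_mod_one\<^esub>)"
  "add (cofree_module R) g h = (\<lambda>r\<in>carrier R. g r \<oplus>\<^bsub>rat_mod_one\<^esub> h r)"
  "smult (cofree_module R) a h = (\<lambda>r\<in>carrier R. h (r \<otimes>\<^bsub>R\<^esub> a))"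
  by (simp_all add: cofree_module_def Hom_module_simps)

lemma cofree_module_module:
  assumes R: "cring R"
  shows "module R (cofree_module R)"
proof -
  interpret R: cring R by fact
  interpret Q: module \<Z> rat_mod_one by (rule rat_mod_one_module)
  let ?H = "Hom_module \<Z> (as_int_module R (self_module R)) rat_mod_one"
  have H: "module \<Z> ?H"
    by (intro Hom_module_module rat_mod_one_module as_int_module_module
        self_module_module R)
  then have G: "abelian_group ?H" by (simp add: module_def)
  have c: "carrier ?H = carrier (cofree_module R)" by (simp add: cofree_module_def Let_def)
  have a: "add ?H = add (cofree_module R)" by (simp add: cofree_module_def Let_def)
  note cs = cofree_module_carrier[OF R] extensional_def
  show ?thesis
  proof (rule module_cong_group[OF R G])
    fix a b g h assume "a \<in> carrier R" "b \<in> carrier R" "h \<in> carrier ?H"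
    then show "a \<odot>\<^bsub>cofree_module R\<^esub> h \<in> carrier ?H"
      and "(a \<oplus>\<^bsub>R\<^esub> b) \<odot>\<^bsub>cofree_module R\<^esub> h =
        (a \<odot>\<^bsub>cofree_module R\<^esub> h) \<oplus>\<^bsub>?H\<^esub> (b \<odot>\<^bsub>cofree_module R\<^esub> h)"
      and "(a \<otimes>\<^bsub>R\<^esub> b) \<odot>\<^bsub>cofree_module R\<^esub> h = a \<odot>\<^bsub>cofree_module R\<^esub> (b \<odot>\<^bsub>cofree_module R\<^esub> h)"
      unfolding c a
      by (auto simp: cs cofree_module_simps R.l_distr R.r_distr R.m_ac fun_eq_iff)
  next
    fix a g h assume "a \<in> carrier R" "h \<in> carrier ?H" "g \<in> carrier ?H"
    then show "a \<odot>\<^bsub>cofree_module R\<^esub> (g \<oplus>\<^bsub>?H\<^esub> h) =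
        (a \<odot>\<^bsub>cofree_module R\<^esub> g) \<oplus>\<^bsub>?H\<^esub> (a \<odot>\<^bsub>cofree_module R\<^esub> h)"
      unfolding c a by (auto simp: cs cofree_module_simps fun_eq_iff)
  next
    fix h assume "h \<in> carrier ?H"
    then show "\<one>\<^bsub>R\<^esub> \<odot>\<^bsub>cofree_module R\<^esub> h = h"
      unfolding c by (auto simp: cs cofree_module_simps fun_eq_iff)
  qed (simp_all add: cofree_module_def Let_def)
qed

text \<open>Evaluation at one turns a linear map from an ideal to the cofree module into an additive map from
  the ideal to \<open>\<rat>/\<int>\<close>. The latter extends to \<open>R\<close>, and the extension is the required element.\<close>

lemma baer_cofree_module:
  assumes R: "cring R"
  shows "baer R (cofree_module R)"
  unfolding baer_def
proof (intro conjI allI impI, rule cofree_module_module[OF R], elim conjE)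
  interpret R: cring R by fact
  fix I f assume I: "submodule I R (self_module R)"
    and f: "linear_map R ((self_module R)\<lparr>carrier := I\<rparr>) (cofree_module R) f"
  interpret S: module R "self_module R" by (rule self_module_module[OF R])
  note IE = S.submoduleE[OF I]
  let ?Z = "as_int_module R (self_module R)"
  have Z: "module \<Z> ?Z"
    by (intro as_int_module_module self_module_module R)
  interpret Z: module \<Z> ?Z by (rule Z)
  have fc: "f a \<in> carrier (cofree_module R)" if "a \<in> I" for a
    using linear_map_closed[OF f] that by simp
  note fc' = fc[unfolded cofree_module_carrier[OF R]]
  have f_add: "f (a \<oplus>\<^bsub>R\<^esub> b) = f a \<oplus>\<^bsub>cofree_module R\<^esub> f b" if "a \<in> I" "b \<in> I" for a b
    using linear_map_add[OF f, of a b] that by simp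
  have f_smult: "f (a \<otimes>\<^bsub>R\<^esub> b) = a \<odot>\<^bsub>cofree_module R\<^esub> f b" if "a \<in> carrier R" "b \<in> I" for a b
    using linear_map_smult[OF f, of a b] that by simp
  have ZI: "submodule I \<Z> ?Z"
  proof (rule module.submoduleI[OF Z])
    show "\<ominus>\<^bsub>?Z\<^esub> a \<in> I" if "a \<in> I" for a
      using IE(3)[OF that] by (simp add: a_inv_def m_inv_def)
    show "a \<odot>\<^bsub>?Z\<^esub> x \<in> I" if "a \<in> carrier \<Z>" "x \<in> I" for a x
      using IE(4)[of "int_embed R a" x] that ring_hom_closed[OF int_embed_hom[OF R]] by simp
    show "I \<subseteq> carrier ?Z" "\<zero>\<^bsub>?Z\<^esub> \<in> I" using IE(1) S.submodule_zero[OF I] by simp_all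
    show "a \<oplus>\<^bsub>?Z\<^esub> b \<in> I" if "a \<in> I" "b \<in> I" for a b using IE(5)[OF that] by simp
  qed
  have "linear_map \<Z> (?Z\<lparr>carrier := I\<rparr>) rat_mod_one (\<lambda>a. f a \<one>\<^bsub>R\<^esub>)"
  proof (rule additive_int_linear[OF submodule.submodule_is_module[OF ZI Z] rat_mod_one_module])
    fix x y assume "x \<in> carrier (?Z\<lparr>carrier := I\<rparr>)" "y \<in> carrier (?Z\<lparr>carrier := I\<rparr>)"
    then have xy: "x \<in> I" "y \<in> I" by simp_all
    show "f x \<one>\<^bsub>R\<^esub> \<in> carrier rat_mod_one" using fc'[OF xy(1)] by simp
    show "f (x \<oplus>\<^bsub>?Z\<lparr>carrier := I\<rparr>\<^esub> y) \<one>\<^bsub>R\<^esub> = f x \<one>\<^bsub>R\<^esub> \<oplus>\<^bsub>rat_mod_one\<^esub> f y \<one>\<^bsub>R\<^esub>"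
      using f_add[OF xy] by (simp add: cofree_module_simps)
  qed
  then obtain g where g: "linear_map \<Z> ?Z rat_mod_one g" "\<And>a. a \<in> I \<Longrightarrow> g a = f a \<one>\<^bsub>R\<^esub>"
    using baer_extension[OF baer_rat_mod_one Z ZI] by blast
  let ?e = "\<lambda>r\<in>carrier R. g r"
  show "\<exists>e\<in>carrier (cofree_module R). \<forall>a\<in>I. f a = a \<odot>\<^bsub>cofree_module R\<^esub> e"
  proof (intro bexI ballI)
    show "?e \<in> carrier (cofree_module R)"
      using g(1) by (auto simp: cofree_module_carrier[OF R] linear_map_def)
    fix a assume a: "a \<in> I"
    show "f a = a \<odot>\<^bsub>cofree_module R\<^esub> ?e"
    proof (rule extensionalityI[where A = "carrier R"])
      show "f a \<in> extensional (carrier R)" using fc'[OF a] by simp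
      show "a \<odot>\<^bsub>cofree_module R\<^esub> ?e \<in> extensional (carrier R)" by (simp add: cofree_module_simps)
      fix r assume r: "r \<in> carrier R"
      have ra: "r \<otimes>\<^bsub>R\<^esub> a \<in> I" "a \<in> carrier R" using IE(4)[OF r a] IE(1) a by auto
      have "(a \<odot>\<^bsub>cofree_module R\<^esub> ?e) r = f (r \<otimes>\<^bsub>R\<^esub> a) \<one>\<^bsub>R\<^esub>"
        using r ra g(2) by (simp add: cofree_module_simps)
      also have "\<dots> = f a r" using f_smult[OF r a] r by (simp add: cofree_module_simps)
      finally show "f a r = (a \<odot>\<^bsub>cofree_module R\<^esub> ?e) r" by simp
    qed
  qed
qed

text \<open>The subgroup generated by \<open>x\<close> maps to the rationals modulo one with \<open>x\<close> going to \<open>1/d\<close>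
  if \<open>x\<close> has finite order \<open>d\<close>, and to \<open>1/2\<close> otherwise; this map extends to the whole group.\<close>

lemma rat_mod_one_separates:
  fixes M :: "(int, 'm) module"
  assumes M: "module \<Z> M" and x: "x \<in> carrier M" "x \<noteq> \<zero>\<^bsub>M\<^esub>"
  obtains g where "linear_map \<Z> M rat_mod_one g" "g x \<noteq> \<zero>\<^bsub>rat_mod_one\<^esub>"
proof -
  interpret M: module \<Z> M by fact
  interpret Q: module \<Z> rat_mod_one by (rule rat_mod_one_module)
  have "linear_map \<Z> (self_module \<Z>) M (\<lambda>k. k \<odot>\<^bsub>M\<^esub> x)"
    using x M.smult_l_distr[of _ _ x] M.smult_assoc1[of _ _ x] M.smult_closed[of _ x]
    by (intro linear_mapI) auto
  then interpret m: lin \<Z> "self_module \<Z>" M "\<lambda>k. k \<odot>\<^bsub>M\<^esub> x"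
    by (intro linI self_module_module int_is_cring M)
  obtain d :: int where d: "d \<ge> 0" "{k. k \<odot>\<^bsub>M\<^esub> x = \<zero>\<^bsub>M\<^esub>} = {k. d dvd k}"
    using int_submodule_principal m.kernel_submodule by auto
  have "1 \<odot>\<^bsub>M\<^esub> x = x" using M.smult_one[OF x(1)] by simp
  have d1: "d \<noteq> 1"
  proof
    assume "d = 1"
    then have "1 \<in> {k. k \<odot>\<^bsub>M\<^esub> x = \<zero>\<^bsub>M\<^esub>}" using d(2) by simp
    then show False using x(2) \<open>1 \<odot>\<^bsub>M\<^esub> x = x\<close> by simp
  qed
  define q :: rat where "q = (if d = 0 then 1 / 2 else 1 / of_int d)"
  have q: "q \<in> carrier rat_mod_one" "q \<noteq> 0"
    using d(1) d1 by (auto simp: q_def rat_mod_one_def divide_simps)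
  have dq: "of_int d * q \<in> \<int>" by (cases "d = 0") (simp_all add: q_def)
  define h where "h y = (SOME k :: int. y = k \<odot>\<^bsub>M\<^esub> x) \<odot>\<^bsub>rat_mod_one\<^esub> q" for y
  have h: "h (k \<odot>\<^bsub>M\<^esub> x) = k \<odot>\<^bsub>rat_mod_one\<^esub> q" for k
  proof -
    let ?l = "SOME l :: int. k \<odot>\<^bsub>M\<^esub> x = l \<odot>\<^bsub>M\<^esub> x"
    have "k \<odot>\<^bsub>M\<^esub> x = ?l \<odot>\<^bsub>M\<^esub> x" by (rule someI[of "\<lambda>l. k \<odot>\<^bsub>M\<^esub> x = l \<odot>\<^bsub>M\<^esub> x" k]) simp
    moreover have "k \<odot>\<^bsub>M\<^esub> x = (k - ?l) \<odot>\<^bsub>M\<^esub> x \<oplus>\<^bsub>M\<^esub> ?l \<odot>\<^bsub>M\<^esub> x"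
      using M.smult_l_distr[of "k - ?l" ?l x] x by simp
    moreover have "i \<odot>\<^bsub>M\<^esub> x \<in> carrier M" for i :: int using M.smult_closed[of i x] x by simp
    ultimately have "(k - ?l) \<odot>\<^bsub>M\<^esub> x = \<zero>\<^bsub>M\<^esub>" by (metis M.M.add.r_cancel_one')
    then have "d dvd k - ?l" using d(2) by auto
    then obtain c where "k - ?l = c * d" by (auto simp: dvd_def mult.commute)
    then have "of_int k * q - of_int ?l * q = of_int c * (of_int d * q)"
      by (metis (no_types, lifting) left_diff_distrib mult.assoc of_int_diff of_int_mult)
    also have "\<dots> \<in> \<int>" using dq by (rule Ints_mult[OF Ints_of_int])
    finally have "Archimedean_Field.frac (of_int k * q) = Archimedean_Field.frac (of_int ?l * q)"
      by (rule frac_eqI)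
    then show ?thesis by (simp add: h_def rat_mod_one_def)
  qed
  let ?A = "(\<lambda>k :: int. k \<odot>\<^bsub>M\<^esub> x) ` UNIV"
  have A: "submodule ?A \<Z> M" using m.image_submodule by simp
  have "linear_map \<Z> (M\<lparr>carrier := ?A\<rparr>) rat_mod_one h"
  proof (rule additive_int_linear[OF submodule.submodule_is_module[OF A M] rat_mod_one_module])
    fix y assume "y \<in> carrier (M\<lparr>carrier := ?A\<rparr>)"
    then obtain k where k: "y = k \<odot>\<^bsub>M\<^esub> x" by auto
    then show "h y \<in> carrier rat_mod_one" using h Q.smult_closed[of k q] q by simp
    fix z assume "z \<in> carrier (M\<lparr>carrier := ?A\<rparr>)"
    then obtain l where l: "z = l \<odot>\<^bsub>M\<^esub> x" by auto
    have "y \<oplus>\<^bsub>M\<^esub> z = (k + l) \<odot>\<^bsub>M\<^esub> x" using M.smult_l_distr[of k l x] x k l by simp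
    then have "h (y \<oplus>\<^bsub>M\<^esub> z) = (k + l) \<odot>\<^bsub>rat_mod_one\<^esub> q" by (simp only: h)
    also have "\<dots> = h y \<oplus>\<^bsub>rat_mod_one\<^esub> h z" using Q.smult_l_distr[of k l q] q k l h by simp
    finally show "h (y \<oplus>\<^bsub>M\<lparr>carrier := ?A\<rparr>\<^esub> z) = h y \<oplus>\<^bsub>rat_mod_one\<^esub> h z" by simp
  qed
  then obtain g where g: "linear_map \<Z> M rat_mod_one g" "\<And>y. y \<in> ?A \<Longrightarrow> g y = h y"
    using baer_extension[OF baer_rat_mod_one M A] by blast
  have "g x = h (1 \<odot>\<^bsub>M\<^esub> x)" using g(2)[of x] \<open>1 \<odot>\<^bsub>M\<^esub> x = x\<close> by (metis rangeI)
  also have "\<dots> = q" using h[of 1] Q.smult_one[of q] q by simp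
  finally have "g x \<noteq> \<zero>\<^bsub>rat_mod_one\<^esub>" using q by (simp add: rat_mod_one_def)
  with g(1) show ?thesis by (rule that)
qed

text \<open>Choose for each nonzero \<open>x\<close> in \<open>N\<close> an additive map \<open>\<chi> x\<close> to \<open>\<rat>/\<int>\<close> that does not vanish at \<open>x\<close>. The maps
  \<open>y \<mapsto> (r \<mapsto> \<chi> x (r y))\<close> are the components of an embedding into a power of the cofree module.\<close>

lemma embedding_into_injective:
  fixes N :: "('a, 'n) module" and R :: "('a, 'r) ring_scheme"
  assumes N: "module R N"
  obtains J :: "('a, 'n \<Rightarrow> 'a \<Rightarrow> rat) module" and \<iota>
  where "baer R J" "linear_map R N J \<iota>" "inj_on \<iota> (carrier N)"
proof -
  interpret N: module R N by fact
  have R: "cring R" by (rule N.R.cring_axioms)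
  let ?J = "direct_product (carrier N) (\<lambda>_. cofree_module R)"
  let ?Z = "as_int_module R N"
  have Z: "module \<Z> ?Z" by (rule as_int_module_module[OF N])
  have "\<exists>g. linear_map \<Z> ?Z rat_mod_one g \<and> (x \<noteq> \<zero>\<^bsub>N\<^esub> \<longrightarrow> g x \<noteq> \<zero>\<^bsub>rat_mod_one\<^esub>)"
    if x: "x \<in> carrier N" for x
  proof (cases "x = \<zero>\<^bsub>N\<^esub>")
    case True
    interpret Q: module \<Z> rat_mod_one by (rule rat_mod_one_module)
    have "linear_map \<Z> ?Z rat_mod_one (\<lambda>_. \<zero>\<^bsub>rat_mod_one\<^esub>)"
      by (rule additive_int_linear[OF Z rat_mod_one_module]) auto
    with True show ?thesis by blast
  next
    case False
    then obtain g where "linear_map \<Z> ?Z rat_mod_one g" "g x \<noteq> \<zero>\<^bsub>rat_mod_one\<^esub>"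
      using rat_mod_one_separates[OF Z, of x] x by (metis restrict_scalars_simps(1,3))
    then show ?thesis by blast
  qed
  then obtain \<chi> where \<chi>: "\<And>x. x \<in> carrier N \<Longrightarrow> linear_map \<Z> ?Z rat_mod_one (\<chi> x)"
    "\<And>x. x \<in> carrier N \<Longrightarrow> x \<noteq> \<zero>\<^bsub>N\<^esub> \<Longrightarrow> \<chi> x x \<noteq> \<zero>\<^bsub>rat_mod_one\<^esub>" by metis
  have \<chi>c: "\<chi> x y \<in> carrier rat_mod_one" if "x \<in> carrier N" "y \<in> carrier N" for x y
    using linear_map_closed[OF \<chi>(1)[OF that(1)], of y] that by simp
  have \<chi>a: "\<chi> x (y \<oplus>\<^bsub>N\<^esub> z) = \<chi> x y \<oplus>\<^bsub>rat_mod_one\<^esub> \<chi> x z"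
    if "x \<in> carrier N" "y \<in> carrier N" "z \<in> carrier N" for x y z
    using linear_map_add[OF \<chi>(1)[OF that(1)], of y z] that by simp
  define \<iota> where "\<iota> y = (\<lambda>x\<in>carrier N. \<lambda>r\<in>carrier R. \<chi> x (r \<odot>\<^bsub>N\<^esub> y))" for y
  have J: "baer R ?J" by (intro baer_direct_product baer_cofree_module R)
  interpret J: module R ?J using J by (simp add: baer_def)
  have lin: "linear_map R N ?J \<iota>"
  proof (rule linear_mapI)
    fix y assume "y \<in> carrier N"
    then show "\<iota> y \<in> carrier ?J"
      by (auto simp: \<iota>_def direct_product_simps cofree_module_carrier[OF R] \<chi>c \<chi>a N.smult_l_distr)
  next
    fix y z assume "y \<in> carrier N" "z \<in> carrier N"
    then show "\<iota> (y \<oplus>\<^bsub>N\<^esub> z) = \<iota> y \<oplus>\<^bsub>?J\<^esub> \<iota> z"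
      by (auto simp: \<iota>_def direct_product_simps cofree_module_simps \<chi>c \<chi>a N.smult_r_distr fun_eq_iff)
  next
    fix a y assume "a \<in> carrier R" "y \<in> carrier N"
    then show "\<iota> (a \<odot>\<^bsub>N\<^esub> y) = a \<odot>\<^bsub>?J\<^esub> \<iota> y"
      by (auto simp: \<iota>_def direct_product_simps cofree_module_simps N.smult_assoc1 fun_eq_iff)
  qed
  interpret i: lin R N ?J \<iota> by (intro linI N J.module_axioms lin)
  have "inj_on \<iota> (carrier N)"
  proof (rule inj_onI)
    fix y z assume yz: "y \<in> carrier N" "z \<in> carrier N" "\<iota> y = \<iota> z"
    let ?x = "y \<ominus>\<^bsub>N\<^esub> z"
    have x: "?x \<in> carrier N" using yz by simp
    have "\<iota> ?x = \<zero>\<^bsub>?J\<^esub>" using yz i.minus J.M.minus_eq_zero_iff[of "\<iota> y" "\<iota> z"] i.closed by simp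
    then have "\<iota> ?x ?x \<one>\<^bsub>R\<^esub> = \<zero>\<^bsub>?J\<^esub> ?x \<one>\<^bsub>R\<^esub>" by simp
    then have "\<chi> ?x ?x = \<zero>\<^bsub>rat_mod_one\<^esub>"
      using x by (simp add: \<iota>_def direct_product_simps cofree_module_simps)
    then have "?x = \<zero>\<^bsub>N\<^esub>" using \<chi>(2)[OF x] by blast
    then show "y = z" using yz N.M.minus_eq_zero_iff by blast
  qed
  with J lin show ?thesis by (rule that)
qed

lemma (in module) submodule_chain_Union:
  assumes "C \<noteq> {}" and sub: "\<And>H. H \<in> C \<Longrightarrow> submodule H R M"
    and ch: "\<And>H K. H \<in> C \<Longrightarrow> K \<in> C \<Longrightarrow> H \<subseteq> K \<or> K \<subseteq> H"
  shows "submodule (\<Union>C) R M"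
proof (rule submoduleI)
  show "\<Union>C \<subseteq> carrier M" using submoduleE(1)[OF sub] by blast
  obtain H where "H \<in> C" using assms(1) by (meson ex_in_conv)
  then show "\<zero>\<^bsub>M\<^esub> \<in> \<Union>C" using submodule_zero[OF sub] by (meson UnionI)
next
  fix a assume "a \<in> \<Union>C"
  then obtain H where "H \<in> C" "a \<in> H" by (rule UnionE)
  then show "\<ominus>\<^bsub>M\<^esub> a \<in> \<Union>C" using submoduleE(3)[OF sub] by (meson UnionI)
next
  fix r a assume "r \<in> carrier R" "a \<in> \<Union>C"
  then obtain H where "H \<in> C" "a \<in> H" by (meson UnionE)
  then show "r \<odot>\<^bsub>M\<^esub> a \<in> \<Union>C" using submoduleE(4)[OF sub \<open>r \<in> carrier R\<close>] by (meson UnionI)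
next
  fix a b assume "a \<in> \<Union>C" "b \<in> \<Union>C"
  then obtain H K where HK: "H \<in> C" "a \<in> H" "K \<in> C" "b \<in> K" by (meson UnionE)
  then obtain L where "L \<in> C" "a \<in> L" "b \<in> L" using ch[OF HK(1,3)] by (meson subsetD)
  then show "a \<oplus>\<^bsub>M\<^esub> b \<in> \<Union>C" using submoduleE(5)[OF sub] by (meson UnionI)
qed

definition essential :: "('a, 'r) ring_scheme \<Rightarrow> ('a, 'm) module \<Rightarrow> 'm set \<Rightarrow> 'm set \<Rightarrow> bool" where
  "essential R M N H \<longleftrightarrow>
     (\<forall>x\<in>H. x \<noteq> \<zero>\<^bsub>M\<^esub> \<longrightarrow> (\<exists>r\<in>carrier R. r \<odot>\<^bsub>M\<^esub> x \<in> N \<and> r \<odot>\<^bsub>M\<^esub> x \<noteq> \<zero>\<^bsub>M\<^esub>))"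

text \<open>A maximal essential extension \<open>E\<close> of \<open>N\<close> inside an injective module \<open>J\<close> is injective:
  if \<open>C\<close> is maximal among the submodules meeting \<open>E\<close> trivially, then the projection \<open>E \<oplus> C \<rightarrow> E\<close>
  extends to an endomorphism of \<open>J\<close> with kernel \<open>C\<close>, whose image is again essential over \<open>N\<close>
  and hence is \<open>E\<close>. So \<open>E\<close> is a retract of \<open>J\<close>.\<close>

lemma baer_maximal_essential:
  fixes J :: "('a, 'j) module"
  assumes J: "baer R J" and N: "N \<subseteq> E" and E: "submodule E R J" and ess: "essential R J N E"
    and max: "\<And>H. submodule H R J \<Longrightarrow> E \<subseteq> H \<Longrightarrow> essential R J N H \<Longrightarrow> H = E"
  shows "baer R (J\<lparr>carrier := E\<rparr>)"
proof -
  have mJ: "module R J" using J by (simp add: baer_def)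
  interpret J: module R J by (rule mJ)
  note EE = J.submoduleE[OF E] J.submodule_zero[OF E]
  let ?S = "{C. submodule C R J \<and> C \<inter> E = {\<zero>\<^bsub>J\<^esub>}}"
  have ne: "?S \<noteq> {}" using J.zero_submodule EE(7) by blast
  have "\<exists>C\<in>?S. \<forall>X\<in>?S. C \<subseteq> X \<longrightarrow> X = C"
  proof (rule subset_Zorn_nonempty[OF ne])
    fix A assume A: "A \<noteq> {}" "subset.chain ?S A"
    then have AS: "A \<subseteq> ?S" and ch: "\<And>H K. H \<in> A \<Longrightarrow> K \<in> A \<Longrightarrow> H \<subseteq> K \<or> K \<subseteq> H"
      by (auto simp: subset_chain_def)
    have "submodule (\<Union>A) R J"
      by (rule J.submodule_chain_Union[OF A(1) _ ch]) (use AS in auto)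
    moreover have "\<Union>A \<inter> E = (\<Union>C\<in>A. C \<inter> E)" by blast
    moreover have "(\<Union>C\<in>A. C \<inter> E) = (\<Union>C\<in>A. {\<zero>\<^bsub>J\<^esub>})" using AS by (intro SUP_cong) auto
    moreover have "\<dots> = {\<zero>\<^bsub>J\<^esub>}" using A(1) by simp
    ultimately show "\<Union>A \<in> ?S" by simp
  qed
  then obtain C where CS: "C \<in> ?S" and Cmax: "\<forall>X\<in>?S. C \<subseteq> X \<longrightarrow> X = C" ..
  then have C: "submodule C R J" "C \<inter> E = {\<zero>\<^bsub>J\<^esub>}" by simp_all
  note CE = J.submoduleE[OF C(1)] J.submodule_zero[OF C(1)]
  define P where "P = {e \<oplus>\<^bsub>J\<^esub> c | e c. e \<in> E \<and> c \<in> C}"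
  have PI: "e \<oplus>\<^bsub>J\<^esub> c \<in> P" if "e \<in> E" "c \<in> C" for e c using that unfolding P_def by blast
  have Ec: "e \<in> carrier J" if "e \<in> E" for e using EE(1) that by (rule subsetD)
  have Cc: "e \<in> carrier J" if "e \<in> C" for e using CE(1) that by (rule subsetD)
  have uniq: "e = e'" if "e \<in> E" "c \<in> C" "e' \<in> E" "c' \<in> C" "e \<oplus>\<^bsub>J\<^esub> c = e' \<oplus>\<^bsub>J\<^esub> c'" for e c e' c'
  proof -
    note cc = Ec[OF that(1)] Cc[OF that(2)] Ec[OF that(3)] Cc[OF that(4)]
    have "(e \<ominus>\<^bsub>J\<^esub> e') \<oplus>\<^bsub>J\<^esub> c = (e \<oplus>\<^bsub>J\<^esub> c) \<ominus>\<^bsub>J\<^esub> e'"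
      using cc by (simp add: J.M.minus_eq J.M.a_ac)
    also have "\<dots> = (e' \<oplus>\<^bsub>J\<^esub> c') \<ominus>\<^bsub>J\<^esub> e'" using that(5) by simp
    also have "\<dots> = c'" using cc by (simp add: J.M.minus_eq J.M.a_ac J.M.r_neg J.M.r_neg1 J.M.r_neg2)
    finally have sum: "(e \<ominus>\<^bsub>J\<^esub> e') \<oplus>\<^bsub>J\<^esub> c = c'" .
    have "e \<ominus>\<^bsub>J\<^esub> e' = (e \<ominus>\<^bsub>J\<^esub> e') \<oplus>\<^bsub>J\<^esub> c \<ominus>\<^bsub>J\<^esub> c"
      using cc by (simp add: J.M.minus_eq J.M.a_assoc J.M.r_neg)
    then have "e \<ominus>\<^bsub>J\<^esub> e' = c' \<ominus>\<^bsub>J\<^esub> c" by (simp only: sum)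
    moreover have "c' \<ominus>\<^bsub>J\<^esub> c \<in> C" unfolding a_minus_def by (intro CE(3,5) that)
    ultimately have "e \<ominus>\<^bsub>J\<^esub> e' \<in> C" by simp
    moreover have "e \<ominus>\<^bsub>J\<^esub> e' \<in> E" unfolding a_minus_def by (intro EE(3,5) that)
    ultimately have "e \<ominus>\<^bsub>J\<^esub> e' \<in> {\<zero>\<^bsub>J\<^esub>}" unfolding C(2)[symmetric] by (rule IntI)
    then have "e \<ominus>\<^bsub>J\<^esub> e' = \<zero>\<^bsub>J\<^esub>" by (rule singletonD)
    then show ?thesis using J.M.minus_eq_zero_iff[OF cc(1,3)] by simp
  qed
  define f where "f z = (THE e. e \<in> E \<and> (\<exists>c\<in>C. z = e \<oplus>\<^bsub>J\<^esub> c))" for z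
  have f: "f (e \<oplus>\<^bsub>J\<^esub> c) = e" if "e \<in> E" "c \<in> C" for e c
    unfolding f_def
  proof (rule the_equality)
    show "e \<in> E \<and> (\<exists>c'\<in>C. e \<oplus>\<^bsub>J\<^esub> c = e \<oplus>\<^bsub>J\<^esub> c')" using that by blast
    show "e' = e" if "e' \<in> E \<and> (\<exists>c'\<in>C. e \<oplus>\<^bsub>J\<^esub> c = e' \<oplus>\<^bsub>J\<^esub> c')" for e'
      using that uniq \<open>e \<in> E\<close> \<open>c \<in> C\<close> by blast
  qed
  have Padd: "(e \<oplus>\<^bsub>J\<^esub> c) \<oplus>\<^bsub>J\<^esub> (e' \<oplus>\<^bsub>J\<^esub> c') = (e \<oplus>\<^bsub>J\<^esub> e') \<oplus>\<^bsub>J\<^esub> (c \<oplus>\<^bsub>J\<^esub> c')"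
    if "e \<in> E" "c \<in> C" "e' \<in> E" "c' \<in> C" for e c e' c'
    using that Ec Cc by (simp add: J.M.a_ac)
  have Psm: "r \<odot>\<^bsub>J\<^esub> (e \<oplus>\<^bsub>J\<^esub> c) = r \<odot>\<^bsub>J\<^esub> e \<oplus>\<^bsub>J\<^esub> r \<odot>\<^bsub>J\<^esub> c"
    if "e \<in> E" "c \<in> C" "r \<in> carrier R" for e c r
    using that Ec Cc by (simp add: J.smult_r_distr)
  have PE: "\<exists>e\<in>E. \<exists>c\<in>C. z = e \<oplus>\<^bsub>J\<^esub> c" if "z \<in> P" for z using that unfolding P_def by blast
  have P: "submodule P R J"
  proof (rule J.submoduleI)
    show "P \<subseteq> carrier J" unfolding P_def using Ec Cc by auto
    show "\<zero>\<^bsub>J\<^esub> \<in> P" using PI[OF EE(7) CE(7)] by simp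
  next
    fix z assume "z \<in> P"
    then obtain e c where z: "e \<in> E" "c \<in> C" "z = e \<oplus>\<^bsub>J\<^esub> c" using PE by meson
    then have "\<ominus>\<^bsub>J\<^esub> z = (\<ominus>\<^bsub>J\<^esub> e) \<oplus>\<^bsub>J\<^esub> (\<ominus>\<^bsub>J\<^esub> c)" using Ec Cc by (simp add: J.M.minus_add)
    then show "\<ominus>\<^bsub>J\<^esub> z \<in> P" using PI[OF EE(3) CE(3)] z by simp
  next
    fix z w assume "z \<in> P" "w \<in> P"
    then obtain e c e' c' where z: "e \<in> E" "c \<in> C" "z = e \<oplus>\<^bsub>J\<^esub> c" "e' \<in> E" "c' \<in> C" "w = e' \<oplus>\<^bsub>J\<^esub> c'"
      using PE by meson
    then show "z \<oplus>\<^bsub>J\<^esub> w \<in> P"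
      unfolding z(3,6) Padd[OF z(1,2,4,5)] by (intro PI EE(5) CE(5))
  next
    fix r z assume r: "r \<in> carrier R" and "z \<in> P"
    then obtain e c where z: "e \<in> E" "c \<in> C" "z = e \<oplus>\<^bsub>J\<^esub> c" using PE by meson
    then show "r \<odot>\<^bsub>J\<^esub> z \<in> P" using PI[OF EE(4) CE(4)] r by (simp add: Psm)
  qed
  have "linear_map R (J\<lparr>carrier := P\<rparr>) J f"
  proof (rule linear_mapI)
    fix z assume "z \<in> carrier (J\<lparr>carrier := P\<rparr>)"
    then have "z \<in> P" by simp
    then obtain e c where z: "e \<in> E" "c \<in> C" "z = e \<oplus>\<^bsub>J\<^esub> c" using PE by meson
    then show "f z \<in> carrier J" using f Ec by simp
    fix w assume "w \<in> carrier (J\<lparr>carrier := P\<rparr>)"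
    then have "w \<in> P" by simp
    then obtain e' c' where w: "e' \<in> E" "c' \<in> C" "w = e' \<oplus>\<^bsub>J\<^esub> c'" using PE by meson
    have "f ((e \<oplus>\<^bsub>J\<^esub> e') \<oplus>\<^bsub>J\<^esub> (c \<oplus>\<^bsub>J\<^esub> c')) = e \<oplus>\<^bsub>J\<^esub> e'"
      by (rule f[OF EE(5)[OF z(1) w(1)] CE(5)[OF z(2) w(2)]])
    then show "f (z \<oplus>\<^bsub>J\<lparr>carrier := P\<rparr>\<^esub> w) = f z \<oplus>\<^bsub>J\<^esub> f w"
      using f[OF z(1,2)] f[OF w(1,2)] Padd[OF z(1,2) w(1,2)] z(3) w(3) by simp
  next
    fix r z assume r: "r \<in> carrier R" and "z \<in> carrier (J\<lparr>carrier := P\<rparr>)"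
    then have "z \<in> P" by simp
    then obtain e c where z: "e \<in> E" "c \<in> C" "z = e \<oplus>\<^bsub>J\<^esub> c" using PE by meson
    have "f (r \<odot>\<^bsub>J\<^esub> e \<oplus>\<^bsub>J\<^esub> r \<odot>\<^bsub>J\<^esub> c) = r \<odot>\<^bsub>J\<^esub> e"
      by (rule f[OF EE(4)[OF r z(1)] CE(4)[OF r z(2)]])
    then show "f (r \<odot>\<^bsub>J\<lparr>carrier := P\<rparr>\<^esub> z) = r \<odot>\<^bsub>J\<^esub> f z" using z r by (simp add: Psm f)
  qed
  then obtain g where g: "linear_map R J J g" "\<And>x. x \<in> P \<Longrightarrow> g x = f x"
    using baer_extension[OF J mJ P] by blast
  interpret g: lin R J J g by (intro linI mJ g(1))
  have gE: "g e = e" if "e \<in> E" for e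
    using g(2)[OF PI[OF that CE(7)]] f[OF that CE(7)] Ec[OF that] by simp
  have gC: "g c = \<zero>\<^bsub>J\<^esub>" if "c \<in> C" for c
    using g(2)[OF PI[OF EE(7) that]] f[OF EE(7) that] Cc[OF that] by simp
  let ?K = "{x \<in> carrier J. g x = \<zero>\<^bsub>J\<^esub>}"
  have "?K \<in> ?S" using g.kernel_submodule gE EE(1,7) by auto
  moreover have "C \<subseteq> ?K" using gC Cc by auto
  ultimately have KC: "?K = C" using Cmax by blast
  have "essential R J N (g ` carrier J)"
    unfolding essential_def
  proof (intro ballI impI)
    fix y assume "y \<in> g ` carrier J" and y0: "y \<noteq> \<zero>\<^bsub>J\<^esub>"
    then obtain x where x: "x \<in> carrier J" "y = g x" by auto
    (* C is strictly smaller than its sum with the multiples of x, which therefore meets E. *)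
    interpret m: lin R "self_module R" J "\<lambda>r. r \<odot>\<^bsub>J\<^esub> x"
      using x by (intro linI self_module_module linear_mapI mJ)
        (auto simp: J.smult_l_distr J.smult_assoc1 J.R.cring_axioms)
    define X where "X = {c \<oplus>\<^bsub>J\<^esub> r \<odot>\<^bsub>J\<^esub> x | c r. c \<in> C \<and> r \<in> carrier R}"
    have XI: "c \<oplus>\<^bsub>J\<^esub> r \<odot>\<^bsub>J\<^esub> x \<in> X" if "c \<in> C" "r \<in> carrier R" for c r
      using that unfolding X_def by blast
    have XE: "\<exists>c\<in>C. \<exists>r\<in>carrier R. z = c \<oplus>\<^bsub>J\<^esub> r \<odot>\<^bsub>J\<^esub> x" if "z \<in> X" for z
      using that unfolding X_def by blast
    have X: "submodule X R J"
    proof (rule J.submoduleI)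
      show "X \<subseteq> carrier J" using Cc x unfolding X_def by auto
      show "\<zero>\<^bsub>J\<^esub> \<in> X" using XI[OF CE(7), of "\<zero>\<^bsub>R\<^esub>"] x by simp
    next
      fix z assume "z \<in> X"
      then obtain c r where z: "c \<in> C" "r \<in> carrier R" "z = c \<oplus>\<^bsub>J\<^esub> r \<odot>\<^bsub>J\<^esub> x" using XE by meson
      then have "\<ominus>\<^bsub>J\<^esub> z = \<ominus>\<^bsub>J\<^esub> c \<oplus>\<^bsub>J\<^esub> (\<ominus>\<^bsub>R\<^esub> r) \<odot>\<^bsub>J\<^esub> x"
        using x Cc by (simp add: J.M.minus_add J.smult_l_minus)
      then show "\<ominus>\<^bsub>J\<^esub> z \<in> X" using XI[OF CE(3)[OF z(1)], of "\<ominus>\<^bsub>R\<^esub> r"] z(2) by simp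
    next
      fix z w assume "z \<in> X" "w \<in> X"
      then obtain c r c' r' where z: "c \<in> C" "r \<in> carrier R" "z = c \<oplus>\<^bsub>J\<^esub> r \<odot>\<^bsub>J\<^esub> x"
        "c' \<in> C" "r' \<in> carrier R" "w = c' \<oplus>\<^bsub>J\<^esub> r' \<odot>\<^bsub>J\<^esub> x" using XE by meson
      then have "z \<oplus>\<^bsub>J\<^esub> w = (c \<oplus>\<^bsub>J\<^esub> c') \<oplus>\<^bsub>J\<^esub> (r \<oplus>\<^bsub>R\<^esub> r') \<odot>\<^bsub>J\<^esub> x"
        using x Cc by (simp add: J.M.a_ac J.smult_l_distr)
      then show "z \<oplus>\<^bsub>J\<^esub> w \<in> X" using XI[OF CE(5)[OF z(1,4)], of "r \<oplus>\<^bsub>R\<^esub> r'"] z(2,5) by simp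
    next
      fix a z assume a: "a \<in> carrier R" and "z \<in> X"
      then obtain c r where z: "c \<in> C" "r \<in> carrier R" "z = c \<oplus>\<^bsub>J\<^esub> r \<odot>\<^bsub>J\<^esub> x" using XE by meson
      then have "a \<odot>\<^bsub>J\<^esub> z = a \<odot>\<^bsub>J\<^esub> c \<oplus>\<^bsub>J\<^esub> (a \<otimes>\<^bsub>R\<^esub> r) \<odot>\<^bsub>J\<^esub> x"
        using x Cc a by (simp add: J.smult_r_distr J.smult_assoc1)
      then show "a \<odot>\<^bsub>J\<^esub> z \<in> X" using XI[OF CE(4)[OF a z(1)], of "a \<otimes>\<^bsub>R\<^esub> r"] z(2) a by simp
    qed
    have CX: "C \<subseteq> X"
    proof
      fix c assume "c \<in> C"
      then show "c \<in> X" using XI[of c "\<zero>\<^bsub>R\<^esub>"] Cc x by simp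
    qed
    have xX: "x \<in> X" using XI[OF CE(7), of "\<one>\<^bsub>R\<^esub>"] x by simp
    have "x \<notin> C" using gC x y0 by auto
    then have XC: "X \<noteq> C" using xX by metis
    have "X \<inter> E \<noteq> {\<zero>\<^bsub>J\<^esub>}"
    proof
      assume "X \<inter> E = {\<zero>\<^bsub>J\<^esub>}"
      with X have "X \<in> ?S" by simp
      from bspec[OF Cmax this] CX have "X = C" by (rule mp)
      with XC show False by simp
    qed
    moreover have "\<zero>\<^bsub>J\<^esub> \<in> X \<inter> E" using EE(7) J.submodule_zero[OF X] by simp
    ultimately obtain e where e: "e \<in> X" "e \<in> E" "e \<noteq> \<zero>\<^bsub>J\<^esub>" by blast
    then obtain c r where cr: "c \<in> C" "r \<in> carrier R" "e = c \<oplus>\<^bsub>J\<^esub> r \<odot>\<^bsub>J\<^esub> x"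
      using XE by meson
    have er: "e = r \<odot>\<^bsub>J\<^esub> y" using gE[OF e(2)] gC[OF cr(1)] cr Cc x by simp
    obtain s where s: "s \<in> carrier R" "s \<odot>\<^bsub>J\<^esub> e \<in> N" "s \<odot>\<^bsub>J\<^esub> e \<noteq> \<zero>\<^bsub>J\<^esub>"
      using ess e unfolding essential_def by blast
    have "s \<odot>\<^bsub>J\<^esub> e = (s \<otimes>\<^bsub>R\<^esub> r) \<odot>\<^bsub>J\<^esub> y" using er s(1) cr(2) x g.closed by (simp add: J.smult_assoc1)
    then show "\<exists>r\<in>carrier R. r \<odot>\<^bsub>J\<^esub> y \<in> N \<and> r \<odot>\<^bsub>J\<^esub> y \<noteq> \<zero>\<^bsub>J\<^esub>"
      using s cr(2) by (intro bexI[where x = "s \<otimes>\<^bsub>R\<^esub> r"]) auto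
  qed
  moreover have "E \<subseteq> g ` carrier J" using gE Ec by force
  ultimately have img: "g ` carrier J = E" by (intro max g.image_submodule)
  show ?thesis unfolding baer_def
  proof (intro conjI allI impI, rule submodule.submodule_is_module[OF E mJ], elim conjE)
    fix I h assume I: "submodule I R (self_module R)"
      and h: "linear_map R ((self_module R)\<lparr>carrier := I\<rparr>) (J\<lparr>carrier := E\<rparr>) h"
    have hE: "h a \<in> E" if "a \<in> I" for a using linear_map_closed[OF h, of a] that by simp
    have "linear_map R ((self_module R)\<lparr>carrier := I\<rparr>) J h"
      using h Ec by (auto simp: linear_map_def)
    then obtain j where j: "j \<in> carrier J" "\<And>a. a \<in> I \<Longrightarrow> h a = a \<odot>\<^bsub>J\<^esub> j"
      using J I unfolding baer_def by blast
    interpret S: module R "self_module R" by (rule self_module_module[OF J.R.cring_axioms])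
    show "\<exists>e\<in>carrier (J\<lparr>carrier := E\<rparr>). \<forall>a\<in>I. h a = a \<odot>\<^bsub>J\<lparr>carrier := E\<rparr>\<^esub> e"
    proof (intro bexI ballI)
      show "g j \<in> carrier (J\<lparr>carrier := E\<rparr>)" using img j(1) by auto
      fix a assume a: "a \<in> I"
      then have aR: "a \<in> carrier R" using S.submoduleE(1)[OF I] by auto
      have "h a = g (h a)" using gE[OF hE[OF a]] by simp
      also have "\<dots> = a \<odot>\<^bsub>J\<^esub> g j" using j a aR by simp
      finally show "h a = a \<odot>\<^bsub>J\<lparr>carrier := E\<rparr>\<^esub> g j" by simp
    qed
  qed
qed

text \<open>By Zorn's lemma the image of \<open>N\<close> in an injective module has a maximal essential extension there.\<close>

theorem injective_envelope_exists:
  fixes N :: "('a, 'n) module" and R :: "('a, 'r) ring_scheme"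
  assumes N: "module R N"
  shows "\<exists>(E :: ('a, 'n \<Rightarrow> 'a \<Rightarrow> rat) module) \<iota>. is_injective_envelope R N E \<iota>"
proof -
  obtain J :: "('a, 'n \<Rightarrow> 'a \<Rightarrow> rat) module" and \<iota> where J: "baer R J" "linear_map R N J \<iota>"
    and inj: "inj_on \<iota> (carrier N)"
    using embedding_into_injective[OF N] .
  have mJ: "module R J" using J by (simp add: baer_def)
  interpret J: module R J by (rule mJ)
  interpret i: lin R N J \<iota> by (intro linI N mJ J(2))
  let ?N = "\<iota> ` carrier N"
  let ?S = "{H. submodule H R J \<and> ?N \<subseteq> H \<and> essential R J ?N H}"
  have "?N \<in> ?S"
  proof -
    have "essential R J ?N ?N" unfolding essential_def
    proof (intro ballI impI)
      fix x assume "x \<in> ?N" "x \<noteq> \<zero>\<^bsub>J\<^esub>"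
      then show "\<exists>r\<in>carrier R. r \<odot>\<^bsub>J\<^esub> x \<in> ?N \<and> r \<odot>\<^bsub>J\<^esub> x \<noteq> \<zero>\<^bsub>J\<^esub>"
        by (intro bexI[where x = "\<one>\<^bsub>R\<^esub>"]) auto
    qed
    then show ?thesis using i.image_submodule by simp
  qed
  then have ne: "?S \<noteq> {}" by (metis empty_iff)
  have "\<exists>E\<in>?S. \<forall>X\<in>?S. E \<subseteq> X \<longrightarrow> X = E"
  proof (rule subset_Zorn_nonempty[OF ne])
    fix A assume A: "A \<noteq> {}" "subset.chain ?S A"
    then have AS: "A \<subseteq> ?S" and ch: "\<And>H K. H \<in> A \<Longrightarrow> K \<in> A \<Longrightarrow> H \<subseteq> K \<or> K \<subseteq> H"
      by (simp_all add: subset_chain_def)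
    have AS': "submodule H R J" "?N \<subseteq> H" "essential R J ?N H" if "H \<in> A" for H
      using subsetD[OF AS that] by simp_all
    have "submodule (\<Union>A) R J" by (rule J.submodule_chain_Union[OF A(1) AS'(1) ch])
    moreover obtain H where H: "H \<in> A" using A(1) by (meson ex_in_conv)
    have "?N \<subseteq> \<Union>A" using AS'(2)[OF H] Union_upper[OF H] by (rule subset_trans)
    moreover have "essential R J ?N (\<Union>A)" using AS'(3) unfolding essential_def by (meson UnionE)
    ultimately show "\<Union>A \<in> ?S" by simp
  qed
  then obtain E where ES: "E \<in> ?S" and max: "\<forall>X\<in>?S. E \<subseteq> X \<longrightarrow> X = E" ..
  from ES have E: "submodule E R J" "?N \<subseteq> E" "essential R J ?N E" by simp_all
  have B: "baer R (J\<lparr>carrier := E\<rparr>)"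
  proof (rule baer_maximal_essential[OF J(1) E(2,1,3)])
    fix H assume H: "submodule H R J" "E \<subseteq> H" "essential R J ?N H"
    have "?N \<subseteq> H" using E(2) H(2) by (rule subset_trans)
    with H max show "H = E" by simp
  qed
  have "is_injective_envelope R N (J\<lparr>carrier := E\<rparr>) \<iota>"
    unfolding is_injective_envelope_def
  proof (intro conjI allI impI)
    show "injective_module R (J\<lparr>carrier := E\<rparr>)"
      using B injective_module_iff_baer[OF J.R.cring_axioms] by blast
    show "linear_map R N (J\<lparr>carrier := E\<rparr>) \<iota>"
      using J(2) subsetD[OF E(2)] by (auto simp: linear_map_def)
    show "inj_on \<iota> (carrier N)" by (rule inj)
    interpret E: module R "J\<lparr>carrier := E\<rparr>" using B by (simp add: baer_def)
    fix H assume "submodule H R (J\<lparr>carrier := E\<rparr>) \<and> H \<noteq> {\<zero>\<^bsub>J\<lparr>carrier := E\<rparr>\<^esub>}"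
    then have H: "submodule H R (J\<lparr>carrier := E\<rparr>)" "H \<noteq> {\<zero>\<^bsub>J\<^esub>}" by auto
    then obtain x where x: "x \<in> H" "x \<noteq> \<zero>\<^bsub>J\<^esub>" using E.submodule_zero by auto
    then have "x \<in> E" using E.submoduleE(1)[OF H(1)] by auto
    then obtain r where r: "r \<in> carrier R" "r \<odot>\<^bsub>J\<^esub> x \<in> ?N" "r \<odot>\<^bsub>J\<^esub> x \<noteq> \<zero>\<^bsub>J\<^esub>"
      using E(3) x(2) unfolding essential_def by meson
    have "r \<odot>\<^bsub>J\<^esub> x \<in> H" using E.submoduleE(4)[OF H(1) r(1) x(1)] by simp
    with r show "H \<inter> ?N \<noteq> {\<zero>\<^bsub>J\<lparr>carrier := E\<rparr>\<^esub>}" by auto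
  qed
  then show ?thesis by blast
qed

corollary baer_injective_envelope:
  assumes "module R N" shows "baer R (injective_envelope R N)"
proof -
  have "\<exists>\<iota>. is_injective_envelope R N (injective_envelope R N) \<iota>"
    unfolding injective_envelope_def using injective_envelope_exists[OF assms] by (rule someI_ex)
  then have "injective_module R (injective_envelope R N)" by (auto simp: is_injective_envelope_def)
  moreover have "cring R" using assms by (simp add: module_def)
  ultimately show ?thesis using injective_module_iff_baer by blast
qed


section \<open>Complexes and their homology\<close>

lemma chain_complexD:
  assumes "chain_complex R X"
  shows "module R (obj X n)" "linear_map R (obj X n) (obj X (n - 1)) (diff X n)"
    "x \<in> carrier (obj X n) \<Longrightarrow> diff X (n - 1) (diff X n x) = \<zero>\<^bsub>obj X (n - 2)\<^esub>"
  using assms unfolding chain_complex_def by auto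

lemma cycles_submodule:
  assumes "module R (obj X n)" "module R (obj X (n - 1))"
    and "linear_map R (obj X n) (obj X (n - 1)) (diff X n)"
  shows "submodule (cycles X n) R (obj X n)"
  using lin.kernel_submodule[OF linI[OF assms]] by (simp add: cycles_def)

lemma boundaries_submodule:
  assumes "module R (obj X n)" "module R (obj X (n + 1))"
    and "linear_map R (obj X (n + 1)) (obj X (n + 1 - 1)) (diff X (n + 1))"
  shows "submodule (boundaries X n) R (obj X n)"
  using lin.image_submodule[OF linI[OF assms(2,1)]] assms(3) by (simp add: boundaries_def)

lemma boundaries_subset_cycles:
  assumes "chain_complex R X"
  shows "boundaries X n \<subseteq> cycles X n"
proof
  fix x assume "x \<in> boundaries X n"
  then obtain y where y: "y \<in> carrier (obj X (n + 1))" "x = diff X (n + 1) y"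
    by (auto simp: boundaries_def)
  have "x \<in> carrier (obj X n)"
    using linear_map_closed[OF chain_complexD(2)[OF assms, of "n + 1"] y(1)] y(2) by simp
  moreover have "diff X n x = \<zero>\<^bsub>obj X (n - 1)\<^esub>"
    using chain_complexD(3)[OF assms y(1)] y(2) by simp
  ultimately show "x \<in> cycles X n" by (simp add: cycles_def)
qed

text \<open>\<open>is_homology R X j H \<pi>\<close> presents \<open>H\<close> as the homology of \<open>X\<close> in degree \<open>j\<close> through the map
  \<open>\<pi>\<close> that takes a cycle to its class. Unlike the module of cosets, such presentations are
  transported by exact functors without any isomorphism having to be composed.\<close>

definition is_homology ::
  "('a, 'r) ring_scheme \<Rightarrow> ('a, 'x) cplx \<Rightarrow> int \<Rightarrow> ('a, 'h) module \<Rightarrow> ('x \<Rightarrow> 'h) \<Rightarrow> bool" where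
  "is_homology R X j H \<pi> \<longleftrightarrow> module R H \<and>
     linear_map R ((obj X j)\<lparr>carrier := cycles X j\<rparr>) H \<pi> \<and> \<pi> ` cycles X j = carrier H \<and>
     (\<forall>z\<in>cycles X j. \<pi> z = \<zero>\<^bsub>H\<^esub> \<longleftrightarrow> z \<in> boundaries X j)"

lemma is_homologyD:
  assumes "is_homology R X j H \<pi>"
  shows "module R H"
    and "z \<in> cycles X j \<Longrightarrow> \<pi> z \<in> carrier H"
    and "z \<in> cycles X j \<Longrightarrow> w \<in> cycles X j \<Longrightarrow> \<pi> (z \<oplus>\<^bsub>obj X j\<^esub> w) = \<pi> z \<oplus>\<^bsub>H\<^esub> \<pi> w"
    and "a \<in> carrier R \<Longrightarrow> z \<in> cycles X j \<Longrightarrow> \<pi> (a \<odot>\<^bsub>obj X j\<^esub> z) = a \<odot>\<^bsub>H\<^esub> \<pi> z"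
    and "h \<in> carrier H \<Longrightarrow> \<exists>z\<in>cycles X j. \<pi> z = h"
    and "z \<in> cycles X j \<Longrightarrow> \<pi> z = \<zero>\<^bsub>H\<^esub> \<longleftrightarrow> z \<in> boundaries X j"
proof -
  show "h \<in> carrier H \<Longrightarrow> \<exists>z\<in>cycles X j. \<pi> z = h"
    using assms unfolding is_homology_def by (metis imageE)
qed (use assms in \<open>auto simp: is_homology_def linear_map_def\<close>)

lemma homology_boundaries_submodule:
  assumes "chain_complex R X"
  shows "submod R ((obj X n)\<lparr>carrier := cycles X n\<rparr>) (boundaries X n)"
proof -
  note C = chain_complexD[OF assms]
  have Z: "submodule (cycles X n) R (obj X n)" by (intro cycles_submodule C)
  have B: "submodule (boundaries X n) R (obj X n)" by (intro boundaries_submodule C)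
  have mZ: "module R ((obj X n)\<lparr>carrier := cycles X n\<rparr>)"
    by (rule submodule.submodule_is_module[OF Z C(1)])
  interpret X: module R "obj X n" by (rule C)
  interpret Z: module R "(obj X n)\<lparr>carrier := cycles X n\<rparr>" by (rule mZ)
  note BE = X.submoduleE[OF B] X.submodule_zero[OF B]
  note ZE = X.submoduleE[OF Z]
  have "submodule (boundaries X n) R ((obj X n)\<lparr>carrier := cycles X n\<rparr>)"
  proof (rule Z.submoduleI)
    fix a assume a: "a \<in> boundaries X n"
    have aZ: "a \<in> cycles X n" using boundaries_subset_cycles[OF assms] a by (rule subsetD)
    have aX: "a \<in> carrier (obj X n)" using BE(1) a by (rule subsetD)
    have "\<ominus>\<^bsub>(obj X n)\<lparr>carrier := cycles X n\<rparr>\<^esub> a = \<ominus>\<^bsub>obj X n\<^esub> a"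
      using aZ ZE(3)[OF aZ] X.M.l_neg[OF aX] by (intro Z.M.minus_equality) simp_all
    then show "\<ominus>\<^bsub>(obj X n)\<lparr>carrier := cycles X n\<rparr>\<^esub> a \<in> boundaries X n" using BE(3)[OF a] by simp
  next
    show "boundaries X n \<subseteq> carrier ((obj X n)\<lparr>carrier := cycles X n\<rparr>)"
      using boundaries_subset_cycles[OF assms] by simp
    show "\<zero>\<^bsub>(obj X n)\<lparr>carrier := cycles X n\<rparr>\<^esub> \<in> boundaries X n" using BE(7) by simp
    show "a \<oplus>\<^bsub>(obj X n)\<lparr>carrier := cycles X n\<rparr>\<^esub> b \<in> boundaries X n"
      if "a \<in> boundaries X n" "b \<in> boundaries X n" for a b using BE(5)[OF that] by simp
    show "a \<odot>\<^bsub>(obj X n)\<lparr>carrier := cycles X n\<rparr>\<^esub> b \<in> boundaries X n"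
      if "a \<in> carrier R" "b \<in> boundaries X n" for a b using BE(4)[OF that] by simp
  qed
  then show ?thesis using mZ by (simp add: submod_def submod_axioms_def)
qed

lemma a_r_coset_update [simp]: "H +>\<^bsub>M\<lparr>carrier := Z\<rparr>\<^esub> x = H +>\<^bsub>M\<^esub> x"
  by (simp add: a_r_coset_def')

lemma homology_is_homology:
  assumes "chain_complex R X"
  shows "is_homology R X n (homology X n) (\<lambda>z. boundaries X n +>\<^bsub>obj X n\<^esub> z)"
proof -
  interpret B: submod R "(obj X n)\<lparr>carrier := cycles X n\<rparr>" "boundaries X n"
    by (rule homology_boundaries_submodule[OF assms])
  show ?thesis unfolding is_homology_def homology_def
    using B.quotient_module_module B.coset_linear B.quotient_carrier B.coset_eq_zero_iff by simp
qed

definition exact_complex :: "('a, 'm) cplx \<Rightarrow> bool" where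
  "exact_complex X \<longleftrightarrow> (\<forall>n. cycles X n \<subseteq> boundaries X n)"

lemma concentrated_simps [simp]:
  "carrier (obj (concentrated N) n) = (if n = 0 then carrier N else {\<zero>\<^bsub>N\<^esub>})"
  "add (obj (concentrated N) n) = add N" "zero (obj (concentrated N) n) = zero N"
  "smult (obj (concentrated N) n) = smult N" "diff (concentrated N) n = (\<lambda>_. \<zero>\<^bsub>N\<^esub>)"
  by (simp_all add: concentrated_def)

lemma concentrated_obj_module:
  assumes "module R N" shows "module R (obj (concentrated N) n)"
  using assms submodule.submodule_is_module[OF module.zero_submodule[OF assms] assms]
  by (simp add: concentrated_def)

lemma concentrated_complex:
  assumes "module R N" shows "chain_complex R (concentrated N)"
proof -
  interpret module R N by fact
  show ?thesis unfolding chain_complex_def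
    using concentrated_obj_module[OF assms] by (auto simp: linear_map_def)
qed

lemma concentrated_homology:
  assumes "module R N"
  shows "is_homology R (concentrated N) 0 N (\<lambda>x. x)"
proof -
  have "cycles (concentrated N) 0 = carrier N" by (auto simp: cycles_def)
  moreover have "boundaries (concentrated N) 0 = {\<zero>\<^bsub>N\<^esub>}"
    by (auto simp: boundaries_def)
  ultimately show ?thesis unfolding is_homology_def using assms by (auto simp: linear_map_def)
qed

section \<open>Localization\<close>

locale localizing = P: primeideal p R + M: module R M
  for p and R :: "('a, 'r) ring_scheme" (structure) and M :: "('a, 'm) module"
begin

abbreviation (input) "S \<equiv> carrier R - p"

lemma S_one: "\<one> \<in> S"
  using P.I_notcarr P.one_imp_carrier by auto

lemma S_mult [simp]: "s \<in> S \<Longrightarrow> t \<in> S \<Longrightarrow> s \<otimes> t \<in> S"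
  using P.I_prime by auto

lemma S_carrier: "s \<in> S \<Longrightarrow> s \<in> carrier R" by simp

lemma mem_frac_iff: "(y, t) \<in> frac R p M x s \<longleftrightarrow> y \<in> carrier M \<and> t \<in> S \<and>
    (\<exists>u\<in>S. u \<odot>\<^bsub>M\<^esub> (t \<odot>\<^bsub>M\<^esub> x) = u \<odot>\<^bsub>M\<^esub> (s \<odot>\<^bsub>M\<^esub> y))"
  by (simp add: frac_def)

lemma frac_trans:
  assumes "x \<in> carrier M" "y \<in> carrier M" "s \<in> S" "t \<in> S" "u \<in> S"
    and u: "u \<odot>\<^bsub>M\<^esub> (t \<odot>\<^bsub>M\<^esub> x) = u \<odot>\<^bsub>M\<^esub> (s \<odot>\<^bsub>M\<^esub> y)" and z: "(z, r) \<in> frac R p M x s"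
  shows "(z, r) \<in> frac R p M y t"
proof -
  obtain w where w: "z \<in> carrier M" "r \<in> S" "w \<in> S" "w \<odot>\<^bsub>M\<^esub> (r \<odot>\<^bsub>M\<^esub> x) = w \<odot>\<^bsub>M\<^esub> (s \<odot>\<^bsub>M\<^esub> z)"
    using z by (auto simp: mem_frac_iff)
  note c = S_carrier[OF assms(3)] S_carrier[OF assms(4)] S_carrier[OF assms(5)] S_carrier[OF w(2)]
    S_carrier[OF w(3)]
  have "(u \<otimes> w \<otimes> s) \<odot>\<^bsub>M\<^esub> (r \<odot>\<^bsub>M\<^esub> y) = (w \<otimes> r) \<odot>\<^bsub>M\<^esub> (u \<odot>\<^bsub>M\<^esub> (s \<odot>\<^bsub>M\<^esub> y))"
    using c assms(1,2) by (simp add: M.smult_assoc1[symmetric] P.m_ac)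
  also have "\<dots> = (w \<otimes> r) \<odot>\<^bsub>M\<^esub> (u \<odot>\<^bsub>M\<^esub> (t \<odot>\<^bsub>M\<^esub> x))" by (simp only: u)
  also have "\<dots> = (u \<otimes> t) \<odot>\<^bsub>M\<^esub> (w \<odot>\<^bsub>M\<^esub> (r \<odot>\<^bsub>M\<^esub> x))"
    using c assms(1,2) by (simp add: M.smult_assoc1[symmetric] P.m_ac)
  also have "\<dots> = (u \<otimes> t) \<odot>\<^bsub>M\<^esub> (w \<odot>\<^bsub>M\<^esub> (s \<odot>\<^bsub>M\<^esub> z))" by (simp only: w(4))
  also have "\<dots> = (u \<otimes> w \<otimes> s) \<odot>\<^bsub>M\<^esub> (t \<odot>\<^bsub>M\<^esub> z)"
    using c assms(1,2) w(1) by (simp add: M.smult_assoc1[symmetric] P.m_ac)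
  finally show ?thesis
    unfolding mem_frac_iff using w(1,2) assms(3,5) w(3)
    by (intro conjI bexI[where x = "u \<otimes> w \<otimes> s"] S_mult) auto
qed

lemma frac_eq_iff:
  assumes "x \<in> carrier M" "y \<in> carrier M" "s \<in> S" "t \<in> S"
  shows "frac R p M x s = frac R p M y t \<longleftrightarrow> (\<exists>u\<in>S. u \<odot>\<^bsub>M\<^esub> (t \<odot>\<^bsub>M\<^esub> x) = u \<odot>\<^bsub>M\<^esub> (s \<odot>\<^bsub>M\<^esub> y))"
proof
  assume eq: "frac R p M x s = frac R p M y t"
  have "(y, t) \<in> frac R p M y t" using assms S_one by (auto simp: mem_frac_iff)
  then show "\<exists>u\<in>S. u \<odot>\<^bsub>M\<^esub> (t \<odot>\<^bsub>M\<^esub> x) = u \<odot>\<^bsub>M\<^esub> (s \<odot>\<^bsub>M\<^esub> y)"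
    using eq[symmetric] by (simp add: mem_frac_iff)
next
  assume "\<exists>u\<in>S. u \<odot>\<^bsub>M\<^esub> (t \<odot>\<^bsub>M\<^esub> x) = u \<odot>\<^bsub>M\<^esub> (s \<odot>\<^bsub>M\<^esub> y)"
  then obtain u where u: "u \<in> S" "u \<odot>\<^bsub>M\<^esub> (t \<odot>\<^bsub>M\<^esub> x) = u \<odot>\<^bsub>M\<^esub> (s \<odot>\<^bsub>M\<^esub> y)" by (rule bexE)
  show "frac R p M x s = frac R p M y t"
  proof (intro equalityI subsetI)
    fix q assume "q \<in> frac R p M x s"
    then show "q \<in> frac R p M y t"
      using frac_trans[OF assms u, of "fst q" "snd q"] by simp
  next
    fix q assume "q \<in> frac R p M y t"
    then show "q \<in> frac R p M x s"
      using frac_trans[OF assms(2,1,4,3) u(1) u(2)[symmetric], of "fst q" "snd q"] by simp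
  qed
qed

lemma frac_eqI:
  assumes "x \<in> carrier M" "y \<in> carrier M" "s \<in> S" "t \<in> S" "t \<odot>\<^bsub>M\<^esub> x = s \<odot>\<^bsub>M\<^esub> y"
  shows "frac R p M x s = frac R p M y t"
  using assms S_one by (subst frac_eq_iff) auto

lemma frac_cancel:
  assumes "x \<in> carrier M" "s \<in> S" "u \<in> S"
  shows "frac R p M (u \<odot>\<^bsub>M\<^esub> x) (u \<otimes> s) = frac R p M x s"
  using assms(1,2) S_carrier[OF assms(3)] S_mult[OF assms(3,2)]
  by (intro frac_eqI) (simp_all add: M.smult_assoc1[symmetric] P.m_ac)

lemma frac_eq_zero_iff:
  assumes "x \<in> carrier M" "s \<in> S"
  shows "frac R p M x s = \<zero>\<^bsub>localization_module R p M\<^esub> \<longleftrightarrow> (\<exists>u\<in>S. u \<odot>\<^bsub>M\<^esub> x = \<zero>\<^bsub>M\<^esub>)"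
  using assms S_one by (simp add: localization_module_def frac_eq_iff)

lemma localization_carrier:
  "carrier (localization_module R p M) = {frac R p M x s | x s. x \<in> carrier M \<and> s \<in> S}"
  by (simp add: localization_module_def)

lemma localization_cases:
  assumes "A \<in> carrier (localization_module R p M)"
  obtains x s where "A = frac R p M x s" "x \<in> carrier M" "s \<in> S"
  using assms unfolding localization_carrier by blast

lemma frac_in_carrier [simp]:
  "x \<in> carrier M \<Longrightarrow> s \<in> S \<Longrightarrow> frac R p M x s \<in> carrier (localization_module R p M)"
  unfolding localization_carrier by blast

lemma frac_rep:
  assumes "(y, t) \<in> frac R p M x s" "x \<in> carrier M" "s \<in> S"
  shows "y \<in> carrier M" "t \<in> S" "\<exists>u\<in>S. u \<odot>\<^bsub>M\<^esub> (t \<odot>\<^bsub>M\<^esub> x) = u \<odot>\<^bsub>M\<^esub> (s \<odot>\<^bsub>M\<^esub> y)"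
    "frac R p M y t = frac R p M x s"
  using assms frac_eq_iff[of x y s t] by (auto simp: mem_frac_iff)

lemma frac_self: "x \<in> carrier M \<Longrightarrow> s \<in> S \<Longrightarrow> (x, s) \<in> frac R p M x s"
  using S_one by (auto simp: mem_frac_iff)

text \<open>The operations on fractions are unions over representatives. All members of such a union agree,
  so it equals any one of them. The set \<open>A\<close> restricts the representatives, for the sake of maps that
  are defined only on some numerators, such as the cycles.\<close>

lemma UN_frac:
  assumes "x \<in> carrier M" "s \<in> S"
    and "\<And>y t. y \<in> carrier M \<Longrightarrow> t \<in> S \<Longrightarrow> \<exists>u\<in>S. u \<odot>\<^bsub>M\<^esub> (t \<odot>\<^bsub>M\<^esub> x) = u \<odot>\<^bsub>M\<^esub> (s \<odot>\<^bsub>M\<^esub> y)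
      \<Longrightarrow> (y, t) \<in> A \<Longrightarrow> g y t = g x s"
    and "(x, s) \<in> A"
  shows "(\<Union>(y, t) \<in> frac R p M x s \<inter> A. g y t) = g x s"
proof (rule UN_constant_eq)
  show "(x, s) \<in> frac R p M x s \<inter> A" using frac_self[OF assms(1,2)] assms(4) by simp
  show "\<forall>q\<in>frac R p M x s \<inter> A. (case q of (y, t) \<Rightarrow> g y t) = g x s"
  proof (intro ballI, clarify)
    fix y t assume "(y, t) \<in> frac R p M x s" "(y, t) \<in> A"
    then show "g y t = g x s" using frac_rep[OF _ assms(1,2)] assms(3) by meson
  qed
qed

lemma frac_add:
  assumes "x \<in> carrier M" "y \<in> carrier M" "s \<in> S" "t \<in> S"
  shows "frac R p M x s \<oplus>\<^bsub>localization_module R p M\<^esub> frac R p M y t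
    = frac R p M (t \<odot>\<^bsub>M\<^esub> x \<oplus>\<^bsub>M\<^esub> s \<odot>\<^bsub>M\<^esub> y) (s \<otimes> t)"
proof -
  let ?g = "\<lambda>x s y t. frac R p M (t \<odot>\<^bsub>M\<^esub> x \<oplus>\<^bsub>M\<^esub> s \<odot>\<^bsub>M\<^esub> y) (s \<otimes> t)"
  have 1: "(\<Union>(y', t') \<in> frac R p M y t \<inter> UNIV. ?g x s y' t') = ?g x s y t"
    if xs: "x \<in> carrier M" "s \<in> S" for x s
  proof (rule UN_frac[OF assms(2,4)])
    fix z r assume z: "z \<in> carrier M" "r \<in> S"
      and "\<exists>u\<in>S. u \<odot>\<^bsub>M\<^esub> (r \<odot>\<^bsub>M\<^esub> y) = u \<odot>\<^bsub>M\<^esub> (t \<odot>\<^bsub>M\<^esub> z)"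
    then obtain u where u: "u \<in> S" "u \<odot>\<^bsub>M\<^esub> (r \<odot>\<^bsub>M\<^esub> y) = u \<odot>\<^bsub>M\<^esub> (t \<odot>\<^bsub>M\<^esub> z)" by meson
    note c = S_carrier[OF xs(2)] S_carrier[OF z(2)] S_carrier[OF u(1)] S_carrier[OF assms(4)]
    have E: "(s \<otimes> s) \<odot>\<^bsub>M\<^esub> (u \<odot>\<^bsub>M\<^esub> (r \<odot>\<^bsub>M\<^esub> y)) = (s \<otimes> s) \<odot>\<^bsub>M\<^esub> (u \<odot>\<^bsub>M\<^esub> (t \<odot>\<^bsub>M\<^esub> z))" by (simp only: u(2))
    have "u \<odot>\<^bsub>M\<^esub> ((s \<otimes> t) \<odot>\<^bsub>M\<^esub> (r \<odot>\<^bsub>M\<^esub> x \<oplus>\<^bsub>M\<^esub> s \<odot>\<^bsub>M\<^esub> z))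
      = u \<odot>\<^bsub>M\<^esub> ((s \<otimes> r) \<odot>\<^bsub>M\<^esub> (t \<odot>\<^bsub>M\<^esub> x \<oplus>\<^bsub>M\<^esub> s \<odot>\<^bsub>M\<^esub> y))"
      using c xs(1) z(1) assms(2) E
      by (simp add: M.smult_r_distr M.smult_assoc1[symmetric] P.m_ac)
    then show "?g x s z r = ?g x s y t"
      using c xs z assms u(1) S_mult[OF xs(2) z(2)] S_mult[OF xs(2) assms(4)]
      by (subst frac_eq_iff) (auto)
  qed simp
  have "(\<Union>(x', s') \<in> frac R p M x s \<inter> UNIV. \<Union>(y', t') \<in> frac R p M y t \<inter> UNIV. ?g x' s' y' t')
    = (\<Union>(y', t') \<in> frac R p M y t \<inter> UNIV. ?g x s y' t')"
  proof (rule UN_frac[OF assms(1,3)])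
    fix z r assume z: "z \<in> carrier M" "r \<in> S"
      and "\<exists>u\<in>S. u \<odot>\<^bsub>M\<^esub> (r \<odot>\<^bsub>M\<^esub> x) = u \<odot>\<^bsub>M\<^esub> (s \<odot>\<^bsub>M\<^esub> z)"
    then obtain u where u: "u \<in> S" "u \<odot>\<^bsub>M\<^esub> (r \<odot>\<^bsub>M\<^esub> x) = u \<odot>\<^bsub>M\<^esub> (s \<odot>\<^bsub>M\<^esub> z)" by meson
    note c = S_carrier[OF assms(3)] S_carrier[OF z(2)] S_carrier[OF u(1)] S_carrier[OF assms(4)]
    have E: "(t \<otimes> t) \<odot>\<^bsub>M\<^esub> (u \<odot>\<^bsub>M\<^esub> (r \<odot>\<^bsub>M\<^esub> x)) = (t \<otimes> t) \<odot>\<^bsub>M\<^esub> (u \<odot>\<^bsub>M\<^esub> (s \<odot>\<^bsub>M\<^esub> z))" by (simp only: u(2))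
    have "u \<odot>\<^bsub>M\<^esub> ((s \<otimes> t) \<odot>\<^bsub>M\<^esub> (t \<odot>\<^bsub>M\<^esub> z \<oplus>\<^bsub>M\<^esub> r \<odot>\<^bsub>M\<^esub> y))
      = u \<odot>\<^bsub>M\<^esub> ((r \<otimes> t) \<odot>\<^bsub>M\<^esub> (t \<odot>\<^bsub>M\<^esub> x \<oplus>\<^bsub>M\<^esub> s \<odot>\<^bsub>M\<^esub> y))"
      using c assms(1,2) z(1) E
      by (simp add: M.smult_r_distr M.smult_assoc1[symmetric] P.m_ac)
    then have "?g z r y t = ?g x s y t"
      using c z assms u(1) S_mult[OF z(2) assms(4)] S_mult[OF assms(3,4)]
      by (subst frac_eq_iff) (auto)
    then show "(\<Union>(y', t') \<in> frac R p M y t \<inter> UNIV. ?g z r y' t') =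
      (\<Union>(y', t') \<in> frac R p M y t \<inter> UNIV. ?g x s y' t')"
      unfolding 1[OF z] 1[OF assms(1,3)] .
  qed simp
  then show ?thesis using 1[OF assms(1,3)] by (simp add: localization_module_def)
qed

lemma localization_group: "abelian_group (localization_module R p M)"
proof (rule abelian_groupI)
  fix A B assume "A \<in> carrier (localization_module R p M)" "B \<in> carrier (localization_module R p M)"
  then obtain x s y t where xy: "A = frac R p M x s" "x \<in> carrier M" "s \<in> S"
    "B = frac R p M y t" "y \<in> carrier M" "t \<in> S" by (metis localization_cases)
  then have [simp]: "s \<in> carrier R" "t \<in> carrier R" by auto
  show "A \<oplus>\<^bsub>localization_module R p M\<^esub> B \<in> carrier (localization_module R p M)"
    unfolding xy(1,4) frac_add[OF xy(2,5,3,6)] using xy S_mult[OF xy(3,6)] by simp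
  show "A \<oplus>\<^bsub>localization_module R p M\<^esub> B = B \<oplus>\<^bsub>localization_module R p M\<^esub> A"
    unfolding xy(1,4) frac_add[OF xy(2,5,3,6)] frac_add[OF xy(5,2,6,3)]
    using xy(2,5) by (simp add: M.M.a_ac P.m_ac)
  fix C assume "C \<in> carrier (localization_module R p M)"
  then obtain z r where z: "C = frac R p M z r" "z \<in> carrier M" "r \<in> S" by (rule localization_cases)
  then have [simp]: "r \<in> carrier R" by auto
  show "A \<oplus>\<^bsub>localization_module R p M\<^esub> B \<oplus>\<^bsub>localization_module R p M\<^esub> C =
    A \<oplus>\<^bsub>localization_module R p M\<^esub> (B \<oplus>\<^bsub>localization_module R p M\<^esub> C)"
    using xy z S_mult[OF xy(3,6)] S_mult[OF xy(6) z(3)]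
    by (simp add: frac_add M.smult_r_distr M.smult_assoc1[symmetric] M.M.a_ac P.m_ac)
next
  fix A assume "A \<in> carrier (localization_module R p M)"
  then obtain x s where x: "A = frac R p M x s" "x \<in> carrier M" "s \<in> S" by (rule localization_cases)
  then have [simp]: "s \<in> carrier R" by auto
  have z: "\<zero>\<^bsub>localization_module R p M\<^esub> = frac R p M \<zero>\<^bsub>M\<^esub> \<one>" by (simp add: localization_module_def)
  show "\<zero>\<^bsub>localization_module R p M\<^esub> \<oplus>\<^bsub>localization_module R p M\<^esub> A = A"
    unfolding z x(1) using x S_one by (subst frac_add) auto
  have "frac R p M (\<ominus>\<^bsub>M\<^esub> x) s \<oplus>\<^bsub>localization_module R p M\<^esub> A = \<zero>\<^bsub>localization_module R p M\<^esub>"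
    unfolding x(1) using x S_mult[OF x(3,3)] S_one
    by (auto simp: frac_add frac_eq_zero_iff M.smult_r_minus M.M.l_neg intro!: bexI[where x = \<one>])
  then show "\<exists>B\<in>carrier (localization_module R p M).
      B \<oplus>\<^bsub>localization_module R p M\<^esub> A = \<zero>\<^bsub>localization_module R p M\<^esub>"
    using x by (intro bexI[where x = "frac R p M (\<ominus>\<^bsub>M\<^esub> x) s"]) auto
next
  have "frac R p M \<zero>\<^bsub>M\<^esub> \<one> \<in> carrier (localization_module R p M)" using S_one by simp
  then show "\<zero>\<^bsub>localization_module R p M\<^esub> \<in> carrier (localization_module R p M)"
    by (simp add: localization_module_def)
qed

end

lemma localizing_self:
  assumes "primeideal p R" shows "localizing p R (self_module R)"
proof -
  interpret primeideal p R by fact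
  show ?thesis by (intro localizing.intro assms self_module_module is_cring)
qed

lemma (in localizing) frac_smult:
  assumes a: "a \<in> carrier R" "s \<in> S" and x: "x \<in> carrier M" "t \<in> S"
  shows "frac R p (self_module R) a s \<odot>\<^bsub>localization_module R p M\<^esub> frac R p M x t
    = frac R p M (a \<odot>\<^bsub>M\<^esub> x) (s \<otimes> t)"
proof -
  interpret L: localizing p R "self_module R" by (rule localizing_self) unfold_locales
  let ?g = "\<lambda>a s x t. frac R p M (a \<odot>\<^bsub>M\<^esub> x) (s \<otimes> t)"
  have 1: "(\<Union>(x', t') \<in> frac R p M x t \<inter> UNIV. ?g a s x' t') = ?g a s x t"
    if as: "a \<in> carrier R" "s \<in> S" for a s
  proof (rule UN_frac[OF x])
    fix z r assume z: "z \<in> carrier M" "r \<in> S"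
      and "\<exists>u\<in>S. u \<odot>\<^bsub>M\<^esub> (r \<odot>\<^bsub>M\<^esub> x) = u \<odot>\<^bsub>M\<^esub> (t \<odot>\<^bsub>M\<^esub> z)"
    then obtain u where u: "u \<in> S" "u \<odot>\<^bsub>M\<^esub> (r \<odot>\<^bsub>M\<^esub> x) = u \<odot>\<^bsub>M\<^esub> (t \<odot>\<^bsub>M\<^esub> z)" by meson
    note c = S_carrier[OF as(2)] S_carrier[OF z(2)] S_carrier[OF u(1)] S_carrier[OF x(2)]
    have E: "(s \<otimes> a) \<odot>\<^bsub>M\<^esub> (u \<odot>\<^bsub>M\<^esub> (r \<odot>\<^bsub>M\<^esub> x)) = (s \<otimes> a) \<odot>\<^bsub>M\<^esub> (u \<odot>\<^bsub>M\<^esub> (t \<odot>\<^bsub>M\<^esub> z))" by (simp only: u(2))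
    have "u \<odot>\<^bsub>M\<^esub> ((s \<otimes> t) \<odot>\<^bsub>M\<^esub> (a \<odot>\<^bsub>M\<^esub> z)) = u \<odot>\<^bsub>M\<^esub> ((s \<otimes> r) \<odot>\<^bsub>M\<^esub> (a \<odot>\<^bsub>M\<^esub> x))"
      using c as(1) z(1) x(1) E by (simp add: M.smult_assoc1[symmetric] P.m_ac)
    then show "?g a s z r = ?g a s x t"
      using c as z x u(1) S_mult[OF as(2) z(2)] S_mult[OF as(2) x(2)]
      by (subst frac_eq_iff) (auto)
  qed simp
  have a': "a \<in> carrier (self_module R)" using a by simp
  have "(\<Union>(a', s') \<in> frac R p (self_module R) a s \<inter> UNIV.
      \<Union>(x', t') \<in> frac R p M x t \<inter> UNIV. ?g a' s' x' t')
    = (\<Union>(x', t') \<in> frac R p M x t \<inter> UNIV. ?g a s x' t')"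
  proof (rule L.UN_frac[OF a' a(2)])
    fix b r assume b: "b \<in> carrier (self_module R)" "r \<in> S"
      and "\<exists>u\<in>S. u \<odot>\<^bsub>self_module R\<^esub> (r \<odot>\<^bsub>self_module R\<^esub> a) = u \<odot>\<^bsub>self_module R\<^esub> (s \<odot>\<^bsub>self_module R\<^esub> b)"
    then obtain u where u: "u \<in> S" "u \<otimes> (r \<otimes> a) = u \<otimes> (s \<otimes> b)" by auto
    have b': "b \<in> carrier R" using b by simp
    note c = S_carrier[OF a(2)] S_carrier[OF b(2)] S_carrier[OF u(1)] S_carrier[OF x(2)]
    have E: "(u \<otimes> (r \<otimes> a)) \<odot>\<^bsub>M\<^esub> (t \<odot>\<^bsub>M\<^esub> x) = (u \<otimes> (s \<otimes> b)) \<odot>\<^bsub>M\<^esub> (t \<odot>\<^bsub>M\<^esub> x)" by (simp only: u(2))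
    have "u \<odot>\<^bsub>M\<^esub> ((s \<otimes> t) \<odot>\<^bsub>M\<^esub> (b \<odot>\<^bsub>M\<^esub> x)) = u \<odot>\<^bsub>M\<^esub> ((r \<otimes> t) \<odot>\<^bsub>M\<^esub> (a \<odot>\<^bsub>M\<^esub> x))"
      using c a(1) b' x(1) E by (simp add: M.smult_assoc1[symmetric] P.m_ac)
    then have "?g b r x t = ?g a s x t"
      using c a b' b(2) x u(1) S_mult[OF b(2) x(2)] S_mult[OF a(2) x(2)]
      by (subst frac_eq_iff) (auto)
    then show "(\<Union>(x', t') \<in> frac R p M x t \<inter> UNIV. ?g b r x' t') =
      (\<Union>(x', t') \<in> frac R p M x t \<inter> UNIV. ?g a s x' t')"
      unfolding 1[OF b' b(2)] 1[OF a] .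
  qed simp
  then show ?thesis using 1[OF a] by (simp add: localization_module_def)
qed

lemma localization_ring_simps:
  "carrier (localization_ring R p) = carrier (localization_module R p (self_module R))"
  "add (localization_ring R p) = add (localization_module R p (self_module R))"
  "zero (localization_ring R p) = zero (localization_module R p (self_module R))"
  "mult (localization_ring R p) = smult (localization_module R p (self_module R))"
  "one (localization_ring R p) = frac R p (self_module R) \<one>\<^bsub>R\<^esub> \<one>\<^bsub>R\<^esub>"
  by (simp_all add: localization_ring_def Let_def)

lemma localization_ring_cring:
  assumes p: "primeideal p R" shows "cring (localization_ring R p)"
proof -
  interpret P: primeideal p R by fact
  interpret L: localizing p R "self_module R" by (rule localizing_self[OF p])
  let ?L = "localization_module R p (self_module R)"
  note [simp] = localization_ring_simps
  have cases: "\<exists>x s. A = frac R p (self_module R) x s \<and> x \<in> carrier R \<and> s \<in> carrier R - p"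
    if "A \<in> carrier ?L" for A using that by (metis L.localization_cases self_module_simps(1))
  show ?thesis
  proof (rule cringI)
    show "abelian_group (localization_ring R p)"
      by (rule abelian_group_cong[OF L.localization_group]) simp_all
    show "comm_monoid (localization_ring R p)"
    proof (rule comm_monoidI)
      show "\<one>\<^bsub>localization_ring R p\<^esub> \<in> carrier (localization_ring R p)" using L.S_one by simp
    next
      fix A B assume "A \<in> carrier (localization_ring R p)" "B \<in> carrier (localization_ring R p)"
      then obtain x s y t where xy: "A = frac R p (self_module R) x s" "x \<in> carrier R"
        "s \<in> carrier R - p" "B = frac R p (self_module R) y t" "y \<in> carrier R" "t \<in> carrier R - p"
        using cases by simp meson
      then have c: "s \<in> carrier R" "t \<in> carrier R" by auto
      note st = L.S_mult[OF xy(3,6)] L.S_mult[OF xy(6,3)]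
      have e: "A \<otimes>\<^bsub>localization_ring R p\<^esub> B = frac R p (self_module R) (x \<otimes>\<^bsub>R\<^esub> y) (s \<otimes>\<^bsub>R\<^esub> t)"
        using xy L.frac_smult[of x s y t] by simp
      show "A \<otimes>\<^bsub>localization_ring R p\<^esub> B \<in> carrier (localization_ring R p)"
        unfolding e using xy st by simp
      show "A \<otimes>\<^bsub>localization_ring R p\<^esub> B = B \<otimes>\<^bsub>localization_ring R p\<^esub> A"
        unfolding e using xy L.frac_smult[of y t x s] c by (simp add: P.m_comm)
      fix C assume "C \<in> carrier (localization_ring R p)"
      then obtain z r where z: "C = frac R p (self_module R) z r" "z \<in> carrier R" "r \<in> carrier R - p"
        using cases by simp meson
      then have "r \<in> carrier R" by auto
      then show "A \<otimes>\<^bsub>localization_ring R p\<^esub> B \<otimes>\<^bsub>localization_ring R p\<^esub> C =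
          A \<otimes>\<^bsub>localization_ring R p\<^esub> (B \<otimes>\<^bsub>localization_ring R p\<^esub> C)"
        unfolding e using xy z c st L.S_mult[OF xy(6) z(3)] L.frac_smult[of y t z r]
          L.frac_smult[of "x \<otimes>\<^bsub>R\<^esub> y" "s \<otimes>\<^bsub>R\<^esub> t" z r] L.frac_smult[of x s "y \<otimes>\<^bsub>R\<^esub> z" "t \<otimes>\<^bsub>R\<^esub> r"]
        by (simp add: P.m_assoc)
    next
      fix A assume "A \<in> carrier (localization_ring R p)"
      then obtain x s where x: "A = frac R p (self_module R) x s" "x \<in> carrier R" "s \<in> carrier R - p"
        using cases by simp meson
      then show "\<one>\<^bsub>localization_ring R p\<^esub> \<otimes>\<^bsub>localization_ring R p\<^esub> A = A"
        using L.frac_smult[of "\<one>\<^bsub>R\<^esub>" "\<one>\<^bsub>R\<^esub>" x s] L.S_one by simp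
    qed
    fix A B C assume "A \<in> carrier (localization_ring R p)" "B \<in> carrier (localization_ring R p)"
      "C \<in> carrier (localization_ring R p)"
    then obtain x s y t z r where xy: "A = frac R p (self_module R) x s" "x \<in> carrier R"
      "s \<in> carrier R - p" "B = frac R p (self_module R) y t" "y \<in> carrier R" "t \<in> carrier R - p"
      "C = frac R p (self_module R) z r" "z \<in> carrier R" "r \<in> carrier R - p"
      using cases by simp meson
    then have c: "s \<in> carrier R" "t \<in> carrier R" "r \<in> carrier R" by auto
    note st = L.S_mult[OF xy(3,6)] L.S_mult[OF xy(3,9)] L.S_mult[OF xy(6,9)]
    note S4 = L.S_mult[OF st(2,3)] L.S_mult[OF st(1) xy(9)]
    have "(A \<oplus>\<^bsub>?L\<^esub> B) \<odot>\<^bsub>?L\<^esub> C =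
      frac R p (self_module R) ((t \<otimes>\<^bsub>R\<^esub> x \<oplus>\<^bsub>R\<^esub> s \<otimes>\<^bsub>R\<^esub> y) \<otimes>\<^bsub>R\<^esub> z) (s \<otimes>\<^bsub>R\<^esub> t \<otimes>\<^bsub>R\<^esub> r)"
      using xy c st L.frac_add[of x y s t]
        L.frac_smult[of "t \<otimes>\<^bsub>R\<^esub> x \<oplus>\<^bsub>R\<^esub> s \<otimes>\<^bsub>R\<^esub> y" "s \<otimes>\<^bsub>R\<^esub> t" z r] by simp
    also have "\<dots> = frac R p (self_module R) ((t \<otimes>\<^bsub>R\<^esub> r) \<otimes>\<^bsub>R\<^esub> (x \<otimes>\<^bsub>R\<^esub> z) \<oplus>\<^bsub>R\<^esub>
       (s \<otimes>\<^bsub>R\<^esub> r) \<otimes>\<^bsub>R\<^esub> (y \<otimes>\<^bsub>R\<^esub> z)) ((s \<otimes>\<^bsub>R\<^esub> r) \<otimes>\<^bsub>R\<^esub> (t \<otimes>\<^bsub>R\<^esub> r))"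
      using xy(2,5,8) c st S4
      by (intro L.frac_eqI) (simp_all add: P.l_distr P.r_distr P.m_ac)
    also have "\<dots> = A \<odot>\<^bsub>?L\<^esub> C \<oplus>\<^bsub>?L\<^esub> B \<odot>\<^bsub>?L\<^esub> C"
      using xy c st L.frac_smult[of x s z r] L.frac_smult[of y t z r]
        L.frac_add[of "x \<otimes>\<^bsub>R\<^esub> z" "y \<otimes>\<^bsub>R\<^esub> z" "s \<otimes>\<^bsub>R\<^esub> r" "t \<otimes>\<^bsub>R\<^esub> r"] by simp
    finally show "(A \<oplus>\<^bsub>localization_ring R p\<^esub> B) \<otimes>\<^bsub>localization_ring R p\<^esub> C =
      A \<otimes>\<^bsub>localization_ring R p\<^esub> C \<oplus>\<^bsub>localization_ring R p\<^esub> B \<otimes>\<^bsub>localization_ring R p\<^esub> C" by simp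
  qed
qed

lemma localization_hom_hom:
  assumes p: "primeideal p R" shows "localization_hom R p \<in> ring_hom R (localization_ring R p)"
proof -
  interpret P: primeideal p R by fact
  interpret L: localizing p R "self_module R" by (rule localizing_self[OF p])
  show ?thesis
    using L.S_one
    by (intro ring_hom_memI) (auto simp: localization_hom_def localization_ring_simps
        L.frac_add L.frac_smult)
qed

context localizing
begin

lemma localization_ring_cases:
  assumes "A \<in> carrier (localization_ring R p)"
  obtains a s where "A = frac R p (self_module R) a s" "a \<in> carrier R" "s \<in> S"
proof -
  interpret L: localizing p R "self_module R" by (rule localizing_self) unfold_locales
  show ?thesis using assms that
    by (metis L.localization_cases self_module_simps(1) localization_ring_simps(1))
qed

lemma localization_module_module: "module (localization_ring R p) (localization_module R p M)"
proof (rule moduleI)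
  interpret L: localizing p R "self_module R" by (rule localizing_self) unfold_locales
  show "cring (localization_ring R p)" by (rule localization_ring_cring) unfold_locales
  show "abelian_group (localization_module R p M)" by (rule localization_group)
  let ?L = "localization_module R p M"
  {
    fix A X assume A: "A \<in> carrier (localization_ring R p)" and X: "X \<in> carrier ?L"
    obtain a s where a: "A = frac R p (self_module R) a s" "a \<in> carrier R" "s \<in> S"
      using localization_ring_cases[OF A] .
    obtain x t where x: "X = frac R p M x t" "x \<in> carrier M" "t \<in> S"
      using localization_cases[OF X] .
    have c: "s \<in> carrier R" "t \<in> carrier R" using a x by auto
    note st = S_mult[OF a(3) x(3)]
    show "A \<odot>\<^bsub>?L\<^esub> X \<in> carrier ?L"
      using a x st by (simp add: frac_smult)
    {
      fix B assume B: "B \<in> carrier (localization_ring R p)"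
      obtain b r where b: "B = frac R p (self_module R) b r" "b \<in> carrier R" "r \<in> S"
        using localization_ring_cases[OF B] .
      then have c': "r \<in> carrier R" by auto
      note st' = S_mult[OF a(3) b(3)] S_mult[OF b(3) x(3)] 
      note S4 = S_mult[OF st'(1) x(3)] S_mult[OF st st'(2)]
      have "(A \<oplus>\<^bsub>localization_ring R p\<^esub> B) \<odot>\<^bsub>?L\<^esub> X
        = frac R p M ((r \<otimes> a \<oplus> s \<otimes> b) \<odot>\<^bsub>M\<^esub> x) (s \<otimes> r \<otimes> t)"
        using a b x c c' st' L.frac_add[of a b s r] frac_smult[of "r \<otimes> a \<oplus> s \<otimes> b" "s \<otimes> r" x t]
        by (simp add: localization_ring_simps)
      also have "\<dots> = frac R p M ((r \<otimes> t) \<odot>\<^bsub>M\<^esub> (a \<odot>\<^bsub>M\<^esub> x) \<oplus>\<^bsub>M\<^esub> (s \<otimes> t) \<odot>\<^bsub>M\<^esub> (b \<odot>\<^bsub>M\<^esub> x))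
          ((s \<otimes> t) \<otimes> (r \<otimes> t))"
        using a(2) b(2) x(2) c c' S4
        by (intro frac_eqI)
          (simp_all add: M.smult_r_distr M.smult_l_distr M.smult_assoc1[symmetric] P.r_distr P.m_ac)
      also have "\<dots> = A \<odot>\<^bsub>?L\<^esub> X \<oplus>\<^bsub>?L\<^esub> B \<odot>\<^bsub>?L\<^esub> X"
        using a b x st st' by (simp add: frac_smult frac_add)
      finally show "(A \<oplus>\<^bsub>localization_ring R p\<^esub> B) \<odot>\<^bsub>?L\<^esub> X = A \<odot>\<^bsub>?L\<^esub> X \<oplus>\<^bsub>?L\<^esub> B \<odot>\<^bsub>?L\<^esub> X" .
      show "(A \<otimes>\<^bsub>localization_ring R p\<^esub> B) \<odot>\<^bsub>?L\<^esub> X = A \<odot>\<^bsub>?L\<^esub> (B \<odot>\<^bsub>?L\<^esub> X)"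
        using a b x c c' st' L.frac_smult[of a s b r] frac_smult[of "a \<otimes> b" "s \<otimes> r" x t]
          frac_smult[of b r x t] frac_smult[of a s "b \<odot>\<^bsub>M\<^esub> x" "r \<otimes> t"]
        by (simp add: localization_ring_simps M.smult_assoc1 P.m_assoc)
    }
    {
      fix Y assume Y: "Y \<in> carrier ?L"
      obtain y r where y: "Y = frac R p M y r" "y \<in> carrier M" "r \<in> S"
        using localization_cases[OF Y] .
      then have c': "r \<in> carrier R" by auto
      note st' = S_mult[OF a(3) y(3)] S_mult[OF x(3) y(3)]
      note S4 = S_mult[OF a(3) st'(2)] S_mult[OF st st'(1)]
      have "A \<odot>\<^bsub>?L\<^esub> (X \<oplus>\<^bsub>?L\<^esub> Y) = frac R p M (a \<odot>\<^bsub>M\<^esub> (r \<odot>\<^bsub>M\<^esub> x \<oplus>\<^bsub>M\<^esub> t \<odot>\<^bsub>M\<^esub> y)) (s \<otimes> (t \<otimes> r))"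
        using a x y c c' st' by (simp add: frac_add frac_smult)
      also have "\<dots> = frac R p M ((s \<otimes> r) \<odot>\<^bsub>M\<^esub> (a \<odot>\<^bsub>M\<^esub> x) \<oplus>\<^bsub>M\<^esub> (s \<otimes> t) \<odot>\<^bsub>M\<^esub> (a \<odot>\<^bsub>M\<^esub> y))
          ((s \<otimes> t) \<otimes> (s \<otimes> r))"
        using a(2) x(2) y(2) c c' S4
        by (intro frac_eqI)
          (simp_all add: M.smult_r_distr M.smult_assoc1[symmetric] P.m_ac)
      also have "\<dots> = A \<odot>\<^bsub>?L\<^esub> X \<oplus>\<^bsub>?L\<^esub> A \<odot>\<^bsub>?L\<^esub> Y"
        using a x y c c' st st' by (simp add: frac_add frac_smult)
      finally show "A \<odot>\<^bsub>?L\<^esub> (X \<oplus>\<^bsub>?L\<^esub> Y) = A \<odot>\<^bsub>?L\<^esub> X \<oplus>\<^bsub>?L\<^esub> A \<odot>\<^bsub>?L\<^esub> Y" .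
    }
  }
  fix X assume X: "X \<in> carrier ?L"
  obtain x t where x: "X = frac R p M x t" "x \<in> carrier M" "t \<in> S"
    using localization_cases[OF X] .
  then show "\<one>\<^bsub>localization_ring R p\<^esub> \<odot>\<^bsub>?L\<^esub> X = X"
    using S_one frac_smult[of \<one> \<one> x t] by (simp add: localization_ring_simps)
qed

end

lemma localizing_intro: "primeideal p R \<Longrightarrow> module R M \<Longrightarrow> localizing p R M"
  by (rule localizing.intro)

subsection \<open>Localization commutes with homology\<close>

lemma (in lin) UN_frac_image:
  assumes p: "primeideal p R" and x: "x \<in> carrier M" "s \<in> carrier R - p"
  shows "(\<Union>(y, t) \<in> frac R p M x s. frac R p N (f y) t) = frac R p N (f x) s"
proof -
  interpret LM: localizing p R M by (rule localizing_intro[OF p M.module_axioms])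
  interpret LN: localizing p R N by (rule localizing_intro[OF p N.module_axioms])
  have "(\<Union>(y, t) \<in> frac R p M x s \<inter> UNIV. frac R p N (f y) t) = frac R p N (f x) s"
  proof (rule LM.UN_frac[OF x])
    fix y t assume y: "y \<in> carrier M" "t \<in> carrier R - p"
      and "\<exists>u\<in>carrier R - p. u \<odot>\<^bsub>M\<^esub> (t \<odot>\<^bsub>M\<^esub> x) = u \<odot>\<^bsub>M\<^esub> (s \<odot>\<^bsub>M\<^esub> y)"
    then obtain u where u: "u \<in> carrier R - p" "u \<odot>\<^bsub>M\<^esub> (t \<odot>\<^bsub>M\<^esub> x) = u \<odot>\<^bsub>M\<^esub> (s \<odot>\<^bsub>M\<^esub> y)" by meson
    have "f (u \<odot>\<^bsub>M\<^esub> (t \<odot>\<^bsub>M\<^esub> x)) = f (u \<odot>\<^bsub>M\<^esub> (s \<odot>\<^bsub>M\<^esub> y))" by (simp only: u(2))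
    then have "u \<odot>\<^bsub>N\<^esub> (s \<odot>\<^bsub>N\<^esub> f y) = u \<odot>\<^bsub>N\<^esub> (t \<odot>\<^bsub>N\<^esub> f x)" using x y u(1) by simp
    then show "frac R p N (f y) t = frac R p N (f x) s"
      using x y u(1) by (subst LN.frac_eq_iff) auto
  qed simp
  then show ?thesis by simp
qed

lemma localization_complex_diff:
  assumes p: "primeideal p R" and X: "chain_complex R X"
    and x: "x \<in> carrier (obj X n)" "s \<in> carrier R - p"
  shows "diff (localization_complex R p X) n (frac R p (obj X n) x s)
    = frac R p (obj X (n - 1)) (diff X n x) s"
proof -
  interpret d: lin R "obj X n" "obj X (n - 1)" "diff X n" by (intro linI chain_complexD X)
  show ?thesis using d.UN_frac_image[OF p x] by (simp add: localization_complex_def)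
qed

lemma localization_complex_complex:
  assumes p: "primeideal p R" and X: "chain_complex R X"
  shows "chain_complex (localization_ring R p) (localization_complex R p X)"
proof -
  note C = chain_complexD[OF X]
  have L: "localizing p R (obj X n)" for n by (rule localizing_intro[OF p C(1)])
  let ?L = "localization_complex R p X"
  have o: "obj ?L n = localization_module R p (obj X n)" for n
    by (simp add: localization_complex_def)
  note D = localization_complex_diff[OF p X]
  have cl: "diff X n x \<in> carrier (obj X (n - 1))" if "x \<in> carrier (obj X n)" for n x
    using linear_map_closed[OF C(2) that] .
  show ?thesis unfolding chain_complex_def
  proof (intro conjI allI ballI)
    fix n
    interpret X: localizing p R "obj X n" by (rule L)
    interpret Y: localizing p R "obj X (n - 1)" by (rule L)
    interpret d: lin R "obj X n" "obj X (n - 1)" "diff X n" by (intro linI C)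
    interpret S: localizing p R "self_module R" by (rule localizing_self[OF p])
    show "module (localization_ring R p) (obj ?L n)"
      unfolding o by (rule X.localization_module_module)
    show "linear_map (localization_ring R p) (obj ?L n) (obj ?L (n - 1)) (diff ?L n)"
      unfolding o
    proof (rule linear_mapI)
      fix A assume "A \<in> carrier (localization_module R p (obj X n))"
      then obtain x s where x: "A = frac R p (obj X n) x s" "x \<in> carrier (obj X n)" "s \<in> carrier R - p"
        by (rule X.localization_cases)
      then have [simp]: "s \<in> carrier R" by simp
      show "diff ?L n A \<in> carrier (localization_module R p (obj X (n - 1)))"
        unfolding x(1) D[OF x(2,3)] using x by simp
      {
        fix B assume "B \<in> carrier (localization_module R p (obj X n))"
        then obtain y t where y: "B = frac R p (obj X n) y t" "y \<in> carrier (obj X n)" "t \<in> carrier R - p"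
          by (rule X.localization_cases)
        then have [simp]: "t \<in> carrier R" by simp
        show "diff ?L n (A \<oplus>\<^bsub>localization_module R p (obj X n)\<^esub> B)
          = diff ?L n A \<oplus>\<^bsub>localization_module R p (obj X (n - 1))\<^esub> diff ?L n B"
          unfolding x(1) y(1) D[OF x(2,3)] D[OF y(2,3)] X.frac_add[OF x(2) y(2) x(3) y(3)]
            Y.frac_add[OF d.closed[OF x(2)] d.closed[OF y(2)] x(3) y(3)]
          using x(2) y(2) X.S_mult[OF x(3) y(3)] by (subst D) simp_all
      }
      {
        fix B assume "B \<in> carrier (localization_ring R p)"
        then obtain a t where y: "B = frac R p (self_module R) a t" "a \<in> carrier R" "t \<in> carrier R - p"
          by (rule X.localization_ring_cases)
        show "diff ?L n (B \<odot>\<^bsub>localization_module R p (obj X n)\<^esub> A)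
          = B \<odot>\<^bsub>localization_module R p (obj X (n - 1))\<^esub> diff ?L n A"
          unfolding x(1) y(1) D[OF x(2,3)] X.frac_smult[OF y(2,3) x(2,3)]
            Y.frac_smult[OF y(2,3) d.closed[OF x(2)] x(3)]
          using x(2) y(2) X.S_mult[OF y(3) x(3)] by (subst D) simp_all
      }
    qed
    fix A assume "A \<in> carrier (obj ?L n)"
    then obtain x s where x: "A = frac R p (obj X n) x s" "x \<in> carrier (obj X n)" "s \<in> carrier R - p"
      unfolding o by (rule X.localization_cases)
    interpret Z: localizing p R "obj X (n - 2)" by (rule L)
    show "diff ?L (n - 1) (diff ?L n A) = \<zero>\<^bsub>obj ?L (n - 2)\<^esub>"
      unfolding x(1) D[OF x(2,3)] D[OF d.closed[OF x(2)] x(3)] C(3)[OF x(2)] o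
      using Z.frac_eq_zero_iff[of "\<zero>\<^bsub>obj X (n - 2)\<^esub>" s] x(3) by auto
  qed
qed

text \<open>Some element outside \<open>p\<close> kills the differential of the numerator of a fraction that is a cycle. On
  multiplying numerator and denominator by it, the numerator becomes a cycle, and the class of the
  fraction is computed from representatives of this kind.\<close>

lemma localization_is_homology:
  assumes p: "primeideal p R" and X: "chain_complex R X" and H: "is_homology R X j H \<pi>"
  shows "is_homology (localization_ring R p) (localization_complex R p X) j
    (localization_module R p H)
    (\<lambda>C. \<Union>(x, s) \<in> C \<inter> (cycles X j \<times> UNIV). frac R p H (\<pi> x) s)"
proof -
  note C = chain_complexD[OF X]
  note HD = is_homologyD[OF H]
  let ?L = "localization_complex R p X"
  let ?p = "\<lambda>C. \<Union>(x, s) \<in> C \<inter> (cycles X j \<times> UNIV). frac R p H (\<pi> x) s"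
  have o: "obj ?L n = localization_module R p (obj X n)" for n
    by (simp add: localization_complex_def)
  interpret X: localizing p R "obj X j" by (rule localizing_intro[OF p C(1)])
  interpret Y: localizing p R "obj X (j - 1)" by (rule localizing_intro[OF p C(1)])
  interpret W: localizing p R "obj X (j + 1)" by (rule localizing_intro[OF p C(1)])
  interpret H: localizing p R H by (rule localizing_intro[OF p HD(1)])
  interpret d: lin R "obj X j" "obj X (j - 1)" "diff X j" by (intro linI C)
  have d1: "linear_map R (obj X (j + 1)) (obj X j) (diff X (j + 1))" using C(2)[of "j + 1"] by simp
  interpret d1: lin R "obj X (j + 1)" "obj X j" "diff X (j + 1)" by (intro linI C d1)
  have Z: "submodule (cycles X j) R (obj X j)" by (intro cycles_submodule C)
  note ZE = X.M.submoduleE[OF Z]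
  have Zc: "z \<in> carrier (obj X j)" if "z \<in> cycles X j" for z using ZE(1) that by (rule subsetD)
  note D = localization_complex_diff[OF p X]
  have cyc: "\<exists>z s. A = frac R p (obj X j) z s \<and> z \<in> cycles X j \<and> s \<in> carrier R - p"
    if A: "A \<in> cycles ?L j" for A
  proof -
    have "A \<in> carrier (localization_module R p (obj X j))" using A by (simp add: cycles_def o)
    then obtain x s where x: "A = frac R p (obj X j) x s" "x \<in> carrier (obj X j)" "s \<in> carrier R - p"
      by (rule X.localization_cases)
    have "frac R p (obj X (j - 1)) (diff X j x) s = \<zero>\<^bsub>localization_module R p (obj X (j - 1))\<^esub>"
      using A by (simp add: cycles_def o x(1) D[OF x(2,3)])
    then obtain u where u: "u \<in> carrier R - p" "u \<odot>\<^bsub>obj X (j - 1)\<^esub> diff X j x = \<zero>\<^bsub>obj X (j - 1)\<^esub>"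
      using Y.frac_eq_zero_iff[OF d.closed[OF x(2)] x(3)] by meson
    have "u \<odot>\<^bsub>obj X j\<^esub> x \<in> cycles X j" using u x(2) by (simp add: cycles_def)
    moreover have "A = frac R p (obj X j) (u \<odot>\<^bsub>obj X j\<^esub> x) (u \<otimes>\<^bsub>R\<^esub> s)"
      using X.frac_cancel[OF x(2,3) u(1)] x(1) by simp
    ultimately show ?thesis using X.S_mult[OF u(1) x(3)] by (intro exI conjI)
  qed
  have cyc': "frac R p (obj X j) z s \<in> cycles ?L j" if "z \<in> cycles X j" "s \<in> carrier R - p" for z s
    using that Zc[OF that(1)] Y.frac_eq_zero_iff[of "\<zero>\<^bsub>obj X (j - 1)\<^esub>" s] X.S_one
    by (auto simp: cycles_def o D)
  have pf: "?p (frac R p (obj X j) z s) = frac R p H (\<pi> z) s"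
    if z: "z \<in> cycles X j" "s \<in> carrier R - p" for z s
  proof (rule X.UN_frac[OF Zc[OF z(1)] z(2)])
    fix y t assume y: "y \<in> carrier (obj X j)" "t \<in> carrier R - p" "(y, t) \<in> cycles X j \<times> UNIV"
      and "\<exists>u\<in>carrier R - p. u \<odot>\<^bsub>obj X j\<^esub> (t \<odot>\<^bsub>obj X j\<^esub> z) = u \<odot>\<^bsub>obj X j\<^esub> (s \<odot>\<^bsub>obj X j\<^esub> y)"
    then obtain u where u: "u \<in> carrier R - p"
      "u \<odot>\<^bsub>obj X j\<^esub> (t \<odot>\<^bsub>obj X j\<^esub> z) = u \<odot>\<^bsub>obj X j\<^esub> (s \<odot>\<^bsub>obj X j\<^esub> y)" by meson
    note c = X.S_carrier[OF z(2)] X.S_carrier[OF y(2)] X.S_carrier[OF u(1)]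
    have yZ: "y \<in> cycles X j" using y(3) by simp
    have "\<pi> (u \<odot>\<^bsub>obj X j\<^esub> (t \<odot>\<^bsub>obj X j\<^esub> z)) = \<pi> (u \<odot>\<^bsub>obj X j\<^esub> (s \<odot>\<^bsub>obj X j\<^esub> y))" by (simp only: u(2))
    then have "u \<odot>\<^bsub>H\<^esub> (t \<odot>\<^bsub>H\<^esub> \<pi> z) = u \<odot>\<^bsub>H\<^esub> (s \<odot>\<^bsub>H\<^esub> \<pi> y)"
      using c yZ z(1) ZE(4) by (simp add: HD(4))
    then show "frac R p H (\<pi> y) t = frac R p H (\<pi> z) s"
      using z(2) y(2) u(1) HD(2)[OF z(1)] HD(2)[OF yZ]
      by (subst H.frac_eq_iff) (auto intro!: bexI[OF _ u(1)])
  qed (use z in simp)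
  show ?thesis unfolding is_homology_def
  proof (intro conjI ballI)
    show "module (localization_ring R p) (localization_module R p H)"
      by (rule H.localization_module_module)
    show "linear_map (localization_ring R p) ((obj ?L j)\<lparr>carrier := cycles ?L j\<rparr>)
        (localization_module R p H) ?p"
    proof (rule linear_mapI)
      fix A assume "A \<in> carrier ((obj ?L j)\<lparr>carrier := cycles ?L j\<rparr>)"
      then have "A \<in> cycles ?L j" by simp
      from cyc[OF this] obtain z s where z: "A = frac R p (obj X j) z s" "z \<in> cycles X j"
        "s \<in> carrier R - p" by blast
      have c: "s \<in> carrier R" using z(3) by simp
      show "?p A \<in> carrier (localization_module R p H)"
        unfolding z(1) pf[OF z(2,3)] using z HD(2) by simp
      {
        fix B assume "B \<in> carrier ((obj ?L j)\<lparr>carrier := cycles ?L j\<rparr>)"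
        then have "B \<in> cycles ?L j" by simp
        from cyc[OF this] obtain w t where w: "B = frac R p (obj X j) w t" "w \<in> cycles X j"
          "t \<in> carrier R - p" by blast
        have c': "t \<in> carrier R" using w(3) by simp
        have "t \<odot>\<^bsub>obj X j\<^esub> z \<oplus>\<^bsub>obj X j\<^esub> s \<odot>\<^bsub>obj X j\<^esub> w \<in> cycles X j"
          using ZE(4,5) z(2) w(2) c c' by simp
        from pf[OF this X.S_mult[OF z(3) w(3)]]
        have "?p (A \<oplus>\<^bsub>obj ?L j\<^esub> B) = ?p A \<oplus>\<^bsub>localization_module R p H\<^esub> ?p B"
          unfolding z(1) w(1) o X.frac_add[OF Zc[OF z(2)] Zc[OF w(2)] z(3) w(3)]
            pf[OF z(2,3)] pf[OF w(2,3)] H.frac_add[OF HD(2)[OF z(2)] HD(2)[OF w(2)] z(3) w(3)]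
          using c c' ZE(4) z(2) w(2) by (simp add: HD(3,4))
        then show "?p (A \<oplus>\<^bsub>(obj ?L j)\<lparr>carrier := cycles ?L j\<rparr>\<^esub> B)
          = ?p A \<oplus>\<^bsub>localization_module R p H\<^esub> ?p B" by simp
      }
      {
        fix B assume "B \<in> carrier (localization_ring R p)"
        then obtain a t where a: "B = frac R p (self_module R) a t" "a \<in> carrier R" "t \<in> carrier R - p"
          by (rule X.localization_ring_cases)
        from pf[OF ZE(4)[OF a(2) z(2)] X.S_mult[OF a(3) z(3)]]
        have "?p (B \<odot>\<^bsub>obj ?L j\<^esub> A) = B \<odot>\<^bsub>localization_module R p H\<^esub> ?p A"
          unfolding z(1) a(1) o X.frac_smult[OF a(2,3) Zc[OF z(2)] z(3)]
            pf[OF z(2,3)] H.frac_smult[OF a(2,3) HD(2)[OF z(2)] z(3)]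
          using a(2) z(2) by (simp add: HD(4))
        then show "?p (B \<odot>\<^bsub>(obj ?L j)\<lparr>carrier := cycles ?L j\<rparr>\<^esub> A)
          = B \<odot>\<^bsub>localization_module R p H\<^esub> ?p A" by simp
      }
    qed
    show "?p ` cycles ?L j = carrier (localization_module R p H)"
    proof (intro equalityI subsetI)
      fix B assume "B \<in> ?p ` cycles ?L j"
      then obtain A where A: "A \<in> cycles ?L j" "B = ?p A" by (rule imageE)
      from cyc[OF A(1)] obtain z s where z: "A = frac R p (obj X j) z s" "z \<in> cycles X j"
        "s \<in> carrier R - p" by blast
      show "B \<in> carrier (localization_module R p H)"
        unfolding A(2) z(1) pf[OF z(2,3)] using z HD(2) by simp
    next
      fix B assume "B \<in> carrier (localization_module R p H)"
      then obtain h s where h: "B = frac R p H h s" "h \<in> carrier H" "s \<in> carrier R - p"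
        by (rule H.localization_cases)
      obtain z where z: "z \<in> cycles X j" "\<pi> z = h" using HD(5)[OF h(2)] by meson
      have "B = ?p (frac R p (obj X j) z s)" unfolding pf[OF z(1) h(3)] using z(2) h(1) by simp
      then show "B \<in> ?p ` cycles ?L j" using cyc'[OF z(1) h(3)] by (rule image_eqI)
    qed
    fix A assume A: "A \<in> cycles ?L j"
    from cyc[OF A] obtain z s where z: "A = frac R p (obj X j) z s" "z \<in> cycles X j"
      "s \<in> carrier R - p" by blast
    show "?p A = \<zero>\<^bsub>localization_module R p H\<^esub> \<longleftrightarrow> A \<in> boundaries ?L j"
    proof
      assume "?p A = \<zero>\<^bsub>localization_module R p H\<^esub>"
      then have "frac R p H (\<pi> z) s = \<zero>\<^bsub>localization_module R p H\<^esub>"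
        unfolding z(1) pf[OF z(2,3)] .
      then obtain u where u: "u \<in> carrier R - p" "u \<odot>\<^bsub>H\<^esub> \<pi> z = \<zero>\<^bsub>H\<^esub>"
        using H.frac_eq_zero_iff[OF HD(2)[OF z(2)] z(3)] by meson
      have uz: "u \<odot>\<^bsub>obj X j\<^esub> z \<in> cycles X j" using ZE(4) u(1) z(2) by simp
      have "\<pi> (u \<odot>\<^bsub>obj X j\<^esub> z) = \<zero>\<^bsub>H\<^esub>"
        using HD(4)[OF X.S_carrier[OF u(1)] z(2)] u(2) by (rule trans)
      then have "u \<odot>\<^bsub>obj X j\<^esub> z \<in> boundaries X j" using HD(6)[OF uz] by simp
      then obtain w where w: "w \<in> carrier (obj X (j + 1))" "u \<odot>\<^bsub>obj X j\<^esub> z = diff X (j + 1) w"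
        by (auto simp: boundaries_def)
      have "A = frac R p (obj X j) (u \<odot>\<^bsub>obj X j\<^esub> z) (u \<otimes>\<^bsub>R\<^esub> s)"
        using X.frac_cancel[OF Zc[OF z(2)] z(3) u(1)] z(1) by simp
      also have "\<dots> = diff ?L (j + 1) (frac R p (obj X (j + 1)) w (u \<otimes>\<^bsub>R\<^esub> s))"
        using D[OF w(1) X.S_mult[OF u(1) z(3)]] w(2) by simp
      finally show "A \<in> boundaries ?L j"
        unfolding boundaries_def o
        using W.frac_in_carrier[OF w(1) X.S_mult[OF u(1) z(3)]] by (rule image_eqI)
    next
      assume "A \<in> boundaries ?L j"
      then obtain B where B: "B \<in> carrier (localization_module R p (obj X (j + 1)))"
        "A = diff ?L (j + 1) B" by (auto simp: boundaries_def o)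
      obtain w t where w: "B = frac R p (obj X (j + 1)) w t" "w \<in> carrier (obj X (j + 1))"
        "t \<in> carrier R - p" using W.localization_cases[OF B(1)] .
      note c = X.S_carrier[OF z(3)] X.S_carrier[OF w(3)]
      have "frac R p (obj X j) z s = frac R p (obj X j) (diff X (j + 1) w) t"
        using B(2) z(1) w D[OF w(2,3)] by simp
      then obtain u where u: "u \<in> carrier R - p"
        "u \<odot>\<^bsub>obj X j\<^esub> (t \<odot>\<^bsub>obj X j\<^esub> z) = u \<odot>\<^bsub>obj X j\<^esub> (s \<odot>\<^bsub>obj X j\<^esub> diff X (j + 1) w)"
        using X.frac_eq_iff[OF Zc[OF z(2)] d1.closed[OF w(2)] z(3) w(3)] by meson
      note c = c X.S_carrier[OF u(1)]
      have "diff X (j + 1) (u \<odot>\<^bsub>obj X (j + 1)\<^esub> (s \<odot>\<^bsub>obj X (j + 1)\<^esub> w)) \<in> boundaries X j"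
        unfolding boundaries_def using c w(2) by (intro imageI) simp
      then have b: "u \<odot>\<^bsub>obj X j\<^esub> (t \<odot>\<^bsub>obj X j\<^esub> z) \<in> boundaries X j"
        using u(2) c w(2) by simp
      have "u \<odot>\<^bsub>obj X j\<^esub> (t \<odot>\<^bsub>obj X j\<^esub> z) \<in> cycles X j" using ZE(4) c z(2) by simp
      with b have "\<pi> (u \<odot>\<^bsub>obj X j\<^esub> (t \<odot>\<^bsub>obj X j\<^esub> z)) = \<zero>\<^bsub>H\<^esub>" using HD(6) by simp
      then have "(u \<otimes>\<^bsub>R\<^esub> t) \<odot>\<^bsub>H\<^esub> \<pi> z = \<zero>\<^bsub>H\<^esub>"
        using c z(2) ZE(4) HD(2) by (simp add: HD(4) H.M.smult_assoc1)
      then have "frac R p H (\<pi> z) s = \<zero>\<^bsub>localization_module R p H\<^esub>"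
        using X.S_mult[OF u(1) w(3)]
        by (intro iffD2[OF H.frac_eq_zero_iff[OF HD(2)[OF z(2)] z(3)]] bexI)
      then show "?p A = \<zero>\<^bsub>localization_module R p H\<^esub>" unfolding z(1) pf[OF z(2,3)] .
    qed
  qed
qed


section \<open>Vanishing in the derived category\<close>

lemma homology_carrier:
  "chain_complex R X \<Longrightarrow>
    carrier (homology X n) = (\<lambda>z. boundaries X n +>\<^bsub>obj X n\<^esub> z) ` cycles X n"
  using submod.quotient_carrier[OF homology_boundaries_submodule] by (simp add: homology_def)

lemma homology_coset_eq_iff:
  assumes X: "chain_complex R X" and z: "z \<in> cycles X n" "w \<in> cycles X n"
  shows "boundaries X n +>\<^bsub>obj X n\<^esub> z = boundaries X n +>\<^bsub>obj X n\<^esub> w \<longleftrightarrow>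
    z \<ominus>\<^bsub>obj X n\<^esub> w \<in> boundaries X n"
proof -
  note C = chain_complexD[OF X]
  interpret X: module R "obj X n" by (rule C)
  have Z: "submodule (cycles X n) R (obj X n)" by (intro cycles_submodule C)
  have zc: "z \<in> carrier (obj X n)" "w \<in> carrier (obj X n)" using z by (auto simp: cycles_def)
  have "submod R (obj X n) (boundaries X n)"
    by (intro submod.intro submod_axioms.intro boundaries_submodule C)
  then show ?thesis by (rule submod.coset_eq_iff[OF _ zc])
qed

text \<open>Bijectivity on homology, expressed by cycles and boundaries instead of cosets.\<close>

lemma quasi_isoI:
  assumes Z: "chain_complex R Z" and Y: "chain_complex R Y" and f: "chain_map R Z Y f"
    and inj: "\<And>n z. z \<in> cycles Z n \<Longrightarrow> f n z \<in> boundaries Y n \<Longrightarrow> z \<in> boundaries Z n"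
    and surj: "\<And>n y. y \<in> cycles Y n \<Longrightarrow> \<exists>z\<in>cycles Z n. f n z \<ominus>\<^bsub>obj Y n\<^esub> y \<in> boundaries Y n"
  shows "quasi_iso R Z Y f"
  unfolding quasi_iso_def
proof (intro conjI allI, rule f)
  fix n
  note CZ = chain_complexD[OF Z] and CY = chain_complexD[OF Y]
  interpret f: lin R "obj Z n" "obj Y n" "f n"
    using f by (intro linI CZ CY) (simp add: chain_map_def)
  have comm: "f (n - 1) (diff Z n x) = diff Y n (f n x)" if "x \<in> carrier (obj Z n)" for n x
    using f that by (simp add: chain_map_def)
  interpret f0: lin R "obj Z (n - 1)" "obj Y (n - 1)" "f (n - 1)"
    using f by (intro linI CZ CY) (simp add: chain_map_def)
  have Zc: "z \<in> carrier (obj Z n)" if "z \<in> cycles Z n" for z using that by (simp add: cycles_def)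
  have fZ: "f n z \<in> cycles Y n" if "z \<in> cycles Z n" for z
  proof -
    have "diff Z n z = \<zero>\<^bsub>obj Z (n - 1)\<^esub>" using that by (simp add: cycles_def)
    then have "diff Y n (f n z) = \<zero>\<^bsub>obj Y (n - 1)\<^esub>" using comm[OF Zc[OF that]] f0.zero by simp
    then show ?thesis using f.closed[OF Zc[OF that]] by (simp add: cycles_def)
  qed
  have fB: "f n b \<in> boundaries Y n" if "b \<in> boundaries Z n" for b
  proof -
    obtain w where w: "w \<in> carrier (obj Z (n + 1))" "b = diff Z (n + 1) w"
      using \<open>b \<in> boundaries Z n\<close> by (auto simp: boundaries_def)
    have "f n b = diff Y (n + 1) (f (n + 1) w)" using comm[OF w(1)] w(2) by simp
    moreover have "f (n + 1) w \<in> carrier (obj Y (n + 1))"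
      using f w(1) by (auto simp: chain_map_def linear_map_def)
    ultimately show ?thesis unfolding boundaries_def by (rule image_eqI)
  qed
  have B: "submod R (obj Z n) (boundaries Z n)"
    by (intro submod.intro submod_axioms.intro boundaries_submodule CZ)
  have BZ: "submodule (boundaries Z n) R (obj Z n)" using B by (simp add: submod_def submod_axioms_def)
  have ZZ: "submodule (cycles Z n) R (obj Z n)" by (intro cycles_submodule CZ)
  note ZE = f.M.submoduleE[OF ZZ]
  have hm: "homology_map Z Y f n (boundaries Z n +>\<^bsub>obj Z n\<^esub> z) = boundaries Y n +>\<^bsub>obj Y n\<^esub> f n z"
    if z: "z \<in> cycles Z n" for z
  proof -
    have "boundaries Y n +>\<^bsub>obj Y n\<^esub> f n c = boundaries Y n +>\<^bsub>obj Y n\<^esub> f n z"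
      if c: "c \<in> boundaries Z n +>\<^bsub>obj Z n\<^esub> z" for c
    proof -
      have cz: "c \<in> carrier (obj Z n)" "c \<ominus>\<^bsub>obj Z n\<^esub> z \<in> boundaries Z n"
        using submod.coset_memberD[OF B c Zc[OF z]] by auto
      have "c = (c \<ominus>\<^bsub>obj Z n\<^esub> z) \<oplus>\<^bsub>obj Z n\<^esub> z"
        using cz(1) Zc[OF z] by (simp add: f.M.M.minus_eq f.M.M.a_assoc f.M.M.l_neg)
      moreover have "c \<ominus>\<^bsub>obj Z n\<^esub> z \<in> cycles Z n"
        using boundaries_subset_cycles[OF Z] cz(2) by (rule subsetD)
      ultimately have "c \<in> cycles Z n" using ZE(5)[OF _ z] by metis
      moreover have "f n c \<ominus>\<^bsub>obj Y n\<^esub> f n z \<in> boundaries Y n"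
        using fB[OF cz(2)] cz(1) Zc[OF z] by simp
      ultimately show ?thesis using homology_coset_eq_iff[OF Y] fZ z by blast
    qed
    then have "(\<Union>c\<in>boundaries Z n +>\<^bsub>obj Z n\<^esub> z. boundaries Y n +>\<^bsub>obj Y n\<^esub> f n c)
      = boundaries Y n +>\<^bsub>obj Y n\<^esub> f n z"
      by (intro UN_constant_eq[OF submod.coset_self[OF B Zc[OF z]]] ballI)
    moreover have "boundaries Z n +>\<^bsub>obj Z n\<^esub> z \<in> carrier (homology Z n)"
      unfolding homology_carrier[OF Z] using z by (rule imageI)
    ultimately show ?thesis by (simp add: homology_map_def)
  qed
  show "bij_betw (homology_map Z Y f n) (carrier (homology Z n)) (carrier (homology Y n))"
    unfolding bij_betw_def
  proof
    show "inj_on (homology_map Z Y f n) (carrier (homology Z n))"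
    proof (rule inj_onI)
      fix C C' assume "C \<in> carrier (homology Z n)" "C' \<in> carrier (homology Z n)"
        and eq: "homology_map Z Y f n C = homology_map Z Y f n C'"
      then obtain z w where z: "z \<in> cycles Z n" "C = boundaries Z n +>\<^bsub>obj Z n\<^esub> z"
        and w: "w \<in> cycles Z n" "C' = boundaries Z n +>\<^bsub>obj Z n\<^esub> w"
        unfolding homology_carrier[OF Z] by blast
      have "f n z \<ominus>\<^bsub>obj Y n\<^esub> f n w \<in> boundaries Y n"
        using eq homology_coset_eq_iff[OF Y fZ[OF z(1)] fZ[OF w(1)]]
        unfolding z(2) w(2) hm[OF z(1)] hm[OF w(1)] by simp
      then have "f n (z \<ominus>\<^bsub>obj Z n\<^esub> w) \<in> boundaries Y n" using Zc z(1) w(1) by simp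
      moreover have "z \<ominus>\<^bsub>obj Z n\<^esub> w \<in> cycles Z n"
        unfolding a_minus_def by (intro ZE(3,5) z(1) w(1))
      ultimately show "C = C'"
        unfolding z(2) w(2) using inj homology_coset_eq_iff[OF Z z(1) w(1)] by simp
    qed
    show "homology_map Z Y f n ` carrier (homology Z n) = carrier (homology Y n)"
    proof (intro equalityI subsetI)
      fix D assume "D \<in> homology_map Z Y f n ` carrier (homology Z n)"
      then obtain z where "z \<in> cycles Z n" "D = homology_map Z Y f n (boundaries Z n +>\<^bsub>obj Z n\<^esub> z)"
        unfolding homology_carrier[OF Z] by blast
      then show "D \<in> carrier (homology Y n)"
        unfolding homology_carrier[OF Y] using hm fZ by simp
    next
      fix D assume "D \<in> carrier (homology Y n)"
      then obtain y where y: "y \<in> cycles Y n" "D = boundaries Y n +>\<^bsub>obj Y n\<^esub> y"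
        unfolding homology_carrier[OF Y] by blast
      obtain z where z: "z \<in> cycles Z n" "f n z \<ominus>\<^bsub>obj Y n\<^esub> y \<in> boundaries Y n"
        using surj[OF y(1)] by blast
      then have "D = homology_map Z Y f n (boundaries Z n +>\<^bsub>obj Z n\<^esub> z)"
        using homology_coset_eq_iff[OF Y fZ[OF z(1)] y(1)] hm[OF z(1)] y(2) by simp
      then show "D \<in> homology_map Z Y f n ` carrier (homology Z n)"
        unfolding homology_carrier[OF Z] using z(1) by (intro image_eqI[OF _ imageI])
    qed
  qed
qed

lemma exact_quasi_iso:
  assumes Z: "chain_complex R Z" and Y: "chain_complex R Y" and f: "chain_map R Z Y f"
    and "exact_complex Z" "exact_complex Y"
  shows "quasi_iso R Z Y f"
proof (rule quasi_isoI[OF Z Y f])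
  show "z \<in> boundaries Z n" if "z \<in> cycles Z n" for n z
    using that assms(4) unfolding exact_complex_def by blast
  fix n y assume y: "y \<in> cycles Y n"
  note CZ = chain_complexD[OF Z] and CY = chain_complexD[OF Y]
  interpret f: lin R "obj Z n" "obj Y n" "f n"
    using f by (intro linI CZ CY) (simp add: chain_map_def)
  have ZZ: "submodule (cycles Z n) R (obj Z n)" by (intro cycles_submodule CZ)
  have ZY: "submodule (cycles Y n) R (obj Y n)" by (intro cycles_submodule CY)
  have "f n \<zero>\<^bsub>obj Z n\<^esub> \<ominus>\<^bsub>obj Y n\<^esub> y \<in> cycles Y n"
    unfolding f.zero a_minus_def by (intro f.N.submoduleE[OF ZY] f.N.submodule_zero[OF ZY] y)
  then have "f n \<zero>\<^bsub>obj Z n\<^esub> \<ominus>\<^bsub>obj Y n\<^esub> y \<in> boundaries Y n"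
    using assms(5) unfolding exact_complex_def by blast
  then show "\<exists>z\<in>cycles Z n. f n z \<ominus>\<^bsub>obj Y n\<^esub> y \<in> boundaries Y n"
    using f.M.submodule_zero[OF ZZ] by (rule bexI)
qed

lemma zero_complex_complex: "cring R \<Longrightarrow> chain_complex R zero_complex"
  unfolding zero_complex_def by (intro concentrated_complex zero_module_module)

lemma exact_concentrated_zero:
  assumes "carrier N = {\<zero>\<^bsub>N\<^esub>}" shows "exact_complex (concentrated N)"
  unfolding exact_complex_def by (auto simp: cycles_def boundaries_def assms split: if_splits)

text \<open>A roof of quasi-isomorphisms between \<open>X\<close> and zero makes the homology of \<open>X\<close> a one-element set. Conversely,
  an exact complex and the zero complex are joined by a copy of zero of the type that the middle of
  a roof must have.\<close>

theorem derived_iso_zero_iff: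
  fixes R :: "('a, 'r) ring_scheme" and X :: "('a, 'x) cplx"
  assumes R: "cring R" and X: "chain_complex R X"
  shows "derived_iso R X zero_complex \<longleftrightarrow> exact_complex X"
proof
  assume "derived_iso R X zero_complex"
  then obtain Z :: "('a, ('a + 'x) list) cplx" and f g where "chain_complex R Z"
    and q: "quasi_iso R Z X f" "quasi_iso R Z zero_complex g"
    unfolding derived_iso_def by blast
  note O = zero_complex_complex[OF R]
  show "exact_complex X" unfolding exact_complex_def
  proof (intro allI subsetI)
    fix n x assume x: "x \<in> cycles X n"
    interpret B: submod R "(obj X n)\<lparr>carrier := cycles X n\<rparr>" "boundaries X n"
      by (rule homology_boundaries_submodule[OF X])
    let ?O = "zero_complex :: ('a, unit) cplx"
    have cyc: "cycles ?O n = {()}" by (auto simp: cycles_def zero_complex_def zero_module_def)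
    have "carrier (homology ?O n) = {boundaries ?O n +>\<^bsub>obj ?O n\<^esub> ()}"
      unfolding homology_carrier[OF O] cyc by simp
    then have "card (carrier (homology ?O n)) = 1" by simp
    moreover have "bij_betw (homology_map Z X f n) (carrier (homology Z n)) (carrier (homology X n))"
      "bij_betw (homology_map Z ?O g n) (carrier (homology Z n)) (carrier (homology ?O n))"
      using q unfolding quasi_iso_def by blast+
    ultimately have "card (carrier (homology X n)) = 1" by (metis bij_betw_same_card)
    then obtain c where c: "carrier (homology X n) = {c}" by (rule card_1_singletonE)
    have x': "x \<in> carrier ((obj X n)\<lparr>carrier := cycles X n\<rparr>)" using x by simp
    have "boundaries X n +>\<^bsub>obj X n\<^esub> x = c"
      using c x unfolding homology_carrier[OF X] by blast
    moreover have "boundaries X n +>\<^bsub>obj X n\<^esub> \<zero>\<^bsub>obj X n\<^esub> = c"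
      using c B.M.M.zero_closed unfolding homology_carrier[OF X] by auto
    ultimately show "x \<in> boundaries X n"
      using B.coset_eq_zero_iff[OF x'] B.coset_zero by simp
  qed
next
  assume ex: "exact_complex X"
  define N :: "('a, ('a + 'x) list) module" where "N = \<lparr>carrier = {[]}, mult = undefined,
    one = undefined, zero = [], add = \<lambda>_ _. [], smult = \<lambda>_ _. []\<rparr>"
  have N: "module R N"
    by (rule module_surj_image[OF zero_module_module[OF R], where p = "\<lambda>_. []"])
      (auto simp: N_def zero_module_def)
  let ?Z = "concentrated N"
  have Z: "chain_complex R ?Z" by (rule concentrated_complex[OF N])
  have eZ: "exact_complex ?Z" by (rule exact_concentrated_zero) (simp add: N_def)
  note C = chain_complexD[OF X] and O = zero_complex_complex[OF R]
  have "chain_map R ?Z X (\<lambda>n _. \<zero>\<^bsub>obj X n\<^esub>)"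
    unfolding chain_map_def
  proof (intro conjI allI ballI)
    fix n
    interpret X: module R "obj X n" by (rule C)
    interpret d: lin R "obj X n" "obj X (n - 1)" "diff X n" by (intro linI C)
    show "linear_map R (obj ?Z n) (obj X n) (\<lambda>_. \<zero>\<^bsub>obj X n\<^esub>)" by (rule linear_mapI) auto
    show "\<zero>\<^bsub>obj X (n - 1)\<^esub> = diff X n \<zero>\<^bsub>obj X n\<^esub>" by simp
  qed
  then have q1: "quasi_iso R ?Z X (\<lambda>n _. \<zero>\<^bsub>obj X n\<^esub>)" by (rule exact_quasi_iso[OF Z X _ eZ ex])
  have "chain_map R ?Z zero_complex (\<lambda>n _. ())"
    by (auto simp: chain_map_def linear_map_def zero_complex_def zero_module_def)
  moreover have "exact_complex zero_complex"
    unfolding zero_complex_def by (rule exact_concentrated_zero) (simp add: zero_module_def)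
  ultimately have "quasi_iso R ?Z zero_complex (\<lambda>n _. ())" by (intro exact_quasi_iso[OF Z O _ eZ])
  with q1 Z show "derived_iso R X zero_complex" unfolding derived_iso_def by blast
qed

section \<open>Complexes of homomorphisms\<close>

text \<open>The scalar \<open>-(-1)\<^sup>n\<close>, with which \<open>\<phi> \<circ> d\<close> enters the differential of \<open>\<phi>\<close>. Writing the sign as a
  scalar lets one computation cover both parities.\<close>

definition hom_sign :: "('a, 'r) ring_scheme \<Rightarrow> int \<Rightarrow> 'a" where
  "hom_sign R n = (if even n then \<ominus>\<^bsub>R\<^esub> \<one>\<^bsub>R\<^esub> else \<one>\<^bsub>R\<^esub>)"

context cring
begin

lemma hom_sign_closed [simp]: "hom_sign R n \<in> carrier R"
  by (simp add: hom_sign_def)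

lemma hom_sign_cancel: "hom_sign R n \<oplus> hom_sign R (n - 1) = \<zero>"
  by (auto simp: hom_sign_def l_neg r_neg)

lemma hom_sign_square: "hom_sign R n \<otimes> hom_sign R n = \<one>"
  by (simp add: hom_sign_def l_minus)

end

lemma (in module) hom_sign_smult:
  "y \<in> carrier M \<Longrightarrow> hom_sign R n \<odot>\<^bsub>M\<^esub> y = (if even n then \<ominus>\<^bsub>M\<^esub> y else y)"
  by (simp add: hom_sign_def smult_l_minus)

lemma Hom_complex_carrier:
  "\<phi> \<in> carrier (obj (Hom_complex R X Y) n) \<longleftrightarrow>
    (\<forall>i. \<phi> i \<in> extensional (carrier (obj X i)) \<and> linear_map R (obj X i) (obj Y (i + n)) (\<phi> i))"
  by (auto simp: Hom_complex_def direct_product_simps Hom_module_simps PiE_def Pi_def)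

lemma Hom_complex_simps:
  "zero (obj (Hom_complex R X Y) n) = (\<lambda>i. \<lambda>x\<in>carrier (obj X i). \<zero>\<^bsub>obj Y (i + n)\<^esub>)"
  "(\<phi> \<oplus>\<^bsub>obj (Hom_complex R X Y) n\<^esub> \<psi>) i = (\<lambda>x\<in>carrier (obj X i). \<phi> i x \<oplus>\<^bsub>obj Y (i + n)\<^esub> \<psi> i x)"
  "(a \<odot>\<^bsub>obj (Hom_complex R X Y) n\<^esub> \<phi>) i = (\<lambda>x\<in>carrier (obj X i). a \<odot>\<^bsub>obj Y (i + n)\<^esub> \<phi> i x)"
  by (simp_all add: Hom_complex_def direct_product_simps Hom_module_simps restrict_def)

lemma Hom_complex_obj_module:
  assumes "cring R" "\<And>i. module R (obj X i)" "\<And>i. module R (obj Y i)"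
  shows "module R (obj (Hom_complex R X Y) n)"
  using assms by (simp add: Hom_complex_def direct_product_module Hom_module_module)

lemma Hom_complex_eqI:
  assumes "\<phi> \<in> carrier (obj (Hom_complex R X Y) n)" "\<psi> \<in> carrier (obj (Hom_complex R X Y) m)"
    and "\<And>i x. x \<in> carrier (obj X i) \<Longrightarrow> \<phi> i x = \<psi> i x"
  shows "\<phi> = \<psi>"
proof
  fix i
  show "\<phi> i = \<psi> i"
    using assms by (intro extensionalityI[where A = "carrier (obj X i)"]) (simp_all add: Hom_complex_carrier)
qed

context
  fixes R :: "('a, 'r) ring_scheme" and X :: "('a, 'x) cplx" and Y :: "('a, 'y) cplx"
  assumes X: "chain_complex R X" and Y: "chain_complex R Y"
begin

private lemma hom_base_cring: "cring R"
  using chain_complexD(1)[OF X, of 0] by (simp add: module_def)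

lemma Hom_complex_diff:
  assumes \<phi>: "\<phi> \<in> carrier (obj (Hom_complex R X Y) n)" and x: "x \<in> carrier (obj X i)"
  shows "diff (Hom_complex R X Y) n \<phi> i x =
    diff Y (i + n) (\<phi> i x) \<oplus>\<^bsub>obj Y (i + n - 1)\<^esub> hom_sign R n \<odot>\<^bsub>obj Y (i + n - 1)\<^esub> \<phi> (i - 1) (diff X i x)"
proof -
  interpret Y: module R "obj Y (i + n - 1)" by (rule chain_complexD[OF Y])
  have e: "i - 1 + n = i + n - 1" by simp
  have "diff X i x \<in> carrier (obj X (i - 1))"
    using linear_map_closed[OF chain_complexD(2)[OF X] x] .
  then have "\<phi> (i - 1) (diff X i x) \<in> carrier (obj Y (i - 1 + n))"
    using \<phi> unfolding Hom_complex_carrier by (blast intro: linear_map_closed)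
  then have "\<phi> (i - 1) (diff X i x) \<in> carrier (obj Y (i + n - 1))" unfolding e .
  then show ?thesis using x by (simp add: Hom_complex_def Y.hom_sign_smult a_minus_def)
qed

lemma Hom_complex_diff_closed:
  assumes \<phi>: "\<phi> \<in> carrier (obj (Hom_complex R X Y) n)"
  shows "diff (Hom_complex R X Y) n \<phi> \<in> carrier (obj (Hom_complex R X Y) (n - 1))"
  unfolding Hom_complex_carrier
proof (intro allI conjI)
  fix i
  show "diff (Hom_complex R X Y) n \<phi> i \<in> extensional (carrier (obj X i))"
    by (simp add: Hom_complex_def)
  have e: "i + (n - 1) = i + n - 1" "i - 1 + n = i + n - 1" by simp_all
  interpret R: cring R by (rule hom_base_cring)
  interpret p: lin R "obj X i" "obj Y (i + n)" "\<phi> i"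
    using \<phi> by (intro linI chain_complexD[OF X] chain_complexD[OF Y]) (simp add: Hom_complex_carrier)
  have "linear_map R (obj X (i - 1)) (obj Y (i - 1 + n)) (\<phi> (i - 1))"
    using \<phi> unfolding Hom_complex_carrier by blast
  then interpret p': lin R "obj X (i - 1)" "obj Y (i + n - 1)" "\<phi> (i - 1)"
    unfolding e by (intro linI chain_complexD[OF X] chain_complexD[OF Y])
  interpret d: lin R "obj X i" "obj X (i - 1)" "diff X i" by (intro linI chain_complexD[OF X])
  interpret d': lin R "obj Y (i + n)" "obj Y (i + n - 1)" "diff Y (i + n)"
    by (intro linI chain_complexD[OF Y])
  show "linear_map R (obj X i) (obj Y (i + (n - 1))) (diff (Hom_complex R X Y) n \<phi> i)"
    unfolding e(1)
    by (rule linear_mapI)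
      (simp_all add: Hom_complex_diff[OF \<phi>] p'.N.smult_r_distr p'.N.M.a_ac
        p'.N.smult_assoc1[symmetric] R.m_comm)
qed

lemma Hom_complex_complex: "chain_complex R (Hom_complex R X Y)"
  unfolding chain_complex_def
proof (intro conjI allI ballI)
  fix n
  note CX = chain_complexD[OF X] and CY = chain_complexD[OF Y]
  interpret R: cring R by (rule hom_base_cring)
  let ?H = "Hom_complex R X Y"
  show H: "module R (obj ?H n)" for n by (intro Hom_complex_obj_module CX CY hom_base_cring)
  interpret Hn: module R "obj ?H n" by (rule H)
  have e: "i + (n - 1) = i + n - 1" "i - 1 + n = i + n - 1" for i by simp_all
  note cl = Hom_complex_diff_closed
  have ap: "\<phi> i x \<in> carrier (obj Y (i + n))"
    if "\<phi> \<in> carrier (obj ?H n)" "x \<in> carrier (obj X i)" for \<phi> i x n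
    using that unfolding Hom_complex_carrier by (blast intro: linear_map_closed)
  have dX: "diff X i x \<in> carrier (obj X (i - 1))" if "x \<in> carrier (obj X i)" for i x
    using linear_map_closed[OF CX(2) that] .
  have ap': "\<phi> (i - 1) (diff X i x) \<in> carrier (obj Y (i + n - 1))"
    if "\<phi> \<in> carrier (obj ?H n)" "x \<in> carrier (obj X i)" for \<phi> i x
    using ap[OF that(1) dX[OF that(2)]] unfolding e .
  show "linear_map R (obj ?H n) (obj ?H (n - 1)) (diff ?H n)"
  proof (rule linear_mapI[OF cl])
    fix \<phi> \<psi> assume p: "\<phi> \<in> carrier (obj ?H n)" and q: "\<psi> \<in> carrier (obj ?H n)"
    interpret H1: module R "obj ?H (n - 1)" by (rule H)
    show "diff ?H n (\<phi> \<oplus>\<^bsub>obj ?H n\<^esub> \<psi>) = diff ?H n \<phi> \<oplus>\<^bsub>obj ?H (n - 1)\<^esub> diff ?H n \<psi>"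
    proof (rule Hom_complex_eqI)
      show "diff ?H n (\<phi> \<oplus>\<^bsub>obj ?H n\<^esub> \<psi>) \<in> carrier (obj ?H (n - 1))"
        by (intro cl Hn.M.a_closed p q)
      show "diff ?H n \<phi> \<oplus>\<^bsub>obj ?H (n - 1)\<^esub> diff ?H n \<psi> \<in> carrier (obj ?H (n - 1))"
        by (intro cl H1.M.a_closed p q)
      fix i x assume x: "x \<in> carrier (obj X i)"
      interpret Y: module R "obj Y (i + n - 1)" by (rule CY)
      interpret d': lin R "obj Y (i + n)" "obj Y (i + n - 1)" "diff Y (i + n)" by (intro linI CY)
      show "diff ?H n (\<phi> \<oplus>\<^bsub>obj ?H n\<^esub> \<psi>) i x = (diff ?H n \<phi> \<oplus>\<^bsub>obj ?H (n - 1)\<^esub> diff ?H n \<psi>) i x"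
        using x dX[OF x] ap[OF p x] ap[OF q x] ap'[OF p x] ap'[OF q x]
        by (simp add: Hom_complex_diff[OF p x] Hom_complex_diff[OF q x]
            Hom_complex_diff[OF Hn.M.a_closed[OF p q] x] Hom_complex_simps e Y.smult_r_distr Y.M.a_ac)
    qed
  next
    fix a \<phi> assume a: "a \<in> carrier R" and p: "\<phi> \<in> carrier (obj ?H n)"
    interpret H1: module R "obj ?H (n - 1)" by (rule H)
    show "diff ?H n (a \<odot>\<^bsub>obj ?H n\<^esub> \<phi>) = a \<odot>\<^bsub>obj ?H (n - 1)\<^esub> diff ?H n \<phi>"
    proof (rule Hom_complex_eqI)
      show "diff ?H n (a \<odot>\<^bsub>obj ?H n\<^esub> \<phi>) \<in> carrier (obj ?H (n - 1))"
        by (intro cl Hn.smult_closed p a)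
      show "a \<odot>\<^bsub>obj ?H (n - 1)\<^esub> diff ?H n \<phi> \<in> carrier (obj ?H (n - 1))"
        by (intro cl H1.smult_closed p a)
      fix i x assume x: "x \<in> carrier (obj X i)"
      interpret Y: module R "obj Y (i + n - 1)" by (rule CY)
      interpret d': lin R "obj Y (i + n)" "obj Y (i + n - 1)" "diff Y (i + n)" by (intro linI CY)
      show "diff ?H n (a \<odot>\<^bsub>obj ?H n\<^esub> \<phi>) i x = (a \<odot>\<^bsub>obj ?H (n - 1)\<^esub> diff ?H n \<phi>) i x"
        using x dX[OF x] ap[OF p x] ap'[OF p x] a
        by (simp add: Hom_complex_diff[OF p x] Hom_complex_diff[OF Hn.smult_closed[OF a p] x]
            Hom_complex_simps e Y.smult_r_distr Y.smult_assoc1[symmetric] R.m_comm)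
    qed
  qed
  fix \<phi> assume p: "\<phi> \<in> carrier (obj ?H n)"
  interpret H2: module R "obj ?H (n - 2)" by (rule H)
  have dp: "diff ?H n \<phi> \<in> carrier (obj ?H (n - 1))" by (rule cl[OF p])
  have ddp: "diff ?H (n - 1) (diff ?H n \<phi>) \<in> carrier (obj ?H (n - 2))" using cl[OF dp] by simp
  show "diff ?H (n - 1) (diff ?H n \<phi>) = \<zero>\<^bsub>obj ?H (n - 2)\<^esub>"
  proof (rule Hom_complex_eqI[OF ddp H2.M.zero_closed])
    fix i x assume x: "x \<in> carrier (obj X i)"
    have e2: "i + (n - 1) - 1 = i + n - 2" "i - 1 + n - 1 = i + n - 2" "i + n - 1 - 1 = i + n - 2"
      "i + (n - 2) = i + n - 2" "i - 1 - 1 = i - 2" "i - 2 + n = i + n - 2" by simp_all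
    interpret Y1: module R "obj Y (i + n - 1)" by (rule CY)
    interpret Y2: module R "obj Y (i + n - 2)" by (rule CY)
    have "linear_map R (obj Y (i + n - 1)) (obj Y (i + n - 2)) (diff Y (i + n - 1))"
      using CY(2)[of "i + n - 1"] unfolding e2 .
    then interpret d1: lin R "obj Y (i + n - 1)" "obj Y (i + n - 2)" "diff Y (i + n - 1)"
      by (intro linI CY)
    interpret d0: lin R "obj Y (i + n)" "obj Y (i + n - 1)" "diff Y (i + n)" by (intro linI CY)
    note x1 = dX[OF x]
    have "linear_map R (obj X (i - 2)) (obj Y (i - 2 + n)) (\<phi> (i - 2))"
      using p unfolding Hom_complex_carrier by blast
    then interpret p2: lin R "obj X (i - 2)" "obj Y (i + n - 2)" "\<phi> (i - 2)"
      unfolding e2 by (intro linI CX CY)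
    have 1: "diff ?H n \<phi> i x = diff Y (i + n) (\<phi> i x)
        \<oplus>\<^bsub>obj Y (i + n - 1)\<^esub> hom_sign R n \<odot>\<^bsub>obj Y (i + n - 1)\<^esub> \<phi> (i - 1) (diff X i x)"
      by (rule Hom_complex_diff[OF p x])
    have 2: "diff ?H n \<phi> (i - 1) (diff X i x) = diff Y (i + n - 1) (\<phi> (i - 1) (diff X i x))"
      using Hom_complex_diff[OF p x1] CX(3)[OF x] ap'[OF p x] d1.closed[OF ap'[OF p x]]
      by (simp add: e e2)
    have 3: "diff Y (i + n - 1) (diff Y (i + n) (\<phi> i x)) = \<zero>\<^bsub>obj Y (i + n - 2)\<^esub>"
      using CY(3)[OF ap[OF p x]] .
    let ?w = "diff Y (i + n - 1) (\<phi> (i - 1) (diff X i x))"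
    have w: "?w \<in> carrier (obj Y (i + n - 2))" by (rule d1.closed[OF ap'[OF p x]])
    have "diff ?H (n - 1) (diff ?H n \<phi>) i x = diff Y (i + n - 1) (diff ?H n \<phi> i x)
        \<oplus>\<^bsub>obj Y (i + n - 2)\<^esub> hom_sign R (n - 1) \<odot>\<^bsub>obj Y (i + n - 2)\<^esub> ?w"
      using Hom_complex_diff[OF dp x] unfolding e e2 2 .
    also have "diff Y (i + n - 1) (diff ?H n \<phi> i x) = hom_sign R n \<odot>\<^bsub>obj Y (i + n - 2)\<^esub> ?w"
      unfolding 1 using ap[OF p x] ap'[OF p x] w by (simp add: 3)
    also have "\<dots> \<oplus>\<^bsub>obj Y (i + n - 2)\<^esub> hom_sign R (n - 1) \<odot>\<^bsub>obj Y (i + n - 2)\<^esub> ?w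
      = \<zero>\<^bsub>obj Y (i + n - 2)\<^esub>"
      using w by (simp add: Y2.smult_l_distr[symmetric] R.hom_sign_cancel)
    finally show "diff ?H (n - 1) (diff ?H n \<phi>) i x = \<zero>\<^bsub>obj ?H (n - 2)\<^esub> i x"
      using x by (simp add: Hom_complex_simps e2)
  qed
qed

end

subsection \<open>Homomorphisms into an injective module\<close>

text \<open>The value at \<open>f x\<close> has to be \<open>g x\<close>, and the kernel condition makes it independent of \<open>x\<close>.\<close>

lemma linear_factor:
  assumes f: "lin R A B f" and g: "lin R A E g"
    and ker: "\<And>x. x \<in> carrier A \<Longrightarrow> f x = \<zero>\<^bsub>B\<^esub> \<Longrightarrow> g x = \<zero>\<^bsub>E\<^esub>"
  obtains h where "linear_map R (B\<lparr>carrier := f ` carrier A\<rparr>) E h" "\<And>x. x \<in> carrier A \<Longrightarrow> h (f x) = g x"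
proof -
  interpret f: lin R A B f by fact
  interpret g: lin R A E g by fact
  define h where "h y = g (SOME x. x \<in> carrier A \<and> f x = y)" for y
  have h: "h (f x) = g x" if x: "x \<in> carrier A" for x
  proof -
    let ?x = "SOME x'. x' \<in> carrier A \<and> f x' = f x"
    have s: "?x \<in> carrier A \<and> f ?x = f x" by (rule someI[of _ x]) (simp add: x)
    have fx: "f x \<in> carrier B" by (rule f.closed[OF x])
    have "f (?x \<ominus>\<^bsub>A\<^esub> x) = \<zero>\<^bsub>B\<^esub>" using s x fx f.N.M.minus_eq_zero_iff[OF fx fx] by simp
    then have "g (?x \<ominus>\<^bsub>A\<^esub> x) = \<zero>\<^bsub>E\<^esub>" using s x by (intro ker) simp_all
    then show ?thesis using s x g.N.M.minus_eq_zero_iff[of "g ?x" "g x"] by (simp add: h_def)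
  qed
  show ?thesis
  proof (rule that[OF _ h])
    show "linear_map R (B\<lparr>carrier := f ` carrier A\<rparr>) E h"
    proof (rule linear_mapI)
      fix y assume "y \<in> carrier (B\<lparr>carrier := f ` carrier A\<rparr>)"
      then obtain x where x: "x \<in> carrier A" "y = f x" by auto
      then show "h y \<in> carrier E" using h by simp
      fix y' assume "y' \<in> carrier (B\<lparr>carrier := f ` carrier A\<rparr>)"
      then obtain x' where x': "x' \<in> carrier A" "y' = f x'" by auto
      have "h (f (x \<oplus>\<^bsub>A\<^esub> x')) = g (x \<oplus>\<^bsub>A\<^esub> x')" using x x' by (intro h) simp
      then show "h (y \<oplus>\<^bsub>B\<lparr>carrier := f ` carrier A\<rparr>\<^esub> y') = h y \<oplus>\<^bsub>E\<^esub> h y'" using x x' h by simp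
    next
      fix a y assume a: "a \<in> carrier R" and "y \<in> carrier (B\<lparr>carrier := f ` carrier A\<rparr>)"
      then obtain x where x: "x \<in> carrier A" "y = f x" by auto
      have "h (f (a \<odot>\<^bsub>A\<^esub> x)) = g (a \<odot>\<^bsub>A\<^esub> x)" using x a by (intro h) simp
      then show "h (a \<odot>\<^bsub>B\<lparr>carrier := f ` carrier A\<rparr>\<^esub> y) = a \<odot>\<^bsub>E\<^esub> h y" using x h a by simp
    qed
  qed
qed

text \<open>Maps into a complex concentrated in degree 0 have a single component that can be nonzero.\<close>

lemma Hom_concentrated_zero:
  assumes "\<phi> \<in> carrier (obj (Hom_complex R X (concentrated E)) n)" "i + n \<noteq> 0"
    and "x \<in> carrier (obj X i)"
  shows "\<phi> i x = \<zero>\<^bsub>E\<^esub>"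
proof -
  have "linear_map R (obj X i) (obj (concentrated E) (i + n)) (\<phi> i)"
    using assms(1) unfolding Hom_complex_carrier by blast
  from linear_map_closed[OF this assms(3)] show ?thesis using assms(2) by simp
qed

lemma Hom_concentrated_single:
  assumes X: "chain_complex R X" and E: "module R E" and k: "linear_map R (obj X j) E k"
  shows "(\<lambda>i. \<lambda>x\<in>carrier (obj X i). if i = j then k x else \<zero>\<^bsub>E\<^esub>)
    \<in> carrier (obj (Hom_complex R X (concentrated E)) (- j))"
  unfolding Hom_complex_carrier
proof (intro allI conjI)
  fix i
  interpret E: module R E by fact
  interpret X: module R "obj X i" by (rule chain_complexD[OF X])
  show "linear_map R (obj X i) (obj (concentrated E) (i + - j))
    (\<lambda>x\<in>carrier (obj X i). if i = j then k x else \<zero>\<^bsub>E\<^esub>)"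
  proof (cases "i = j")
    case True
    have "linear_map R (obj X j) E (\<lambda>x\<in>carrier (obj X j). k x)"
      by (rule linear_map_cong[OF k chain_complexD(1)[OF X]]) simp
    then show ?thesis using True by (simp add: linear_map_def)
  qed (auto simp: linear_map_def)
qed simp

text \<open>Exactness of \<open>Hom(-, E)\<close>: a cycle \<open>\<phi>\<close> of \<open>Hom(X, E)\<close> is a map on \<open>X\<^sub>j\<close> that vanishes on
  boundaries, and its class is the map that it induces on homology. Injectivity of \<open>E\<close> is used
  twice: a map on homology, viewed as a map on the cycles, extends to \<open>X\<^sub>j\<close>; and a map that vanishes
  on all cycles factors through the image of the differential and extends to \<open>X\<^sub>j\<^sub>-\<^sub>1\<close>.\<close>

theorem Hom_injective_is_homology:
  fixes R :: "('a, 'r) ring_scheme" and X :: "('a, 'x) cplx"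
    and H :: "('a, 'h) module" and E :: "('a, 'e) module"
  assumes E: "baer R E" and X: "chain_complex R X" and H: "is_homology R X j H \<pi>"
  shows "is_homology R (Hom_complex R X (concentrated E)) (- j) (Hom_module R H E)
    (\<lambda>\<phi>. \<lambda>h\<in>carrier H. \<phi> j (SOME z. z \<in> cycles X j \<and> \<pi> z = h))" (is "is_homology R ?G _ ?HE ?p")
proof -
  note C = chain_complexD[OF X] and HD = is_homologyD[OF H]
  have mE: "module R E" using E by (simp add: baer_def)
  interpret E: module R E by (rule mE)
  interpret H: module R H by (rule HD)
  interpret X: module R "obj X j" by (rule C)
  note CE = concentrated_complex[OF mE]
  note G = Hom_complex_complex[OF X CE]
  have Z: "submodule (cycles X j) R (obj X j)" by (intro cycles_submodule C)
  note ZE = X.submoduleE[OF Z]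
  have Zc: "z \<in> carrier (obj X j)" if "z \<in> cycles X j" for z using ZE(1) that by (rule subsetD)
  interpret d: lin R "obj X j" "obj X (j - 1)" "diff X j" by (intro linI C)
  have d1: "linear_map R (obj X (j + 1)) (obj X j) (diff X (j + 1))" using C(2)[of "j + 1"] by simp
  interpret d1: lin R "obj X (j + 1)" "obj X j" "diff X (j + 1)" by (intro linI C d1)
  note diffG = Hom_complex_diff[OF X CE]
  have BZ: "diff X (j + 1) x \<in> cycles X j" "\<pi> (diff X (j + 1) x) = \<zero>\<^bsub>H\<^esub>"
    if "x \<in> carrier (obj X (j + 1))" for x
  proof -
    have b: "diff X (j + 1) x \<in> boundaries X j" unfolding boundaries_def using that by (rule imageI)
    show c: "diff X (j + 1) x \<in> cycles X j" using boundaries_subset_cycles[OF X] b by (rule subsetD)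
    show "\<pi> (diff X (j + 1) x) = \<zero>\<^bsub>H\<^esub>" using HD(6)[OF c] b by simp
  qed
  have Gap: "\<phi> j x \<in> carrier E" if "\<phi> \<in> carrier (obj ?G (- j))" "x \<in> carrier (obj X j)" for \<phi> x
  proof -
    have "linear_map R (obj X j) (obj (concentrated E) (j + - j)) (\<phi> j)"
      using that(1) unfolding Hom_complex_carrier by blast
    from linear_map_closed[OF this that(2)] show ?thesis by simp
  qed
  have Glin: "linear_map R (obj X j) E (\<phi> j)" if "\<phi> \<in> carrier (obj ?G (- j))" for \<phi>
  proof -
    have "linear_map R (obj X j) (obj (concentrated E) (j + - j)) (\<phi> j)"
      using that(1) unfolding Hom_complex_carrier by blast
    then show ?thesis by (simp add: linear_map_def)
  qed
  have cyc: "\<phi> \<in> cycles ?G (- j) \<longleftrightarrow>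
      \<phi> \<in> carrier (obj ?G (- j)) \<and> (\<forall>x\<in>carrier (obj X (j + 1)). \<phi> j (diff X (j + 1) x) = \<zero>\<^bsub>E\<^esub>)"
    (is "_ \<longleftrightarrow> ?r") for \<phi>
  proof
    assume "\<phi> \<in> cycles ?G (- j)"
    then have p: "\<phi> \<in> carrier (obj ?G (- j))" "diff ?G (- j) \<phi> = \<zero>\<^bsub>obj ?G (- j - 1)\<^esub>"
      by (simp_all add: cycles_def)
    show ?r
    proof (intro conjI ballI, rule p(1))
      fix x assume x: "x \<in> carrier (obj X (j + 1))"
      have c: "\<phi> j (diff X (j + 1) x) \<in> carrier E" by (rule Gap[OF p(1) d1.closed[OF x]])
      have "\<zero>\<^bsub>E\<^esub> \<oplus>\<^bsub>E\<^esub> hom_sign R (- j) \<odot>\<^bsub>E\<^esub> \<phi> j (diff X (j + 1) x) = \<zero>\<^bsub>E\<^esub>"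
        using diffG[OF p(1) x] x unfolding p(2) by (simp add: Hom_complex_simps)
      then have "hom_sign R (- j) \<odot>\<^bsub>E\<^esub> (hom_sign R (- j) \<odot>\<^bsub>E\<^esub> \<phi> j (diff X (j + 1) x)) = \<zero>\<^bsub>E\<^esub>"
        using c by simp
      then show "\<phi> j (diff X (j + 1) x) = \<zero>\<^bsub>E\<^esub>"
        using c by (simp add: E.smult_assoc1[symmetric] E.R.hom_sign_square)
    qed
  next
    assume r: ?r
    then have p: "\<phi> \<in> carrier (obj ?G (- j))" by blast
    have "diff ?G (- j) \<phi> = \<zero>\<^bsub>obj ?G (- j - 1)\<^esub>"
    proof (rule Hom_complex_eqI[OF Hom_complex_diff_closed[OF X CE p]])
      show "\<zero>\<^bsub>obj ?G (- j - 1)\<^esub> \<in> carrier (obj ?G (- j - 1))"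
        by (intro abelian_groupE(2)) (use chain_complexD(1)[OF G] in \<open>simp add: module_def\<close>)
      fix i x assume x: "x \<in> carrier (obj X i)"
      have "\<phi> (i - 1) (diff X i x) = \<zero>\<^bsub>E\<^esub>"
      proof (cases "i = j + 1")
        case False
        then show ?thesis
          by (intro Hom_concentrated_zero[OF p] linear_map_closed[OF C(2) x]) simp
      qed (use r x in simp)
      then show "diff ?G (- j) \<phi> i x = \<zero>\<^bsub>obj ?G (- j - 1)\<^esub> i x"
        using x by (simp add: diffG[OF p x] Hom_complex_simps)
    qed
    then show "\<phi> \<in> cycles ?G (- j)" using p by (simp add: cycles_def)
  qed
  have key: "?p \<phi> (\<pi> z) = \<phi> j z" if p: "\<phi> \<in> cycles ?G (- j)" and z: "z \<in> cycles X j" for \<phi> z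
  proof -
    let ?w = "SOME w. w \<in> cycles X j \<and> \<pi> w = \<pi> z"
    have "?w \<in> cycles X j \<and> \<pi> ?w = \<pi> z" by (rule someI[of _ z]) (simp add: z)
    then have w: "?w \<in> cycles X j" "\<pi> ?w = \<pi> z" by simp_all
    have pc: "\<phi> \<in> carrier (obj ?G (- j))" using p cyc by blast
    interpret f: lin R "obj X j" E "\<phi> j" by (intro linI C mE Glin pc)
    let ?m = "\<ominus>\<^bsub>R\<^esub> \<one>\<^bsub>R\<^esub>"
    have m: "?m \<in> carrier R" by simp
    have "?w \<oplus>\<^bsub>obj X j\<^esub> ?m \<odot>\<^bsub>obj X j\<^esub> z \<in> cycles X j" by (intro ZE(4,5) w(1) z m)
    moreover have "\<pi> (?w \<oplus>\<^bsub>obj X j\<^esub> ?m \<odot>\<^bsub>obj X j\<^esub> z) = \<pi> z \<oplus>\<^bsub>H\<^esub> ?m \<odot>\<^bsub>H\<^esub> \<pi> z"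
      using HD(3)[OF w(1) ZE(4)[OF m z]] HD(4)[OF m z] w(2) by simp
    moreover have "\<dots> = \<zero>\<^bsub>H\<^esub>" using HD(2)[OF z] by (simp add: H.smult_l_minus H.M.r_neg)
    ultimately have "?w \<oplus>\<^bsub>obj X j\<^esub> ?m \<odot>\<^bsub>obj X j\<^esub> z \<in> boundaries X j" using HD(6) by simp
    then obtain y where y: "y \<in> carrier (obj X (j + 1))"
      "?w \<oplus>\<^bsub>obj X j\<^esub> ?m \<odot>\<^bsub>obj X j\<^esub> z = diff X (j + 1) y" by (auto simp: boundaries_def)
    have "\<phi> j (?w \<oplus>\<^bsub>obj X j\<^esub> ?m \<odot>\<^bsub>obj X j\<^esub> z) = \<zero>\<^bsub>E\<^esub>" unfolding y(2) using p cyc y(1) by blast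
    then have "\<phi> j ?w \<ominus>\<^bsub>E\<^esub> \<phi> j z = \<zero>\<^bsub>E\<^esub>"
      using Zc[OF w(1)] Zc[OF z] by (simp add: E.smult_l_minus a_minus_def)
    then have "\<phi> j ?w = \<phi> j z" using E.M.minus_eq_zero_iff Zc[OF w(1)] Zc[OF z] by simp
    then show ?thesis using HD(2)[OF z] by simp
  qed
  have pHom: "?p \<phi> \<in> carrier ?HE" if p: "\<phi> \<in> cycles ?G (- j)" for \<phi>
  proof -
    have pc: "\<phi> \<in> carrier (obj ?G (- j))" using p cyc by blast
    interpret f: lin R "obj X j" E "\<phi> j" by (intro linI C mE Glin pc)
    note k = key[OF p]
    have "linear_map R H E (?p \<phi>)"
    proof (rule linear_mapI)
      fix h assume "h \<in> carrier H"
      then obtain z where z: "z \<in> cycles X j" "h = \<pi> z" using HD(5) by blast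
      show "?p \<phi> h \<in> carrier E" unfolding z(2) k[OF z(1)] using Zc z(1) by simp
      fix g assume "g \<in> carrier H"
      then obtain w where w: "w \<in> cycles X j" "g = \<pi> w" using HD(5) by blast
      show "?p \<phi> (h \<oplus>\<^bsub>H\<^esub> g) = ?p \<phi> h \<oplus>\<^bsub>E\<^esub> ?p \<phi> g"
        unfolding z(2) w(2) HD(3)[OF z(1) w(1), symmetric] k[OF ZE(5)[OF z(1) w(1)]] k[OF z(1)] k[OF w(1)]
        using Zc z(1) w(1) by simp
    next
      fix a h assume a: "a \<in> carrier R" and "h \<in> carrier H"
      then obtain z where z: "z \<in> cycles X j" "h = \<pi> z" using HD(5) by blast
      show "?p \<phi> (a \<odot>\<^bsub>H\<^esub> h) = a \<odot>\<^bsub>E\<^esub> ?p \<phi> h"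
        unfolding z(2) HD(4)[OF a z(1), symmetric] k[OF ZE(4)[OF a z(1)]] k[OF z(1)]
        using Zc z(1) a by simp
    qed
    then show ?thesis by (simp add: Hom_module_simps)
  qed
  have ext: "f = g" if "f \<in> carrier ?HE" "g \<in> carrier ?HE" "\<And>z. z \<in> cycles X j \<Longrightarrow> f (\<pi> z) = g (\<pi> z)"
    for f g
  proof (rule extensionalityI[where A = "carrier H"])
    show "f \<in> extensional (carrier H)" "g \<in> extensional (carrier H)"
      using that by (simp_all add: Hom_module_simps)
    show "f h = g h" if "h \<in> carrier H" for h using HD(5)[OF that] \<open>\<And>z. z \<in> cycles X j \<Longrightarrow> f (\<pi> z) = g (\<pi> z)\<close> by blast
  qed
  have mHE: "module R ?HE" by (intro Hom_module_module HD mE)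
  interpret HE: module R ?HE by (rule mHE)
  interpret G0: module R "obj ?G (- j)" by (rule chain_complexD(1)[OF G])
  have ZG: "submodule (cycles ?G (- j)) R (obj ?G (- j))" by (intro cycles_submodule chain_complexD[OF G])
  note ZGE = G0.submoduleE[OF ZG]
  show ?thesis unfolding is_homology_def
  proof (intro conjI ballI, rule mHE)
    show "linear_map R ((obj ?G (- j))\<lparr>carrier := cycles ?G (- j)\<rparr>) ?HE ?p"
    proof (rule linear_mapI)
      fix \<phi> \<psi> assume "\<phi> \<in> carrier ((obj ?G (- j))\<lparr>carrier := cycles ?G (- j)\<rparr>)"
        "\<psi> \<in> carrier ((obj ?G (- j))\<lparr>carrier := cycles ?G (- j)\<rparr>)"
      then have p: "\<phi> \<in> cycles ?G (- j)" and q: "\<psi> \<in> cycles ?G (- j)" by simp_all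
      note pq = ZGE(5)[OF p q]
      have "?p (\<phi> \<oplus>\<^bsub>obj ?G (- j)\<^esub> \<psi>) = ?p \<phi> \<oplus>\<^bsub>?HE\<^esub> ?p \<psi>"
      proof (rule ext[OF pHom[OF pq] HE.M.a_closed[OF pHom[OF p] pHom[OF q]]])
        fix z assume z: "z \<in> cycles X j"
        have "(\<phi> \<oplus>\<^bsub>obj ?G (- j)\<^esub> \<psi>) j z = \<phi> j z \<oplus>\<^bsub>E\<^esub> \<psi> j z"
          using Zc[OF z] by (simp add: Hom_complex_simps)
        also have "\<dots> = ?p \<phi> (\<pi> z) \<oplus>\<^bsub>E\<^esub> ?p \<psi> (\<pi> z)" unfolding key[OF p z] key[OF q z] ..
        also have "\<dots> = (?p \<phi> \<oplus>\<^bsub>?HE\<^esub> ?p \<psi>) (\<pi> z)" using HD(2)[OF z] by (simp add: Hom_module_simps)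
        finally show "?p (\<phi> \<oplus>\<^bsub>obj ?G (- j)\<^esub> \<psi>) (\<pi> z) = (?p \<phi> \<oplus>\<^bsub>?HE\<^esub> ?p \<psi>) (\<pi> z)"
          unfolding key[OF pq z] .
      qed
      then show "?p (\<phi> \<oplus>\<^bsub>(obj ?G (- j))\<lparr>carrier := cycles ?G (- j)\<rparr>\<^esub> \<psi>) = ?p \<phi> \<oplus>\<^bsub>?HE\<^esub> ?p \<psi>" by simp
    next
      fix a \<phi> assume a: "a \<in> carrier R" and "\<phi> \<in> carrier ((obj ?G (- j))\<lparr>carrier := cycles ?G (- j)\<rparr>)"
      then have p: "\<phi> \<in> cycles ?G (- j)" by simp
      note pq = ZGE(4)[OF a p]
      have "?p (a \<odot>\<^bsub>obj ?G (- j)\<^esub> \<phi>) = a \<odot>\<^bsub>?HE\<^esub> ?p \<phi>"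
      proof (rule ext[OF pHom[OF pq] HE.smult_closed[OF a pHom[OF p]]])
        fix z assume z: "z \<in> cycles X j"
        have "(a \<odot>\<^bsub>obj ?G (- j)\<^esub> \<phi>) j z = a \<odot>\<^bsub>E\<^esub> \<phi> j z"
          using Zc[OF z] by (simp add: Hom_complex_simps)
        also have "\<dots> = a \<odot>\<^bsub>E\<^esub> ?p \<phi> (\<pi> z)" unfolding key[OF p z] ..
        also have "\<dots> = (a \<odot>\<^bsub>?HE\<^esub> ?p \<phi>) (\<pi> z)" using HD(2)[OF z] by (simp add: Hom_module_simps)
        finally show "?p (a \<odot>\<^bsub>obj ?G (- j)\<^esub> \<phi>) (\<pi> z) = (a \<odot>\<^bsub>?HE\<^esub> ?p \<phi>) (\<pi> z)"
          unfolding key[OF pq z] .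
      qed
      then show "?p (a \<odot>\<^bsub>(obj ?G (- j))\<lparr>carrier := cycles ?G (- j)\<rparr>\<^esub> \<phi>) = a \<odot>\<^bsub>?HE\<^esub> ?p \<phi>" by simp
    qed (use pHom in simp)
    show "?p ` cycles ?G (- j) = carrier ?HE"
    proof (intro equalityI subsetI)
      fix g assume g: "g \<in> carrier ?HE"
      have glin: "linear_map R H E g" using g by (simp add: Hom_module_simps)
      interpret g: lin R H E g by (intro linI HD mE glin)
      have "linear_map R ((obj X j)\<lparr>carrier := cycles X j\<rparr>) E (\<lambda>z. g (\<pi> z))"
        using HD(2) by (intro linear_mapI) (simp_all add: HD(3,4))
      then obtain k where k: "linear_map R (obj X j) E k" "\<And>z. z \<in> cycles X j \<Longrightarrow> k z = g (\<pi> z)"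
        using baer_extension[OF E C(1) Z] by blast
      define \<phi> where "\<phi> = (\<lambda>i. \<lambda>x\<in>carrier (obj X i). if i = j then k x else \<zero>\<^bsub>E\<^esub>)"
      have pc: "\<phi> \<in> carrier (obj ?G (- j))"
        unfolding \<phi>_def by (rule Hom_concentrated_single[OF X mE k(1)])
      have p: "\<phi> \<in> cycles ?G (- j)"
        unfolding cyc using pc k(2) BZ d1.closed by (simp add: \<phi>_def)
      have "g = ?p \<phi>"
      proof (rule ext[OF g pHom[OF p]])
        fix z assume z: "z \<in> cycles X j"
        show "g (\<pi> z) = ?p \<phi> (\<pi> z)" unfolding key[OF p z] using k(2)[OF z] Zc[OF z] by (simp add: \<phi>_def)
      qed
      then show "g \<in> ?p ` cycles ?G (- j)" using p by (rule image_eqI)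
    qed (use pHom in blast)
    fix \<phi> assume p: "\<phi> \<in> cycles ?G (- j)"
    then have pc: "\<phi> \<in> carrier (obj ?G (- j))" using cyc by blast
    interpret f: lin R "obj X j" E "\<phi> j" by (intro linI C mE Glin pc)
    have "?p \<phi> = \<zero>\<^bsub>?HE\<^esub> \<longleftrightarrow> (\<forall>z\<in>cycles X j. \<phi> j z = \<zero>\<^bsub>E\<^esub>)"
    proof
      assume 0: "?p \<phi> = \<zero>\<^bsub>?HE\<^esub>"
      show "\<forall>z\<in>cycles X j. \<phi> j z = \<zero>\<^bsub>E\<^esub>"
      proof
        fix z assume z: "z \<in> cycles X j"
        have "?p \<phi> (\<pi> z) = \<zero>\<^bsub>E\<^esub>" unfolding 0 using HD(2)[OF z] by (simp add: Hom_module_simps)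
        then show "\<phi> j z = \<zero>\<^bsub>E\<^esub>" unfolding key[OF p z] .
      qed
    next
      assume 0: "\<forall>z\<in>cycles X j. \<phi> j z = \<zero>\<^bsub>E\<^esub>"
      show "?p \<phi> = \<zero>\<^bsub>?HE\<^esub>"
      proof (rule ext[OF pHom[OF p] HE.M.zero_closed])
        fix z assume z: "z \<in> cycles X j"
        show "?p \<phi> (\<pi> z) = \<zero>\<^bsub>?HE\<^esub> (\<pi> z)"
          unfolding key[OF p z] using 0 z HD(2)[OF z] by (simp add: Hom_module_simps)
      qed
    qed
    also have "\<dots> \<longleftrightarrow> \<phi> \<in> boundaries ?G (- j)"
    proof
      assume "\<phi> \<in> boundaries ?G (- j)"
      then obtain \<psi> where q: "\<psi> \<in> carrier (obj ?G (- j + 1))" "\<phi> = diff ?G (- j + 1) \<psi>"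
        by (auto simp: boundaries_def)
      have "linear_map R (obj X (j - 1)) (obj (concentrated E) (j - 1 + (- j + 1))) (\<psi> (j - 1))"
        using q(1) unfolding Hom_complex_carrier by blast
      then interpret q: lin R "obj X (j - 1)" "obj (concentrated E) (j - 1 + (- j + 1))" "\<psi> (j - 1)"
        by (intro linI C concentrated_obj_module mE)
      have q0: "\<psi> (j - 1) \<zero>\<^bsub>obj X (j - 1)\<^esub> = \<zero>\<^bsub>E\<^esub>" using q.zero by simp
      show "\<forall>z\<in>cycles X j. \<phi> j z = \<zero>\<^bsub>E\<^esub>"
      proof
        fix z assume z: "z \<in> cycles X j"
        then have "diff X j z = \<zero>\<^bsub>obj X (j - 1)\<^esub>" by (simp add: cycles_def)
        then show "\<phi> j z = \<zero>\<^bsub>E\<^esub>"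
          unfolding q(2) diffG[OF q(1) Zc[OF z]] using q0 by simp
      qed
    next
      assume 0: "\<forall>z\<in>cycles X j. \<phi> j z = \<zero>\<^bsub>E\<^esub>"
      have l: "lin R (obj X j) E (\<phi> j)" by (intro linI C mE Glin pc)
      obtain h where h: "linear_map R ((obj X (j - 1))\<lparr>carrier := diff X j ` carrier (obj X j)\<rparr>) E h"
        "\<And>x. x \<in> carrier (obj X j) \<Longrightarrow> h (diff X j x) = \<phi> j x"
        using linear_factor[OF d.lin_axioms l] 0 by (auto simp: cycles_def)
      obtain k where k: "linear_map R (obj X (j - 1)) E k"
        "\<And>y. y \<in> diff X j ` carrier (obj X j) \<Longrightarrow> k y = h y"
        using baer_extension[OF E C(1) d.image_submodule h(1)] by blast
      let ?e = "hom_sign R (- j + 1)"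
      interpret k: lin R "obj X (j - 1)" E k by (intro linI C mE k(1))
      have ek: "linear_map R (obj X (j - 1)) E (\<lambda>y. ?e \<odot>\<^bsub>E\<^esub> k y)"
        by (rule linear_mapI)
          (simp_all add: E.smult_r_distr E.smult_assoc1[symmetric] E.R.m_comm)
      define \<psi> where "\<psi> = (\<lambda>i. \<lambda>x\<in>carrier (obj X i). if i = j - 1 then ?e \<odot>\<^bsub>E\<^esub> k x else \<zero>\<^bsub>E\<^esub>)"
      have q: "\<psi> \<in> carrier (obj ?G (- j + 1))"
        using Hom_concentrated_single[OF X mE ek] by (simp add: \<psi>_def)
      have dq: "diff ?G (- j + 1) \<psi> \<in> carrier (obj ?G (- j))"
        using Hom_complex_diff_closed[OF X CE q] by simp
      have "\<phi> = diff ?G (- j + 1) \<psi>"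
      proof (rule Hom_complex_eqI[OF pc dq])
        fix i x assume x: "x \<in> carrier (obj X i)"
        show "\<phi> i x = diff ?G (- j + 1) \<psi> i x"
        proof (cases "i = j")
          case True
          have xj: "x \<in> carrier (obj X j)" using x True by simp
          have "\<phi> j x = k (diff X j x)" using h(2)[OF xj] k(2)[OF imageI[OF xj]] by simp
          then show ?thesis
            unfolding diffG[OF q x] using True xj d.closed[OF xj]
            by (simp add: \<psi>_def E.smult_assoc1[symmetric] E.R.hom_sign_square)
        next
          case False
          have "diff X i x \<in> carrier (obj X (i - 1))" by (rule linear_map_closed[OF C(2) x])
          moreover have "\<phi> i x = \<zero>\<^bsub>E\<^esub>" using False by (intro Hom_concentrated_zero[OF pc _ x]) simp
          ultimately show ?thesis
            unfolding diffG[OF q x] using False by (simp add: \<psi>_def)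
        qed
      qed
      then show "\<phi> \<in> boundaries ?G (- j)" unfolding boundaries_def using q by (rule image_eqI)
    qed
    finally show "?p \<phi> = \<zero>\<^bsub>?HE\<^esub> \<longleftrightarrow> \<phi> \<in> boundaries ?G (- j)" .
  qed
qed

subsection \<open>The colocal dual\<close>

lemma restrict_scalars_complex_simps [simp]:
  "obj (restrict_scalars_complex h X) n = restrict_scalars h (obj X n)"
  "diff (restrict_scalars_complex h X) = diff X"
  "cycles (restrict_scalars_complex h X) n = cycles X n"
  "boundaries (restrict_scalars_complex h X) n = boundaries X n"
  by (simp_all add: restrict_scalars_complex_def cycles_def boundaries_def)

lemma restrict_scalars_complex_complex:
  assumes "cring R" "chain_complex S X" "h \<in> ring_hom R S"
  shows "chain_complex R (restrict_scalars_complex h X)"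
  unfolding chain_complex_def restrict_scalars_complex_simps restrict_scalars_simps
  by (intro conjI allI ballI restrict_scalars_module[OF assms(1) _ assms(3)]
      restrict_scalars_linear[OF _ assms(3)] chain_complexD[OF assms(2)])

lemma restrict_scalars_is_homology:
  assumes R: "cring R" and H: "is_homology S X j H \<pi>" and h: "h \<in> ring_hom R S"
  shows "is_homology R (restrict_scalars_complex h X) j (restrict_scalars h H) \<pi>"
  unfolding is_homology_def
proof (intro conjI)
  note HD = is_homologyD[OF H]
  show "module R (restrict_scalars h H)" by (rule restrict_scalars_module[OF R HD(1) h])
  show "linear_map R ((obj (restrict_scalars_complex h X) j)\<lparr>carrier :=
      cycles (restrict_scalars_complex h X) j\<rparr>) (restrict_scalars h H) \<pi>"
    by (rule linear_mapI) (simp_all add: HD(2,3,4) ring_hom_closed[OF h])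
qed (use H in \<open>simp_all add: is_homology_def\<close>)

definition max_injective :: "('a, 'r) ring_scheme \<Rightarrow> ('a, 'a set \<Rightarrow> 'a set \<Rightarrow> 'a \<Rightarrow> rat) module" where
  "max_injective R = direct_sum (Max_Spec R)
     (\<lambda>m. injective_envelope R (quotient_module (self_module R) m))"

lemma ideal_quotient_module:
  assumes "cring R" "ideal I R"
  shows "module R (quotient_module (self_module R) I)"
proof -
  have "submod R (self_module R) I"
    using assms submodule_self_iff_ideal[OF assms(1)]
    by (intro submod.intro submod_axioms.intro self_module_module) auto
  then show ?thesis by (rule submod.quotient_module_module)
qed

lemma baer_max_injective:
  assumes "cring R" "noetherian_ring R" shows "baer R (max_injective R)"
  unfolding max_injective_def
proof (rule baer_direct_sum[OF assms])
  fix m assume "m \<in> Max_Spec R"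
  then have "ideal m R" by (simp add: Max_Spec_def maximalideal_def)
  then show "baer R (injective_envelope R (quotient_module (self_module R) m))"
    by (intro baer_injective_envelope ideal_quotient_module assms)
qed

lemma residue_field_module:
  assumes p: "primeideal p R"
  shows "module (localization_ring R p) (residue_field R p)"
proof -
  interpret L: cring "localization_ring R p" by (rule localization_ring_cring[OF p])
  interpret P: primeideal p R by fact
  have "localization_hom R p ` p \<subseteq> carrier (localization_ring R p)"
    using ring_hom_closed[OF localization_hom_hom[OF p]] P.a_subset by auto
  then have "ideal (Idl\<^bsub>localization_ring R p\<^esub> (localization_hom R p ` p)) (localization_ring R p)"
    by (rule L.genideal_ideal)
  then show ?thesis
    unfolding residue_field_def Let_def by (intro ideal_quotient_module L.cring_axioms)
qed

text \<open>The module to which the three functors that define the colocal dual take a single module.\<close>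

definition colocal_dual_module ::
  "('a, 'r) ring_scheme \<Rightarrow> 'a set \<Rightarrow> ('a, 'h) module
    \<Rightarrow> (('a \<times> 'a) set, (('h \<Rightarrow> 'a set \<Rightarrow> 'a set \<Rightarrow> 'a \<Rightarrow> rat) \<times> 'a) set
          \<Rightarrow> ('a \<times> 'a) set set \<Rightarrow> ('a \<times> 'a) set \<Rightarrow> rat) module" where
  "colocal_dual_module R p H = Hom_module (localization_ring R p)
     (localization_module R p (Hom_module R H (max_injective R)))
     (injective_envelope (localization_ring R p) (residue_field R p))"

lemma global_dual_complex:
  assumes "cring R" "noetherian_ring R" "chain_complex R M"
  shows "chain_complex R (global_dual R M)"
  unfolding global_dual_def max_injective_def[symmetric]
  using baer_max_injective[OF assms(1,2)]
  by (intro Hom_complex_complex concentrated_complex assms) (simp add: baer_def)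

lemma colocal_dual_complex:
  assumes "cring R" "noetherian_ring R" "chain_complex R M" and p: "primeideal p R"
  shows "chain_complex (localization_ring R p) (colocal_dual R p M)"
  unfolding colocal_dual_def
  using baer_injective_envelope[OF residue_field_module[OF p]]
  by (intro Hom_complex_complex concentrated_complex localization_complex_complex
      global_dual_complex assms) (simp add: baer_def)

text \<open>The colocal dual is a composite of three exact functors, so its homology in degree \<open>j\<close>
  depends on the homology of \<open>M\<close> in degree \<open>j\<close> only; the two contravariant steps cancel the
  changes of degree.\<close>

theorem colocal_dual_is_homology:
  assumes R: "cring R" and N: "noetherian_ring R" and M: "chain_complex R M"
    and p: "primeideal p R" and H: "is_homology R M j H \<pi>"
  shows "\<exists>\<pi>'. is_homology (localization_ring R p) (colocal_dual R p M) j
    (colocal_dual_module R p H) \<pi>'"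
proof -
  note C = global_dual_complex[OF R N M]
  have "\<exists>\<pi>'. is_homology R (global_dual R M) (- j) (Hom_module R H (max_injective R)) \<pi>'"
    unfolding global_dual_def max_injective_def[symmetric]
    using Hom_injective_is_homology[OF baer_max_injective[OF R N] M H] by blast
  then obtain \<pi>1 where "is_homology R (global_dual R M) (- j) (Hom_module R H (max_injective R)) \<pi>1" ..
  from Hom_injective_is_homology[OF baer_injective_envelope[OF residue_field_module[OF p]]
      localization_complex_complex[OF p C] localization_is_homology[OF p C this]]
  show ?thesis unfolding colocal_dual_def colocal_dual_module_def by auto
qed

definition single_degree :: "('a, 'x) cplx \<Rightarrow> bool" where
  "single_degree X \<longleftrightarrow> (\<forall>n. n \<noteq> 0 \<longrightarrow> carrier (obj X n) = {\<zero>\<^bsub>obj X n\<^esub>})"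

lemma Hom_concentrated_single_degree:
  assumes X: "chain_complex R X" and E: "module R E" and s: "single_degree X"
  shows "single_degree (Hom_complex R X (concentrated E))"
  unfolding single_degree_def
proof (intro allI impI)
  let ?G = "Hom_complex R X (concentrated E)"
  fix n :: int assume n: "n \<noteq> 0"
  note G = Hom_complex_complex[OF X concentrated_complex[OF E]]
  interpret G: module R "obj ?G n" by (rule chain_complexD[OF G])
  have "\<phi> = \<zero>\<^bsub>obj ?G n\<^esub>" if p: "\<phi> \<in> carrier (obj ?G n)" for \<phi>
  proof (rule Hom_complex_eqI[OF p G.M.zero_closed])
    fix i x assume x: "x \<in> carrier (obj X i)"
    have "\<phi> i x = \<zero>\<^bsub>E\<^esub>"
    proof (cases "i = 0")
      case True
      then show ?thesis using n by (intro Hom_concentrated_zero[OF p _ x]) simp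
    next
      case False
      then have x0: "x = \<zero>\<^bsub>obj X i\<^esub>" using s x unfolding single_degree_def by blast
      have "linear_map R (obj X i) (obj (concentrated E) (i + n)) (\<phi> i)"
        using p unfolding Hom_complex_carrier by blast
      then interpret f: lin R "obj X i" "obj (concentrated E) (i + n)" "\<phi> i"
        by (intro linI chain_complexD[OF X] concentrated_obj_module E)
      show ?thesis using f.zero x0 by simp
    qed
    then show "\<phi> i x = \<zero>\<^bsub>obj ?G n\<^esub> i x" using x by (simp add: Hom_complex_simps)
  qed
  then show "carrier (obj ?G n) = {\<zero>\<^bsub>obj ?G n\<^esub>}" using G.M.zero_closed by blast
qed

lemma localization_single_degree:
  assumes X: "chain_complex R X" and p: "primeideal p R" and s: "single_degree X"
  shows "single_degree (localization_complex R p X)"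
  unfolding single_degree_def
proof (intro allI impI)
  fix n :: int assume n: "n \<noteq> 0"
  interpret X: localizing p R "obj X n" by (rule localizing_intro[OF p chain_complexD(1)[OF X]])
  have "A = \<zero>\<^bsub>localization_module R p (obj X n)\<^esub>"
    if A: "A \<in> carrier (localization_module R p (obj X n))" for A
  proof -
    obtain x t where x: "A = frac R p (obj X n) x t" "x \<in> carrier (obj X n)" "t \<in> carrier R - p"
      using X.localization_cases[OF A] .
    have "x = \<zero>\<^bsub>obj X n\<^esub>" using s n x(2) unfolding single_degree_def by blast
    then show ?thesis unfolding x(1) X.frac_eq_zero_iff[OF x(2,3)]
      using X.S_one X.M.smult_r_null by (intro bexI[OF _ X.S_one]) simp
  qed
  moreover have "\<zero>\<^bsub>localization_module R p (obj X n)\<^esub> \<in> carrier (localization_module R p (obj X n))"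
    using abelian_groupE(2)[OF X.localization_group] .
  ultimately have "carrier (localization_module R p (obj X n)) = {\<zero>\<^bsub>localization_module R p (obj X n)\<^esub>}"
    by blast
  then show "carrier (obj (localization_complex R p X) n) = {\<zero>\<^bsub>obj (localization_complex R p X) n\<^esub>}"
    by (simp only: localization_complex_def cplx.simps)
qed

lemma colocal_dual_single_degree:
  assumes R: "cring R" and N: "noetherian_ring R" and M: "chain_complex R M"
    and p: "primeideal p R" and s: "single_degree M"
  shows "single_degree (colocal_dual R p M)"
proof -
  have "single_degree (global_dual R M)"
    unfolding global_dual_def max_injective_def[symmetric] using baer_max_injective[OF R N]
    by (intro Hom_concentrated_single_degree M s) (simp add: baer_def)
  then show ?thesis
    unfolding colocal_dual_def
    using baer_injective_envelope[OF residue_field_module[OF p]]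
    by (intro Hom_concentrated_single_degree localization_single_degree
        localization_complex_complex global_dual_complex R N M p) (simp add: baer_def)
qed


section \<open>Free modules\<close>

lemma free_module_module: "cring R \<Longrightarrow> module R (free_module R S)"
  unfolding free_module_def by (intro direct_sum_module self_module_module)

lemma free_module_carrier:
  "f \<in> carrier (free_module R S) \<longleftrightarrow>
    f \<in> extensional S \<and> (\<forall>s\<in>S. f s \<in> carrier R) \<and> finite {s \<in> S. f s \<noteq> \<zero>\<^bsub>R\<^esub>}"
  by (auto simp: free_module_def direct_sum_simps PiE_iff)

lemma free_module_simps:
  "zero (free_module R S) = (\<lambda>s\<in>S. \<zero>\<^bsub>R\<^esub>)"
  "f \<oplus>\<^bsub>free_module R S\<^esub> g = (\<lambda>s\<in>S. f s \<oplus>\<^bsub>R\<^esub> g s)"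
  "a \<odot>\<^bsub>free_module R S\<^esub> f = (\<lambda>s\<in>S. a \<otimes>\<^bsub>R\<^esub> f s)"
  by (simp_all add: free_module_def direct_sum_simps)

lemma free_gen_carrier:
  assumes "cring R" "s \<in> S" shows "free_gen R S s \<in> carrier (free_module R S)"
proof -
  interpret cring R by fact
  have "finite {t \<in> S. free_gen R S s t \<noteq> \<zero>\<^bsub>R\<^esub>}"
    by (rule finite_subset[of _ "{s}"]) (auto simp: free_gen_def split: if_splits)
  then show ?thesis by (auto simp: free_module_carrier free_gen_def)
qed

lemma free_module_induct:
  assumes R: "cring R" and K: "submodule K R (free_module R S)"
    and gen: "\<And>s. s \<in> S \<Longrightarrow> free_gen R S s \<in> K"
  shows "K = carrier (free_module R S)"
proof -
  interpret R: cring R by fact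
  interpret F: module R "free_module R S" by (rule free_module_module[OF R])
  note KE = F.submoduleE[OF K] F.submodule_zero[OF K]
  have "f \<in> K" if "finite A" "f \<in> carrier (free_module R S)" "{s \<in> S. f s \<noteq> \<zero>\<^bsub>R\<^esub>} \<subseteq> A" for A f
    using that
  proof (induction A arbitrary: f rule: finite_induct)
    case empty
    then have "f = \<zero>\<^bsub>free_module R S\<^esub>"
      by (intro extensionalityI[where A = S]) (auto simp: free_module_carrier free_module_simps)
    then show ?case using KE(7) by simp
  next
    case (insert a A)
    note fc = insert.prems(1)[unfolded free_module_carrier]
    show ?case
    proof (cases "a \<in> S")
      case False
      then show ?thesis using insert.prems by (intro insert.IH) auto
    next
      case True
      let ?g = "\<lambda>s\<in>S. if s = a then \<zero>\<^bsub>R\<^esub> else f s"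
      have "{s \<in> S. ?g s \<noteq> \<zero>\<^bsub>R\<^esub>} \<subseteq> {s \<in> S. f s \<noteq> \<zero>\<^bsub>R\<^esub>}" by auto
      then have "finite {s \<in> S. ?g s \<noteq> \<zero>\<^bsub>R\<^esub>}" using fc finite_subset by blast
      then have gc: "?g \<in> carrier (free_module R S)" using fc by (auto simp: free_module_carrier)
      moreover have "{s \<in> S. ?g s \<noteq> \<zero>\<^bsub>R\<^esub>} \<subseteq> A" using insert.prems(2) by auto
      ultimately have g: "?g \<in> K" by (rule insert.IH)
      have "f = f a \<odot>\<^bsub>free_module R S\<^esub> free_gen R S a \<oplus>\<^bsub>free_module R S\<^esub> ?g"
        using fc True
        by (intro extensionalityI[where A = S]) (auto simp: free_module_simps free_gen_def)
      moreover have "f a \<odot>\<^bsub>free_module R S\<^esub> free_gen R S a \<in> K"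
        using fc True gen by (intro KE(4)) auto
      ultimately show ?thesis using KE(5) g by metis
    qed
  qed
  then show ?thesis using KE(1) by (auto simp: free_module_carrier)
qed

lemma linear_eq_on_free_module:
  assumes "cring R" and f: "lin R (free_module R S) N f" and g: "lin R (free_module R S) N g"
    and eq: "\<And>s. s \<in> S \<Longrightarrow> f (free_gen R S s) = g (free_gen R S s)"
    and x: "x \<in> carrier (free_module R S)"
  shows "f x = g x"
proof -
  interpret f: lin R "free_module R S" N f by fact
  interpret g: lin R "free_module R S" N g by fact
  let ?K = "{x \<in> carrier (free_module R S). f x = g x}"
  have "submodule ?K R (free_module R S)" by (rule f.M.submoduleI) auto
  then have "?K = carrier (free_module R S)"
    using assms by (intro free_module_induct) (auto intro: free_gen_carrier)
  then show ?thesis using x by blast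
qed

definition direct_sum_lift ::
  "'s set \<Rightarrow> ('a, 'n) module \<Rightarrow> ('a, 'p) module \<Rightarrow> ('s \<Rightarrow> 'n \<Rightarrow> 'p) \<Rightarrow> ('s \<Rightarrow> 'n) \<Rightarrow> 'p" where
  "direct_sum_lift S N P g f = finsum P (\<lambda>s. g s (f s)) {s \<in> S. f s \<noteq> \<zero>\<^bsub>N\<^esub>}"

definition single :: "'s set \<Rightarrow> ('a, 'n) module \<Rightarrow> 's \<Rightarrow> 'n \<Rightarrow> 's \<Rightarrow> 'n" where
  "single S N s x = (\<lambda>t\<in>S. if t = s then x else \<zero>\<^bsub>N\<^esub>)"

context
  fixes R :: "('a, 'r) ring_scheme" and S :: "'s set" and N :: "('a, 'n) module"
    and P :: "('a, 'p) module" and g :: "'s \<Rightarrow> 'n \<Rightarrow> 'p"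
  assumes N: "module R N" and P: "module R P"
    and g: "\<And>s. s \<in> S \<Longrightarrow> linear_map R N P (g s)"
begin

lemma direct_sum_lift_superset:
  assumes f: "f \<in> carrier (direct_sum S (\<lambda>_. N))"
    and A: "finite A" "{s \<in> S. f s \<noteq> \<zero>\<^bsub>N\<^esub>} \<subseteq> A" "A \<subseteq> S"
  shows "direct_sum_lift S N P g f = finsum P (\<lambda>s. g s (f s)) A"
proof -
  interpret P: module R P by (rule P)
  have fc: "f s \<in> carrier N" if "s \<in> S" for s using f that by (auto simp: direct_sum_simps)
  have z: "g s \<zero>\<^bsub>N\<^esub> = \<zero>\<^bsub>P\<^esub>" if "s \<in> S" for s using lin.zero[OF linI[OF N P g[OF that]]] .
  show ?thesis unfolding direct_sum_lift_def
  proof (rule P.M.add.finprod_mono_neutral_cong_left[OF A(1,2)])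
    show "g s (f s) = \<zero>\<^bsub>P\<^esub>" if "s \<in> A - {s \<in> S. f s \<noteq> \<zero>\<^bsub>N\<^esub>}" for s using that A(3) z by auto
    show "(\<lambda>s. g s (f s)) \<in> A \<rightarrow> carrier P" using A(3) fc linear_map_closed[OF g] by blast
  qed simp
qed

lemma direct_sum_lift_linear:
  "linear_map R (direct_sum S (\<lambda>_. N)) P (direct_sum_lift S N P g)"
proof (rule linear_mapI)
  interpret P: module R P by (rule P)
  interpret N: module R N by (rule N)
  let ?D = "direct_sum S (\<lambda>_. N)"
  interpret D: module R ?D by (intro direct_sum_module N P.R.cring_axioms)
  note sup = direct_sum_lift_superset
  have gl: "lin R N P (g s)" if "s \<in> S" for s by (intro linI N P g that)
  have gc: "g s (f s) \<in> carrier P" if "f \<in> carrier ?D" "s \<in> S" for f s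
    using lin.closed[OF gl[OF that(2)]] that by (auto simp: direct_sum_simps)
  fix f assume f: "f \<in> carrier ?D"
  show "direct_sum_lift S N P g f \<in> carrier P"
    unfolding direct_sum_lift_def using gc[OF f] by (intro P.M.finsum_closed) auto
  have fc: "f s \<in> carrier N" if "s \<in> S" for s using f that by (auto simp: direct_sum_simps)
  {
    fix h assume h: "h \<in> carrier ?D"
    have hc: "h s \<in> carrier N" if "s \<in> S" for s using h that by (auto simp: direct_sum_simps)
    let ?A = "{s \<in> S. f s \<noteq> \<zero>\<^bsub>N\<^esub>} \<union> {s \<in> S. h s \<noteq> \<zero>\<^bsub>N\<^esub>}"
    have A: "finite ?A" "?A \<subseteq> S" using f h by (auto simp: direct_sum_simps)
    have fh: "f \<oplus>\<^bsub>?D\<^esub> h \<in> carrier ?D" using f h by (rule D.M.a_closed)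
    have s3: "{s \<in> S. (f \<oplus>\<^bsub>?D\<^esub> h) s \<noteq> \<zero>\<^bsub>N\<^esub>} \<subseteq> ?A" by (auto simp: direct_sum_simps)
    have "direct_sum_lift S N P g (f \<oplus>\<^bsub>?D\<^esub> h) = finsum P (\<lambda>s. g s ((f \<oplus>\<^bsub>?D\<^esub> h) s)) ?A"
      by (rule sup[OF fh A(1) s3 A(2)])
    also have "\<dots> = finsum P (\<lambda>s. g s (f s) \<oplus>\<^bsub>P\<^esub> g s (h s)) ?A"
    proof (rule P.M.finsum_cong'[OF refl])
      show "(\<lambda>s. g s (f s) \<oplus>\<^bsub>P\<^esub> g s (h s)) \<in> ?A \<rightarrow> carrier P" using gc[OF f] gc[OF h] by auto
      fix s assume "s \<in> ?A"
      then have s: "s \<in> S" by auto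
      show "g s ((f \<oplus>\<^bsub>?D\<^esub> h) s) = g s (f s) \<oplus>\<^bsub>P\<^esub> g s (h s)"
        using lin.add[OF gl[OF s] fc[OF s] hc[OF s]] s by (simp add: direct_sum_simps)
    qed
    also have "\<dots> = finsum P (\<lambda>s. g s (f s)) ?A \<oplus>\<^bsub>P\<^esub> finsum P (\<lambda>s. g s (h s)) ?A"
      using gc[OF f] gc[OF h] by (intro P.M.finsum_addf) auto
    also have "\<dots> = direct_sum_lift S N P g f \<oplus>\<^bsub>P\<^esub> direct_sum_lift S N P g h"
      using sup[OF f A(1) _ A(2)] sup[OF h A(1) _ A(2)] by simp
    finally show "direct_sum_lift S N P g (f \<oplus>\<^bsub>?D\<^esub> h)
      = direct_sum_lift S N P g f \<oplus>\<^bsub>P\<^esub> direct_sum_lift S N P g h" .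
  }
  fix a assume a: "a \<in> carrier R"
  let ?A = "{s \<in> S. f s \<noteq> \<zero>\<^bsub>N\<^esub>}"
  have A: "finite ?A" "?A \<subseteq> S" using f by (auto simp: direct_sum_simps)
  have fh: "a \<odot>\<^bsub>?D\<^esub> f \<in> carrier ?D" using a f by (rule D.smult_closed)
  have s3: "{s \<in> S. (a \<odot>\<^bsub>?D\<^esub> f) s \<noteq> \<zero>\<^bsub>N\<^esub>} \<subseteq> ?A" using a by (auto simp: direct_sum_simps)
  have "direct_sum_lift S N P g (a \<odot>\<^bsub>?D\<^esub> f) = finsum P (\<lambda>s. g s ((a \<odot>\<^bsub>?D\<^esub> f) s)) ?A"
    by (rule sup[OF fh A(1) s3 A(2)])
  also have "\<dots> = finsum P (\<lambda>s. a \<odot>\<^bsub>P\<^esub> g s (f s)) ?A"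
  proof (rule P.M.finsum_cong'[OF refl])
    show "(\<lambda>s. a \<odot>\<^bsub>P\<^esub> g s (f s)) \<in> ?A \<rightarrow> carrier P" using gc[OF f] a by auto
    fix s assume "s \<in> ?A"
    then have s: "s \<in> S" by auto
    show "g s ((a \<odot>\<^bsub>?D\<^esub> f) s) = a \<odot>\<^bsub>P\<^esub> g s (f s)"
      using lin.smult[OF gl[OF s] a fc[OF s]] s by (simp add: direct_sum_simps)
  qed
  also have "\<dots> = a \<odot>\<^bsub>P\<^esub> finsum P (\<lambda>s. g s (f s)) ?A"
    using gc[OF f] a A by (intro P.finsum_smult_ldistr[symmetric]) auto
  finally show "direct_sum_lift S N P g (a \<odot>\<^bsub>?D\<^esub> f) = a \<odot>\<^bsub>P\<^esub> direct_sum_lift S N P g f"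
    by (simp add: direct_sum_lift_def)
qed

lemma single_carrier:
  assumes "s \<in> S" "x \<in> carrier N" shows "single S N s x \<in> carrier (direct_sum S (\<lambda>_. N))"
proof -
  interpret N: module R N by (rule N)
  show ?thesis
    using assms by (intro direct_sumI[where A = "{s}"]) (auto simp: direct_product_simps single_def)
qed

lemma direct_sum_lift_single:
  assumes s: "s \<in> S" and x: "x \<in> carrier N"
  shows "direct_sum_lift S N P g (single S N s x) = g s x"
proof -
  interpret P: module R P by (rule P)
  have "direct_sum_lift S N P g (single S N s x) = finsum P (\<lambda>t. g t (single S N s x t)) {s}"
    using s by (intro direct_sum_lift_superset single_carrier x) (auto simp: single_def)
  also have "\<dots> = g s x" using s linear_map_closed[OF g[OF s] x] by (simp add: single_def Pi_iff)
  finally show ?thesis .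
qed

end

definition free_lift ::
  "('a, 'r) ring_scheme \<Rightarrow> 's set \<Rightarrow> ('a, 'n) module \<Rightarrow> ('s \<Rightarrow> 'n) \<Rightarrow> ('s \<Rightarrow> 'a) \<Rightarrow> 'n" where
  "free_lift R S N g = direct_sum_lift S (self_module R) N (\<lambda>s r. r \<odot>\<^bsub>N\<^esub> g s)"

lemma free_lift:
  assumes N: "module R N" and g: "\<And>s. s \<in> S \<Longrightarrow> g s \<in> carrier N"
  shows free_lift_linear: "linear_map R (free_module R S) N (free_lift R S N g)"
    and free_lift_gen: "s \<in> S \<Longrightarrow> free_lift R S N g (free_gen R S s) = g s"
proof -
  interpret N: module R N by fact
  note S = self_module_module[OF N.R.cring_axioms]
  have l: "linear_map R (self_module R) N (\<lambda>r. r \<odot>\<^bsub>N\<^esub> g s)" if "s \<in> S" for s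
    using g[OF that] by (intro linear_mapI) (simp_all add: N.smult_l_distr N.smult_assoc1)
  show "linear_map R (free_module R S) N (free_lift R S N g)"
    unfolding free_module_def free_lift_def by (intro direct_sum_lift_linear S N l)
  assume s: "s \<in> S"
  have "free_gen R S s = single S (self_module R) s \<one>\<^bsub>R\<^esub>"
    by (rule ext) (simp add: free_gen_def single_def restrict_def)
  then show "free_lift R S N g (free_gen R S s) = g s"
    using direct_sum_lift_single[where g = "\<lambda>s r. r \<odot>\<^bsub>N\<^esub> g s" and x = "\<one>\<^bsub>R\<^esub>", OF S N l s] g[OF s]
    by (simp add: free_lift_def)
qed

text \<open>Free modules are projective.\<close>

lemma free_module_lift_through:
  assumes p: "lin R A B p" and f: "lin R (free_module R S) B f"
    and img: "\<And>x. x \<in> carrier (free_module R S) \<Longrightarrow> f x \<in> p ` carrier A"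
  obtains g where "linear_map R (free_module R S) A g"
    "\<And>x. x \<in> carrier (free_module R S) \<Longrightarrow> p (g x) = f x"
proof -
  interpret p: lin R A B p by fact
  interpret f: lin R "free_module R S" B f by fact
  have R: "cring R" by (rule p.M.R.cring_axioms)
  have "\<forall>s\<in>S. \<exists>a. a \<in> carrier A \<and> p a = f (free_gen R S s)"
  proof
    fix s assume "s \<in> S"
    from img[OF free_gen_carrier[OF R this]]
    obtain a where "f (free_gen R S s) = p a" "a \<in> carrier A" by (rule imageE)
    then show "\<exists>a. a \<in> carrier A \<and> p a = f (free_gen R S s)" by (intro exI[of _ a]) simp
  qed
  from bchoice[OF this]
  obtain b where "\<forall>s\<in>S. b s \<in> carrier A \<and> p (b s) = f (free_gen R S s)" ..
  then have b: "s \<in> S \<Longrightarrow> b s \<in> carrier A" "s \<in> S \<Longrightarrow> p (b s) = f (free_gen R S s)" for s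
    by simp_all
  note L = free_lift[OF p.M.module_axioms b(1)]
  show ?thesis
  proof (rule that[OF L(1)])
    fix x assume x: "x \<in> carrier (free_module R S)"
    have "lin R (free_module R S) B (\<lambda>x. p (free_lift R S A b x))"
      by (intro linI f.M.module_axioms p.N.module_axioms linear_map_compose[OF L(1) p.lin])
    then show "p (free_lift R S A b x) = f x"
      by (rule linear_eq_on_free_module[OF R _ f _ x]) (simp only: L(2) b(2))
  qed
qed

section \<open>Existence of free resolutions\<close>

text \<open>A finitely supported function on words is encoded by one word that lists its support and
  values, with two distinct letters serving as continuation and end markers. So a submodule of a
  free module with basis a set of words can be covered by another such free module.\<close>

fun encode_pairs :: "(('a + 'n) list \<times> 'a) list \<Rightarrow> ('a + 'n) list" where
  "encode_pairs [] = []"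
| "encode_pairs ((w, a) # ps) =
    concat (map (\<lambda>x. [Inl undefined, x]) w) @ Inr undefined # Inl a # encode_pairs ps"

lemma encode_word_inj:
  "concat (map (\<lambda>x. [Inl u, x]) w) @ Inr v # r = concat (map (\<lambda>x. [Inl u, x]) w') @ Inr v # r'
    \<Longrightarrow> w = w' \<and> r = r'"
proof (induction w arbitrary: w')
  case Nil
  then show ?case by (cases w') auto
next
  case (Cons x w)
  then show ?case by (cases w') auto
qed

lemma encode_pairs_inj: "encode_pairs ps = encode_pairs qs \<Longrightarrow> ps = qs"
proof (induction ps arbitrary: qs rule: encode_pairs.induct)
  case 1
  then show ?case by (cases qs rule: encode_pairs.cases) auto
next
  case (2 w a ps)
  show ?case
  proof (cases qs rule: encode_pairs.cases)
    case 1
    then show ?thesis using 2(2) by auto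
  next
    case (2 w' a' qs')
    have "w = w' \<and> Inl a # encode_pairs ps = Inl a' # encode_pairs qs'"
      using "2.prems" unfolding 2 by (intro encode_word_inj) simp
    then show ?thesis using "2.IH"[of qs'] 2 by simp
  qed
qed

lemma free_module_encoding:
  fixes S :: "('a + 'n) list set" and R :: "('a, 'r) ring_scheme"
  obtains e :: "(('a + 'n) list \<Rightarrow> 'a) \<Rightarrow> ('a + 'n) list" where "inj_on e (carrier (free_module R S))"
proof -
  define supp where "supp f = {s \<in> S. f s \<noteq> \<zero>\<^bsub>R\<^esub>}" for f
  define l where "l f = (SOME xs. set xs = supp f)" for f
  have l: "set (l f) = supp f" if f: "f \<in> carrier (free_module R S)" for f
  proof -
    have "finite (supp f)" using f by (simp add: supp_def free_module_carrier)
    then show ?thesis unfolding l_def by (rule someI_ex[OF finite_list])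
  qed
  have "inj_on (\<lambda>f. encode_pairs (map (\<lambda>s. (s, f s)) (l f))) (carrier (free_module R S))"
  proof (rule inj_onI)
    fix f g assume f: "f \<in> carrier (free_module R S)" and g: "g \<in> carrier (free_module R S)"
      and "encode_pairs (map (\<lambda>s. (s, f s)) (l f)) = encode_pairs (map (\<lambda>s. (s, g s)) (l g))"
    then have "map (\<lambda>s. (s, f s)) (l f) = map (\<lambda>s. (s, g s)) (l g)" by (intro encode_pairs_inj)
    then have "set (map (\<lambda>s. (s, f s)) (l f)) = set (map (\<lambda>s. (s, g s)) (l g))" by (rule arg_cong)
    then have *: "(\<lambda>s. (s, f s)) ` supp f = (\<lambda>s. (s, g s)) ` supp g" using l[OF f] l[OF g] by simp
    show "f = g"
    proof (rule extensionalityI[where A = S])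
      show "f \<in> extensional S" "g \<in> extensional S" using f g by (simp_all add: free_module_carrier)
      fix s assume s: "s \<in> S"
      have "(s, f s) \<in> (\<lambda>s. (s, g s)) ` supp g" if "s \<in> supp f"
        unfolding *[symmetric] using that by (rule imageI)
      moreover have "(s, g s) \<in> (\<lambda>s. (s, f s)) ` supp f" if "s \<in> supp g"
        unfolding * using that by (rule imageI)
      ultimately show "f s = g s" using s by (cases "s \<in> supp f"; cases "s \<in> supp g") (auto simp: supp_def)
    qed
  qed
  then show ?thesis by (rule that)
qed

lemma free_cover:
  fixes N :: "('a, 'n) module" and e :: "'n \<Rightarrow> 's"
  assumes N: "module R N" and e: "inj_on e (carrier N)"
  obtains S d where "linear_map R (free_module R (S :: 's set)) N d"
    "d ` carrier (free_module R S) = carrier N"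
proof -
  have R: "cring R" using N by (simp add: module_def)
  let ?S = "e ` carrier N" and ?g = "inv_into (carrier N) e"
  have g: "?g s \<in> carrier N" if "s \<in> ?S" for s using that by (rule inv_into_into)
  note L = free_lift[OF N g]
  show ?thesis
  proof (rule that[OF L(1)])
    show "free_lift R ?S N ?g ` carrier (free_module R ?S) = carrier N"
    proof (intro equalityI subsetI)
      fix n assume n: "n \<in> carrier N"
      have "free_lift R ?S N ?g (free_gen R ?S (e n)) = ?g (e n)" by (intro L(2) imageI n)
      also have "\<dots> = n" using e n by simp
      finally show "n \<in> free_lift R ?S N ?g ` carrier (free_module R ?S)"
        using free_gen_carrier[OF R imageI[OF n]] by (metis imageI)
    qed (use linear_map_closed[OF L(1)] in auto)
  qed
qed

text \<open>Each step covers the kernel of the previous differential by a free module. All kernels are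
  submodules of free modules whose bases consist of words, so one type accommodates every step.\<close>

theorem free_resolution_exists:
  fixes R :: "('a, 'r) ring_scheme" and N :: "('a, 'n) module"
  assumes N: "module R N"
  shows "\<exists>F :: ('a, ('a + 'n) list \<Rightarrow> 'a) cplx. is_free_resolution R N F"
proof -
  interpret N: module R N by fact
  have R: "cring R" by (rule N.R.cring_axioms)
  have Fm: "module R (free_module R S)" for S by (rule free_module_module[OF R])
  have iN: "inj_on (\<lambda>x. [Inr x :: 'a + 'n]) (carrier N)" by (auto intro: inj_onI)
  obtain S0 :: "('a + 'n) list set" and \<epsilon> where
    e: "linear_map R (free_module R S0) N \<epsilon>" "\<epsilon> ` carrier (free_module R S0) = carrier N"
    by (rule free_cover[OF N iN])
  interpret e: lin R "free_module R S0" N \<epsilon> by (intro linI Fm N e)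
  let ?K0 = "{x \<in> carrier (free_module R S0). \<epsilon> x = \<zero>\<^bsub>N\<^esub>}"
  (* A state consists of the basis in degree n and the submodule that is to be the image of the next
    differential. *)
  let ?P = "\<lambda>n :: nat. \<lambda>(S :: ('a + 'n) list set, K). submodule K R (free_module R S) \<and>
    (n = 0 \<longrightarrow> S = S0 \<and> K = ?K0)"
  let ?Q = "\<lambda>n :: nat. \<lambda>(S :: ('a + 'n) list set, K) (S' :: ('a + 'n) list set, K').
    \<exists>d. linear_map R (free_module R S') (free_module R S) d \<and> d ` carrier (free_module R S') = K \<and>
      K' = {x \<in> carrier (free_module R S'). d x = \<zero>\<^bsub>free_module R S\<^esub>}"
  have "\<exists>t. \<forall>n. ?P n (t n) \<and> ?Q n (t n) (t (Suc n))"
  proof (rule dependent_nat_choice)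
    show "\<exists>x. ?P 0 x" using e.kernel_submodule by (intro exI[where x = "(S0, ?K0)"]) simp
  next
    fix x n assume "?P n x"
    then obtain S K where x: "x = (S, K)" and K: "submodule K R (free_module R S)" by (cases x) simp
    obtain c :: "(('a + 'n) list \<Rightarrow> 'a) \<Rightarrow> ('a + 'n) list" where c: "inj_on c (carrier (free_module R S))"
      by (rule free_module_encoding)
    interpret F: module R "free_module R S" by (rule Fm)
    have Km: "module R ((free_module R S)\<lparr>carrier := K\<rparr>)" by (rule submodule.submodule_is_module[OF K Fm])
    have cK: "inj_on c (carrier ((free_module R S)\<lparr>carrier := K\<rparr>))"
      using inj_on_subset[OF c F.submoduleE(1)[OF K]] by simp
    obtain S' :: "('a + 'n) list set" and d where
      d: "linear_map R (free_module R S') ((free_module R S)\<lparr>carrier := K\<rparr>) d"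
      "d ` carrier (free_module R S') = carrier ((free_module R S)\<lparr>carrier := K\<rparr>)"
      by (rule free_cover[OF Km cK])
    have d': "linear_map R (free_module R S') (free_module R S) d"
      using d(1) F.submoduleE(1)[OF K] by (auto simp: linear_map_def)
    interpret d: lin R "free_module R S'" "free_module R S" d by (intro linI Fm d')
    show "\<exists>y. ?P (Suc n) y \<and> ?Q n x y"
      using d.kernel_submodule d' d(2) unfolding x
      by (intro exI[where x = "(S', {x \<in> carrier (free_module R S'). d x = \<zero>\<^bsub>free_module R S\<^esub>})"]) auto
  qed
  then obtain t where t': "\<forall>n. ?P n (t n) \<and> ?Q n (t n) (t (Suc n))" by (rule exE)
  have t: "?P n (t n)" for n using spec[OF t'] by (rule conjunct1)
  have t2: "?Q n (t n) (t (Suc n))" for n using spec[OF t'] by (rule conjunct2)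
  define S where "S n = fst (t n)" for n
  define K where "K n = snd (t n)" for n
  have tn: "t n = (S n, K n)" for n by (simp add: S_def K_def)
  have t0: "S 0 = S0" "K 0 = ?K0" using t[of 0] by (simp_all add: tn)
  have Ksub: "submodule (K n) R (free_module R (S n))" for n using t[of n] by (simp add: tn)
  have "\<exists>d. linear_map R (free_module R (S (Suc n))) (free_module R (S n)) d \<and>
      d ` carrier (free_module R (S (Suc n))) = K n \<and>
      K (Suc n) = {x \<in> carrier (free_module R (S (Suc n))). d x = \<zero>\<^bsub>free_module R (S n)\<^esub>}" for n
    using t2[of n] unfolding tn by simp
  from choice[OF allI[OF this]] obtain D where
    "\<forall>n. linear_map R (free_module R (S (Suc n))) (free_module R (S n)) (D n) \<and>
      D n ` carrier (free_module R (S (Suc n))) = K n \<and>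
      K (Suc n) = {x \<in> carrier (free_module R (S (Suc n))). D n x = \<zero>\<^bsub>free_module R (S n)\<^esub>}" ..
  then have D: "linear_map R (free_module R (S (Suc n))) (free_module R (S n)) (D n)"
    "D n ` carrier (free_module R (S (Suc n))) = K n"
    "K (Suc n) = {x \<in> carrier (free_module R (S (Suc n))). D n x = \<zero>\<^bsub>free_module R (S n)\<^esub>}" for n
    by simp_all
  let ?E = "free_module R ({} :: ('a + 'n) list set)"
  interpret E: module R ?E by (rule Fm)
  have E0: "carrier ?E = {\<zero>\<^bsub>?E\<^esub>}"
    by (auto simp: free_module_carrier free_module_simps extensional_def)
  define F :: "('a, ('a + 'n) list \<Rightarrow> 'a) cplx" where
    "F = \<lparr>obj = \<lambda>n. if n < 0 then ?E else free_module R (S (nat n)),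
      diff = \<lambda>n. if n \<le> 0 then (\<lambda>_. \<zero>\<^bsub>?E\<^esub>) else D (nat n - 1)\<rparr>"
  have oneg: "obj F n = ?E" if "n < 0" for n using that by (simp add: F_def)
  have opos: "obj F (int m) = free_module R (S m)" for m by (simp add: F_def)
  have dneg: "diff F n = (\<lambda>_. \<zero>\<^bsub>?E\<^esub>)" if "n \<le> 0" for n using that by (simp add: F_def)
  have dpos: "diff F (int (Suc m)) = D m" for m by (simp add: F_def del: of_nat_Suc)
  have Fo: "module R (obj F n)" for n by (simp add: F_def Fm)
  have cases: "n < 0 \<or> n = 0 \<or> (\<exists>m. n = int (Suc m))" for n :: int
  proof -
    have "n = int (Suc (nat (n - 1)))" if "n > 0" using that by simp
    then show ?thesis by (meson linorder_neqE_linordered_idom)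
  qed
  have suc1: "int (Suc m) - 1 = int m" for m by simp
  have DK: "D m x \<in> K m" if "x \<in> carrier (free_module R (S (Suc m)))" for m x
    using D(2)[of m] imageI[OF that, of "D m"] by simp
  have F: "chain_complex R F"
    unfolding chain_complex_def
  proof (intro conjI allI ballI Fo)
    fix n
    consider "n \<le> 0" | m where "n = int (Suc m)" using cases[of n] by force
    then show "linear_map R (obj F n) (obj F (n - 1)) (diff F n)"
    proof cases
      case 1
      then show ?thesis unfolding dneg[OF 1] using oneg[of "n - 1"] by (auto simp: linear_map_def)
    next
      case 2
      show ?thesis unfolding 2 suc1 opos dpos by (rule D(1))
    qed
    fix x assume x: "x \<in> carrier (obj F n)"
    have "n = int (Suc (Suc (nat (n - 2))))" if "\<not> n \<le> 1" using that by simp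
    then consider "n \<le> 1" | m where "n = int (Suc (Suc m))" by blast
    then show "diff F (n - 1) (diff F n x) = \<zero>\<^bsub>obj F (n - 2)\<^esub>"
    proof cases
      case 1
      then show ?thesis using dneg[of "n - 1"] oneg[of "n - 2"] by simp
    next
      case 2
      have "D (Suc m) x \<in> K (Suc m)" using x unfolding 2 opos by (rule DK)
      then have "D m (D (Suc m) x) = \<zero>\<^bsub>free_module R (S m)\<^esub>" unfolding D(3) by simp
      moreover have "int (Suc (Suc m)) - 2 = int m" by simp
      ultimately show ?thesis unfolding 2 suc1 dpos by (simp only: opos)
    qed
  qed
  note C = chain_complexD[OF F]
  define f where "f n = (if n = 0 then \<epsilon> else (\<lambda>_. \<zero>\<^bsub>N\<^esub>))" for n :: int
  have o0: "obj F 0 = free_module R S0" using opos[of 0] t0(1) by simp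
  have b0: "boundaries F 0 = ?K0"
    using D(2)[of 0] opos[of 1] dpos[of 0] t0 by (simp add: boundaries_def)
  have cm: "chain_map R F (concentrated N) f"
    unfolding chain_map_def
  proof (intro conjI allI ballI)
    fix n
    show "linear_map R (obj F n) (obj (concentrated N) n) (f n)"
    proof (cases "n = 0")
      case True
      then show ?thesis using e(1) o0 by (simp add: f_def linear_map_def)
    qed (auto simp: f_def linear_map_def)
    fix x assume x: "x \<in> carrier (obj F n)"
    show "f (n - 1) (diff F n x) = diff (concentrated N) n (f n x)"
    proof (cases "n = 1")
      case True
      have "diff F 1 x \<in> boundaries F 0" using x True by (simp add: boundaries_def)
      then show ?thesis using True unfolding b0 by (simp add: f_def)
    qed (simp add: f_def)
  qed
  have "quasi_iso R F (concentrated N) f"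
  proof (rule quasi_isoI[OF F concentrated_complex[OF N] cm])
    fix n z assume z: "z \<in> cycles F n" and fz: "f n z \<in> boundaries (concentrated N) n"
    have zc: "z \<in> carrier (obj F n)" using z by (simp add: cycles_def)
    consider "n < 0" | "n = 0" | m where "n = int (Suc m)" using cases[of n] by blast
    then show "z \<in> boundaries F n"
    proof cases
      case 1
      then have "z = \<zero>\<^bsub>obj F n\<^esub>" using zc oneg E0 by auto
      moreover have "submodule (boundaries F n) R (obj F n)" by (intro boundaries_submodule C)
      ultimately show ?thesis using module.submodule_zero[OF Fo] by simp
    next
      case 2
      then show ?thesis using fz zc b0 o0 by (auto simp: f_def boundaries_def split: if_splits)
    next
      case 3
      have "int (Suc m) + 1 = int (Suc (Suc m))" by simp
      then have "boundaries F n = K (Suc m)"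
        unfolding boundaries_def 3 by (simp only: opos dpos D(2))
      moreover have "z \<in> K (Suc m)"
        using z unfolding cycles_def 3 suc1 opos dpos D(3) by simp
      ultimately show ?thesis by simp
    qed
  next
    fix n y assume y: "y \<in> cycles (concentrated N) n"
    show "\<exists>z\<in>cycles F n. f n z \<ominus>\<^bsub>obj (concentrated N) n\<^esub> y \<in> boundaries (concentrated N) n"
    proof -
      interpret Cn: module R "obj (concentrated N) n" by (rule concentrated_obj_module[OF N])
      have Bn: "submodule (boundaries (concentrated N) n) R (obj (concentrated N) n)"
        by (intro boundaries_submodule chain_complexD[OF concentrated_complex[OF N]])
      have yc: "y \<in> carrier (obj (concentrated N) n)" using y by (simp add: cycles_def)
      have "\<exists>z\<in>cycles F n. f n z = y"
      proof (cases "n = 0")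
        case True
        then have "y \<in> \<epsilon> ` carrier (free_module R S0)" using yc e(2) by simp
        then obtain z where "z \<in> carrier (free_module R S0)" "y = \<epsilon> z" by (rule imageE)
        then show ?thesis using True o0 dneg[of 0] oneg[of "-1"]
          by (intro bexI[where x = z]) (simp_all add: f_def cycles_def)
      next
        case False
        then have "f n \<zero>\<^bsub>obj F n\<^esub> = y" using yc by (simp add: f_def)
        moreover have "submodule (cycles F n) R (obj F n)" by (intro cycles_submodule C)
        then have "\<zero>\<^bsub>obj F n\<^esub> \<in> cycles F n" by (rule module.submodule_zero[OF Fo])
        ultimately show ?thesis by blast
      qed
      then obtain z where z: "z \<in> cycles F n" "f n z = y" by blast
      have "y \<ominus>\<^bsub>obj (concentrated N) n\<^esub> y = \<zero>\<^bsub>obj (concentrated N) n\<^esub>"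
        using Cn.M.minus_eq_zero_iff[OF yc yc] by blast
      then show ?thesis using z Cn.submodule_zero[OF Bn] by (intro bexI[where x = z]) simp_all
    qed
  qed
  then have "is_free_resolution R N F"
    unfolding is_free_resolution_def
  proof (intro conjI allI impI F)
    show "\<exists>S. obj F n = free_module R S" for n by (cases "n < 0") (auto simp: F_def)
  qed (auto simp: oneg)
  then show ?thesis by blast
qed

text \<open>Freeness makes lifting along surjections possible, and vanishing in negative degrees gives the
  inductions over the components of a cycle a place to start.\<close>

definition free_complex :: "('a, 'r) ring_scheme \<Rightarrow> ('a, 's \<Rightarrow> 'a) cplx \<Rightarrow> bool" where
  "free_complex R F \<longleftrightarrow> chain_complex R F \<and> (\<forall>n. \<exists>S. obj F n = free_module R S) \<and>
     (\<forall>n<0. carrier (obj F n) = {\<zero>\<^bsub>obj F n\<^esub>})"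

lemma free_resolution_free_complex:
  assumes "module R N" shows "free_complex R (free_resolution R N)"
proof -
  have "is_free_resolution R N (free_resolution R N)"
    unfolding free_resolution_def by (rule someI_ex[OF free_resolution_exists[OF assms]])
  then show ?thesis unfolding is_free_resolution_def free_complex_def
    by (auto simp: free_module_carrier free_module_simps extensional_def)
qed


section \<open>Homomorphisms from a free resolution\<close>

text \<open>Acyclicity of \<open>Hom(F, H)\<close>, stated for single maps because \<open>H\<close> is a module and not a complex.\<close>

definition hom_exact :: "('a, 'r) ring_scheme \<Rightarrow> ('a, 'f) cplx \<Rightarrow> ('a, 'h) module \<Rightarrow> bool" where
  "hom_exact R F H \<longleftrightarrow> (\<forall>k f. linear_map R (obj F k) H f \<and>
     (\<forall>x\<in>carrier (obj F (k + 1)). f (diff F (k + 1) x) = \<zero>\<^bsub>H\<^esub>) \<longrightarrow>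
     (\<exists>w. linear_map R (obj F (k - 1)) H w \<and> (\<forall>x\<in>carrier (obj F k). f x = w (diff F k x))))"

lemma free_complexD:
  assumes "free_complex R F"
  shows "chain_complex R F" "\<exists>S. obj F n = free_module R S"
    "n < 0 \<Longrightarrow> x \<in> carrier (obj F n) \<Longrightarrow> x = \<zero>\<^bsub>obj F n\<^esub>"
  using assms unfolding free_complex_def by blast+

lemma free_complex_lift_through:
  assumes F: "free_complex R F" and p: "lin R A B p" and f: "lin R (obj F n) B f"
    and img: "\<And>x. x \<in> carrier (obj F n) \<Longrightarrow> f x \<in> p ` carrier A"
  obtains g where "linear_map R (obj F n) A g" "\<And>x. x \<in> carrier (obj F n) \<Longrightarrow> p (g x) = f x"
proof -
  obtain S where S: "obj F n = free_module R S" using free_complexD(2)[OF F] by blast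
  show ?thesis
    using free_module_lift_through[OF p f[unfolded S]] img that unfolding S by blast
qed

text \<open>A cocycle \<open>g\<close> with values in cycles is a coboundary up to boundaries, by exactness on
  homology; both corrections lift along surjections because \<open>F\<close> is free.\<close>

lemma hom_exact_correction:
  fixes N :: "('a, 'm) cplx" and H :: "('a, 'h) module"
  assumes F: "free_complex R F" and N: "chain_complex R N" and H: "is_homology R N j H \<pi>"
    and ex: "hom_exact R F H"
    and g: "linear_map R (obj F k) (obj N j) g"
    and cyc: "\<And>x. x \<in> carrier (obj F k) \<Longrightarrow> diff N j (g x) = \<zero>\<^bsub>obj N (j - 1)\<^esub>"
    and bd: "\<And>x. x \<in> carrier (obj F (k + 1)) \<Longrightarrow> g (diff F (k + 1) x) \<in> boundaries N j"
  obtains \<omega> \<chi> where "linear_map R (obj F (k - 1)) (obj N j) \<omega>"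
    "\<And>x. x \<in> carrier (obj F (k - 1)) \<Longrightarrow> diff N j (\<omega> x) = \<zero>\<^bsub>obj N (j - 1)\<^esub>"
    "linear_map R (obj F k) (obj N (j + 1)) \<chi>"
    "\<And>x. x \<in> carrier (obj F k) \<Longrightarrow> g x = diff N (j + 1) (\<chi> x) \<oplus>\<^bsub>obj N j\<^esub> \<omega> (diff F k x)"
proof -
  note CN = chain_complexD[OF N] and CF = chain_complexD[OF free_complexD(1)[OF F]]
  note HD = is_homologyD[OF H]
  interpret N: module R "obj N j" by (rule CN)
  interpret H: module R H by (rule HD)
  interpret g: lin R "obj F k" "obj N j" g by (intro linI CN CF g)
  interpret dF: lin R "obj F k" "obj F (k - 1)" "diff F k" by (intro linI CF)
  have Z: "submodule (cycles N j) R (obj N j)" by (intro cycles_submodule CN)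
  note ZE = N.submoduleE[OF Z]
  have gZ: "g x \<in> cycles N j" if "x \<in> carrier (obj F k)" for x
    using cyc[OF that] g.closed[OF that] by (simp add: cycles_def)
  have dF1: "diff F (k + 1) x \<in> carrier (obj F k)" if "x \<in> carrier (obj F (k + 1))" for x
    using linear_map_closed[OF CF(2) that] by simp
  have "linear_map R (obj F k) H (\<lambda>x. \<pi> (g x))"
    using gZ HD(2) by (intro linear_mapI) (simp_all add: HD(3,4))
  moreover have "\<pi> (g (diff F (k + 1) x)) = \<zero>\<^bsub>H\<^esub>" if "x \<in> carrier (obj F (k + 1))" for x
    using HD(6)[OF gZ[OF dF1[OF that]]] bd[OF that] by simp
  ultimately obtain w where w: "linear_map R (obj F (k - 1)) H w"
    "\<And>x. x \<in> carrier (obj F k) \<Longrightarrow> \<pi> (g x) = w (diff F k x)"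
    using ex unfolding hom_exact_def by blast
  interpret p: lin R "(obj N j)\<lparr>carrier := cycles N j\<rparr>" H \<pi>
    using H by (intro linI submodule.submodule_is_module[OF Z] CN HD) (simp add: is_homology_def)
  interpret w: lin R "obj F (k - 1)" H w by (intro linI CF HD w)
  have "w x \<in> \<pi> ` carrier ((obj N j)\<lparr>carrier := cycles N j\<rparr>)" if x: "x \<in> carrier (obj F (k - 1))" for x
  proof -
    obtain z where "z \<in> cycles N j" "\<pi> z = w x" using HD(5)[OF w.closed[OF x]] by (rule bexE)
    then show ?thesis by (intro image_eqI[of _ _ z]) simp_all
  qed
  then obtain \<omega> where o: "linear_map R (obj F (k - 1)) ((obj N j)\<lparr>carrier := cycles N j\<rparr>) \<omega>"
    "\<And>x. x \<in> carrier (obj F (k - 1)) \<Longrightarrow> \<pi> (\<omega> x) = w x"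
    using free_complex_lift_through[OF F p.lin_axioms w.lin_axioms] by blast
  have oZ: "\<omega> x \<in> cycles N j" if "x \<in> carrier (obj F (k - 1))" for x
    using linear_map_closed[OF o(1) that] by simp
  have oc: "\<omega> x \<in> carrier (obj N j)" if "x \<in> carrier (obj F (k - 1))" for x
    using oZ[OF that] by (simp add: cycles_def)
  have olin: "linear_map R (obj F (k - 1)) (obj N j) \<omega>"
    using o(1) oc by (simp add: linear_map_def)
  interpret o: lin R "obj F (k - 1)" "obj N j" \<omega> by (intro linI CF CN olin)
  let ?m = "\<ominus>\<^bsub>R\<^esub> \<one>\<^bsub>R\<^esub>"
  have m: "?m \<in> carrier R" by simp
  let ?h = "\<lambda>x. g x \<oplus>\<^bsub>obj N j\<^esub> ?m \<odot>\<^bsub>obj N j\<^esub> \<omega> (diff F k x)"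
  have "linear_map R (obj F k) (obj N j) ?h"
    by (rule linear_mapI)
      (simp_all add: N.smult_r_distr N.M.a_ac N.smult_assoc1[symmetric] N.R.m_comm)
  then interpret h: lin R "obj F k" "obj N j" ?h by (intro linI CF CN)
  have d1: "linear_map R (obj N (j + 1)) (obj N j) (diff N (j + 1))" using CN(2)[of "j + 1"] by simp
  interpret d1: lin R "obj N (j + 1)" "obj N j" "diff N (j + 1)" by (intro linI CN d1)
  have "?h x \<in> diff N (j + 1) ` carrier (obj N (j + 1))" if x: "x \<in> carrier (obj F k)" for x
  proof -
    note a = gZ[OF x] oZ[OF dF.closed[OF x]]
    have "\<pi> (?h x) = \<pi> (g x) \<oplus>\<^bsub>H\<^esub> ?m \<odot>\<^bsub>H\<^esub> w (diff F k x)"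
      using HD(3)[OF a(1) ZE(4)[OF m a(2)]] HD(4)[OF m a(2)] o(2)[OF dF.closed[OF x]] by simp
    also have "\<dots> = \<zero>\<^bsub>H\<^esub>"
      using w(2)[OF x] w.closed[OF dF.closed[OF x]] by (simp add: H.smult_l_minus H.M.r_neg)
    finally have "?h x \<in> boundaries N j" using HD(6)[OF ZE(5)[OF a(1) ZE(4)[OF m a(2)]]] by simp
    then show ?thesis by (simp add: boundaries_def)
  qed
  then obtain \<chi> where c: "linear_map R (obj F k) (obj N (j + 1)) \<chi>"
    "\<And>x. x \<in> carrier (obj F k) \<Longrightarrow> diff N (j + 1) (\<chi> x) = ?h x"
    using free_complex_lift_through[OF F d1.lin_axioms h.lin_axioms] by blast
  show ?thesis
  proof (rule that[OF olin _ c(1)])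
    show "diff N j (\<omega> x) = \<zero>\<^bsub>obj N (j - 1)\<^esub>" if "x \<in> carrier (obj F (k - 1))" for x
      using oZ[OF that] by (simp add: cycles_def)
    fix x assume x: "x \<in> carrier (obj F k)"
    then show "g x = diff N (j + 1) (\<chi> x) \<oplus>\<^bsub>obj N j\<^esub> \<omega> (diff F k x)"
      unfolding c(2)[OF x] by (simp add: N.smult_l_minus N.M.a_assoc N.M.l_neg)
  qed
qed

text \<open>If \<open>Hom(F, -)\<close> is exact on every homology module of \<open>N\<close>, then \<open>Hom(F, N)\<close> is exact: a
  cycle \<open>\<phi> = (\<phi>\<^sub>i)\<close> is made a boundary component by component, starting at \<open>i = 0\<close>. Treating
  component \<open>k\<close> changes the preimage only in degrees \<open>k - 1\<close> and \<open>k\<close>, so each of its components is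
  eventually constant, and the limit exists because the components form a product. This is the
  convergence of the spectral sequence from \<open>Ext(-, H(N))\<close> to \<open>H(RHom(-, N))\<close>, which rests on the
  vanishing of \<open>F\<close> in negative degrees.\<close>

theorem Hom_free_complex_exact:
  fixes R :: "('a, 'r) ring_scheme" and F :: "('a, 's \<Rightarrow> 'a) cplx" and N :: "('a, 'm) cplx"
    and H :: "int \<Rightarrow> ('a, 'h) module"
  assumes F: "free_complex R F" and N: "chain_complex R N"
    and H: "\<And>j. is_homology R N j (H j) (\<pi> j)" and ex: "\<And>j. hom_exact R F (H j)"
  shows "exact_complex (Hom_complex R F N)"
  unfolding exact_complex_def
proof (intro allI subsetI)
  fix n \<phi>
  let ?X = "Hom_complex R F N"
  assume p: "\<phi> \<in> cycles ?X n"
  have FC: "chain_complex R F" by (rule free_complexD(1)[OF F])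
  note CN = chain_complexD[OF N] and CF = chain_complexD[OF FC]
  note X = Hom_complex_complex[OF FC N]
  note CX = chain_complexD[OF X]
  have pc: "\<phi> \<in> carrier (obj ?X n)" using p by (simp add: cycles_def)
  interpret R: cring R using CN(1)[of 0] by (simp add: module_def)
  interpret Xn: module R "obj ?X n" by (rule CX)
  interpret Xn1: module R "obj ?X (n + 1)" by (rule CX)
  have d1: "linear_map R (obj ?X (n + 1)) (obj ?X n) (diff ?X (n + 1))" using CX(2)[of "n + 1"] by simp
  interpret d1: lin R "obj ?X (n + 1)" "obj ?X n" "diff ?X (n + 1)" by (intro linI CX d1)
  have ZX: "submodule (cycles ?X n) R (obj ?X n)" by (intro cycles_submodule CX)
  note ZXE = Xn.submoduleE[OF ZX]
  have HX: "linear_map R (obj F i) (obj N (i + m)) (\<psi> i)" "\<psi> i \<in> extensional (carrier (obj F i))"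
    if "\<psi> \<in> carrier (obj ?X m)" for \<psi> m i
    using that unfolding Hom_complex_carrier by simp_all
  have dF: "diff F i x \<in> carrier (obj F (i - 1))" if "x \<in> carrier (obj F i)" for i x
    using linear_map_closed[OF CF(2) that] .
  let ?m = "\<ominus>\<^bsub>R\<^esub> \<one>\<^bsub>R\<^esub>"
  let ?e = "hom_sign R (n + 1)"
  define correct where "correct k \<psi> \<longleftrightarrow> \<psi> \<in> carrier (obj ?X (n + 1)) \<and>
    (\<forall>i<k. \<forall>x\<in>carrier (obj F i). diff ?X (n + 1) \<psi> i x = \<phi> i x)" for k :: int and \<psi>
  have step: "\<exists>\<psi>'. correct (k + 1) \<psi>' \<and> (\<forall>i<k - 1. \<psi>' i = \<psi> i)" if c: "correct k \<psi>" for k \<psi>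
  proof -
    have q: "\<psi> \<in> carrier (obj ?X (n + 1))"
      and cor: "\<And>i x. i < k \<Longrightarrow> x \<in> carrier (obj F i) \<Longrightarrow> diff ?X (n + 1) \<psi> i x = \<phi> i x"
      using c unfolding correct_def by blast+
    let ?dq = "diff ?X (n + 1) \<psi>"
    have dqc: "?dq \<in> carrier (obj ?X n)" by (rule d1.closed[OF q])
    have dqb: "?dq \<in> boundaries ?X n" unfolding boundaries_def using q by (rule imageI)
    have dqZ: "?dq \<in> cycles ?X n" using boundaries_subset_cycles[OF X] dqb by (rule subsetD)
    (* The error of psi, a cycle that vanishes in all components below k. *)
    define \<rho> where "\<rho> = \<phi> \<oplus>\<^bsub>obj ?X n\<^esub> ?m \<odot>\<^bsub>obj ?X n\<^esub> ?dq"
    have rZ: "\<rho> \<in> cycles ?X n" unfolding \<rho>_def by (intro ZXE(4,5) p dqZ) simp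
    then have r: "\<rho> \<in> carrier (obj ?X n)" and dr: "diff ?X n \<rho> = \<zero>\<^bsub>obj ?X (n - 1)\<^esub>"
      by (simp_all add: cycles_def)
    have rho: "\<rho> i x = \<phi> i x \<oplus>\<^bsub>obj N (i + n)\<^esub> ?m \<odot>\<^bsub>obj N (i + n)\<^esub> ?dq i x" if "x \<in> carrier (obj F i)" for i x
      using that by (simp add: \<rho>_def Hom_complex_simps)
    have r0: "\<rho> i x = \<zero>\<^bsub>obj N (i + n)\<^esub>" if "i < k" "x \<in> carrier (obj F i)" for i x
    proof -
      interpret Ni: module R "obj N (i + n)" by (rule CN)
      show ?thesis unfolding rho[OF that(2)] cor[OF that]
        using linear_map_closed[OF HX(1)[OF pc] that(2)] by (simp add: Ni.smult_l_minus Ni.M.r_neg)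
    qed
    have e1: "k - 1 + n = k + n - 1" "k + 1 + n - 1 = k + n" "k + 1 - 1 = k" "k + (n + 1) = k + n + 1"
      "k - 1 + (n + 1) = k + n" "k + (n + 1) - 1 = k + n" by simp_all
    interpret Nk: module R "obj N (k + n)" by (rule CN)
    interpret Nk': module R "obj N (k + n - 1)" by (rule CN)
    interpret r: lin R "obj F k" "obj N (k + n)" "\<rho> k" by (intro linI CF CN HX r)
    interpret dN: lin R "obj N (k + n)" "obj N (k + n - 1)" "diff N (k + n)" by (intro linI CN)
    have g_cyc: "diff N (k + n) (\<rho> k x) = \<zero>\<^bsub>obj N (k + n - 1)\<^esub>" if x: "x \<in> carrier (obj F k)" for x
    proof -
      have "\<rho> (k - 1) (diff F k x) = \<zero>\<^bsub>obj N (k + n - 1)\<^esub>" using r0[OF _ dF[OF x]] unfolding e1 by simp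
      then show ?thesis
        using Hom_complex_diff[OF FC N r x] r.closed[OF x] dN.closed[OF r.closed[OF x]] x
        unfolding dr by (simp add: Hom_complex_simps add_diff_eq)
    qed
    have g_bd: "\<rho> k (diff F (k + 1) x) \<in> boundaries N (k + n)" if x: "x \<in> carrier (obj F (k + 1))" for x
    proof -
      have dx: "diff F (k + 1) x \<in> carrier (obj F k)" using dF[OF x] by simp
      let ?v = "\<rho> k (diff F (k + 1) x)" and ?y = "\<rho> (k + 1) x" and ?s = "hom_sign R n"
      have v: "?v \<in> carrier (obj N (k + n))" by (rule r.closed[OF dx])
      have y: "?y \<in> carrier (obj N (k + 1 + n))" by (rule linear_map_closed[OF HX(1)[OF r] x])
      have "linear_map R (obj N (k + 1 + n)) (obj N (k + n)) (diff N (k + 1 + n))"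
        using CN(2)[of "k + 1 + n"] unfolding e1 .
      then interpret d: lin R "obj N (k + 1 + n)" "obj N (k + n)" "diff N (k + 1 + n)" by (intro linI CN)
      let ?u = "diff N (k + 1 + n) ?y"
      have u: "?u \<in> carrier (obj N (k + n))" by (rule d.closed[OF y])
      have "k + 1 + (n - 1) = k + n" by simp
      then have "?u \<oplus>\<^bsub>obj N (k + n)\<^esub> ?s \<odot>\<^bsub>obj N (k + n)\<^esub> ?v = \<zero>\<^bsub>obj N (k + n)\<^esub>"
        using Hom_complex_diff[OF FC N r x] x unfolding dr e1 by (simp only: Hom_complex_simps restrict_apply if_True)
      then have "?s \<odot>\<^bsub>obj N (k + n)\<^esub> (?u \<oplus>\<^bsub>obj N (k + n)\<^esub> ?s \<odot>\<^bsub>obj N (k + n)\<^esub> ?v) = \<zero>\<^bsub>obj N (k + n)\<^esub>" by simp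
      then have "?s \<odot>\<^bsub>obj N (k + n)\<^esub> ?u \<oplus>\<^bsub>obj N (k + n)\<^esub> ?v = \<zero>\<^bsub>obj N (k + n)\<^esub>"
        using u v by (simp add: Nk.smult_r_distr Nk.smult_assoc1[symmetric] R.hom_sign_square)
      then have "?v = \<ominus>\<^bsub>obj N (k + n)\<^esub> (?s \<odot>\<^bsub>obj N (k + n)\<^esub> ?u)"
        using u v by (intro Nk.M.minus_equality[symmetric]) (simp_all add: Nk.M.a_comm)
      also have "\<dots> = diff N (k + 1 + n) (\<ominus>\<^bsub>obj N (k + 1 + n)\<^esub> (?s \<odot>\<^bsub>obj N (k + 1 + n)\<^esub> ?y))" using y by simp
      finally have v': "?v = diff N (k + 1 + n) (\<ominus>\<^bsub>obj N (k + 1 + n)\<^esub> (?s \<odot>\<^bsub>obj N (k + 1 + n)\<^esub> ?y))" .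
      have e': "k + n + 1 = k + 1 + n" by simp
      show ?thesis unfolding boundaries_def e' v' using y by (intro imageI) simp
    qed
    obtain \<omega> \<chi> where o: "linear_map R (obj F (k - 1)) (obj N (k + n)) \<omega>"
      "\<And>x. x \<in> carrier (obj F (k - 1)) \<Longrightarrow> diff N (k + n) (\<omega> x) = \<zero>\<^bsub>obj N (k + n - 1)\<^esub>"
      and ch: "linear_map R (obj F k) (obj N (k + n + 1)) \<chi>"
      "\<And>x. x \<in> carrier (obj F k) \<Longrightarrow>
        \<rho> k x = diff N (k + n + 1) (\<chi> x) \<oplus>\<^bsub>obj N (k + n)\<^esub> \<omega> (diff F k x)"
      using hom_exact_correction[OF F N H ex HX(1)[OF r] g_cyc g_bd] by blast
    interpret o: lin R "obj F (k - 1)" "obj N (k + n)" \<omega> by (intro linI CF CN o)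
    interpret ch: lin R "obj F k" "obj N (k + n + 1)" \<chi> by (intro linI CF CN ch)
    define \<theta> where "\<theta> i = (\<lambda>x\<in>carrier (obj F i). if i = k then \<chi> x
      else if i = k - 1 then ?e \<odot>\<^bsub>obj N (k + n)\<^esub> \<omega> x else \<zero>\<^bsub>obj N (i + (n + 1))\<^esub>)" for i
    have t: "\<theta> \<in> carrier (obj ?X (n + 1))"
      unfolding Hom_complex_carrier
    proof (intro allI conjI)
      fix i
      show "\<theta> i \<in> extensional (carrier (obj F i))" by (simp add: \<theta>_def)
      interpret Fi: module R "obj F i" by (rule CF)
      interpret Ni: module R "obj N (i + (n + 1))" by (rule CN)
      consider "i = k" | "i = k - 1" | "i \<noteq> k" "i \<noteq> k - 1" by blast
      then show "linear_map R (obj F i) (obj N (i + (n + 1))) (\<theta> i)"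
      proof cases
        case 1
        show ?thesis unfolding 1 e1
          by (rule linear_map_cong[OF ch(1) CF(1)]) (simp add: \<theta>_def)
      next
        case 2
        have "linear_map R (obj F (k - 1)) (obj N (k + n)) (\<lambda>x. ?e \<odot>\<^bsub>obj N (k + n)\<^esub> \<omega> x)"
          by (rule linear_mapI) (simp_all add: Nk.smult_r_distr Nk.smult_assoc1[symmetric] R.m_comm)
        then show ?thesis unfolding 2 e1
          by (rule linear_map_cong[OF _ CF(1)]) (simp add: \<theta>_def)
      next
        case 3
        have "linear_map R (obj F i) (obj N (i + (n + 1))) (\<lambda>_. \<zero>\<^bsub>obj N (i + (n + 1))\<^esub>)"
          by (rule linear_mapI) simp_all
        then show ?thesis
          by (rule linear_map_cong[OF _ CF(1)]) (simp add: \<theta>_def 3)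
      qed
    qed
    let ?q = "\<psi> \<oplus>\<^bsub>obj ?X (n + 1)\<^esub> \<theta>"
    have qt: "?q \<in> carrier (obj ?X (n + 1))" by (intro Xn1.M.a_closed q t)
    have dqt: "diff ?X (n + 1) ?q i x
      = ?dq i x \<oplus>\<^bsub>obj N (i + n)\<^esub> diff ?X (n + 1) \<theta> i x" if "x \<in> carrier (obj F i)" for i x
      using that d1.add[OF q t] by (simp add: Hom_complex_simps)
    have dt0: "diff ?X (n + 1) \<theta> i x = \<zero>\<^bsub>obj N (i + n)\<^esub>" if i: "i < k" and x: "x \<in> carrier (obj F i)" for i x
    proof -
      have e2: "i + (n + 1) - 1 = i + n" "i - 1 + (n + 1) = i + n" by simp_all
      interpret Ni: module R "obj N (i + n)" by (rule CN)
      have "linear_map R (obj N (i + (n + 1))) (obj N (i + n)) (diff N (i + (n + 1)))"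
        using CN(2)[of "i + (n + 1)"] unfolding e2 .
      then interpret d: lin R "obj N (i + (n + 1))" "obj N (i + n)" "diff N (i + (n + 1))" by (intro linI CN)
      have 1: "\<theta> (i - 1) (diff F i x) = \<zero>\<^bsub>obj N (i + n)\<^esub>"
        using i dF[OF x] unfolding \<theta>_def e2 by simp
      have 2: "diff N (i + (n + 1)) (\<theta> i x) = \<zero>\<^bsub>obj N (i + n)\<^esub>"
      proof (cases "i = k - 1")
        case True
        have x': "x \<in> carrier (obj F (k - 1))" using x True by simp
        have "\<theta> i x = ?e \<odot>\<^bsub>obj N (k + n)\<^esub> \<omega> x" using True x' by (simp add: \<theta>_def)
        moreover have "diff N (k + n) (?e \<odot>\<^bsub>obj N (k + n)\<^esub> \<omega> x) = \<zero>\<^bsub>obj N (k + n - 1)\<^esub>"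
          using o(2)[OF x'] o.closed[OF x'] by simp
        ultimately show ?thesis using True by (simp add: e1)
      next
        case False
        then show ?thesis using i x by (simp add: \<theta>_def)
      qed
      show ?thesis using Hom_complex_diff[OF FC N t x] unfolding 1 2 e2 by simp
    qed
    have dtk: "diff ?X (n + 1) \<theta> k x = \<rho> k x" if x: "x \<in> carrier (obj F k)" for x
    proof -
      have 1: "\<theta> k x = \<chi> x" using x by (simp add: \<theta>_def)
      have 2: "\<theta> (k - 1) (diff F k x) = ?e \<odot>\<^bsub>obj N (k + n)\<^esub> \<omega> (diff F k x)"
        using dF[OF x] by (simp add: \<theta>_def)
      have "?e \<odot>\<^bsub>obj N (k + n)\<^esub> (?e \<odot>\<^bsub>obj N (k + n)\<^esub> \<omega> (diff F k x)) = \<omega> (diff F k x)"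
        using o.closed[OF dF[OF x]] by (simp add: Nk.smult_assoc1[symmetric] R.hom_sign_square)
      then show ?thesis
        using Hom_complex_diff[OF FC N t x] unfolding 1 2 e1 ch(2)[OF x] by simp
    qed
    have "correct (k + 1) ?q"
      unfolding correct_def
    proof (intro conjI allI impI ballI, rule qt)
      fix i x assume i: "i < k + 1" and x: "x \<in> carrier (obj F i)"
      interpret Ni: module R "obj N (i + n)" by (rule CN)
      have c1: "\<phi> i x \<in> carrier (obj N (i + n))" "?dq i x \<in> carrier (obj N (i + n))"
        using linear_map_closed[OF HX(1)[OF pc] x] linear_map_closed[OF HX(1)[OF dqc] x] by simp_all
      show "diff ?X (n + 1) ?q i x = \<phi> i x"
      proof (cases "i = k")
        case True
        have "?dq i x \<oplus>\<^bsub>obj N (i + n)\<^esub> \<rho> i x = \<phi> i x"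
          unfolding rho[OF x] using c1
          by (simp add: Ni.smult_l_minus Ni.M.a_lcomm Ni.M.r_neg)
        then show ?thesis unfolding dqt[OF x] using dtk x True by simp
      next
        case False
        then have "i < k" using i by simp
        then show ?thesis unfolding dqt[OF x] dt0[OF \<open>i < k\<close> x] cor[OF \<open>i < k\<close> x] using c1 by simp
      qed
    qed
    moreover have "?q i = \<psi> i" if "i < k - 1" for i
    proof (rule extensionalityI[OF HX(2)[OF qt] HX(2)[OF q]])
      fix x assume x: "x \<in> carrier (obj F i)"
      interpret Ni: module R "obj N (i + (n + 1))" by (rule CN)
      show "?q i x = \<psi> i x"
        using that x linear_map_closed[OF HX(1)[OF q] x] by (simp add: Hom_complex_simps \<theta>_def)
    qed
    ultimately show ?thesis by blast
  qed
  have at0: "\<psi> i x = \<zero>\<^bsub>obj N (i + m)\<^esub>" if "\<psi> \<in> carrier (obj ?X m)" "i < 0" "x \<in> carrier (obj F i)" for \<psi> m i x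
  proof -
    interpret l: lin R "obj F i" "obj N (i + m)" "\<psi> i" by (intro linI CF CN HX that)
    show ?thesis using l.zero free_complexD(3)[OF F that(2,3)] by simp
  qed
  have base: "correct 0 \<zero>\<^bsub>obj ?X (n + 1)\<^esub>"
    unfolding correct_def
    using at0[OF pc] at0[OF d1.closed[OF Xn1.M.zero_closed]] by simp
  have "\<exists>t. \<forall>m. correct (int m) (t m) \<and> (\<forall>i<int m - 1. t (Suc m) i = t m i)"
  proof (rule dependent_nat_choice)
    show "\<exists>\<psi>. correct (int 0) \<psi>" using base by auto
    fix \<psi> m assume "correct (int m) \<psi>"
    from step[OF this] show "\<exists>\<psi>'. correct (int (Suc m)) \<psi>' \<and> (\<forall>i<int m - 1. \<psi>' i = \<psi> i)"
      by (simp add: add.commute)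
  qed
  then obtain t where t: "\<And>m. correct (int m) (t m)" "\<And>m i. i < int m - 1 \<Longrightarrow> t (Suc m) i = t m i"
    by blast
  have tc: "t m \<in> carrier (obj ?X (n + 1))" for m using t(1) unfolding correct_def by blast
  (* The component of index i does not change any more once the components below i + 2 are treated. *)
  define \<psi> where "\<psi> i = t (nat (i + 2)) i" for i
  have stable: "t (nat (i + 2) + l) i = \<psi> i" for i l
  proof (induction l)
    case (Suc l)
    have "i < int (nat (i + 2) + l) - 1" by simp
    from t(2)[OF this] Suc show ?case by simp
  qed (simp add: \<psi>_def)
  have q: "\<psi> \<in> carrier (obj ?X (n + 1))"
    unfolding Hom_complex_carrier \<psi>_def using HX[OF tc] by blast
  have dq: "diff ?X (n + 1) \<psi> \<in> carrier (obj ?X n)" by (rule d1.closed[OF q])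
  have "\<phi> = diff ?X (n + 1) \<psi>"
  proof (rule Hom_complex_eqI[OF pc dq])
    fix i x assume x: "x \<in> carrier (obj F i)"
    show "\<phi> i x = diff ?X (n + 1) \<psi> i x"
    proof (cases "i < 0")
      case True
      then show ?thesis using at0[OF pc True x] at0[OF dq True x] by simp
    next
      case False
      let ?m = "nat (i + 2)"
      have "nat (i + 2) = nat (i - 1 + 2) + 1" using False by simp
      then have "\<psi> (i - 1) = t ?m (i - 1)" using stable[of "i - 1" 1] by simp
      moreover have "\<psi> i = t ?m i" by (simp add: \<psi>_def)
      ultimately have "diff ?X (n + 1) \<psi> i x = diff ?X (n + 1) (t ?m) i x"
        using Hom_complex_diff[OF FC N q x] Hom_complex_diff[OF FC N tc x] by simp
      also have "\<dots> = \<phi> i x" using t(1)[of ?m] x False unfolding correct_def by simp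
      finally show ?thesis by simp
    qed
  qed
  then show "\<phi> \<in> boundaries ?X n" unfolding boundaries_def using q by (rule image_eqI)
qed

text \<open>The converse for a complex with a single nonzero component, which is its own homology: a map from
  \<open>F\<^sub>k\<close> that vanishes on boundaries is a cycle of \<open>Hom(F, N)\<close> with a single component, and a preimage of
  that cycle also has only one component.\<close>

theorem hom_exact_of_single_degree:
  fixes N :: "('a, 'm) cplx" and H :: "('a, 'h) module"
  assumes F: "free_complex R F" and N: "chain_complex R N" and s: "single_degree N"
    and H: "is_homology R N 0 H \<pi>" and ex: "exact_complex (Hom_complex R F N)"
  shows "hom_exact R F H"
  unfolding hom_exact_def
proof (intro allI impI, elim conjE)
  fix k f assume f: "linear_map R (obj F k) H f"
    and f0: "\<forall>x\<in>carrier (obj F (k + 1)). f (diff F (k + 1) x) = \<zero>\<^bsub>H\<^esub>"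
  let ?X = "Hom_complex R F N"
  have FC: "chain_complex R F" by (rule free_complexD(1)[OF F])
  note CN = chain_complexD[OF N] and CF = chain_complexD[OF FC] and HD = is_homologyD[OF H]
  note X = Hom_complex_complex[OF FC N]
  have N0: "x = \<zero>\<^bsub>obj N n\<^esub>" if "n \<noteq> 0" "x \<in> carrier (obj N n)" for n x
    using s that unfolding single_degree_def by blast
  interpret R: cring R using CN(1)[of 0] by (simp add: module_def)
  interpret N0: module R "obj N 0" by (rule CN)
  interpret H: module R H by (rule HD)
  have Z: "cycles N 0 = carrier (obj N 0)"
    using N0[of "0 - 1"] linear_map_closed[OF CN(2)[of 0]] by (auto simp: cycles_def)
  have "linear_map R (obj N 0) H \<pi>"
    using H unfolding is_homology_def Z by (simp add: linear_map_def)
  then interpret p: lin R "obj N 0" H \<pi> by (intro linI CN HD)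
  interpret f: lin R "obj F k" H f by (intro linI CF HD f)
  have inj: "z = \<zero>\<^bsub>obj N 0\<^esub>" if z: "z \<in> carrier (obj N 0)" and "\<pi> z = \<zero>\<^bsub>H\<^esub>" for z
  proof -
    have "z \<in> boundaries N 0" using HD(6)[of z] that unfolding Z by simp
    then obtain y where y: "y \<in> carrier (obj N 1)" "z = diff N 1 y" by (auto simp: boundaries_def)
    interpret d: lin R "obj N 1" "obj N (1 - 1)" "diff N 1" by (intro linI CN)
    show ?thesis using d.zero N0[OF _ y(1)] y(2) by simp
  qed
  have "f x \<in> \<pi> ` carrier (obj N 0)" if x: "x \<in> carrier (obj F k)" for x
  proof -
    obtain z where "z \<in> cycles N 0" "\<pi> z = f x" using HD(5)[OF f.closed[OF x]] by (rule bexE)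
    then show ?thesis unfolding Z by (intro image_eqI[of _ _ z]) simp_all
  qed
  then obtain g where g: "linear_map R (obj F k) (obj N 0) g"
    "\<And>x. x \<in> carrier (obj F k) \<Longrightarrow> \<pi> (g x) = f x"
    using free_complex_lift_through[OF F p.lin_axioms f.lin_axioms] by blast
  interpret g: lin R "obj F k" "obj N 0" g by (intro linI CF CN g)
  define \<phi> where "\<phi> i = (\<lambda>x\<in>carrier (obj F i). if i = k then g x else \<zero>\<^bsub>obj N (i + - k)\<^esub>)" for i
  have pc: "\<phi> \<in> carrier (obj ?X (- k))"
    unfolding Hom_complex_carrier
  proof (intro allI conjI)
    fix i
    show "\<phi> i \<in> extensional (carrier (obj F i))" by (simp add: \<phi>_def)
    interpret Ni: module R "obj N (i + - k)" by (rule CN)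
    show "linear_map R (obj F i) (obj N (i + - k)) (\<phi> i)"
    proof (cases "i = k")
      case True
      have e: "k + - k = 0" by simp
      show ?thesis unfolding True e
        by (rule linear_map_cong[OF g(1) CF(1)]) (simp add: \<phi>_def)
    next
      case False
      have "linear_map R (obj F i) (obj N (i + - k)) (\<lambda>_. \<zero>\<^bsub>obj N (i + - k)\<^esub>)"
        by (rule linear_mapI) (simp_all del: add_uminus_conv_diff)
      then show ?thesis by (rule linear_map_cong[OF _ CF(1)]) (simp add: \<phi>_def False)
    qed
  qed
  have dF: "diff F i x \<in> carrier (obj F (i - 1))" if "x \<in> carrier (obj F i)" for i x
    using linear_map_closed[OF CF(2) that] .
  have pv: "\<phi> i x = \<zero>\<^bsub>obj N (i + - k)\<^esub>" if "i \<noteq> k" "x \<in> carrier (obj F i)" for i x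
    using that by (simp add: \<phi>_def)
  have gd: "g (diff F (k + 1) x) = \<zero>\<^bsub>obj N 0\<^esub>" if x: "x \<in> carrier (obj F (k + 1))" for x
  proof -
    have dx: "diff F (k + 1) x \<in> carrier (obj F k)" using dF[OF x] by simp
    show ?thesis using f0 x g(2)[OF dx] by (intro inj g.closed[OF dx]) simp
  qed
  have dp0: "diff ?X (- k) \<phi> \<in> carrier (obj ?X (- k - 1))" by (rule Hom_complex_diff_closed[OF FC N pc])
  have "diff ?X (- k) \<phi> = \<zero>\<^bsub>obj ?X (- k - 1)\<^esub>"
  proof (rule Hom_complex_eqI[OF dp0])
    interpret G: module R "obj ?X (- k - 1)" by (rule chain_complexD[OF X])
    show "\<zero>\<^bsub>obj ?X (- k - 1)\<^esub> \<in> carrier (obj ?X (- k - 1))" by simp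
    fix i x assume x: "x \<in> carrier (obj F i)"
    have z: "\<zero>\<^bsub>obj ?X (- k - 1)\<^esub> i x = \<zero>\<^bsub>obj N (i + - k - 1)\<^esub>"
      using x by (simp add: Hom_complex_simps add_diff_eq)
    have "diff ?X (- k) \<phi> i x \<in> carrier (obj N (i + (- k - 1)))"
      using linear_map_closed[OF _ x] dp0 unfolding Hom_complex_carrier by blast
    then have c: "diff ?X (- k) \<phi> i x \<in> carrier (obj N (i + - k - 1))" by (simp add: add_diff_eq)
    show "diff ?X (- k) \<phi> i x = \<zero>\<^bsub>obj ?X (- k - 1)\<^esub> i x"
    proof (cases "i = k + 1")
      case False
      then show ?thesis unfolding z by (intro N0[OF _ c]) simp
    next
      case True
      interpret M: module R "obj N (i + - k - 1)" by (rule CN)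
      interpret d: lin R "obj N (i + - k)" "obj N (i + - k - 1)" "diff N (i + - k)" by (intro linI CN)
      have 1: "\<phi> i x = \<zero>\<^bsub>obj N (i + - k)\<^esub>" using pv[OF _ x] True by simp
      have 2: "\<phi> (i - 1) (diff F i x) = \<zero>\<^bsub>obj N (i + - k - 1)\<^esub>"
        using gd x dF[OF x] True by (simp add: \<phi>_def)
      show ?thesis unfolding z Hom_complex_diff[OF FC N pc x] 1 2 by (simp del: add_uminus_conv_diff)
    qed
  qed
  then have "\<phi> \<in> cycles ?X (- k)" using pc by (simp add: cycles_def)
  then have "\<phi> \<in> boundaries ?X (- k)" using ex unfolding exact_complex_def by blast
  then obtain \<psi> where q: "\<psi> \<in> carrier (obj ?X (- k + 1))" "\<phi> = diff ?X (- k + 1) \<psi>"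
    by (auto simp: boundaries_def)
  let ?e = "hom_sign R (- k + 1)"
  have e: "k - 1 + (- k + 1) = 0" "k + (- k + 1) = 1" "(1::int) - 1 = 0" by simp_all
  have "linear_map R (obj F (k - 1)) (obj N (k - 1 + (- k + 1))) (\<psi> (k - 1))"
    using q(1) unfolding Hom_complex_carrier by blast
  then interpret q1: lin R "obj F (k - 1)" "obj N 0" "\<psi> (k - 1)" unfolding e by (intro linI CF CN)
  have "linear_map R (obj F k) (obj N (k + (- k + 1))) (\<psi> k)"
    using q(1) unfolding Hom_complex_carrier by blast
  then interpret q0: lin R "obj F k" "obj N 1" "\<psi> k" unfolding e by (intro linI CF CN)
  have "linear_map R (obj N 1) (obj N 0) (diff N 1)" using CN(2)[of 1] by simp
  then interpret d: lin R "obj N 1" "obj N 0" "diff N 1" by (intro linI CN)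
  have "linear_map R (obj F (k - 1)) H (\<lambda>y. \<pi> (?e \<odot>\<^bsub>obj N 0\<^esub> \<psi> (k - 1) y))"
    by (rule linear_mapI) (simp_all add: H.smult_r_distr H.smult_assoc1[symmetric] R.m_comm)
  moreover have "f x = \<pi> (?e \<odot>\<^bsub>obj N 0\<^esub> \<psi> (k - 1) (diff F k x))" if x: "x \<in> carrier (obj F k)" for x
  proof -
    have 1: "diff N 1 (\<psi> k x) = \<zero>\<^bsub>obj N 0\<^esub>" using N0[OF _ q0.closed[OF x]] by simp
    have "g x = \<phi> k x" using x by (simp add: \<phi>_def)
    also have "\<dots> = \<zero>\<^bsub>obj N 0\<^esub> \<oplus>\<^bsub>obj N 0\<^esub> ?e \<odot>\<^bsub>obj N 0\<^esub> \<psi> (k - 1) (diff F k x)"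
      using Hom_complex_diff[OF FC N q(1) x] unfolding q(2)[symmetric] e 1 .
    also have "\<dots> = ?e \<odot>\<^bsub>obj N 0\<^esub> \<psi> (k - 1) (diff F k x)" using dF[OF x] by simp
    finally show ?thesis using g(2)[OF x] by simp
  qed
  ultimately show "\<exists>w. linear_map R (obj F (k - 1)) H w \<and> (\<forall>x\<in>carrier (obj F k). f x = w (diff F k x))"
    by blast
qed

section \<open>Small cosupport\<close>

lemma small_cosupp_iff:
  assumes R: "cring R" and N: "noetherian_ring R" and M: "chain_complex R M"
  shows "p \<in> small_cosupp R M \<longleftrightarrow> primeideal p R \<and>
    \<not> exact_complex (Hom_complex R (free_resolution R (quotient_module (self_module R) p))
        (restrict_scalars_complex (localization_hom R p) (colocal_dual R p M)))"
proof (cases "primeideal p R")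
  case True
  then have "ideal p R" by (simp add: primeideal_def)
  then have "free_complex R (free_resolution R (quotient_module (self_module R) p))"
    by (intro free_resolution_free_complex ideal_quotient_module R)
  then have "chain_complex R (Hom_complex R (free_resolution R (quotient_module (self_module R) p))
      (restrict_scalars_complex (localization_hom R p) (colocal_dual R p M)))"
    by (intro Hom_complex_complex free_complexD(1) restrict_scalars_complex_complex[OF R
        colocal_dual_complex[OF R N M True] localization_hom_hom[OF True]])
  from derived_iso_zero_iff[OF R this] show ?thesis
    using True by (simp add: small_cosupp_def Spec_def RHom_def)
qed (simp add: small_cosupp_def Spec_def)

lemma concentrated_single_degree: "single_degree (concentrated N)"
  by (simp add: single_degree_def)

text \<open>If \<open>p\<close> lies in none of the cosupports on the right, then \<open>Hom(F, -)\<close>, for the resolution \<open>F\<close> of \<open>R/p\<close>,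
  is exact on the colocal dual of each homology module of \<open>M\<close>. These are the homology modules of the
  colocal dual of \<open>M\<close>, so \<open>Hom(F, -)\<close> is exact on it as well.\<close>

theorem small_cosupp_subset:
  fixes R :: "('a, 'r) ring_scheme" and M :: "('a, 'm) cplx"
  assumes R: "cring R" and N: "noetherian_ring R" and M: "chain_complex R M"
  shows "small_cosupp R M \<subseteq> (\<Union>i. small_cosupp R (concentrated (homology M i)))"
proof
  fix p assume p: "p \<in> small_cosupp R M"
  then have pr: "primeideal p R"
    using small_cosupp_iff[OF R N M] by blast
  then have "ideal p R" by (simp add: primeideal_def)
  then have F: "free_complex R (free_resolution R (quotient_module (self_module R) p))" (is "free_complex R ?F")
    by (intro free_resolution_free_complex ideal_quotient_module R)
  let ?h = "localization_hom R p"
  note h = localization_hom_hom[OF pr]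
  let ?D = "\<lambda>j. restrict_scalars ?h (colocal_dual_module R p (homology M j))"
  have HM: "module R (homology M j)" for j
    by (rule is_homologyD(1)[OF homology_is_homology[OF M]])
  note CH = concentrated_complex[OF HM]
  show "p \<in> (\<Union>i. small_cosupp R (concentrated (homology M i)))"
  proof (rule ccontr)
    assume "\<not> ?thesis"
    then have no: "p \<notin> small_cosupp R (concentrated (homology M j))" for j by blast
    have ex: "hom_exact R ?F (?D j)" for j
    proof -
      obtain \<pi> where "is_homology (localization_ring R p) (colocal_dual R p (concentrated (homology M j))) 0
          (colocal_dual_module R p (homology M j)) \<pi>"
        using colocal_dual_is_homology[OF R N CH pr concentrated_homology[OF HM]] by blast
      note H = restrict_scalars_is_homology[OF R this h]
      have "single_degree (restrict_scalars_complex ?h (colocal_dual R p (concentrated (homology M j))))"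
        using colocal_dual_single_degree[OF R N CH pr concentrated_single_degree]
        by (simp add: single_degree_def)
      moreover have "exact_complex (Hom_complex R ?F
          (restrict_scalars_complex ?h (colocal_dual R p (concentrated (homology M j)))))"
        using no[of j] pr small_cosupp_iff[OF R N CH] by blast
      ultimately show ?thesis
        by (intro hom_exact_of_single_degree[OF F _ _ H]
            restrict_scalars_complex_complex[OF R colocal_dual_complex[OF R N CH pr] h])
    qed
    have "\<exists>\<pi>. is_homology R (restrict_scalars_complex ?h (colocal_dual R p M)) j (?D j) \<pi>" for j
      using colocal_dual_is_homology[OF R N M pr homology_is_homology[OF M]]
        restrict_scalars_is_homology[OF R _ h] by meson
    from choice[OF allI[OF this]] obtain \<pi> where
      "\<forall>j. is_homology R (restrict_scalars_complex ?h (colocal_dual R p M)) j (?D j) (\<pi> j)" ..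
    then have "exact_complex (Hom_complex R ?F (restrict_scalars_complex ?h (colocal_dual R p M)))"
      by (intro Hom_free_complex_exact[OF F _ _ ex]
          restrict_scalars_complex_complex[OF R colocal_dual_complex[OF R N M pr] h]) (rule spec)
    then show False using p small_cosupp_iff[OF R N M] by blast
  qed
qed


section \<open>Tensor products\<close>

lemma (in module) submodule_span_submodule:
  fixes X
  assumes "X \<subseteq> carrier M"
  shows "submodule (\<Inter>{H. submodule H R M \<and> X \<subseteq> H}) R M"
proof (rule submoduleI)
  let ?S = "\<Inter>{H. submodule H R M \<and> X \<subseteq> H}"
  show "?S \<subseteq> carrier M" using carrier_is_submodule assms by blast
  show "\<zero>\<^bsub>M\<^esub> \<in> ?S" using submodule_zero by blast
  show "\<ominus>\<^bsub>M\<^esub> a \<in> ?S" if "a \<in> ?S" for a using that submoduleE(3) by blast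
  show "a \<oplus>\<^bsub>M\<^esub> b \<in> ?S" if "a \<in> ?S" "b \<in> ?S" for a b using that submoduleE(5) by blast
  show "a \<odot>\<^bsub>M\<^esub> x \<in> ?S" if "a \<in> carrier R" "x \<in> ?S" for a x using that submoduleE(4) by blast
qed

text \<open>The tensor product is the source of the universal bilinear map; the lemmas of this locale
  are the only facts about its construction that are used.\<close>

definition bilinear ::
  "('a, 'r) ring_scheme \<Rightarrow> ('a, 'm) module \<Rightarrow> ('a, 'n) module \<Rightarrow> ('a, 'p) module
    \<Rightarrow> ('m \<Rightarrow> 'n \<Rightarrow> 'p) \<Rightarrow> bool" where
  "bilinear R M N P b \<longleftrightarrow> (\<forall>x\<in>carrier M. linear_map R N P (b x)) \<and>
     (\<forall>y\<in>carrier N. linear_map R M P (\<lambda>x. b x y))"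

locale tensor_product = M: module R M + N: module R N
  for R :: "('a, 'r) ring_scheme" (structure) and M :: "('a, 'm) module" and N :: "('a, 'n) module"
begin

abbreviation (input) "MN \<equiv> carrier M \<times> carrier N"
abbreviation (input) "F \<equiv> free_module R MN"
abbreviation (input) "K \<equiv> submodule_span R F (tensor_relations R M N)"
abbreviation (input) "T \<equiv> tensor_module R M N"
abbreviation (input) "pure \<equiv> pure_tensor R M N"

lemma free: "module R F"
  by (rule free_module_module[OF M.R.cring_axioms])

lemma gen_carrier: "x \<in> carrier M \<Longrightarrow> y \<in> carrier N \<Longrightarrow> free_gen R MN (x, y) \<in> carrier F"
  by (rule free_gen_carrier[OF M.R.cring_axioms]) simp

lemma relations_carrier: "tensor_relations R M N \<subseteq> carrier F"
proof -
  interpret F: module R F by (rule free)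
  show ?thesis unfolding tensor_relations_def Let_def
    by (intro Un_least subsetI; elim CollectE exE conjE; hypsubst;
        intro F.M.minus_closed F.M.a_closed F.smult_closed gen_carrier) simp_all
qed

lemma span_submod: "submod R F K"
proof -
  interpret F: module R F by (rule free)
  show ?thesis
    using F.submodule_span_submodule[OF relations_carrier]
    by (intro submod.intro submod_axioms.intro F.module_axioms) (simp add: submodule_span_def)
qed

lemma relation_in_span: "r \<in> tensor_relations R M N \<Longrightarrow> r \<in> K"
  by (auto simp: submodule_span_def)

lemma tensor_eq: "T = quotient_module F K"
  by (simp add: tensor_module_def Let_def)

lemma pure_eq: "pure x y = K +>\<^bsub>F\<^esub> free_gen R MN (x, y)"
  by (simp add: pure_tensor_def Let_def)

lemma module: "module R T"
  unfolding tensor_eq by (rule submod.quotient_module_module[OF span_submod])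

lemma pure_closed: "x \<in> carrier M \<Longrightarrow> y \<in> carrier N \<Longrightarrow> pure x y \<in> carrier T"
  unfolding tensor_eq pure_eq submod.quotient_carrier[OF span_submod]
  by (intro imageI gen_carrier)

lemma pure_add_left:
  assumes "x \<in> carrier M" "x' \<in> carrier M" "y \<in> carrier N"
  shows "pure (x \<oplus>\<^bsub>M\<^esub> x') y = pure x y \<oplus>\<^bsub>T\<^esub> pure x' y"
proof -
  interpret F: module R F by (rule free)
  note Q = span_submod
  have "free_gen R MN (x \<oplus>\<^bsub>M\<^esub> x', y) \<ominus>\<^bsub>F\<^esub> (free_gen R MN (x, y) \<oplus>\<^bsub>F\<^esub> free_gen R MN (x', y))
      \<in> tensor_relations R M N"
    using assms unfolding tensor_relations_def Let_def by blast
  from relation_in_span[OF this]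
  have "K +>\<^bsub>F\<^esub> free_gen R MN (x \<oplus>\<^bsub>M\<^esub> x', y) = K +>\<^bsub>F\<^esub> (free_gen R MN (x, y) \<oplus>\<^bsub>F\<^esub> free_gen R MN (x', y))"
    using submod.coset_eq_iff[OF Q] gen_carrier F.M.a_closed M.M.a_closed assms by simp
  then show ?thesis
    unfolding tensor_eq pure_eq using submod.coset_add[OF Q] gen_carrier assms by simp
qed

lemma pure_add_right:
  assumes "x \<in> carrier M" "y \<in> carrier N" "y' \<in> carrier N"
  shows "pure x (y \<oplus>\<^bsub>N\<^esub> y') = pure x y \<oplus>\<^bsub>T\<^esub> pure x y'"
proof -
  interpret F: module R F by (rule free)
  note Q = span_submod
  have "free_gen R MN (x, y \<oplus>\<^bsub>N\<^esub> y') \<ominus>\<^bsub>F\<^esub> (free_gen R MN (x, y) \<oplus>\<^bsub>F\<^esub> free_gen R MN (x, y'))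
      \<in> tensor_relations R M N"
    using assms unfolding tensor_relations_def Let_def by blast
  from relation_in_span[OF this]
  have "K +>\<^bsub>F\<^esub> free_gen R MN (x, y \<oplus>\<^bsub>N\<^esub> y') = K +>\<^bsub>F\<^esub> (free_gen R MN (x, y) \<oplus>\<^bsub>F\<^esub> free_gen R MN (x, y'))"
    using submod.coset_eq_iff[OF Q] gen_carrier F.M.a_closed N.M.a_closed assms by simp
  then show ?thesis
    unfolding tensor_eq pure_eq using submod.coset_add[OF Q] gen_carrier assms by simp
qed

lemma pure_smult_left:
  assumes "a \<in> carrier R" "x \<in> carrier M" "y \<in> carrier N"
  shows "pure (a \<odot>\<^bsub>M\<^esub> x) y = a \<odot>\<^bsub>T\<^esub> pure x y"
proof -
  interpret F: module R F by (rule free)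
  note Q = span_submod
  have "free_gen R MN (a \<odot>\<^bsub>M\<^esub> x, y) \<ominus>\<^bsub>F\<^esub> a \<odot>\<^bsub>F\<^esub> free_gen R MN (x, y) \<in> tensor_relations R M N"
    using assms unfolding tensor_relations_def Let_def by blast
  from relation_in_span[OF this]
  have "K +>\<^bsub>F\<^esub> free_gen R MN (a \<odot>\<^bsub>M\<^esub> x, y) = K +>\<^bsub>F\<^esub> (a \<odot>\<^bsub>F\<^esub> free_gen R MN (x, y))"
    using submod.coset_eq_iff[OF Q] gen_carrier F.smult_closed M.smult_closed assms by simp
  then show ?thesis
    unfolding tensor_eq pure_eq using submod.coset_smult[OF Q] gen_carrier assms by simp
qed

lemma pure_smult_right:
  assumes "a \<in> carrier R" "x \<in> carrier M" "y \<in> carrier N"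
  shows "pure x (a \<odot>\<^bsub>N\<^esub> y) = a \<odot>\<^bsub>T\<^esub> pure x y"
proof -
  interpret F: module R F by (rule free)
  note Q = span_submod
  have "free_gen R MN (x, a \<odot>\<^bsub>N\<^esub> y) \<ominus>\<^bsub>F\<^esub> a \<odot>\<^bsub>F\<^esub> free_gen R MN (x, y) \<in> tensor_relations R M N"
    using assms unfolding tensor_relations_def Let_def by blast
  from relation_in_span[OF this]
  have "K +>\<^bsub>F\<^esub> free_gen R MN (x, a \<odot>\<^bsub>N\<^esub> y) = K +>\<^bsub>F\<^esub> (a \<odot>\<^bsub>F\<^esub> free_gen R MN (x, y))"
    using submod.coset_eq_iff[OF Q] gen_carrier F.smult_closed N.smult_closed assms by simp
  then show ?thesis
    unfolding tensor_eq pure_eq using submod.coset_smult[OF Q] gen_carrier assms by simp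
qed

lemma pure_bilinear: "bilinear R M N T pure"
  unfolding bilinear_def
  by (intro conjI ballI linear_mapI)
    (simp_all add: pure_closed pure_add_left pure_add_right pure_smult_left pure_smult_right)

lemma tensor_induct:
  assumes H: "submodule H R T"
    and pure: "\<And>x y. x \<in> carrier M \<Longrightarrow> y \<in> carrier N \<Longrightarrow> pure x y \<in> H"
    and t: "t \<in> carrier T"
  shows "t \<in> H"
proof -
  note Q = span_submod
  interpret q: lin R F T "\<lambda>z. K +>\<^bsub>F\<^esub> z"
    by (intro linI free module) (simp only: tensor_eq submod.coset_linear[OF Q])
  have "{z \<in> carrier F. K +>\<^bsub>F\<^esub> z \<in> H} = carrier F"
  proof (rule free_module_induct[OF M.R.cring_axioms q.preimage_submodule[OF H]])
    fix s assume "s \<in> MN"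
    then show "free_gen R MN s \<in> {z \<in> carrier F. K +>\<^bsub>F\<^esub> z \<in> H}"
      using pure gen_carrier by (auto simp: pure_eq)
  qed
  moreover obtain z where "z \<in> carrier F" "t = K +>\<^bsub>F\<^esub> z"
    using t unfolding tensor_eq submod.quotient_carrier[OF Q] by blast
  ultimately show ?thesis by blast
qed

lemma tensor_ext:
  assumes f: "lin R T P f" and g: "lin R T P g"
    and eq: "\<And>x y. x \<in> carrier M \<Longrightarrow> y \<in> carrier N \<Longrightarrow> f (pure x y) = g (pure x y)"
    and t: "t \<in> carrier T"
  shows "f t = g t"
proof -
  interpret f: lin R T P f by fact
  interpret g: lin R T P g by fact
  have "submodule {t \<in> carrier T. f t = g t} R T" by (rule f.M.submoduleI) auto
  from tensor_induct[OF this _ t] show ?thesis using eq pure_closed by simp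
qed

lemma tensor_universal:
  fixes P :: "('a, 'p) module"
  assumes P: "module R P" and b: "bilinear R M N P b"
  obtains h where "linear_map R T P h"
    "\<And>x y. x \<in> carrier M \<Longrightarrow> y \<in> carrier N \<Longrightarrow> h (pure x y) = b x y"
proof -
  interpret P: module R P by fact
  interpret F: module R F by (rule free)
  note Q = span_submod
  have b1: "linear_map R N P (b x)" if "x \<in> carrier M" for x using b that by (simp add: bilinear_def)
  have b2: "linear_map R M P (\<lambda>x. b x y)" if "y \<in> carrier N" for y using b that by (simp add: bilinear_def)
  have bc: "b x y \<in> carrier P" if "x \<in> carrier M" "y \<in> carrier N" for x y
    using linear_map_closed[OF b1[OF that(1)] that(2)] .
  have bc': "case_prod b s \<in> carrier P" if "s \<in> MN" for s using that bc by auto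
  note L = free_lift[OF P bc']
  let ?l = "free_lift R MN P (case_prod b)"
  interpret l: lin R F P ?l by (intro linI free P L(1))
  have lg: "?l (free_gen R MN (x, y)) = b x y" if "x \<in> carrier M" "y \<in> carrier N" for x y
  proof -
    have "?l (free_gen R MN (x, y)) = case_prod b (x, y)" by (intro L(2) SigmaI that)
    then show ?thesis by simp
  qed
  have rel: "tensor_relations R M N \<subseteq> {z \<in> carrier F. ?l z = \<zero>\<^bsub>P\<^esub>}"
  proof
    fix r assume r: "r \<in> tensor_relations R M N"
    then have rc: "r \<in> carrier F" using relations_carrier by (rule rev_subsetD)
    have "?l r = \<zero>\<^bsub>P\<^esub>"
      using r unfolding tensor_relations_def Let_def
      by (elim UnE CollectE exE conjE)
        (simp_all add: gen_carrier lg bc linear_map_add[OF b1] linear_map_add[OF b2]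
          linear_map_smult[OF b1] linear_map_smult[OF b2] P.M.minus_eq P.M.r_neg)
    then show "r \<in> {z \<in> carrier F. ?l z = \<zero>\<^bsub>P\<^esub>}" using rc by simp
  qed
  have KK: "?l z = \<zero>\<^bsub>P\<^esub>" if "z \<in> K" for z
    using that rel l.kernel_submodule unfolding submodule_span_def by blast
  have q: "lin R F T (\<lambda>z. K +>\<^bsub>F\<^esub> z)"
    by (intro linI free module) (simp only: tensor_eq submod.coset_linear[OF Q])
  have ker: "?l z = \<zero>\<^bsub>P\<^esub>" if "z \<in> carrier F" "K +>\<^bsub>F\<^esub> z = \<zero>\<^bsub>T\<^esub>" for z
    using that submod.coset_eq_zero_iff[OF Q that(1)] KK unfolding tensor_eq by simp
  obtain h where h: "linear_map R (T\<lparr>carrier := (\<lambda>z. K +>\<^bsub>F\<^esub> z) ` carrier F\<rparr>) P h"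
    "\<And>z. z \<in> carrier F \<Longrightarrow> h (K +>\<^bsub>F\<^esub> z) = ?l z"
    using linear_factor[OF q l.lin_axioms ker] by blast
  have "(\<lambda>z. K +>\<^bsub>F\<^esub> z) ` carrier F = carrier T"
    unfolding tensor_eq submod.quotient_carrier[OF Q] ..
  then have "linear_map R T P h" using h(1) by simp
  then show ?thesis
    by (rule that) (simp only: pure_eq h(2)[OF gen_carrier] lg)
qed

lemma pure_zero_left: "y \<in> carrier N \<Longrightarrow> pure \<zero>\<^bsub>M\<^esub> y = \<zero>\<^bsub>T\<^esub>"
proof -
  interpret T: module R T by (rule module)
  show "y \<in> carrier N \<Longrightarrow> pure \<zero>\<^bsub>M\<^esub> y = \<zero>\<^bsub>T\<^esub>"
    using pure_smult_left[of "\<zero>" "\<zero>\<^bsub>M\<^esub>" y] pure_closed[of "\<zero>\<^bsub>M\<^esub>" y] by simp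
qed

lemma pure_zero_right: "x \<in> carrier M \<Longrightarrow> pure x \<zero>\<^bsub>N\<^esub> = \<zero>\<^bsub>T\<^esub>"
proof -
  interpret T: module R T by (rule module)
  show "x \<in> carrier M \<Longrightarrow> pure x \<zero>\<^bsub>N\<^esub> = \<zero>\<^bsub>T\<^esub>"
    using pure_smult_right[of "\<zero>" x "\<zero>\<^bsub>N\<^esub>"] pure_closed[of x "\<zero>\<^bsub>N\<^esub>"] by simp
qed

lemma zero_left: "carrier M = {\<zero>\<^bsub>M\<^esub>} \<Longrightarrow> t \<in> carrier T \<Longrightarrow> t = \<zero>\<^bsub>T\<^esub>"
proof -
  assume M0: "carrier M = {\<zero>\<^bsub>M\<^esub>}" and t: "t \<in> carrier T"
  interpret T: module R T by (rule module)
  show ?thesis using tensor_induct[OF T.zero_submodule _ t] pure_zero_left M0 by simp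
qed

lemma zero_right: "carrier N = {\<zero>\<^bsub>N\<^esub>} \<Longrightarrow> t \<in> carrier T \<Longrightarrow> t = \<zero>\<^bsub>T\<^esub>"
proof -
  assume N0: "carrier N = {\<zero>\<^bsub>N\<^esub>}" and t: "t \<in> carrier T"
  interpret T: module R T by (rule module)
  show ?thesis using tensor_induct[OF T.zero_submodule _ t] pure_zero_right N0 by simp
qed

end

lemma tensor_productI: "module R M \<Longrightarrow> module R N \<Longrightarrow> tensor_product R M N"
  by (rule tensor_product.intro)

lemma tensor_module_module: "module R M \<Longrightarrow> module R N \<Longrightarrow> module R (tensor_module R M N)"
  by (rule tensor_product.module[OF tensor_productI])

lemma tensor_map_spec:
  fixes M :: "('a, 'm) module" and N :: "('a, 'n) module"
    and M' :: "('a, 'm2) module" and N' :: "('a, 'n2) module"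
  assumes f: "lin R M M' f" and g: "lin R N N' g"
  shows tensor_map_lin: "lin R (tensor_module R M N) (tensor_module R M' N') (tensor_map R M N M' N' f g)"
    and tensor_map_pure: "x \<in> carrier M \<Longrightarrow> y \<in> carrier N \<Longrightarrow>
      tensor_map R M N M' N' f g (pure_tensor R M N x y) = pure_tensor R M' N' (f x) (g y)"
proof -
  interpret f: lin R M M' f by fact
  interpret g: lin R N N' g by fact
  interpret A: tensor_product R M N by (intro tensor_productI f.M.module_axioms g.M.module_axioms)
  interpret B: tensor_product R M' N' by (intro tensor_productI f.N.module_axioms g.N.module_axioms)
  let ?T = "tensor_module R M N" and ?T' = "tensor_module R M' N'"
  let ?P = "\<lambda>h. h \<in> carrier (Hom_module R ?T ?T') \<and> (\<forall>x\<in>carrier M. \<forall>y\<in>carrier N.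
    h (pure_tensor R M N x y) = pure_tensor R M' N' (f x) (g y))"
  have "bilinear R M N ?T' (\<lambda>x y. pure_tensor R M' N' (f x) (g y))"
    unfolding bilinear_def
    by (intro conjI ballI linear_mapI)
      (simp_all add: B.pure_closed B.pure_add_left B.pure_add_right B.pure_smult_left B.pure_smult_right)
  from A.tensor_universal[OF B.module this] obtain h where h: "linear_map R ?T ?T' h"
    "\<And>x y. x \<in> carrier M \<Longrightarrow> y \<in> carrier N \<Longrightarrow>
      h (pure_tensor R M N x y) = pure_tensor R M' N' (f x) (g y)" by blast
  have ex: "?P (\<lambda>t\<in>carrier ?T. h t)"
    using linear_map_cong[OF h(1) A.module] h(2) A.pure_closed by (simp add: Hom_module_simps)
  have "k = (\<lambda>t\<in>carrier ?T. h t)" if k: "?P k" for k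
  proof (rule extensionalityI[where A = "carrier ?T"])
    show "k \<in> extensional (carrier ?T)" "(\<lambda>t\<in>carrier ?T. h t) \<in> extensional (carrier ?T)"
      using k by (simp_all add: Hom_module_simps)
    fix t assume t: "t \<in> carrier ?T"
    have "linear_map R ?T ?T' k" using k by (simp add: Hom_module_simps)
    then have lk: "lin R ?T ?T' k" by (intro linI A.module B.module)
    have lh: "lin R ?T ?T' h" by (intro linI A.module B.module h(1))
    have "k t = h t"
    proof (rule A.tensor_ext[OF lk lh _ t])
      fix x y assume xy: "x \<in> carrier M" "y \<in> carrier N"
      show "k (pure_tensor R M N x y) = h (pure_tensor R M N x y)"
        unfolding h(2)[OF xy] using k xy by simp
    qed
    then show "k t = (\<lambda>t\<in>carrier ?T. h t) t" using t by simp
  qed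
  with ex have "\<exists>!h. ?P h" by (rule ex1I)
  then have P: "?P (tensor_map R M N M' N' f g)" unfolding tensor_map_def by (rule theI')
  then show "lin R ?T ?T' (tensor_map R M N M' N' f g)"
    by (intro linI A.module B.module) (simp add: Hom_module_simps)
  show "tensor_map R M N M' N' f g (pure_tensor R M N x y) = pure_tensor R M' N' (f x) (g y)"
    if "x \<in> carrier M" "y \<in> carrier N" using P that by blast
qed

lemma lin_compose:
  assumes p: "lin R X Y p" and q: "lin R Y Z q" shows "lin R X Z (\<lambda>x. q (p x))"
proof -
  interpret p: lin R X Y p by fact
  interpret q: lin R Y Z q by fact
  show ?thesis by (intro linI p.M.module_axioms q.N.module_axioms linear_map_compose[OF p.lin q.lin])
qed

text \<open>Every commuting square of differentials and induced maps below is an instance of this one.\<close>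

lemma tensor_map_comp_eq:
  fixes M :: "('a, 'm) module" and N :: "('a, 'n) module"
  assumes f: "lin R M M1 f" and g: "lin R N N1 g" and f': "lin R M1 M3 f'" and g': "lin R N1 N3 g'"
    and k: "lin R M M2 k" and l: "lin R N N2 l" and k': "lin R M2 M3 k'" and l': "lin R N2 N3 l'"
    and eq: "\<And>x. x \<in> carrier M \<Longrightarrow> f' (f x) = k' (k x)" "\<And>y. y \<in> carrier N \<Longrightarrow> g' (g y) = l' (l y)"
    and t: "t \<in> carrier (tensor_module R M N)"
  shows "tensor_map R M1 N1 M3 N3 f' g' (tensor_map R M N M1 N1 f g t)
    = tensor_map R M2 N2 M3 N3 k' l' (tensor_map R M N M2 N2 k l t)"
proof -
  interpret f: lin R M M1 f by fact
  interpret g: lin R N N1 g by fact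
  interpret k: lin R M M2 k by fact
  interpret l: lin R N N2 l by fact
  interpret A: tensor_product R M N by (intro tensor_productI f.M.module_axioms g.M.module_axioms)
  note m = tensor_map_spec[OF f g] tensor_map_spec[OF f' g'] tensor_map_spec[OF k l] tensor_map_spec[OF k' l']
  show ?thesis
  proof (rule A.tensor_ext[OF lin_compose[OF m(1) m(3)] lin_compose[OF m(5) m(7)] _ t])
    fix x y assume xy: "x \<in> carrier M" "y \<in> carrier N"
    show "tensor_map R M1 N1 M3 N3 f' g' (tensor_map R M N M1 N1 f g (pure_tensor R M N x y))
      = tensor_map R M2 N2 M3 N3 k' l' (tensor_map R M N M2 N2 k l (pure_tensor R M N x y))"
      unfolding m(2)[OF xy] m(6)[OF xy] using xy by (simp add: m(4) m(8) eq)
  qed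
qed

lemma tensor_map_comp_zero_left:
  fixes M :: "('a, 'm) module" and N :: "('a, 'n) module"
  assumes f: "lin R M M1 f" and g: "lin R N N1 g" and f': "lin R M1 M3 f'" and g': "lin R N1 N3 g'"
    and eq: "\<And>x. x \<in> carrier M \<Longrightarrow> f' (f x) = \<zero>\<^bsub>M3\<^esub>"
    and t: "t \<in> carrier (tensor_module R M N)"
  shows "tensor_map R M1 N1 M3 N3 f' g' (tensor_map R M N M1 N1 f g t) = \<zero>\<^bsub>tensor_module R M3 N3\<^esub>"
proof -
  interpret f: lin R M M1 f by fact
  interpret g: lin R N N1 g by fact
  interpret f': lin R M1 M3 f' by fact
  interpret g': lin R N1 N3 g' by fact
  interpret A: tensor_product R M N by (intro tensor_productI f.M.module_axioms g.M.module_axioms)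
  interpret B: tensor_product R M3 N3 by (intro tensor_productI f'.N.module_axioms g'.N.module_axioms)
  interpret T: module R "tensor_module R M3 N3" by (rule B.module)
  note m = tensor_map_spec[OF f g] tensor_map_spec[OF f' g']
  have z: "lin R (tensor_module R M N) (tensor_module R M3 N3) (\<lambda>_. \<zero>\<^bsub>tensor_module R M3 N3\<^esub>)"
    by (intro linI A.module B.module linear_mapI) simp_all
  show ?thesis
  proof (rule A.tensor_ext[OF lin_compose[OF m(1) m(3)] z _ t])
    fix x y assume xy: "x \<in> carrier M" "y \<in> carrier N"
    show "tensor_map R M1 N1 M3 N3 f' g' (tensor_map R M N M1 N1 f g (pure_tensor R M N x y))
      = \<zero>\<^bsub>tensor_module R M3 N3\<^esub>"
      unfolding m(2)[OF xy] using xy by (simp add: m(4) eq B.pure_zero_left)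
  qed
qed

lemma tensor_map_comp_zero_right:
  fixes M :: "('a, 'm) module" and N :: "('a, 'n) module"
  assumes f: "lin R M M1 f" and g: "lin R N N1 g" and f': "lin R M1 M3 f'" and g': "lin R N1 N3 g'"
    and eq: "\<And>y. y \<in> carrier N \<Longrightarrow> g' (g y) = \<zero>\<^bsub>N3\<^esub>"
    and t: "t \<in> carrier (tensor_module R M N)"
  shows "tensor_map R M1 N1 M3 N3 f' g' (tensor_map R M N M1 N1 f g t) = \<zero>\<^bsub>tensor_module R M3 N3\<^esub>"
proof -
  interpret f: lin R M M1 f by fact
  interpret g: lin R N N1 g by fact
  interpret f': lin R M1 M3 f' by fact
  interpret g': lin R N1 N3 g' by fact
  interpret A: tensor_product R M N by (intro tensor_productI f.M.module_axioms g.M.module_axioms)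
  interpret B: tensor_product R M3 N3 by (intro tensor_productI f'.N.module_axioms g'.N.module_axioms)
  interpret T: module R "tensor_module R M3 N3" by (rule B.module)
  note m = tensor_map_spec[OF f g] tensor_map_spec[OF f' g']
  have z: "lin R (tensor_module R M N) (tensor_module R M3 N3) (\<lambda>_. \<zero>\<^bsub>tensor_module R M3 N3\<^esub>)"
    by (intro linI A.module B.module linear_mapI) simp_all
  show ?thesis
  proof (rule A.tensor_ext[OF lin_compose[OF m(1) m(3)] z _ t])
    fix x y assume xy: "x \<in> carrier M" "y \<in> carrier N"
    show "tensor_map R M1 N1 M3 N3 f' g' (tensor_map R M N M1 N1 f g (pure_tensor R M N x y))
      = \<zero>\<^bsub>tensor_module R M3 N3\<^esub>"
      unfolding m(2)[OF xy] using xy by (simp add: m(4) eq B.pure_zero_right)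
  qed
qed

lemma lin_id: "module R M \<Longrightarrow> lin R M M id"
  by (intro linI linear_mapI) simp_all


subsection \<open>Tensoring with a free module\<close>

text \<open>An element of \<open>R\<^sup>(\<^sup>S\<^sup>) \<otimes> N\<close> is determined by its coordinates in \<open>N\<close>. Flatness and right exactness
  of a free module are both read off from the coordinates.\<close>

definition tensor_coords ::
  "('a, 'r) ring_scheme \<Rightarrow> 's set \<Rightarrow> ('a, 'n) module \<Rightarrow> (('s \<Rightarrow> 'a) \<times> 'n \<Rightarrow> 'a) set \<Rightarrow> 's \<Rightarrow> 'n" where
  "tensor_coords R S N = (SOME C.
     linear_map R (tensor_module R (free_module R S) N) (direct_sum S (\<lambda>_. N)) C \<and>
     (\<forall>f\<in>carrier (free_module R S). \<forall>n\<in>carrier N.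
       C (pure_tensor R (free_module R S) N f n) = (\<lambda>s\<in>S. f s \<odot>\<^bsub>N\<^esub> n)))"

lemma tensor_coords:
  fixes N :: "('a, 'n) module" and S :: "'s set"
  assumes N: "module R N"
  shows tensor_coords_linear:
      "linear_map R (tensor_module R (free_module R S) N) (direct_sum S (\<lambda>_. N)) (tensor_coords R S N)"
    and tensor_coords_pure: "f \<in> carrier (free_module R S) \<Longrightarrow> n \<in> carrier N \<Longrightarrow>
      tensor_coords R S N (pure_tensor R (free_module R S) N f n) = (\<lambda>s\<in>S. f s \<odot>\<^bsub>N\<^esub> n)"
proof -
  interpret N: module R N by fact
  have R: "cring R" by (rule N.R.cring_axioms)
  let ?F = "free_module R S" and ?D = "direct_sum S (\<lambda>_. N)"
  interpret A: tensor_product R ?F N by (intro tensor_productI free_module_module R N)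
  have D: "module R ?D" by (intro direct_sum_module R N)
  have fs: "f s \<in> carrier R" if "f \<in> carrier ?F" "s \<in> S" for f s
    using that by (simp add: free_module_carrier)
  have c: "(\<lambda>s\<in>S. f s \<odot>\<^bsub>N\<^esub> n) \<in> carrier ?D" if f: "f \<in> carrier ?F" and n: "n \<in> carrier N" for f n
  proof (rule direct_sumI)
    show "finite {s \<in> S. f s \<noteq> \<zero>\<^bsub>R\<^esub>}" using f by (simp add: free_module_carrier)
    show "{s \<in> S. (\<lambda>s\<in>S. f s \<odot>\<^bsub>N\<^esub> n) s \<noteq> \<zero>\<^bsub>N\<^esub>} \<subseteq> {s \<in> S. f s \<noteq> \<zero>\<^bsub>R\<^esub>}" using n by auto
  qed (use fs[OF f] n in \<open>simp add: direct_product_simps\<close>)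
  have "bilinear R ?F N ?D (\<lambda>f n. \<lambda>s\<in>S. f s \<odot>\<^bsub>N\<^esub> n)"
    unfolding bilinear_def
  proof (intro conjI ballI linear_mapI c)
    fix f n n' assume "f \<in> carrier ?F" "n \<in> carrier N" "n' \<in> carrier N"
    then show "(\<lambda>s\<in>S. f s \<odot>\<^bsub>N\<^esub> (n \<oplus>\<^bsub>N\<^esub> n')) = (\<lambda>s\<in>S. f s \<odot>\<^bsub>N\<^esub> n) \<oplus>\<^bsub>?D\<^esub> (\<lambda>s\<in>S. f s \<odot>\<^bsub>N\<^esub> n')"
      by (intro ext) (simp add: direct_sum_simps restrict_def fs N.smult_r_distr)
  next
    fix f n a assume "f \<in> carrier ?F" "n \<in> carrier N" "a \<in> carrier R"
    then show "(\<lambda>s\<in>S. f s \<odot>\<^bsub>N\<^esub> (a \<odot>\<^bsub>N\<^esub> n)) = a \<odot>\<^bsub>?D\<^esub> (\<lambda>s\<in>S. f s \<odot>\<^bsub>N\<^esub> n)"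
      by (intro ext) (simp add: direct_sum_simps restrict_def fs N.smult_assoc1[symmetric] N.R.m_comm)
  next
    fix f f' n assume "f \<in> carrier ?F" "f' \<in> carrier ?F" "n \<in> carrier N"
    then show "(\<lambda>s\<in>S. (f \<oplus>\<^bsub>?F\<^esub> f') s \<odot>\<^bsub>N\<^esub> n) = (\<lambda>s\<in>S. f s \<odot>\<^bsub>N\<^esub> n) \<oplus>\<^bsub>?D\<^esub> (\<lambda>s\<in>S. f' s \<odot>\<^bsub>N\<^esub> n)"
      by (intro ext) (simp add: direct_sum_simps restrict_def free_module_simps fs N.smult_l_distr)
  next
    fix f n a assume "f \<in> carrier ?F" "n \<in> carrier N" "a \<in> carrier R"
    then show "(\<lambda>s\<in>S. (a \<odot>\<^bsub>?F\<^esub> f) s \<odot>\<^bsub>N\<^esub> n) = a \<odot>\<^bsub>?D\<^esub> (\<lambda>s\<in>S. f s \<odot>\<^bsub>N\<^esub> n)"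
      by (intro ext) (simp add: direct_sum_simps restrict_def free_module_simps fs N.smult_assoc1)
  qed
  then have "\<exists>C. linear_map R (tensor_module R ?F N) ?D C \<and>
     (\<forall>f\<in>carrier ?F. \<forall>n\<in>carrier N. C (pure_tensor R ?F N f n) = (\<lambda>s\<in>S. f s \<odot>\<^bsub>N\<^esub> n))"
  proof (rule A.tensor_universal[OF D])
    fix C assume "linear_map R (tensor_module R ?F N) ?D C"
      "\<And>f n. f \<in> carrier ?F \<Longrightarrow> n \<in> carrier N \<Longrightarrow>
        C (pure_tensor R ?F N f n) = (\<lambda>s\<in>S. f s \<odot>\<^bsub>N\<^esub> n)"
    then show ?thesis by (intro exI[of _ C] conjI ballI)
  qed
  note C = someI_ex[OF this, folded tensor_coords_def]
  show "linear_map R (tensor_module R ?F N) ?D (tensor_coords R S N)" using C by (rule conjunct1)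
  assume "f \<in> carrier ?F" "n \<in> carrier N"
  then show "tensor_coords R S N (pure_tensor R ?F N f n) = (\<lambda>s\<in>S. f s \<odot>\<^bsub>N\<^esub> n)"
    using conjunct2[OF C] by simp
qed

context
  fixes R :: "('a, 'r) ring_scheme" and S :: "'s set" and N :: "('a, 'n) module"
  assumes N: "module R N"
begin

private abbreviation (input) "FS \<equiv> free_module R S"

private lemma coefficients_cring: "cring R"
  using N by (simp add: module_def)

lemma tensor_coord_lin:
  assumes s: "s \<in> S"
  shows "lin R (tensor_module R FS N) N (\<lambda>t. tensor_coords R S N t s)"
proof (intro linI tensor_module_module free_module_module coefficients_cring N)
  show "linear_map R (tensor_module R FS N) N (\<lambda>t. tensor_coords R S N t s)"
    using tensor_coords_linear[OF N, of S] s
    by (auto simp: linear_map_def direct_sum_simps Pi_iff PiE_iff)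
qed

text \<open>The expansion of a tensor along the basis \<open>S\<close>.\<close>

lemma tensor_expansion:
  assumes t: "t \<in> carrier (tensor_module R FS N)"
  shows "finsum (tensor_module R FS N)
      (\<lambda>s. pure_tensor R FS N (free_gen R S s) (tensor_coords R S N t s))
      {s \<in> S. tensor_coords R S N t s \<noteq> \<zero>\<^bsub>N\<^esub>} = t"
proof -
  interpret N: module R N by (rule N)
  interpret A: tensor_product R FS N by (intro tensor_productI free_module_module coefficients_cring N)
  let ?T = "tensor_module R FS N" and ?C = "tensor_coords R S N"
  let ?g = "\<lambda>s n. pure_tensor R FS N (free_gen R S s) n"
  have bil1: "linear_map R N ?T (pure_tensor R FS N f)" if "f \<in> carrier FS" for f
    using A.pure_bilinear that unfolding bilinear_def by blast
  have bil2: "linear_map R FS ?T (\<lambda>f. pure_tensor R FS N f n)" if "n \<in> carrier N" for n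
    using A.pure_bilinear that unfolding bilinear_def by blast
  have g: "linear_map R N ?T (?g s)" if "s \<in> S" for s by (rule bil1[OF free_gen_carrier[OF coefficients_cring that]])
  let ?J = "direct_sum_lift S N ?T ?g"
  have D: "module R (direct_sum S (\<lambda>_. N))" by (intro direct_sum_module coefficients_cring N)
  have J: "lin R (direct_sum S (\<lambda>_. N)) ?T ?J"
    by (intro linI D A.module direct_sum_lift_linear N g)
  have C: "lin R ?T (direct_sum S (\<lambda>_. N)) ?C" by (intro linI D A.module tensor_coords_linear N)
  have id: "lin R ?T ?T (\<lambda>t. t)" by (intro linI A.module linear_mapI) simp_all
  have "?J (?C t) = t"
  proof (rule A.tensor_ext[OF lin_compose[OF C J] id _ t])
    fix f n assume f: "f \<in> carrier FS" and n: "n \<in> carrier N"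
    have p: "lin R FS ?T (\<lambda>f. pure_tensor R FS N f n)" by (intro linI free_module_module coefficients_cring A.module bil2 n)
    show "?J (?C (pure_tensor R FS N f n)) = pure_tensor R FS N f n"
    proof (rule linear_eq_on_free_module[OF coefficients_cring lin_compose[OF p lin_compose[OF C J]] p _ f])
      fix s assume s: "s \<in> S"
      have "?C (pure_tensor R FS N (free_gen R S s) n) = single S N s n"
        unfolding tensor_coords_pure[OF N free_gen_carrier[OF coefficients_cring s] n]
        using n by (intro ext) (simp add: single_def free_gen_def restrict_def)
      then show "?J (?C (pure_tensor R FS N (free_gen R S s) n)) = pure_tensor R FS N (free_gen R S s) n"
        using direct_sum_lift_single[where g = ?g, OF N A.module g s n] by simp
    qed
  qed
  then show ?thesis by (simp add: direct_sum_lift_def)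
qed

lemma tensor_eq_zeroI:
  assumes t: "t \<in> carrier (tensor_module R FS N)"
    and 0: "\<And>s. s \<in> S \<Longrightarrow> tensor_coords R S N t s = \<zero>\<^bsub>N\<^esub>"
  shows "t = \<zero>\<^bsub>tensor_module R FS N\<^esub>"
proof -
  interpret T: module R "tensor_module R FS N" by (intro tensor_module_module free_module_module coefficients_cring N)
  have E: "{s \<in> S. tensor_coords R S N t s \<noteq> \<zero>\<^bsub>N\<^esub>} = {}" using 0 by auto
  show ?thesis using tensor_expansion[OF t] unfolding E by (simp only: T.M.finsum_empty)
qed

lemma tensor_coords_natural:
  fixes N' :: "('a, 'n2) module"
  assumes g: "lin R N N' g" and t: "t \<in> carrier (tensor_module R FS N)" and s: "s \<in> S"
  shows "tensor_coords R S N' (tensor_map R FS N FS N' id g t) s = g (tensor_coords R S N t s)"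
proof -
  interpret g: lin R N N' g by fact
  have F: "module R FS" by (rule free_module_module[OF coefficients_cring])
  interpret A: tensor_product R FS N by (intro tensor_productI F N)
  note m = tensor_map_spec[OF lin_id[OF F] g]
  have c': "lin R (tensor_module R FS N') N' (\<lambda>t. tensor_coords R S N' t s)"
  proof (intro linI tensor_module_module F g.N.module_axioms)
    show "linear_map R (tensor_module R FS N') N' (\<lambda>t. tensor_coords R S N' t s)"
      using tensor_coords_linear[OF g.N.module_axioms, of S] s
      by (auto simp: linear_map_def direct_sum_simps Pi_iff PiE_iff)
  qed
  show ?thesis
  proof (rule A.tensor_ext[OF lin_compose[OF m(1) c'] lin_compose[OF tensor_coord_lin[OF s] g] _ t])
    fix f n assume f: "f \<in> carrier FS" and n: "n \<in> carrier N"
    have "f s \<in> carrier R" using f s by (simp add: free_module_carrier)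
    then show "tensor_coords R S N' (tensor_map R FS N FS N' id g (pure_tensor R FS N f n)) s
      = g (tensor_coords R S N (pure_tensor R FS N f n) s)"
      unfolding m(2)[OF f n] id_apply tensor_coords_pure[OF N f n]
        tensor_coords_pure[OF g.N.module_axioms f g.closed[OF n]]
      using s n by simp
  qed
qed

text \<open>Right exactness: lifts of the coordinates along \<open>p\<close> are the coordinates of a lift.\<close>

lemma tensor_lift:
  fixes A :: "('a, 'b) module"
  assumes p: "lin R A N p" and t: "t \<in> carrier (tensor_module R FS N)"
    and img: "\<And>s. s \<in> S \<Longrightarrow> tensor_coords R S N t s \<in> p ` carrier A"
  obtains u where "u \<in> carrier (tensor_module R FS A)" "tensor_map R FS A FS N id p u = t"
proof -
  interpret p: lin R A N p by fact
  have F: "module R FS" by (rule free_module_module[OF coefficients_cring])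
  interpret TA: tensor_product R FS A by (intro tensor_productI F p.M.module_axioms)
  interpret TN: tensor_product R FS N by (intro tensor_productI F N)
  interpret MA: module R "tensor_module R FS A" by (rule TA.module)
  interpret m: lin R "tensor_module R FS A" "tensor_module R FS N" "tensor_map R FS A FS N id p"
    by (rule tensor_map_lin[OF lin_id[OF F] p])
  let ?C = "tensor_coords R S N t"
  let ?s = "{s \<in> S. ?C s \<noteq> \<zero>\<^bsub>N\<^esub>}"
  have "?C \<in> carrier (direct_sum S (\<lambda>_. N))"
    using linear_map_closed[OF tensor_coords_linear[OF N] t] .
  then have fin: "finite ?s" by (simp add: direct_sum_simps)
  have "\<forall>s\<in>S. \<exists>a. a \<in> carrier A \<and> ?C s = p a"
  proof
    fix s assume "s \<in> S"
    from img[OF this] obtain a where "?C s = p a" "a \<in> carrier A" by (rule imageE)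
    then show "\<exists>a. a \<in> carrier A \<and> ?C s = p a" by (intro exI[of _ a] conjI)
  qed
  from bchoice[OF this] obtain b where b: "\<forall>s\<in>S. b s \<in> carrier A \<and> ?C s = p (b s)" ..
  let ?g = "\<lambda>s. pure_tensor R FS A (free_gen R S s) (b s)"
  have gc: "?g \<in> ?s \<rightarrow> carrier (tensor_module R FS A)"
    using b TA.pure_closed[OF free_gen_carrier[OF coefficients_cring]] by auto
  show ?thesis
  proof (rule that)
    show "finsum (tensor_module R FS A) ?g ?s \<in> carrier (tensor_module R FS A)"
      using gc by (rule MA.M.finsum_closed)
    have "tensor_map R FS A FS N id p (finsum (tensor_module R FS A) ?g ?s)
      = finsum (tensor_module R FS N) (\<lambda>s. tensor_map R FS A FS N id p (?g s)) ?s"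
      by (rule m.finsum[OF fin gc])
    also have "\<dots> = finsum (tensor_module R FS N) (\<lambda>s. pure_tensor R FS N (free_gen R S s) (?C s)) ?s"
    proof (rule m.N.M.finsum_cong'[OF refl])
      show "(\<lambda>s. pure_tensor R FS N (free_gen R S s) (?C s)) \<in> ?s \<rightarrow> carrier (tensor_module R FS N)"
        using b TN.pure_closed[OF free_gen_carrier[OF coefficients_cring]] by auto
      fix s assume "s \<in> ?s"
      then have s: "s \<in> S" by simp
      have bs: "b s \<in> carrier A" "?C s = p (b s)" using b s by simp_all
      show "tensor_map R FS A FS N id p (?g s) = pure_tensor R FS N (free_gen R S s) (?C s)"
        unfolding tensor_map_pure[OF lin_id[OF F] p free_gen_carrier[OF coefficients_cring s] bs(1)] bs(2) by simp
    qed
    also have "\<dots> = t" by (rule tensor_expansion[OF t])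
    finally show "tensor_map R FS A FS N id p (finsum (tensor_module R FS A) ?g ?s) = t" .
  qed
qed

end


section \<open>The tensor product with a free resolution\<close>

text \<open>The two differentials of the double complex, without signs. Degrees are written as \<open>i + 1 + 1\<close> so
  that the source of one differential is literally the target of the one before it.\<close>

definition tensor_d1 ::
  "('a, 'r) ring_scheme \<Rightarrow> ('a, 'x) cplx \<Rightarrow> ('a, 'n) module \<Rightarrow> int
    \<Rightarrow> ('x \<times> 'n \<Rightarrow> 'a) set \<Rightarrow> ('x \<times> 'n \<Rightarrow> 'a) set" where
  "tensor_d1 R X N i = tensor_map R (obj X (i + 1)) N (obj X i) N (diff X (i + 1)) id"

definition tensor_d2 ::
  "('a, 'r) ring_scheme \<Rightarrow> ('a, 'x) cplx \<Rightarrow> ('a, 'y) cplx \<Rightarrow> int \<Rightarrow> int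
    \<Rightarrow> ('x \<times> 'y \<Rightarrow> 'a) set \<Rightarrow> ('x \<times> 'y \<Rightarrow> 'a) set" where
  "tensor_d2 R X Y i j = tensor_map R (obj X i) (obj Y (j + 1)) (obj X i) (obj Y j) id (diff Y (j + 1))"

lemma chain_complex_diff_lin:
  assumes "chain_complex R X" shows "lin R (obj X (i + 1)) (obj X i) (diff X (i + 1))"
  using chain_complexD(2)[OF assms, of "i + 1"] by (intro linI chain_complexD(1)[OF assms]) simp

lemma chain_complex_diff_diff:
  assumes "chain_complex R X" "x \<in> carrier (obj X (i + 1 + 1))"
  shows "diff X (i + 1) (diff X (i + 1 + 1) x) = \<zero>\<^bsub>obj X i\<^esub>"
  using chain_complexD(3)[OF assms] by (simp add: algebra_simps)

lemma tensor_d1_lin: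
  assumes "chain_complex R X" "module R N"
  shows "lin R (tensor_module R (obj X (i + 1)) N) (tensor_module R (obj X i) N) (tensor_d1 R X N i)"
  unfolding tensor_d1_def by (intro tensor_map_lin chain_complex_diff_lin lin_id assms)

lemma tensor_d2_lin:
  assumes "chain_complex R X" "chain_complex R Y"
  shows "lin R (tensor_module R (obj X i) (obj Y (j + 1))) (tensor_module R (obj X i) (obj Y j))
    (tensor_d2 R X Y i j)"
  unfolding tensor_d2_def by (intro tensor_map_lin chain_complex_diff_lin lin_id chain_complexD(1) assms)

lemma tensor_d1_d1:
  assumes X: "chain_complex R X" and N: "module R N"
    and t: "t \<in> carrier (tensor_module R (obj X (i + 1 + 1)) N)"
  shows "tensor_d1 R X N i (tensor_d1 R X N (i + 1) t) = \<zero>\<^bsub>tensor_module R (obj X i) N\<^esub>"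
  unfolding tensor_d1_def
  by (rule tensor_map_comp_zero_left[OF chain_complex_diff_lin[OF X] lin_id[OF N]
        chain_complex_diff_lin[OF X] lin_id[OF N] chain_complex_diff_diff[OF X] t])

lemma tensor_d2_d2:
  assumes X: "chain_complex R X" and Y: "chain_complex R Y"
    and t: "t \<in> carrier (tensor_module R (obj X i) (obj Y (j + 1 + 1)))"
  shows "tensor_d2 R X Y i j (tensor_d2 R X Y i (j + 1) t) = \<zero>\<^bsub>tensor_module R (obj X i) (obj Y j)\<^esub>"
proof -
  note l = chain_complex_diff_lin[OF Y] and I = lin_id[OF chain_complexD(1)[OF X]]
  show ?thesis unfolding tensor_d2_def
    by (rule tensor_map_comp_zero_right[OF I l I l chain_complex_diff_diff[OF Y] t])
qed

lemma tensor_d1_d2: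
  assumes X: "chain_complex R X" and Y: "chain_complex R Y"
    and t: "t \<in> carrier (tensor_module R (obj X (i + 1)) (obj Y (j + 1)))"
  shows "tensor_d1 R X (obj Y j) i (tensor_d2 R X Y (i + 1) j t)
    = tensor_d2 R X Y i j (tensor_d1 R X (obj Y (j + 1)) i t)"
proof -
  note lX = chain_complex_diff_lin[OF X] and lY = chain_complex_diff_lin[OF Y]
  note IX = lin_id[OF chain_complexD(1)[OF X]] and IY = lin_id[OF chain_complexD(1)[OF Y]]
  show ?thesis unfolding tensor_d1_def tensor_d2_def
    by (rule tensor_map_comp_eq[OF IX lY lX IY lX IY IX lY _ _ t]) simp_all
qed

context
  fixes R :: "('a, 'r) ring_scheme" and X :: "('a, 'x) cplx" and Y :: "('a, 'y) cplx"
  assumes X: "chain_complex R X" and Y: "chain_complex R Y"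
begin

private abbreviation (input) "TT i j \<equiv> tensor_module R (obj X i) (obj Y j)"
private abbreviation (input) "TC \<equiv> tensor_complex R X Y"

private lemma tensor_base_cring: "cring R"
  using chain_complexD(1)[OF X, of 0] by (simp add: module_def)

private lemma tensor_components_module: "module R (TT i j)"
  by (intro tensor_module_module chain_complexD(1) X Y)

lemma tensor_complex_mem:
  "\<phi> \<in> carrier (obj TC n) \<Longrightarrow> n = i + j \<Longrightarrow> \<phi> i \<in> carrier (TT i j)"
proof -
  assume p: "\<phi> \<in> carrier (obj TC n)" and n: "n = i + j"
  from p have "\<phi> i \<in> carrier (TT i (n - i))" by (simp add: tensor_complex_def direct_sum_simps PiE_iff)
  then show ?thesis by (simp add: n)
qed

lemma tensor_complex_memI:
  assumes "\<And>i j. n = i + j \<Longrightarrow> \<phi> i \<in> carrier (TT i j)" "finite A"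
    and "\<And>i j. n = i + j \<Longrightarrow> i \<notin> A \<Longrightarrow> \<phi> i = \<zero>\<^bsub>TT i j\<^esub>"
  shows "\<phi> \<in> carrier (obj TC n)"
proof -
  have "{i. \<phi> i \<noteq> \<zero>\<^bsub>TT i (n - i)\<^esub>} \<subseteq> A" using assms(3)[of i "n - i" for i] by auto
  then have "finite {i. \<phi> i \<noteq> \<zero>\<^bsub>TT i (n - i)\<^esub>}" using assms(2) finite_subset by blast
  then show ?thesis using assms(1)[of i "n - i" for i]
    by (simp add: tensor_complex_def direct_sum_simps PiE_iff)
qed

lemma tensor_complex_finite:
  assumes "\<phi> \<in> carrier (obj TC n)"
  obtains A where "finite A" "\<And>i j. n = i + j \<Longrightarrow> i \<notin> A \<Longrightarrow> \<phi> i = \<zero>\<^bsub>TT i j\<^esub>"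
proof (rule that)
  show "finite {i. \<phi> i \<noteq> \<zero>\<^bsub>TT i (n - i)\<^esub>}"
    using assms by (simp add: tensor_complex_def direct_sum_simps)
qed auto

lemma tensor_complex_ops:
  "n = i + j \<Longrightarrow> \<zero>\<^bsub>obj TC n\<^esub> i = \<zero>\<^bsub>TT i j\<^esub>"
  "n = i + j \<Longrightarrow> (\<phi> \<oplus>\<^bsub>obj TC n\<^esub> \<psi>) i = \<phi> i \<oplus>\<^bsub>TT i j\<^esub> \<psi> i"
  "n = i + j \<Longrightarrow> (a \<odot>\<^bsub>obj TC n\<^esub> \<phi>) i = a \<odot>\<^bsub>TT i j\<^esub> \<phi> i"
  by (auto simp: tensor_complex_def direct_sum_simps)

lemma tensor_complex_obj_module: "module R (obj TC n)"
  unfolding tensor_complex_def cplx.simps by (intro direct_sum_module tensor_base_cring tensor_components_module)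

lemma tensor_complex_diff:
  assumes p: "\<phi> \<in> carrier (obj TC n)" and n: "n = i + j + 1"
  shows "diff TC n \<phi> i = tensor_d1 R X (obj Y j) i (\<phi> (i + 1))
    \<oplus>\<^bsub>TT i j\<^esub> hom_sign R (i + 1) \<odot>\<^bsub>TT i j\<^esub> tensor_d2 R X Y i j (\<phi> i)"
proof -
  interpret T: module R "TT i j" by (rule tensor_components_module)
  have "tensor_d2 R X Y i j (\<phi> i) \<in> carrier (TT i j)"
    using n by (intro lin.closed[OF tensor_d2_lin[OF X Y]] tensor_complex_mem[OF p]) simp
  moreover have e: "n - 1 - i = j" "n - i = j + 1" using n by simp_all
  ultimately show ?thesis
    unfolding tensor_complex_def cplx.simps Let_def e
    by (simp add: tensor_d1_def tensor_d2_def T.hom_sign_smult a_minus_def)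
qed

lemma tensor_complex_diff_closed:
  assumes p: "\<phi> \<in> carrier (obj TC n)"
  shows "diff TC n \<phi> \<in> carrier (obj TC (n - 1))"
proof -
  obtain A where A: "finite A" "\<And>i j. n = i + j \<Longrightarrow> i \<notin> A \<Longrightarrow> \<phi> i = \<zero>\<^bsub>TT i j\<^esub>"
    using tensor_complex_finite[OF p] by blast
  show ?thesis
  proof (rule tensor_complex_memI[where A = "A \<union> (\<lambda>i. i - 1) ` A"])
    fix i j assume n: "n - 1 = i + j"
    then have n': "n = i + j + 1" "n = (i + 1) + j" "n = i + (j + 1)" by simp_all
    interpret d1: lin R "TT (i + 1) j" "TT i j" "tensor_d1 R X (obj Y j) i"
      by (intro tensor_d1_lin X chain_complexD(1)[OF Y])
    interpret d2: lin R "TT i (j + 1)" "TT i j" "tensor_d2 R X Y i j" by (intro tensor_d2_lin X Y)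
    interpret R: cring R by (rule tensor_base_cring)
    show "diff TC n \<phi> i \<in> carrier (TT i j)"
      unfolding tensor_complex_diff[OF p n'(1)]
      using tensor_complex_mem[OF p n'(2)] tensor_complex_mem[OF p n'(3)] by simp
    assume "i \<notin> A \<union> (\<lambda>i. i - 1) ` A"
    then have "i \<notin> A" "i + 1 \<notin> A" by (auto simp: image_iff)
    then have "\<phi> i = \<zero>\<^bsub>TT i (j + 1)\<^esub>" "\<phi> (i + 1) = \<zero>\<^bsub>TT (i + 1) j\<^esub>"
      using A(2)[OF n'(3)] A(2)[OF n'(2)] by simp_all
    then show "diff TC n \<phi> i = \<zero>\<^bsub>TT i j\<^esub>" unfolding tensor_complex_diff[OF p n'(1)] by simp
  qed (use A(1) in simp)
qed

lemma tensor_complex_eqI: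
  "(\<And>i j. n = i + j \<Longrightarrow> \<phi> i = \<psi> i) \<Longrightarrow> (\<phi> :: int \<Rightarrow> ('x \<times> 'y \<Rightarrow> 'a) set) = \<psi>" for n :: int
proof (rule ext)
  fix i assume a: "\<And>i j. n = i + j \<Longrightarrow> \<phi> i = \<psi> i"
  show "\<phi> i = \<psi> i" by (rule a[of i "n - i"]) simp
qed

lemma tensor_complex_complex: "chain_complex R TC"
  unfolding chain_complex_def
proof (intro conjI allI ballI tensor_complex_obj_module)
  fix n
  interpret R: cring R by (rule tensor_base_cring)
  interpret A: module R "obj TC n" by (rule tensor_complex_obj_module)
  interpret B: module R "obj TC (n - 1)" by (rule tensor_complex_obj_module)
  note cl = tensor_complex_diff_closed
  show "linear_map R (obj TC n) (obj TC (n - 1)) (diff TC n)"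
  proof (rule linear_mapI[OF cl])
    fix \<phi> \<psi> assume p: "\<phi> \<in> carrier (obj TC n)" and q: "\<psi> \<in> carrier (obj TC n)"
    show "diff TC n (\<phi> \<oplus>\<^bsub>obj TC n\<^esub> \<psi>) = diff TC n \<phi> \<oplus>\<^bsub>obj TC (n - 1)\<^esub> diff TC n \<psi>"
    proof (rule tensor_complex_eqI[where n = "n - 1"])
      fix i j assume n: "n - 1 = i + j"
      then have n': "n = i + j + 1" "n = (i + 1) + j" "n = i + (j + 1)" by simp_all
      interpret d1: lin R "TT (i + 1) j" "TT i j" "tensor_d1 R X (obj Y j) i"
        by (intro tensor_d1_lin X chain_complexD(1)[OF Y])
      interpret d2: lin R "TT i (j + 1)" "TT i j" "tensor_d2 R X Y i j" by (intro tensor_d2_lin X Y)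
      note m = tensor_complex_mem[OF p n'(2)] tensor_complex_mem[OF q n'(2)]
        tensor_complex_mem[OF p n'(3)] tensor_complex_mem[OF q n'(3)]
      show "diff TC n (\<phi> \<oplus>\<^bsub>obj TC n\<^esub> \<psi>) i = (diff TC n \<phi> \<oplus>\<^bsub>obj TC (n - 1)\<^esub> diff TC n \<psi>) i"
        unfolding tensor_complex_ops(2)[OF n] tensor_complex_diff[OF p n'(1)] tensor_complex_diff[OF q n'(1)]
          tensor_complex_diff[OF A.M.a_closed[OF p q] n'(1)]
          tensor_complex_ops(2)[OF n'(2)] tensor_complex_ops(2)[OF n'(3)]
        using m by (simp add: d1.N.smult_r_distr d1.N.M.a_ac)
    qed
  next
    fix a \<phi> assume a: "a \<in> carrier R" and p: "\<phi> \<in> carrier (obj TC n)"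
    show "diff TC n (a \<odot>\<^bsub>obj TC n\<^esub> \<phi>) = a \<odot>\<^bsub>obj TC (n - 1)\<^esub> diff TC n \<phi>"
    proof (rule tensor_complex_eqI[where n = "n - 1"])
      fix i j assume n: "n - 1 = i + j"
      then have n': "n = i + j + 1" "n = (i + 1) + j" "n = i + (j + 1)" by simp_all
      interpret d1: lin R "TT (i + 1) j" "TT i j" "tensor_d1 R X (obj Y j) i"
        by (intro tensor_d1_lin X chain_complexD(1)[OF Y])
      interpret d2: lin R "TT i (j + 1)" "TT i j" "tensor_d2 R X Y i j" by (intro tensor_d2_lin X Y)
      note m = tensor_complex_mem[OF p n'(2)] tensor_complex_mem[OF p n'(3)]
      show "diff TC n (a \<odot>\<^bsub>obj TC n\<^esub> \<phi>) i = (a \<odot>\<^bsub>obj TC (n - 1)\<^esub> diff TC n \<phi>) i"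
        unfolding tensor_complex_ops(3)[OF n] tensor_complex_diff[OF p n'(1)]
          tensor_complex_diff[OF A.smult_closed[OF a p] n'(1)]
          tensor_complex_ops(3)[OF n'(2)] tensor_complex_ops(3)[OF n'(3)]
        using m a by (simp add: d1.N.smult_r_distr d1.N.smult_assoc1[symmetric] R.m_comm)
    qed
  qed
  fix \<phi> assume p: "\<phi> \<in> carrier (obj TC n)"
  note dp = cl[OF p]
  show "diff TC (n - 1) (diff TC n \<phi>) = \<zero>\<^bsub>obj TC (n - 2)\<^esub>"
  proof (rule tensor_complex_eqI[where n = "n - 2"])
    fix i j assume n: "n - 2 = i + j"
    then have n': "n - 1 = i + j + 1" "n = (i + 1) + j + 1" "n = i + (j + 1) + 1"
      "n = (i + 1 + 1) + j" "n = (i + 1) + (j + 1)" "n = i + (j + 1 + 1)" by simp_all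
    interpret a1: lin R "TT (i + 1) j" "TT i j" "tensor_d1 R X (obj Y j) i"
      by (intro tensor_d1_lin X chain_complexD(1)[OF Y])
    interpret a2: lin R "TT i (j + 1)" "TT i j" "tensor_d2 R X Y i j" by (intro tensor_d2_lin X Y)
    interpret b1: lin R "TT (i + 1 + 1) j" "TT (i + 1) j" "tensor_d1 R X (obj Y j) (i + 1)"
      by (intro tensor_d1_lin X chain_complexD(1)[OF Y])
    interpret b2: lin R "TT (i + 1) (j + 1)" "TT (i + 1) j" "tensor_d2 R X Y (i + 1) j"
      by (intro tensor_d2_lin X Y)
    interpret c1: lin R "TT (i + 1) (j + 1)" "TT i (j + 1)" "tensor_d1 R X (obj Y (j + 1)) i"
      by (intro tensor_d1_lin X chain_complexD(1)[OF Y])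
    interpret c2: lin R "TT i (j + 1 + 1)" "TT i (j + 1)" "tensor_d2 R X Y i (j + 1)"
      by (intro tensor_d2_lin X Y)
    note m = tensor_complex_mem[OF p n'(4)] tensor_complex_mem[OF p n'(5)] tensor_complex_mem[OF p n'(6)]
    let ?w = "tensor_d1 R X (obj Y j) i (tensor_d2 R X Y (i + 1) j (\<phi> (i + 1)))"
    have w: "?w \<in> carrier (TT i j)" using m by simp
    have z: "tensor_d1 R X (obj Y j) i (tensor_d1 R X (obj Y j) (i + 1) (\<phi> (i + 1 + 1))) = \<zero>\<^bsub>TT i j\<^esub>"
      "tensor_d2 R X Y i j (tensor_d2 R X Y i (j + 1) (\<phi> i)) = \<zero>\<^bsub>TT i j\<^esub>"
      using tensor_d1_d1[OF X chain_complexD(1)[OF Y] m(1)] tensor_d2_d2[OF X Y m(3)] by simp_all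
    have c: "tensor_d2 R X Y i j (tensor_d1 R X (obj Y (j + 1)) i (\<phi> (i + 1))) = ?w"
      using tensor_d1_d2[OF X Y m(2)] by simp
    have e: "i + 1 + 1 - 1 = i + 1" by simp
    have "hom_sign R (i + 1 + 1) \<odot>\<^bsub>TT i j\<^esub> ?w \<oplus>\<^bsub>TT i j\<^esub> hom_sign R (i + 1) \<odot>\<^bsub>TT i j\<^esub> ?w
      = (hom_sign R (i + 1 + 1) \<oplus>\<^bsub>R\<^esub> hom_sign R (i + 1)) \<odot>\<^bsub>TT i j\<^esub> ?w"
      by (rule a1.N.smult_l_distr[symmetric]) (simp_all only: R.hom_sign_closed w)
    also have "\<dots> = \<zero>\<^bsub>TT i j\<^esub>"
      using w unfolding R.hom_sign_cancel[of "i + 1 + 1", unfolded e] by simp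
    finally have s: "hom_sign R (i + 1 + 1) \<odot>\<^bsub>TT i j\<^esub> ?w \<oplus>\<^bsub>TT i j\<^esub> hom_sign R (i + 1) \<odot>\<^bsub>TT i j\<^esub> ?w
      = \<zero>\<^bsub>TT i j\<^esub>" .
    have "diff TC (n - 1) (diff TC n \<phi>) i
      = hom_sign R (i + 1 + 1) \<odot>\<^bsub>TT i j\<^esub> ?w \<oplus>\<^bsub>TT i j\<^esub> hom_sign R (i + 1) \<odot>\<^bsub>TT i j\<^esub> ?w"
      unfolding tensor_complex_diff[OF dp n'(1)] tensor_complex_diff[OF p n'(2)]
        tensor_complex_diff[OF p n'(3)]
      using m w z c by simp
    then show "diff TC (n - 1) (diff TC n \<phi>) i = \<zero>\<^bsub>obj TC (n - 2)\<^esub> i"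
      unfolding tensor_complex_ops(1)[OF n] s .
  qed
qed

end

subsection \<open>Cycles and boundaries after tensoring with a free module\<close>

text \<open>A free module is flat, so tensoring with it commutes with homology. The lemmas of this section
  say so on the level of elements, mostly by comparing coordinates.\<close>

context
  fixes R :: "('a, 'r) ring_scheme" and M :: "('a, 'm) cplx" and j :: int
    and H :: "('a, 'h) module" and \<pi> :: "'m \<Rightarrow> 'h" and F :: "('a, 's \<Rightarrow> 'a) module"
  assumes M: "chain_complex R M" and H: "is_homology R M (j + 1) H \<pi>"
    and F: "\<exists>S. F = free_module R S"
begin

private abbreviation (input) "Zm \<equiv> (obj M (j + 1))\<lparr>carrier := cycles M (j + 1)\<rparr>"

lemma cycles_module: "module R Zm"
  by (intro submodule.submodule_is_module[OF cycles_submodule] chain_complexD[OF M])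

lemma cycles_inclusion: "lin R Zm (obj M (j + 1)) id"
  by (intro linI cycles_module chain_complexD[OF M] linear_mapI) (auto simp: cycles_def)

lemma cycles_class: "lin R Zm H \<pi>"
  using H by (intro linI cycles_module is_homologyD(1)[OF H]) (simp add: is_homology_def)

private lemma homology_base_cring: "cring R"
  using chain_complexD(1)[OF M, of 0] by (simp add: module_def)

lemma tensor_cycle_lift:
  assumes z: "z \<in> carrier (tensor_module R F (obj M (j + 1)))"
    and dz: "tensor_map R F (obj M (j + 1)) F (obj M j) id (diff M (j + 1)) z = \<zero>\<^bsub>tensor_module R F (obj M j)\<^esub>"
  obtains y where "y \<in> carrier (tensor_module R F Zm)" "tensor_map R F Zm F (obj M (j + 1)) id id y = z"
proof -
  obtain S where S: "F = free_module R S" using F by blast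
  note Mm = chain_complexD(1)[OF M]
  note d = chain_complex_diff_lin[OF M, of j]
  show ?thesis
    unfolding S
  proof (rule tensor_lift[OF Mm cycles_inclusion z[unfolded S]])
    fix s assume s: "s \<in> S"
    let ?x = "tensor_coords R S (obj M (j + 1)) z s"
    have x: "?x \<in> carrier (obj M (j + 1))"
      using lin.closed[OF tensor_coord_lin[OF Mm s] z[unfolded S]] .
    have "diff M (j + 1) ?x = tensor_coords R S (obj M j) \<zero>\<^bsub>tensor_module R F (obj M j)\<^esub> s"
      using tensor_coords_natural[OF Mm d z[unfolded S] s] dz unfolding S by simp
    also have "\<dots> = \<zero>\<^bsub>obj M j\<^esub>" unfolding S by (rule lin.zero[OF tensor_coord_lin[OF Mm s]])
    finally have "?x \<in> cycles M (j + 1)" using x by (simp add: cycles_def)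
    then show "?x \<in> id ` carrier Zm" by simp
  qed (use that S in blast)
qed

lemma tensor_class_eq_zero:
  assumes y: "y \<in> carrier (tensor_module R F Zm)"
    and x: "x \<in> carrier (tensor_module R F (obj M (j + 1 + 1)))"
    and eq: "tensor_map R F Zm F (obj M (j + 1)) id id y
      = tensor_map R F (obj M (j + 1 + 1)) F (obj M (j + 1)) id (diff M (j + 1 + 1)) x"
  shows "tensor_map R F Zm F H id \<pi> y = \<zero>\<^bsub>tensor_module R F H\<^esub>"
proof -
  obtain S where S: "F = free_module R S" using F by blast
  note Mm = chain_complexD(1)[OF M]
  note d = chain_complex_diff_lin[OF M, of "j + 1"]
  have Fm: "module R F" unfolding S by (rule free_module_module[OF homology_base_cring])
  have c: "tensor_map R F Zm F H id \<pi> y \<in> carrier (tensor_module R F H)"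
    by (rule lin.closed[OF tensor_map_lin[OF lin_id[OF Fm] cycles_class] y])
  show ?thesis unfolding S
  proof (rule tensor_eq_zeroI[OF is_homologyD(1)[OF H] c[unfolded S]])
    fix s assume s: "s \<in> S"
    let ?y = "tensor_coords R S Zm y s" and ?x = "tensor_coords R S (obj M (j + 1 + 1)) x s"
    have yc: "?y \<in> cycles M (j + 1)"
      using lin.closed[OF tensor_coord_lin[OF cycles_module s] y[unfolded S]] by simp
    have xc: "?x \<in> carrier (obj M (j + 1 + 1))"
      by (rule lin.closed[OF tensor_coord_lin[OF Mm s] x[unfolded S]])
    have "?y = diff M (j + 1 + 1) ?x"
      using tensor_coords_natural[OF cycles_module cycles_inclusion y[unfolded S] s]
        tensor_coords_natural[OF Mm d x[unfolded S] s] eq[unfolded S] by simp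
    then have "?y \<in> boundaries M (j + 1)" unfolding boundaries_def using xc by (rule image_eqI)
    then have "\<pi> ?y = \<zero>\<^bsub>H\<^esub>" using is_homologyD(6)[OF H yc] by simp
    then show "tensor_coords R S H (tensor_map R (free_module R S) Zm (free_module R S) H id \<pi> y) s = \<zero>\<^bsub>H\<^esub>"
      using tensor_coords_natural[OF cycles_module cycles_class y[unfolded S] s] by simp
  qed
qed

lemma tensor_boundary_lift:
  assumes y: "y \<in> carrier (tensor_module R F Zm)"
    and py: "tensor_map R F Zm F H id \<pi> y = \<zero>\<^bsub>tensor_module R F H\<^esub>"
  obtains x where "x \<in> carrier (tensor_module R F (obj M (j + 1 + 1)))"
    "tensor_map R F (obj M (j + 1 + 1)) F (obj M (j + 1)) id (diff M (j + 1 + 1)) x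
      = tensor_map R F Zm F (obj M (j + 1)) id id y"
proof -
  obtain S where S: "F = free_module R S" using F by blast
  note Mm = chain_complexD(1)[OF M]
  note d = chain_complex_diff_lin[OF M, of "j + 1"]
  have Fm: "module R F" unfolding S by (rule free_module_module[OF homology_base_cring])
  let ?z = "tensor_map R F Zm F (obj M (j + 1)) id id y"
  have z: "?z \<in> carrier (tensor_module R F (obj M (j + 1)))"
    by (rule lin.closed[OF tensor_map_lin[OF lin_id[OF Fm] cycles_inclusion] y])
  show ?thesis
  proof (rule tensor_lift[OF Mm d z[unfolded S]])
    fix s assume s: "s \<in> S"
    let ?y = "tensor_coords R S Zm y s"
    have yc: "?y \<in> cycles M (j + 1)"
      using lin.closed[OF tensor_coord_lin[OF cycles_module s] y[unfolded S]] by simp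
    have "\<pi> ?y = tensor_coords R S H \<zero>\<^bsub>tensor_module R F H\<^esub> s"
      using tensor_coords_natural[OF cycles_module cycles_class y[unfolded S] s] py unfolding S by simp
    also have "\<dots> = \<zero>\<^bsub>H\<^esub>" unfolding S by (rule lin.zero[OF tensor_coord_lin[OF is_homologyD(1)[OF H] s]])
    finally have "?y \<in> boundaries M (j + 1)" using is_homologyD(6)[OF H yc] by simp
    moreover have "tensor_coords R S (obj M (j + 1)) ?z s = ?y"
      using tensor_coords_natural[OF cycles_module cycles_inclusion y[unfolded S] s] unfolding S by simp
    ultimately show "tensor_coords R S (obj M (j + 1))
        (tensor_map R (free_module R S) Zm (free_module R S) (obj M (j + 1)) id id y) s
      \<in> diff M (j + 1 + 1) ` carrier (obj M (j + 1 + 1))"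
      unfolding S boundaries_def by simp
  qed (use that S in blast)
qed

lemma tensor_class_surj:
  assumes t: "t \<in> carrier (tensor_module R F H)"
  obtains w where "w \<in> carrier (tensor_module R F Zm)" "tensor_map R F Zm F H id \<pi> w = t"
proof -
  obtain S where S: "F = free_module R S" using F by blast
  note Hm = is_homologyD(1)[OF H]
  show ?thesis
  proof (rule tensor_lift[OF Hm cycles_class t[unfolded S]])
    fix s assume s: "s \<in> S"
    have "tensor_coords R S H t s \<in> carrier H"
      by (rule lin.closed[OF tensor_coord_lin[OF Hm s] t[unfolded S]])
    then obtain z where "z \<in> cycles M (j + 1)" "\<pi> z = tensor_coords R S H t s"
      using is_homologyD(5)[OF H] by blast
    then show "tensor_coords R S H t s \<in> \<pi> ` carrier Zm" by (intro image_eqI[of _ _ z]) simp_all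
  qed (use that S in blast)
qed

lemma tensor_diff_cycles:
  assumes y: "y \<in> carrier (tensor_module R F Zm)"
  shows "tensor_map R F (obj M (j + 1)) F (obj M j) id (diff M (j + 1))
    (tensor_map R F Zm F (obj M (j + 1)) id id y) = \<zero>\<^bsub>tensor_module R F (obj M j)\<^esub>"
proof -
  have Fm: "module R F" using F free_module_module[OF homology_base_cring] by auto
  note I = lin_id[OF Fm]
  have "diff M (j + 1) (id z) = \<zero>\<^bsub>obj M j\<^esub>" if "z \<in> carrier Zm" for z
    using that by (simp add: cycles_def)
  from tensor_map_comp_zero_right[OF I cycles_inclusion I chain_complex_diff_lin[OF M] this y]
  show ?thesis .
qed

end

text \<open>Acyclicity of \<open>F \<otimes> H\<close>.\<close>

definition tensor_exact :: "('a, 'r) ring_scheme \<Rightarrow> ('a, 'f) cplx \<Rightarrow> ('a, 'h) module \<Rightarrow> bool" where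
  "tensor_exact R F H \<longleftrightarrow> (\<forall>i. \<forall>t\<in>carrier (tensor_module R (obj F (i + 1)) H).
     tensor_d1 R F H i t = \<zero>\<^bsub>tensor_module R (obj F i) H\<^esub> \<longrightarrow>
     (\<exists>u\<in>carrier (tensor_module R (obj F (i + 1 + 1)) H). t = tensor_d1 R F H (i + 1) u))"

text \<open>The counterpart for tensor products of the correction step for homomorphisms: \<open>z\<close> is a
  component of highest index of a cycle of the total complex, and \<open>x\<close> is the component below it.
  The class of \<open>z\<close> in \<open>F \<otimes> H\<close> is a cycle, hence the boundary of some \<open>t\<close>. A representative \<open>w\<close> of \<open>t\<close>
  makes the class of \<open>z - d w\<close> vanish, so this difference is the boundary of some \<open>v\<close>.\<close>

lemma tensor_exact_correction:
  fixes M :: "('a, 'm) cplx" and H :: "('a, 'h) module" and F :: "('a, 's \<Rightarrow> 'a) cplx"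
  assumes F: "free_complex R F" and M: "chain_complex R M" and H: "is_homology R M (j + 1) H \<pi>"
    and ex: "tensor_exact R F H"
    and z: "z \<in> carrier (tensor_module R (obj F (i + 1)) (obj M (j + 1)))"
    and dz: "tensor_d2 R F M (i + 1) j z = \<zero>\<^bsub>tensor_module R (obj F (i + 1)) (obj M j)\<^esub>"
    and x: "x \<in> carrier (tensor_module R (obj F i) (obj M (j + 1 + 1)))"
    and zx: "tensor_d1 R F (obj M (j + 1)) i z = tensor_d2 R F M i (j + 1) x"
  obtains w v where "w \<in> carrier (tensor_module R (obj F (i + 1 + 1)) (obj M (j + 1)))"
    "tensor_d2 R F M (i + 1 + 1) j w = \<zero>\<^bsub>tensor_module R (obj F (i + 1 + 1)) (obj M j)\<^esub>"
    "v \<in> carrier (tensor_module R (obj F (i + 1)) (obj M (j + 1 + 1)))"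
    "z = tensor_d1 R F (obj M (j + 1)) (i + 1) w
      \<oplus>\<^bsub>tensor_module R (obj F (i + 1)) (obj M (j + 1))\<^esub> tensor_d2 R F M (i + 1) (j + 1) v"
proof -
  let ?Z = "(obj M (j + 1))\<lparr>carrier := cycles M (j + 1)\<rparr>"
  have FC: "chain_complex R F" by (rule free_complexD(1)[OF F])
  note Fm = chain_complexD(1)[OF FC] and Mm = chain_complexD(1)[OF M] and Hm = is_homologyD(1)[OF H]
  note FS = free_complexD(2)[OF F]
  note I = lin_id[OF Fm] and incl = cycles_inclusion[OF M H FS] and cls = cycles_class[OF M H FS]
  note Zm = cycles_module[OF M H FS]
  let ?i = "\<lambda>k. tensor_map R (obj F k) ?Z (obj F k) (obj M (j + 1)) id id"
  let ?p = "\<lambda>k. tensor_map R (obj F k) ?Z (obj F k) H id \<pi>"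
  note il = tensor_map_lin[OF I incl] and pl = tensor_map_lin[OF I cls]
  (* The differential of F commutes with the maps induced by inclusion and by taking classes. *)
  have ci: "?i k (tensor_d1 R F ?Z k y) = tensor_d1 R F (obj M (j + 1)) k (?i (k + 1) y)"
    if "y \<in> carrier (tensor_module R (obj F (k + 1)) ?Z)" for k y
    unfolding tensor_d1_def
    by (rule tensor_map_comp_eq[OF chain_complex_diff_lin[OF FC] lin_id[OF Zm] I incl
          I incl chain_complex_diff_lin[OF FC] lin_id[OF Mm] _ _ that]) simp_all
  have cp: "?p k (tensor_d1 R F ?Z k y) = tensor_d1 R F H k (?p (k + 1) y)"
    if "y \<in> carrier (tensor_module R (obj F (k + 1)) ?Z)" for k y
    unfolding tensor_d1_def
    by (rule tensor_map_comp_eq[OF chain_complex_diff_lin[OF FC] lin_id[OF Zm] I cls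
          I cls chain_complex_diff_lin[OF FC] lin_id[OF Hm] _ _ that]) simp_all
  interpret dZ: lin R "tensor_module R (obj F (k + 1)) ?Z" "tensor_module R (obj F k) ?Z" "tensor_d1 R F ?Z k" for k
    by (rule tensor_d1_lin[OF FC Zm])
  obtain y where y: "y \<in> carrier (tensor_module R (obj F (i + 1)) ?Z)" "?i (i + 1) y = z"
    using tensor_cycle_lift[OF M H FS z dz[unfolded tensor_d2_def]] by blast
  have "?i i (tensor_d1 R F ?Z i y) = tensor_d2 R F M i (j + 1) x"
    using ci[OF y(1)] y(2) zx by simp
  from tensor_class_eq_zero[OF M H FS dZ.closed[OF y(1)] x this[unfolded tensor_d2_def]]
  have "tensor_d1 R F H i (?p (i + 1) y) = \<zero>\<^bsub>tensor_module R (obj F i) H\<^esub>"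
    unfolding cp[OF y(1)] .
  then obtain t where t: "t \<in> carrier (tensor_module R (obj F (i + 1 + 1)) H)"
    "?p (i + 1) y = tensor_d1 R F H (i + 1) t"
    using ex lin.closed[OF pl y(1)] unfolding tensor_exact_def by blast
  obtain w where w: "w \<in> carrier (tensor_module R (obj F (i + 1 + 1)) ?Z)" "?p (i + 1 + 1) w = t"
    using tensor_class_surj[OF M H FS t(1)] by blast
  interpret il: lin R "tensor_module R (obj F (i + 1)) ?Z" "tensor_module R (obj F (i + 1)) (obj M (j + 1))" "?i (i + 1)"
    by (rule il)
  interpret pl: lin R "tensor_module R (obj F (i + 1)) ?Z" "tensor_module R (obj F (i + 1)) H" "?p (i + 1)"
    by (rule pl)
  let ?y = "y \<ominus>\<^bsub>tensor_module R (obj F (i + 1)) ?Z\<^esub> tensor_d1 R F ?Z (i + 1) w"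
  note dw = dZ.closed[OF w(1)]
  have y': "?y \<in> carrier (tensor_module R (obj F (i + 1)) ?Z)" using y(1) dw by (rule dZ.M.M.minus_closed)
  have "?p (i + 1) ?y = ?p (i + 1) y \<ominus>\<^bsub>tensor_module R (obj F (i + 1)) H\<^esub> ?p (i + 1) y"
    unfolding pl.minus[OF y(1) dw] cp[OF w(1)] w(2) t(2) ..
  also have "\<dots> = \<zero>\<^bsub>tensor_module R (obj F (i + 1)) H\<^esub>"
    using pl.N.M.minus_eq_zero_iff[OF pl.closed[OF y(1)] pl.closed[OF y(1)]] by blast
  finally obtain v where v: "v \<in> carrier (tensor_module R (obj F (i + 1)) (obj M (j + 1 + 1)))"
    "tensor_d2 R F M (i + 1) (j + 1) v = ?i (i + 1) ?y"
    using tensor_boundary_lift[OF M H FS y'] unfolding tensor_d2_def by blast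
  let ?w = "?i (i + 1 + 1) w"
  have wc: "?w \<in> carrier (tensor_module R (obj F (i + 1 + 1)) (obj M (j + 1)))"
    by (rule lin.closed[OF il w(1)])
  show ?thesis
  proof (rule that[OF wc _ v(1)])
    show "tensor_d2 R F M (i + 1 + 1) j ?w = \<zero>\<^bsub>tensor_module R (obj F (i + 1 + 1)) (obj M j)\<^esub>"
      unfolding tensor_d2_def by (rule tensor_diff_cycles[OF M H FS w(1)])
    let ?d = "tensor_d1 R F (obj M (j + 1)) (i + 1) ?w"
    have d: "?d \<in> carrier (tensor_module R (obj F (i + 1)) (obj M (j + 1)))"
      by (rule lin.closed[OF tensor_d1_lin[OF FC Mm] wc])
    have "tensor_d2 R F M (i + 1) (j + 1) v = z \<ominus>\<^bsub>tensor_module R (obj F (i + 1)) (obj M (j + 1))\<^esub> ?d"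
      unfolding v(2) il.minus[OF y(1) dw] ci[OF w(1)] y(2) ..
    then show "z = ?d \<oplus>\<^bsub>tensor_module R (obj F (i + 1)) (obj M (j + 1))\<^esub> tensor_d2 R F M (i + 1) (j + 1) v"
      using d z by (simp add: il.N.M.minus_eq il.N.M.a_lcomm il.N.M.r_neg)
  qed
qed


text \<open>A cycle of the total complex has finitely many components. By the correction step, the one of
  highest index can be removed by adding a boundary, at the expense of changing only components of
  lower index; since the free complex vanishes in negative degrees, this comes to an end.\<close>

theorem tensor_free_complex_exact:
  fixes M :: "('a, 'm) cplx" and H :: "int \<Rightarrow> ('a, 'h) module" and F :: "('a, 's \<Rightarrow> 'a) cplx"
  assumes F: "free_complex R F" and M: "chain_complex R M" and H: "\<And>j. is_homology R M j (H j) (\<pi> j)"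
    and ex: "\<And>j. tensor_exact R F (H j)"
  shows "exact_complex (tensor_complex R F M)"
proof -
  let ?T = "\<lambda>i j. tensor_module R (obj F i) (obj M j)" and ?C = "tensor_complex R F M"
  note FC = free_complexD(1)[OF F]
  note Fm = chain_complexD(1)[OF FC] and Mm = chain_complexD(1)[OF M]
  note C = chain_complexD[OF tensor_complex_complex[OF FC M]]
  note mem = tensor_complex_mem[OF FC M] and ops = tensor_complex_ops[OF FC M]
    and dC = tensor_complex_diff[OF FC M]
  interpret R: cring R using Fm[of 0] by (simp add: module_def)
  interpret T: module R "?T i j" for i j by (intro tensor_module_module Fm Mm)
  interpret d1: lin R "?T (i + 1) j" "?T i j" "tensor_d1 R F (obj M j) i" for i j
    by (intro tensor_d1_lin FC Mm)
  interpret d2: lin R "?T i (j + 1)" "?T i j" "tensor_d2 R F M i j" for i j by (intro tensor_d2_lin FC M)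
  interpret G: module R "obj ?C n" for n by (rule C)
  have T0: "t = \<zero>\<^bsub>?T i j\<^esub>" if "i < 0" "t \<in> carrier (?T i j)" for i j t
  proof -
    interpret tensor_product R "obj F i" "obj M j" by (intro tensor_product.intro Fm Mm)
    show ?thesis using zero_left free_complexD(3)[OF F that(1)] M.zero_closed that(2) by blast
  qed
  have step: "\<phi> \<in> boundaries ?C n"
    if p: "\<phi> \<in> carrier (obj ?C n)" and dp: "diff ?C n \<phi> = \<zero>\<^bsub>obj ?C (n - 1)\<^esub>"
      and top: "\<And>i j. n = i + j \<Longrightarrow> int m \<le> i \<Longrightarrow> \<phi> i = \<zero>\<^bsub>?T i j\<^esub>" for m n \<phi>
    using p dp top
  proof (induction m arbitrary: \<phi>)
    case 0
    interpret d: lin R "obj ?C (n + 1)" "obj ?C n" "diff ?C (n + 1)"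
      by (rule chain_complex_diff_lin[OF tensor_complex_complex[OF FC M]])
    have "\<phi> = \<zero>\<^bsub>obj ?C n\<^esub>"
    proof (rule tensor_complex_eqI[OF FC M, where n = n])
      fix i j assume n: "n = i + j"
      show "\<phi> i = \<zero>\<^bsub>obj ?C n\<^esub> i"
        unfolding ops(1)[OF n] using T0[OF _ mem[OF 0(1) n]] 0(3)[OF n] by fastforce
    qed
    then have "\<phi> = diff ?C (n + 1) \<zero>\<^bsub>obj ?C (n + 1)\<^esub>" using d.zero by simp
    then show ?case unfolding boundaries_def
      by (intro image_eqI[where x = "\<zero>\<^bsub>obj ?C (n + 1)\<^esub>"]) simp_all
  next
    case (Suc m)
    (* The component of index i + 1 is the highest one that can be nonzero. *)
    define i j where "i = int m - 1" and "j = n - int m - 1"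
    have n: "n = (i + 1) + j + 1" "n = i + (j + 1) + 1" "n = i + 1 + (j + 1)" "n = i + (j + 1 + 1)"
      "n = i + 1 + 1 + j" "n + 1 = i + 1 + (j + 1) + 1" "n + 1 = i + 1 + 1 + j + 1"
      "n - 1 = i + 1 + j" "n - 1 = i + (j + 1)"
      by (simp_all add: i_def j_def)
    let ?z = "\<phi> (i + 1)" and ?s = "hom_sign R (i + 1 + 1)" and ?r = "hom_sign R (i + 1)"
    note p = Suc.prems(1)
    note z = mem[OF p n(3)] and x = mem[OF p n(4)]
    have top: "\<phi> (i + 1 + 1) = \<zero>\<^bsub>?T (i + 1 + 1) j\<^esub>" using n(5) by (intro Suc.prems(3)) (simp_all add: i_def)
    have "?s \<odot>\<^bsub>?T (i + 1) j\<^esub> tensor_d2 R F M (i + 1) j ?z \<in> carrier (?T (i + 1) j)"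
      by (rule T.smult_closed[OF R.hom_sign_closed d2.closed[OF z]])
    then have "?s \<odot>\<^bsub>?T (i + 1) j\<^esub> tensor_d2 R F M (i + 1) j ?z = \<zero>\<^bsub>?T (i + 1) j\<^esub>"
      using dC[OF p n(1)] unfolding Suc.prems(2) ops(1)[OF n(8)] top d1.zero by simp
    then have "(?s \<otimes>\<^bsub>R\<^esub> ?s) \<odot>\<^bsub>?T (i + 1) j\<^esub> tensor_d2 R F M (i + 1) j ?z = \<zero>\<^bsub>?T (i + 1) j\<^esub>"
      using d2.closed[OF z] by (simp add: T.smult_assoc1)
    then have dz: "tensor_d2 R F M (i + 1) j ?z = \<zero>\<^bsub>?T (i + 1) j\<^esub>"
      using d2.closed[OF z] by (simp add: R.hom_sign_square)
    let ?x = "\<ominus>\<^bsub>?T i (j + 1 + 1)\<^esub> (?r \<odot>\<^bsub>?T i (j + 1 + 1)\<^esub> \<phi> i)"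
    have xc: "?x \<in> carrier (?T i (j + 1 + 1))" using x by simp
    have "tensor_d1 R F (obj M (j + 1)) i ?z
        \<oplus>\<^bsub>?T i (j + 1)\<^esub> ?r \<odot>\<^bsub>?T i (j + 1)\<^esub> tensor_d2 R F M i (j + 1) (\<phi> i) = \<zero>\<^bsub>?T i (j + 1)\<^esub>"
      using dC[OF p n(2)] unfolding Suc.prems(2) ops(1)[OF n(9)] by (rule sym)
    then have "\<ominus>\<^bsub>?T i (j + 1)\<^esub> (?r \<odot>\<^bsub>?T i (j + 1)\<^esub> tensor_d2 R F M i (j + 1) (\<phi> i))
        = tensor_d1 R F (obj M (j + 1)) i ?z"
      by (rule T.M.minus_equality[OF _ T.smult_closed[OF R.hom_sign_closed d2.closed[OF x]] d1.closed[OF z]])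
    then have zx: "tensor_d1 R F (obj M (j + 1)) i ?z = tensor_d2 R F M i (j + 1) ?x"
      unfolding d2.neg[OF T.smult_closed[OF R.hom_sign_closed x]] d2.smult[OF R.hom_sign_closed x] by (rule sym)
    obtain w v where w: "w \<in> carrier (?T (i + 1 + 1) (j + 1))"
        and dw: "tensor_d2 R F M (i + 1 + 1) j w = \<zero>\<^bsub>?T (i + 1 + 1) j\<^esub>"
        and v: "v \<in> carrier (?T (i + 1) (j + 1 + 1))"
        and zwv: "?z = tensor_d1 R F (obj M (j + 1)) (i + 1) w
          \<oplus>\<^bsub>?T (i + 1) (j + 1)\<^esub> tensor_d2 R F M (i + 1) (j + 1) v"
      by (rule tensor_exact_correction[OF F M H ex z dz xc zx])
    (* The sign cancels the one with which the second differential enters the total complex. *)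
    define \<theta> where "\<theta> l = (if l = i + 1 + 1 then w
      else if l = i + 1 then ?s \<odot>\<^bsub>?T (i + 1) (j + 1 + 1)\<^esub> v else \<zero>\<^bsub>?T l (n + 1 - l)\<^esub>)" for l
    have tc: "\<theta> \<in> carrier (obj ?C (n + 1))"
    proof (rule tensor_complex_memI[OF FC M, where A = "{i + 1 + 1, i + 1}"])
      fix l l' assume l: "n + 1 = l + l'"
      then have l': "n + 1 - l = l'" by simp
      consider "l = i + 1 + 1" "l' = j + 1" | "l = i + 1" "l' = j + 1 + 1" | "l \<notin> {i + 1 + 1, i + 1}"
        using l n(5) by fastforce
      then show "\<theta> l \<in> carrier (?T l l')"
        by cases (use w v in \<open>simp_all add: \<theta>_def l' del: add.assoc\<close>)
      show "\<theta> l = \<zero>\<^bsub>?T l l'\<^esub>" if "l \<notin> {i + 1 + 1, i + 1}" using that by (simp add: \<theta>_def l')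
    qed simp
    interpret d: lin R "obj ?C (n + 1)" "obj ?C n" "diff ?C (n + 1)"
      by (rule chain_complex_diff_lin[OF tensor_complex_complex[OF FC M]])
    interpret e: lin R "obj ?C n" "obj ?C (n - 1)" "diff ?C n" by (intro linI C)
    let ?d = "diff ?C (n + 1) \<theta>"
    have dc: "?d \<in> carrier (obj ?C n)" by (rule d.closed[OF tc])
    have \<theta>1: "\<theta> (i + 1 + 1) = w" "\<theta> (i + 1) = ?s \<odot>\<^bsub>?T (i + 1) (j + 1 + 1)\<^esub> v"
      by (simp_all add: \<theta>_def)
    have \<theta>0: "\<theta> l = \<zero>\<^bsub>?T l l'\<^esub>" if "n + 1 = l + l'" "l > i + 1 + 1" for l l'
      using that by (auto simp: \<theta>_def)
    have c1: "?d (i + 1) = ?z"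
    proof -
      have "?s \<odot>\<^bsub>?T (i + 1) (j + 1)\<^esub> (?s \<odot>\<^bsub>?T (i + 1) (j + 1)\<^esub> tensor_d2 R F M (i + 1) (j + 1) v)
          = tensor_d2 R F M (i + 1) (j + 1) v"
        using d2.closed[OF v] by (simp add: T.smult_assoc1[symmetric] R.hom_sign_square)
      then show ?thesis
        unfolding dC[OF tc n(6)] \<theta>1 d2.smult[OF R.hom_sign_closed v] zwv by (rule arg_cong)
    qed
    have c2: "?d (i + 1 + 1) = \<zero>\<^bsub>?T (i + 1 + 1) j\<^esub>"
    proof -
      have l: "\<theta> (i + 1 + 1 + 1) = \<zero>\<^bsub>?T (i + 1 + 1 + 1) j\<^esub>" using n(7) by (intro \<theta>0) simp_all
      show ?thesis unfolding dC[OF tc n(7)] l \<theta>1 dw d1.zero by simp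
    qed
    have c3: "?d l = \<zero>\<^bsub>?T l l'\<^esub>" if l: "n = l + l'" "l > i + 1 + 1" for l l'
    proof -
      have n': "n + 1 = l + l' + 1" "n + 1 = (l + 1) + l'" "n + 1 = l + (l' + 1)" using l by simp_all
      have l0: "\<theta> (l + 1) = \<zero>\<^bsub>?T (l + 1) l'\<^esub>" "\<theta> l = \<zero>\<^bsub>?T l (l' + 1)\<^esub>"
        using l n' by (intro \<theta>0, simp_all)+
      show ?thesis unfolding dC[OF tc n'(1)] l0 d1.zero d2.zero by simp
    qed
    have agree: "?d l = \<phi> l" if l: "n = l + l'" "int m \<le> l" for l l'
    proof -
      consider "l = i + 1" | "l = i + 1 + 1" "l' = j" | "l > i + 1 + 1"
        using l n(5) by (fastforce simp: i_def)
      then show ?thesis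
      proof cases
        case 2
        then show ?thesis using c2 Suc.prems(3)[OF l(1)] by (simp add: i_def)
      next
        case 3
        then show ?thesis
          using c3[OF l(1)] Suc.prems(3)[OF l(1)] by (simp add: i_def)
      qed (use c1 in simp)
    qed
    let ?q = "\<phi> \<ominus>\<^bsub>obj ?C n\<^esub> ?d"
    have q: "?q \<in> carrier (obj ?C n)" using p dc by (rule G.M.minus_closed)
    have qd: "?q \<oplus>\<^bsub>obj ?C n\<^esub> ?d = \<phi>" using p dc by (simp add: G.M.minus_eq G.M.a_assoc G.M.l_neg)
    have "diff ?C (n + 1 - 1) (diff ?C (n + 1) \<theta>) = \<zero>\<^bsub>obj ?C (n + 1 - 2)\<^esub>" by (rule C(3)[OF tc])
    then have "diff ?C n ?d = \<zero>\<^bsub>obj ?C (n - 1)\<^esub>" by simp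
    then have dq: "diff ?C n ?q = \<zero>\<^bsub>obj ?C (n - 1)\<^esub>"
      unfolding e.minus[OF p dc] Suc.prems(2) by (simp add: G.M.minus_eq)
    have "?q \<in> boundaries ?C n"
    proof (rule Suc.IH[OF q dq])
      fix l l' assume l: "n = l + l'" "int m \<le> l"
      have "?q l \<oplus>\<^bsub>?T l l'\<^esub> \<phi> l = \<phi> l"
        using arg_cong[OF qd, of "\<lambda>f. f l"] unfolding ops(2)[OF l(1)] agree[OF l] .
      then show "?q l = \<zero>\<^bsub>?T l l'\<^esub>"
        using T.M.add.r_cancel_one[OF mem[OF p l(1)] mem[OF q l(1)]] by blast
    qed
    then obtain \<psi> where s: "\<psi> \<in> carrier (obj ?C (n + 1))" "?q = diff ?C (n + 1) \<psi>"
      unfolding boundaries_def by (rule imageE)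
    have "\<phi> = diff ?C (n + 1) (\<psi> \<oplus>\<^bsub>obj ?C (n + 1)\<^esub> \<theta>)"
      unfolding d.add[OF s(1) tc] s(2)[symmetric] qd ..
    then show ?case unfolding boundaries_def by (rule image_eqI[OF _ G.M.a_closed[OF s(1) tc]])
  qed
  show ?thesis
    unfolding exact_complex_def
  proof (intro allI subsetI)
    fix n \<phi> assume "\<phi> \<in> cycles ?C n"
    then have p: "\<phi> \<in> carrier (obj ?C n)" "diff ?C n \<phi> = \<zero>\<^bsub>obj ?C (n - 1)\<^esub>" by (simp_all add: cycles_def)
    obtain A where A: "finite A" "\<And>i j. n = i + j \<Longrightarrow> i \<notin> A \<Longrightarrow> \<phi> i = \<zero>\<^bsub>?T i j\<^esub>"
      by (rule tensor_complex_finite[OF FC M p(1)]) (rule that)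
    let ?b = "Max (insert 0 A)"
    have b: "i \<le> ?b" if "i \<in> A" for i using A(1) that by simp
    show "\<phi> \<in> boundaries ?C n"
    proof (rule step[OF p])
      fix i j assume n: "n = i + j" and i: "int (nat (?b + 1)) \<le> i"
      have "i \<notin> A"
      proof
        assume "i \<in> A"
        from b[OF this] i show False by linarith
      qed
      from A(2)[OF n this] show "\<phi> i = \<zero>\<^bsub>?T i j\<^esub>" .
    qed
  qed
qed

text \<open>The converse for a module: an element of \<open>F\<^sub>i \<otimes> H\<close> is a chain of the total complex with a single component,
  and all chains are of this form.\<close>

lemma tensor_exact_of_concentrated:
  fixes H :: "('a, 'h) module" and F :: "('a, 's \<Rightarrow> 'a) cplx"
  assumes FC: "chain_complex R F" and H: "module R H"
    and ex: "exact_complex (tensor_complex R F (concentrated H))"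
  shows "tensor_exact R F H"
  unfolding tensor_exact_def
proof (intro allI ballI impI)
  fix i t assume t: "t \<in> carrier (tensor_module R (obj F (i + 1)) H)"
    and dt: "tensor_d1 R F H i t = \<zero>\<^bsub>tensor_module R (obj F i) H\<^esub>"
  let ?N = "concentrated H"
  let ?T = "\<lambda>i j. tensor_module R (obj F i) (obj ?N j)" and ?C = "tensor_complex R F ?N"
  note M = concentrated_complex[OF H]
  note Fm = chain_complexD(1)[OF FC] and Mm = chain_complexD(1)[OF M]
  note mem = tensor_complex_mem[OF FC M] and ops = tensor_complex_ops[OF FC M]
    and dC = tensor_complex_diff[OF FC M]
  have N0: "obj ?N 0 = H" by (simp add: concentrated_def)
  interpret T: module R "?T k j" for k j by (intro tensor_module_module Fm Mm)
  interpret d1: lin R "?T (k + 1) j" "?T k j" "tensor_d1 R F (obj ?N j) k" for k j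
    by (intro tensor_d1_lin FC Mm)
  interpret d2: lin R "?T k (j + 1)" "?T k j" "tensor_d2 R F ?N k j" for k j by (intro tensor_d2_lin FC M)
  have T0: "x = \<zero>\<^bsub>?T k j\<^esub>" if "j \<noteq> 0" "x \<in> carrier (?T k j)" for k j x
  proof -
    interpret tensor_product R "obj F k" "obj ?N j" by (intro tensor_product.intro Fm Mm)
    show ?thesis by (rule zero_right[OF _ that(2)]) (simp add: that(1))
  qed
  define \<phi> where "\<phi> l = (if l = i + 1 then t else \<zero>\<^bsub>?T l (i + 1 - l)\<^esub>)" for l
  have p: "\<phi> \<in> carrier (obj ?C (i + 1))"
  proof (rule tensor_complex_memI[OF FC M, where A = "{i + 1}"])
    fix l l' assume l: "i + 1 = l + l'"
    then have l': "i + 1 - l = l'" by simp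
    show "\<phi> l \<in> carrier (?T l l')"
    proof (cases "l = i + 1")
      case True
      then have "l' = 0" using l by simp
      moreover have "\<phi> (i + 1) = t" by (simp add: \<phi>_def)
      ultimately show ?thesis using t unfolding True by (simp add: N0)
    qed (simp add: \<phi>_def l')
    show "\<phi> l = \<zero>\<^bsub>?T l l'\<^esub>" if "l \<notin> {i + 1}" using that by (simp add: \<phi>_def l')
  qed simp
  have dp: "diff ?C (i + 1) \<phi> = \<zero>\<^bsub>obj ?C (i + 1 - 1)\<^esub>"
  proof (rule tensor_complex_eqI[OF FC M, where n = "i + 1 - 1"])
    fix l l' assume l: "i + 1 - 1 = l + l'"
    show "diff ?C (i + 1) \<phi> l = \<zero>\<^bsub>obj ?C (i + 1 - 1)\<^esub> l"
      unfolding ops(1)[OF l]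
    proof (cases "l' = 0")
      case False
      show "diff ?C (i + 1) \<phi> l = \<zero>\<^bsub>?T l l'\<^esub>"
        by (rule T0[OF False mem[OF tensor_complex_diff_closed[OF FC M p] l]])
    next
      case True
      then have li: "l = i" using l by simp
      have n: "i + 1 = i + 0 + 1" "i + 1 = i + (0 + 1)" by simp_all
      have z: "\<phi> i = \<zero>\<^bsub>?T i (0 + 1)\<^esub>" by (simp add: \<phi>_def)
      have "\<phi> (i + 1) = t" by (simp add: \<phi>_def)
      then have y: "tensor_d1 R F (obj ?N 0) i (\<phi> (i + 1)) = \<zero>\<^bsub>?T i 0\<^esub>" using dt by (simp add: N0)
      show "diff ?C (i + 1) \<phi> l = \<zero>\<^bsub>?T l l'\<^esub>"
        unfolding li True dC[OF p n(1)] z y d2.zero by (simp add: T.R.hom_sign_closed)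
    qed
  qed
  have "\<phi> \<in> cycles ?C (i + 1)" using p dp by (simp add: cycles_def)
  then have "\<phi> \<in> boundaries ?C (i + 1)" using ex unfolding exact_complex_def by blast
  then obtain \<psi> where q: "\<psi> \<in> carrier (obj ?C (i + 1 + 1))" "\<phi> = diff ?C (i + 1 + 1) \<psi>"
    unfolding boundaries_def by (rule imageE)
  have n: "i + 1 + 1 = i + 1 + 0 + 1" "i + 1 + 1 = i + 1 + 1 + 0" "i + 1 + 1 = i + 1 + (0 + 1)" by simp_all
  have u: "\<psi> (i + 1 + 1) \<in> carrier (tensor_module R (obj F (i + 1 + 1)) H)" using mem[OF q(1) n(2)] unfolding N0 .
  have z: "\<psi> (i + 1) = \<zero>\<^bsub>?T (i + 1) (0 + 1)\<^esub>" using T0[OF _ mem[OF q(1) n(3)]] by simp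
  have "t = \<phi> (i + 1)" by (simp add: \<phi>_def)
  also have "\<dots> = tensor_d1 R F (obj ?N 0) (i + 1) (\<psi> (i + 1 + 1))"
    unfolding q(2) dC[OF q(1) n(1)] z d2.zero using d1.closed[OF mem[OF q(1) n(2)]] by simp
  finally show "\<exists>u\<in>carrier (tensor_module R (obj F (i + 1 + 1)) H). t = tensor_d1 R F H (i + 1) u"
    unfolding N0 using u by (rule bexI)
qed

section \<open>Small support\<close>

lemma local_residue_field_module:
  assumes "cring R" "primeideal p R"
  shows "module R (restrict_scalars (localization_hom R p) (residue_field R p))"
  by (rule restrict_scalars_module[OF assms(1) residue_field_module[OF assms(2)] localization_hom_hom[OF assms(2)]])

lemma small_supp_iff:
  assumes R: "cring R" and M: "chain_complex R M"
  shows "p \<in> small_supp R M \<longleftrightarrow> primeideal p R \<and> \<not> exact_complex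
    (tensor_complex R (free_resolution R (restrict_scalars (localization_hom R p) (residue_field R p))) M)"
proof (cases "primeideal p R")
  case True
  have "chain_complex R
      (tensor_complex R (free_resolution R (restrict_scalars (localization_hom R p) (residue_field R p))) M)"
    by (intro tensor_complex_complex M free_complexD(1) free_resolution_free_complex
        local_residue_field_module R True)
  from derived_iso_zero_iff[OF R this] show ?thesis
    using True by (simp add: small_supp_def Spec_def derived_tensor_def)
qed (simp add: small_supp_def Spec_def)

text \<open>If \<open>p\<close> lies in none of the supports on the right, then \<open>F \<otimes> -\<close>, for the resolution \<open>F\<close> of the residue
  field, is exact on each homology module of \<open>M\<close>, and hence on \<open>M\<close>.\<close>

theorem small_supp_subset:
  assumes R: "cring R" and M: "chain_complex R M"
  shows "small_supp R M \<subseteq> (\<Union>i. small_supp R (concentrated (homology M i)))"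
proof
  fix p assume p: "p \<in> small_supp R M"
  then have pr: "primeideal p R" using small_supp_iff[OF R M] by blast
  let ?F = "free_resolution R (restrict_scalars (localization_hom R p) (residue_field R p))"
  have F: "free_complex R ?F" by (intro free_resolution_free_complex local_residue_field_module R pr)
  have HM: "module R (homology M j)" for j by (rule is_homologyD(1)[OF homology_is_homology[OF M]])
  show "p \<in> (\<Union>i. small_supp R (concentrated (homology M i)))"
  proof (rule ccontr)
    assume "\<not> ?thesis"
    then have "p \<notin> small_supp R (concentrated (homology M j))" for j by blast
    then have "exact_complex (tensor_complex R ?F (concentrated (homology M j)))" for j
      using pr small_supp_iff[OF R concentrated_complex[OF HM]] by blast
    then have "tensor_exact R ?F (homology M j)" for j
      by (rule tensor_exact_of_concentrated[OF free_complexD(1)[OF F] HM])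
    then have "exact_complex (tensor_complex R ?F M)"
      by (rule tensor_free_complex_exact[OF F M homology_is_homology[OF M]])
    then show False using p small_supp_iff[OF R M] by blast
  qed
qed

theorem proposition5p4:
  fixes R :: "('a, 'r) ring_scheme"
  assumes "cring R" and "noetherian_ring R"
  shows "(\<forall>M :: ('a, 'm) cplx. M \<in> D_minus R \<longrightarrow>
            small_supp R M \<subseteq> (\<Union>i :: int. small_supp R (concentrated (homology M i)))) \<and>
         (\<forall>M :: ('a, 'n) cplx. M \<in> D_plus R \<longrightarrow>
            small_cosupp R M \<subseteq> (\<Union>i :: int. small_cosupp R (concentrated (homology M i))))"
proof (intro conjI allI impI)
  show "small_supp R M \<subseteq> (\<Union>i :: int. small_supp R (concentrated (homology M i)))"
    if "M \<in> D_minus R" for M :: "('a, 'm) cplx"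
    using that by (intro small_supp_subset assms(1)) (simp add: D_minus_def)
  show "small_cosupp R M \<subseteq> (\<Union>i :: int. small_cosupp R (concentrated (homology M i)))"
    if "M \<in> D_plus R" for M :: "('a, 'n) cplx"
    using that by (intro small_cosupp_subset assms) (simp add: D_plus_def)
qed

end
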